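(* Let $s,t$ be two fixed distinct vertices of the complete graph $K_n$, whose edges carry i.i.d.\ weights with uniform distribution $U(0,1)$, and let $X_k$ be the cost of the $k$-th cheapest path $P_k$ (defined in the context). Then $$\frac{X_k}{2k/n+\ln n/n}\ \xrightarrow{\ p\ }\ 1$$ uniformly for all $k\le n-1$. That is, for every $\varepsilon>0$, with probability tending to $1$ as $n\to\infty$, simultaneously for every $k=1,\dots,n-1$, $$1-\varepsilon\le \frac{X_k}{2k/n+\ln n/n}\le 1+\varepsilon .$$
   Context: The cost (weight) of a path is the sum of the weights of its edges. $P_1$ is a minimum-cost $s$--$t$ path; for $k\ge 2$, $P_k$ is a minimum-cost $s$--$t$ path that is edge-disjoint from $P_1\cup\dots\cup P_{k-1}$, provided such a path exists, and $X_k$ denotes its cost. (Ties occur with probability $0$.) An inequality involving $X_k$ is understood to include that $P_k$ exists. All asymptotics are as $n\to\infty$. *)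

theory Defs
  imports "HOL-Probability.Probability"
begin

text \<open>The complete graph $K_n$ has vertex set \<open>{1..n}\<close>; an edge is a two-element set of vertices.\<close>

definition complete_edges :: "nat \<Rightarrow> nat set set" where
  "complete_edges n = {e. e \<subseteq> {1..n} \<and> card e = 2}"

text \<open>A path is the list of its vertices, which are distinct; as the graph is complete, any two
  consecutive vertices are adjacent. Starting the list at \<open>s\<close> makes the list unique for a path
  between \<open>s\<close> and \<open>t\<close>.\<close>

definition st_paths :: "nat \<Rightarrow> nat \<Rightarrow> nat \<Rightarrow> nat list set" where
  "st_paths n s t = {p. p \<noteq> [] \<and> distinct p \<and> set p \<subseteq> {1..n} \<and> hd p = s \<and> last p = t}"

definition path_edges :: "nat list \<Rightarrow> nat set set" where
  "path_edges p = {{p ! i, p ! Suc i} | i. Suc i < length p}"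

definition path_cost :: "(nat set \<Rightarrow> real) \<Rightarrow> nat list \<Rightarrow> real" where
  "path_cost w p = (\<Sum>e\<in>path_edges p. w e)"

text \<open>\<open>P 1, \<dots>, P k\<close> are successive cheapest paths for the weights \<open>w\<close>: each \<open>P j\<close> has
  minimum cost among the paths that are edge-disjoint from \<open>P 1, \<dots>, P (j - 1)\<close>. This is a
  predicate on \<open>P\<close>, not a function of \<open>w\<close>: it can fail for every \<open>P\<close> (no further path exists),
  and when costs tie it can hold for several choices of \<open>P 1, \<dots>, P k\<close>.\<close>

definition successive_cheapest_paths ::
    "nat \<Rightarrow> nat \<Rightarrow> nat \<Rightarrow> (nat set \<Rightarrow> real) \<Rightarrow> (nat \<Rightarrow> nat list) \<Rightarrow> nat \<Rightarrow> bool" where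
  "successive_cheapest_paths n s t w P k \<longleftrightarrow>
     (\<forall>j\<in>{1..k}. is_arg_min (path_cost w)
        (\<lambda>p. p \<in> st_paths n s t \<and> (\<forall>i\<in>{1..<j}. path_edges p \<inter> path_edges (P i) = {}))
        (P j))"

end

theory Submission
  imports Defs "HOL-Real_Asymp.Real_Asymp"
begin

text \<open>Write \<open>L = ln n\<close>. Upper bound, by induction on \<open>k\<close>: the paths \<open>P\<^sub>1, \<dots>, P\<^sub>k\<^sub>-\<^sub>1\<close> use only \<open>k - 1\<close>
  edges at \<open>s\<close> and at \<open>t\<close>, and their small total cost leaves few heavy removed edges, while light
  ones can be avoided by never using light edges. Hence about \<open>\<delta> (k + L)\<close> neighbours of \<open>s\<close> and of \<open>t\<close>
  at cost about \<open>k / n\<close> survive. For \<open>k\<close> up to a small power of \<open>n\<close>, they are expanded into disjoint forests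
  of light edges, which first-passage percolation joins at the further cost \<open>L / n\<close>; a union bound over
  all such forests and all possible sets of removed heavy edges makes this uniform. For larger \<open>k\<close> the
  term \<open>L / n\<close> is negligible and boundedly many expansions of arbitrary vertex sets, using edges of
  weight of order \<open>\<delta> k / n\<close>, suffice; when \<open>k\<close> is close to \<open>n\<close> these start from a single remaining edge
  at \<open>s\<close> and at \<open>t\<close>.

  Lower bound: as the costs increase with \<open>k\<close>, a cheap \<open>P\<^sub>k\<close> makes the total cost of \<open>P\<^sub>1, \<dots>, P\<^sub>k\<close>
  too small, because \<open>k\<close> distinct edges at \<open>s\<close> and at \<open>t\<close> already cost about \<open>k\<^sup>2 / n\<close> and, by a first
  moment computation, the part of each path between them costs almost \<open>L / n\<close> if \<open>k\<close> is of order \<open>L\<close>.\<close>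

section \<open>Independent uniform edge weights\<close>

text \<open>The removed paths depend on all weights, so nothing is fresh once they are known. Hence
  every estimate holds simultaneously for all vertex sets and edge sets that could arise, and the
  upper bound uses of the removed paths only that they are disjoint, have one edge at s and one at t
  each, and are cheap in total. The obstacle is the price of this uniformity. Percolation from a
  vertices fails with probability n^(-c a) for a small constant c, which cannot pay for n^(2a)
  choices of vertices. Sets spanned by a forest of edges of weight at most 2K/n, with K = k + ln n,
  are much rarer: a parent and a weight contribute a factor of order aK/n per vertex, so n cancels
  and K^(O(a)) remains, which is n^(O(\<gamma> a)) for k up to n^\<gamma>. The removed edges of
  weight at least \<eta>/n number O(K^2), and guessing them is affordable only if a is a large
  multiple of K^2; this is why the forests grow to order K^3. For k at least n^\<gamma> an expansion
  step from U fails with probability exp(-c k |U|), where k dominates ln n, and arbitrary sets can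
  be afforded.\<close>

context prob_space
begin

text \<open>A bound for the outer probability, so that union bounds need no measurability.\<close>

definition prob_le :: "('a \<Rightarrow> bool) \<Rightarrow> real \<Rightarrow> bool" where
  "prob_le Q p \<longleftrightarrow> (\<exists>A\<in>events. {\<omega>\<in>space M. Q \<omega>} \<subseteq> A \<and> prob A \<le> p)"

lemma prob_le_mono:
  assumes "prob_le Q p" "\<And>\<omega>. \<omega> \<in> space M \<Longrightarrow> Q' \<omega> \<Longrightarrow> Q \<omega>" "p \<le> p'"
  shows "prob_le Q' p'"
proof -
  obtain A where A: "A \<in> events" "{\<omega>\<in>space M. Q \<omega>} \<subseteq> A" "prob A \<le> p"
    using assms(1) unfolding prob_le_def by blast
  thus ?thesis unfolding prob_le_def using assms(2,3) by (intro bexI[of _ A]) auto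
qed

lemma prob_le_disj:
  assumes "prob_le Q p" "prob_le Q' p'"
  shows "prob_le (\<lambda>\<omega>. Q \<omega> \<or> Q' \<omega>) (p + p')"
proof -
  obtain A A' where A: "A \<in> events" "{\<omega>\<in>space M. Q \<omega>} \<subseteq> A" "prob A \<le> p"
    and A': "A' \<in> events" "{\<omega>\<in>space M. Q' \<omega>} \<subseteq> A'" "prob A' \<le> p'"
    using assms unfolding prob_le_def by blast
  have "prob (A \<union> A') \<le> p + p'"
    using measure_Un_le[OF A(1) A'(1)] A(3) A'(3) by linarith
  thus ?thesis unfolding prob_le_def using A A' by (intro bexI[of _ "A \<union> A'"]) auto
qed

lemma prob_le_bex:
  assumes "finite I" "\<And>i. i \<in> I \<Longrightarrow> prob_le (Q i) (p i)"
  shows "prob_le (\<lambda>\<omega>. \<exists>i\<in>I. Q i \<omega>) (\<Sum>i\<in>I. p i)"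
  using assms
proof (induction I)
  case empty
  show ?case unfolding prob_le_def by (intro bexI[of _ "{}"]) auto
next
  case (insert x I)
  have "prob_le (\<lambda>\<omega>. Q x \<omega> \<or> (\<exists>i\<in>I. Q i \<omega>)) (p x + (\<Sum>i\<in>I. p i))"
    using insert by (intro prob_le_disj) auto
  thus ?case using insert by (auto elim: prob_le_mono)
qed

lemma prob_le_bex_const:
  assumes "finite I" "\<And>i. i \<in> I \<Longrightarrow> prob_le (Q i) p" "real (card I) \<le> c" "0 \<le> p"
  shows "prob_le (\<lambda>\<omega>. \<exists>i\<in>I. Q i \<omega>) (c * p)"
proof -
  have "prob_le (\<lambda>\<omega>. \<exists>i\<in>I. Q i \<omega>) (\<Sum>i\<in>I. p)"
    by (intro prob_le_bex assms)
  moreover have "(\<Sum>i\<in>I. p) \<le> c * p" using assms by (simp add: mult_right_mono)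
  ultimately show ?thesis by (auto elim: prob_le_mono)
qed

text \<open>The common form of the tail bounds below: an event is controlled by a nonnegative
  variable that is at least 1 on it, be it a Chernoff product, a sum over exploration histories or a
  tilted path weight.\<close>

lemma prob_le_markov:
  assumes f: "integrable M f" "\<And>\<omega>. \<omega> \<in> space M \<Longrightarrow> 0 \<le> f \<omega>"
    and Q: "\<And>\<omega>. \<omega> \<in> space M \<Longrightarrow> Q \<omega> \<Longrightarrow> 1 \<le> f \<omega>" and le: "expectation f \<le> p"
  shows "prob_le Q p"
proof -
  have [measurable]: "f \<in> borel_measurable M" using f by auto
  have "prob {\<omega>\<in>space M. 1 \<le> f \<omega>} \<le> expectation f / 1"
    by (intro integral_Markov_inequality_measure[where A="{}"]) (use f in auto)
  thus ?thesis unfolding prob_le_def using Q le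
    by (intro bexI[of _ "{\<omega>\<in>space M. 1 \<le> f \<omega>}"]) auto
qed

lemma prob_le_imp_prob_ge:
  assumes "prob_le Q p" "{\<omega>\<in>space M. R \<omega>} \<in> events" "\<And>\<omega>. \<omega> \<in> space M \<Longrightarrow> \<not> Q \<omega> \<Longrightarrow> R \<omega>"
  shows "prob {\<omega>\<in>space M. R \<omega>} \<ge> 1 - p"
proof -
  obtain A where A: "A \<in> events" "{\<omega>\<in>space M. Q \<omega>} \<subseteq> A" "prob A \<le> p"
    using assms(1) unfolding prob_le_def by blast
  have "prob (space M - A) \<le> prob {\<omega>\<in>space M. R \<omega>}"
    using A assms(2,3) by (intro finite_measure_mono) auto
  thus ?thesis using A prob_compl[OF A(1)] by linarith
qed

end

section \<open>The random weights and functions of few edges\<close>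

lemma finite_complete_edges [simp]: "finite (complete_edges n)"
  by (rule finite_subset[of _ "Pow {1..n}"]) (auto simp: complete_edges_def)

lemma doubleton_complete_edges_iff:
  "{u, v} \<in> complete_edges n \<longleftrightarrow> u \<in> {1..n} \<and> v \<in> {1..n} \<and> u \<noteq> v"
  by (auto simp: complete_edges_def card_2_iff doubleton_eq_iff)

lemma card_complete_edges_le: "card (complete_edges n) \<le> n\<^sup>2"
proof -
  have "complete_edges n \<subseteq> (\<lambda>(u,v). {u,v}) ` ({1..n} \<times> {1..n})"
    by (auto simp: complete_edges_def card_2_iff image_iff)
  from card_mono[OF _ this] have "card (complete_edges n) \<le> card ((\<lambda>(u,v). {u,v}) ` ({1..n} \<times> {1..n}))"
    by auto
  also have "\<dots> \<le> card ({1..n} \<times> {1..n})" by (rule card_image_le) auto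
  finally show ?thesis by (simp add: power2_eq_square)
qed

locale random_weights = prob_space M for M :: "'a measure" +
  fixes n :: nat and W :: "nat set \<Rightarrow> 'a \<Rightarrow> real"
  assumes indep: "indep_vars (\<lambda>_. borel) W (complete_edges n)"
    and unif: "\<And>e. e \<in> complete_edges n \<Longrightarrow> distr M lborel (W e) = uniform_measure lborel {0..1}"
begin

abbreviation "E \<equiv> complete_edges n"

lemma W_measurable [measurable]: "e \<in> E \<Longrightarrow> W e \<in> borel_measurable M"
  using indep by (auto simp: indep_vars_def)

text \<open>The sigma-algebra generated by the weights on \<open>K\<close>. Independence is always
  derived from disjointness of such edge sets.\<close>

definition edge_algebra :: "nat set set \<Rightarrow> 'a measure" where
  "edge_algebra K = vimage_algebra (space M) (\<lambda>\<omega>. \<lambda>e\<in>K. W e \<omega>) (Pi\<^sub>M K (\<lambda>_. borel))"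

lemma space_edge_algebra [simp]: "space (edge_algebra K) = space M"
  by (simp add: edge_algebra_def)

lemma W_measurable_edge_algebra: "e \<in> K \<Longrightarrow> W e \<in> borel_measurable (edge_algebra K)"
proof -
  assume e: "e \<in> K"
  have 1: "(\<lambda>\<omega>. \<lambda>e\<in>K. W e \<omega>) \<in> measurable (edge_algebra K) (Pi\<^sub>M K (\<lambda>_. borel))"
    unfolding edge_algebra_def by (rule measurable_vimage_algebra1) (auto simp: space_PiM)
  have "(\<lambda>f. f e) \<circ> (\<lambda>\<omega>. \<lambda>e\<in>K. W e \<omega>) \<in> borel_measurable (edge_algebra K)"
    by (rule measurable_comp[OF 1]) (use e in measurable)
  thus ?thesis using e by (simp add: comp_def)
qed

lemma sets_edge_algebra_le: "K \<subseteq> E \<Longrightarrow> sets (edge_algebra K) \<subseteq> sets M"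
proof -
  assume "K \<subseteq> E"
  hence m: "(\<lambda>\<omega>. \<lambda>e\<in>K. W e \<omega>) \<in> measurable M (Pi\<^sub>M K (\<lambda>_. borel))"
    by (intro measurable_restrict) auto
  have "sets (edge_algebra K) = {(\<lambda>\<omega>. \<lambda>e\<in>K. W e \<omega>) -` A \<inter> space M |A. A \<in> sets (Pi\<^sub>M K (\<lambda>_. borel))}"
    unfolding edge_algebra_def by (rule sets_vimage_algebra2) (auto simp: space_PiM)
  thus ?thesis using measurable_sets[OF m] by auto
qed

lemma edge_algebra_measurable:
  assumes "f \<in> measurable (edge_algebra K) N" "K \<subseteq> E"
  shows "f \<in> measurable M N"
  using assms sets_edge_algebra_le[of K] by (auto simp: measurable_def)

lemma edge_algebra_mono:
  assumes f: "f \<in> measurable (edge_algebra K) N" and "K \<subseteq> K'"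
  shows "f \<in> measurable (edge_algebra K') N"
proof -
  have 1: "(\<lambda>\<omega>. \<lambda>e\<in>K'. W e \<omega>) \<in> measurable (edge_algebra K') (Pi\<^sub>M K' (\<lambda>_. borel))"
    unfolding edge_algebra_def by (rule measurable_vimage_algebra1) (auto simp: space_PiM)
  have 2: "(\<lambda>f. restrict f K) \<in> measurable (Pi\<^sub>M K' (\<lambda>_. borel)) (Pi\<^sub>M K (\<lambda>_. borel))"
    by (rule measurable_restrict_subset) fact
  have eq: "(\<lambda>\<omega>. \<lambda>e\<in>K. W e \<omega>) = (\<lambda>f. restrict f K) \<circ> (\<lambda>\<omega>. \<lambda>e\<in>K'. W e \<omega>)"
    using assms by (auto simp: fun_eq_iff)
  have 3: "(\<lambda>\<omega>. \<lambda>e\<in>K. W e \<omega>) \<in> measurable (edge_algebra K') (Pi\<^sub>M K (\<lambda>_. borel))"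
    unfolding eq by (rule measurable_comp[OF 1 2])
  have "sets (edge_algebra K) = {(\<lambda>\<omega>. \<lambda>e\<in>K. W e \<omega>) -` A \<inter> space M |A. A \<in> sets (Pi\<^sub>M K (\<lambda>_. borel))}"
    unfolding edge_algebra_def by (rule sets_vimage_algebra2) (auto simp: space_PiM)
  hence "sets (edge_algebra K) \<subseteq> sets (edge_algebra K')"
    using measurable_sets[OF 3] by auto
  thus ?thesis using f by (auto simp: measurable_def)
qed

lemma indep_var_edge_algebra:
  assumes "f \<in> borel_measurable (edge_algebra K)" "g \<in> borel_measurable (edge_algebra K')"
    and K: "K \<subseteq> E" "K' \<subseteq> E" "K \<inter> K' = {}"
  shows "indep_var borel f borel (g :: 'a \<Rightarrow> real)"
proof -
  have "indep_var (Pi\<^sub>M K (\<lambda>_. borel)) (\<lambda>\<omega>. \<lambda>e\<in>K. W e \<omega>) (Pi\<^sub>M K' (\<lambda>_. borel)) (\<lambda>\<omega>. \<lambda>e\<in>K'. W e \<omega>)"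
    by (rule indep_var_restrict[OF indep]) (use K in auto)
  hence "indep_set (sets (edge_algebra K)) (sets (edge_algebra K'))"
    unfolding indep_var_eq edge_algebra_def sets_vimage_algebra by blast
  moreover have "sigma_sets (space M) {f -` A \<inter> space M |A. A \<in> sets borel} \<subseteq> sets (edge_algebra K)"
    using sets.sigma_sets_subset[of "{f -` A \<inter> space M |A. A \<in> sets borel}" "edge_algebra K"] measurable_sets[OF assms(1)] by auto
  moreover have "sigma_sets (space M) {g -` A \<inter> space M |A. A \<in> sets borel} \<subseteq> sets (edge_algebra K')"
    using sets.sigma_sets_subset[of "{g -` A \<inter> space M |A. A \<in> sets borel}" "edge_algebra K'"] measurable_sets[OF assms(2)] by auto
  ultimately have "indep_set (sigma_sets (space M) {f -` A \<inter> space M |A. A \<in> sets borel})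
       (sigma_sets (space M) {g -` A \<inter> space M |A. A \<in> sets borel})"
    unfolding indep_sets2_eq by (meson subset_trans subsetD)
  thus ?thesis unfolding indep_var_eq using assms edge_algebra_measurable by blast
qed

text \<open>The range [0,1] is part of the notion because it yields integrability at once and is
  stable under the products and convex combinations formed below.\<close>

definition depends :: "nat set set \<Rightarrow> ('a \<Rightarrow> real) \<Rightarrow> bool" where
  "depends K f \<longleftrightarrow> K \<subseteq> E \<and> f \<in> borel_measurable (edge_algebra K) \<and> (\<forall>\<omega>\<in>space M. 0 \<le> f \<omega> \<and> f \<omega> \<le> 1)"

lemma depends_integrable: "depends K f \<Longrightarrow> integrable M f"
  unfolding depends_def
  by (intro integrable_const_bound[of f 1] AE_I2) (auto intro: edge_algebra_measurable)

lemma depends_nonneg: "depends K f \<Longrightarrow> 0 \<le> expectation f"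
  unfolding depends_def by (intro integral_nonneg_AE AE_I2) auto

lemma depends_mult:
  assumes "depends K f" "depends K' g"
  shows "depends (K \<union> K') (\<lambda>\<omega>. f \<omega> * g \<omega>)"
proof -
  have "f \<in> borel_measurable (edge_algebra (K \<union> K'))" "g \<in> borel_measurable (edge_algebra (K \<union> K'))"
    using assms by (auto simp: depends_def intro: edge_algebra_mono)
  thus ?thesis using assms by (auto simp: depends_def mult_le_one)
qed

lemma depends_const: "K \<subseteq> E \<Longrightarrow> 0 \<le> c \<Longrightarrow> c \<le> 1 \<Longrightarrow> depends K (\<lambda>_. c)"
  by (auto simp: depends_def)

lemma depends_prod:
  assumes "finite J" "\<And>j. j \<in> J \<Longrightarrow> depends (K j) (f j)"
  shows "depends (\<Union>j\<in>J. K j) (\<lambda>\<omega>. \<Prod>j\<in>J. f j \<omega>)"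
  using assms by (induction J) (auto intro!: depends_const depends_mult)

lemma depends_of_bool:
  assumes "K \<subseteq> E" "Measurable.pred (edge_algebra K) Q"
  shows "depends K (\<lambda>\<omega>. of_bool (Q \<omega>))"
  using assms unfolding depends_def by (auto simp: of_bool_def)

lemma depends_convex:
  assumes "depends K f" "depends K g" "0 \<le> c" "c \<le> 1"
  shows "depends K (\<lambda>\<omega>. c * f \<omega> + (1 - c) * g \<omega>)"
  using assms unfolding depends_def by (auto intro!: convex_bound_le)

lemma expectation_mult:
  assumes "depends K f" "depends K' g" "K \<inter> K' = {}"
  shows "expectation (\<lambda>\<omega>. f \<omega> * g \<omega>) = expectation f * expectation g"
  using assms
  by (intro indep_var_lebesgue_integral indep_var_edge_algebra[of f K g K'])
     (auto simp: depends_integrable depends_def)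

lemma expectation_prod:
  assumes "finite J" "\<And>j. j \<in> J \<Longrightarrow> depends (K j) (f j)" "disjoint_family_on K J"
  shows "expectation (\<lambda>\<omega>. \<Prod>j\<in>J. f j \<omega>) = (\<Prod>j\<in>J. expectation (f j))"
  using assms
proof (induction J)
  case empty
  thus ?case by (simp add: prob_space)
next
  case (insert x J)
  have "expectation (\<lambda>\<omega>. f x \<omega> * (\<Prod>j\<in>J. f j \<omega>)) = expectation (f x) * expectation (\<lambda>\<omega>. \<Prod>j\<in>J. f j \<omega>)"
    using insert.prems insert.hyps
    by (intro expectation_mult[of "K x" _ "\<Union>j\<in>J. K j"] depends_prod) (auto simp: disjoint_family_on_def)
  thus ?case using insert by (auto simp: disjoint_family_on_def)
qed

lemma prob_W_interval:
  assumes "e \<in> E" "0 \<le> a" "a \<le> b" "b \<le> 1"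
  shows "prob {\<omega>\<in>space M. a \<le> W e \<omega> \<and> W e \<omega> \<le> b} = b - a"
proof -
  have "prob {\<omega>\<in>space M. a \<le> W e \<omega> \<and> W e \<omega> \<le> b} = measure (distr M lborel (W e)) {a..b}"
    using assms by (subst measure_distr) (auto intro!: arg_cong[of _ _ prob])
  also have "\<dots> = measure lborel ({0..1} \<inter> {a..b})"
    unfolding unif[OF assms(1)] by (subst measure_uniform_measure) auto
  also have "{0..1} \<inter> {a..b} = {a..b}" using assms by auto
  finally show ?thesis using assms by simp
qed

lemma W_in_unit: "e \<in> E \<Longrightarrow> prob_le (\<lambda>\<omega>. W e \<omega> < 0 \<or> W e \<omega> > 1) 0"
proof -
  assume e: "e \<in> E"
  have "{\<omega>\<in>space M. W e \<omega> < 0 \<or> W e \<omega> > 1} = space M - {\<omega>\<in>space M. 0 \<le> W e \<omega> \<and> W e \<omega> \<le> 1}" by auto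
  also have "prob \<dots> = 0" using e prob_W_interval[OF e, of 0 1] by (subst prob_compl) auto
  finally show ?thesis unfolding prob_le_def using e
    by (intro bexI[of _ "{\<omega>\<in>space M. W e \<omega> < 0 \<or> W e \<omega> > 1}"]) auto
qed

lemma weights_in_unit: "prob_le (\<lambda>\<omega>. \<exists>e\<in>E. W e \<omega> < 0 \<or> W e \<omega> > 1) 0"
  using prob_le_bex[of E "\<lambda>e \<omega>. W e \<omega> < 0 \<or> W e \<omega> > 1" "\<lambda>_. 0"] W_in_unit by auto

text \<open>Needed for counting cheap paths: with \<open>l\<close> slightly above n, each further
  edge contributes at most \<open>1 / l\<close>, against n choices for the next vertex.\<close>

lemma expectation_exp_W:
  assumes e: "e \<in> E" and l: "l > 0"
  shows "integrable M (\<lambda>\<omega>. exp (- l * W e \<omega>))" "expectation (\<lambda>\<omega>. exp (- l * W e \<omega>)) \<le> 1 / l"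
proof -
  let ?U = "uniform_measure lborel {0..1::real}"
  have eq: "distr M lborel (W e) = ?U" using unif e by auto
  interpret U: prob_space ?U by (rule prob_space_uniform_measure) auto
  have ae: "AE x in ?U. x \<in> {0..1::real}" by (rule AE_uniform_measureI) auto
  have int: "integrable ?U (\<lambda>x. exp (- l * x))"
    using l by (intro U.integrable_const_bound[where B=1]) (use ae in \<open>auto elim!: eventually_mono\<close>)
  hence int': "integrable (distr M lborel (W e)) (\<lambda>x. exp (- l * x))" by (simp add: eq)
  show "integrable M (\<lambda>\<omega>. exp (- l * W e \<omega>))"
    using integrable_distr[OF _ int'] e by auto
  have "expectation (\<lambda>\<omega>. exp (- l * W e \<omega>)) = (\<integral>x. exp (- l * x) \<partial>distr M lborel (W e))"
    using e by (subst integral_distr) auto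
  also have "\<dots> = (\<integral>x. indicator {0..1} x *\<^sub>R exp (- l * x) \<partial>lborel)"
  proof -
    have "?U = density lborel (\<lambda>x. ennreal (indicator {0..1} x))"
      unfolding uniform_measure_def by (intro density_cong) (auto simp: indicator_def)
    thus ?thesis unfolding eq by (simp add: integral_density)
  qed
  also have "\<dots> = (\<integral>x. exp (- l * x) * indicator {0..1} x \<partial>lborel)"
    by (simp add: mult.commute)
  also have "\<dots> = (- exp (- l * 1) / l) - (- exp (- l * 0) / l)"
    using l by (intro integral_FTC_Icc_real) (auto intro!: derivative_eq_intros continuous_intros)
  also have "\<dots> \<le> 1 / l" using l by (simp add: field_simps)
  finally show "expectation (\<lambda>\<omega>. exp (- l * W e \<omega>)) \<le> 1 / l" .
qed

text \<open>Chernoff's method: \<open>\<theta> < 1\<close> gives the lower and \<open>\<theta> > 1\<close> the upper tail.\<close>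

lemma chernoff_edges:
  assumes X: "X \<subseteq> E" and ab: "0 \<le> a" "a \<le> b" "b \<le> 1" and \<theta>: "\<theta> > 0"
    and Q: "\<And>\<omega>. \<omega> \<in> space M \<Longrightarrow> Q \<omega> \<Longrightarrow> \<theta> powr r \<le> \<theta> powr real (card {e\<in>X. a \<le> W e \<omega> \<and> W e \<omega> \<le> b})"
  shows "prob_le Q (exp ((\<theta> - 1) * (b - a) * real (card X)) * \<theta> powr (- r))"
proof -
  have fin: "finite X" using X finite_complete_edges by (rule finite_subset)
  define f where "f e \<omega> = (if a \<le> W e \<omega> \<and> W e \<omega> \<le> b then \<theta> else 1)" for e \<omega>
  have meas: "f e \<in> borel_measurable M" if "e \<in> X" for e
    using that X W_measurable[of e] unfolding f_def by auto
  have int: "integrable M (f e)" if "e \<in> X" for e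
    using meas[OF that] \<theta> by (intro integrable_const_bound[of _ "max \<theta> 1"]) (auto simp: f_def)
  have ind: "indep_vars (\<lambda>_. borel) f X"
  proof -
    have "indep_vars (\<lambda>_. borel) (\<lambda>e \<omega>. (\<lambda>x. if a \<le> x \<and> x \<le> b then \<theta> else 1) (W e \<omega>)) X"
      by (rule indep_vars_compose2[OF indep_vars_subset[OF indep X]]) auto
    thus ?thesis by (simp add: f_def[abs_def])
  qed
  have Ef: "expectation (f e) = 1 + (\<theta> - 1) * (b - a)" if "e \<in> X" for e
  proof -
    have m: "{\<omega>\<in>space M. a \<le> W e \<omega> \<and> W e \<omega> \<le> b} \<in> events" using that X W_measurable[of e] by auto
    have "expectation (f e) = expectation (\<lambda>\<omega>. 1 + (\<theta> - 1) * indicator {\<omega>\<in>space M. a \<le> W e \<omega> \<and> W e \<omega> \<le> b} \<omega>)"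
      by (intro Bochner_Integration.integral_cong) (auto simp: f_def indicator_def)
    also have "\<dots> = 1 + (\<theta> - 1) * prob {\<omega>\<in>space M. a \<le> W e \<omega> \<and> W e \<omega> \<le> b}"
    proof -
      have "integrable M (indicator {\<omega>\<in>space M. a \<le> W e \<omega> \<and> W e \<omega> \<le> b} :: 'a \<Rightarrow> real)"
        using m by (intro integrable_real_indicator) (auto simp: less_top[symmetric])
      thus ?thesis using m by (subst Bochner_Integration.integral_add) (auto simp: prob_space)
    qed
    finally show ?thesis using prob_W_interval that X ab by auto
  qed
  have "expectation (\<lambda>\<omega>. (\<Prod>e\<in>X. f e \<omega>)) = (\<Prod>e\<in>X. expectation (f e))"
    by (rule indep_vars_lebesgue_integral[OF fin ind int])
  also have "\<dots> = (1 + (\<theta> - 1) * (b - a)) ^ card X" using Ef by simp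
  also have "\<dots> \<le> exp ((\<theta> - 1) * (b - a)) ^ card X"
  proof (rule power_mono)
    show "1 + (\<theta> - 1) * (b - a) \<le> exp ((\<theta> - 1) * (b - a))" by (rule exp_ge_add_one_self)
    have "(b - a) * (1 - \<theta>) \<le> 1" using ab \<theta> mult_mono[of "b - a" 1 "1 - \<theta>" 1]
      by (cases "\<theta> \<le> 1") (auto simp: mult_nonneg_nonpos intro: order.trans[of _ 0])
    thus "0 \<le> 1 + (\<theta> - 1) * (b - a)" by (simp add: algebra_simps)
  qed
  also have "\<dots> = exp ((\<theta> - 1) * (b - a) * real (card X))"
    by (simp add: exp_of_nat_mult[symmetric] mult.commute)
  finally have E: "expectation (\<lambda>\<omega>. (\<Prod>e\<in>X. f e \<omega>)) \<le> \<dots>" .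
  show ?thesis
  proof (rule prob_le_markov)
    show "integrable M (\<lambda>\<omega>. (\<Prod>e\<in>X. f e \<omega>) * \<theta> powr (-r))"
      using indep_vars_integrable[OF fin ind int] by auto
    show "0 \<le> (\<Prod>e\<in>X. f e \<omega>) * \<theta> powr (-r)" for \<omega>
      using \<theta> by (intro mult_nonneg_nonneg prod_nonneg) (auto simp: f_def)
    show "expectation (\<lambda>\<omega>. (\<Prod>e\<in>X. f e \<omega>) * \<theta> powr (-r)) \<le> exp ((\<theta> - 1) * (b - a) * real (card X)) * \<theta> powr (- r)"
      using E by (simp add: mult_right_mono)
    fix \<omega> assume w: "\<omega> \<in> space M" "Q \<omega>"
    have "(\<Prod>e\<in>X. f e \<omega>) = \<theta> ^ card {e\<in>X. a \<le> W e \<omega> \<and> W e \<omega> \<le> b}"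
      using fin by (simp add: f_def prod.If_cases Int_def)
    also have "\<dots> = \<theta> powr real (card {e\<in>X. a \<le> W e \<omega> \<and> W e \<omega> \<le> b})"
      using \<theta> by (simp add: powr_realpow)
    also have "\<dots> * \<theta> powr (-r) \<ge> \<theta> powr r * \<theta> powr (- r)"
      using Q[OF w] by (intro mult_right_mono) auto
    also have "\<theta> powr r * \<theta> powr (- r) = 1" using \<theta> by (simp flip: powr_add)
    finally show "1 \<le> (\<Prod>e\<in>X. f e \<omega>) * \<theta> powr (-r)" by simp
  qed
qed

end

section \<open>First-passage percolation\<close>

text \<open>Ruling out all weights below \<open>lo\<close> avoids the light removed edges without listing them in \<open>D\<close>.\<close>

definition link :: "(nat set \<Rightarrow> real) \<Rightarrow> nat set set \<Rightarrow> real \<Rightarrow> nat \<Rightarrow> nat \<Rightarrow> real \<Rightarrow> bool" where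
  "link w D lo u v x \<longleftrightarrow> {u, v} \<notin> D \<and> lo \<le> w {u, v} \<and> w {u, v} \<le> x"

lemma link_mono: "link w D lo u v x \<Longrightarrow> x \<le> y \<Longrightarrow> link w D lo u v y"
  by (auto simp: link_def)

text \<open>First-passage percolation from \<open>A\<close> into \<open>V\<close>, observed at the times \<open>tau 0, tau 1, \<dots>\<close>:
  after \<open>j\<close> rounds a vertex carries its birth round, or \<open>Suc j\<close> if it has not been reached.\<close>

primrec birth :: "nat set set \<Rightarrow> real \<Rightarrow> (nat \<Rightarrow> real) \<Rightarrow> nat set \<Rightarrow> (nat set \<Rightarrow> real) \<Rightarrow> nat set \<Rightarrow> nat \<Rightarrow> nat \<Rightarrow> nat" where
  "birth D lo tau A w V 0 = (\<lambda>v. if v \<in> A then 0 else 1)"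
| "birth D lo tau A w V (Suc j) = (\<lambda>v. if birth D lo tau A w V j v \<le> j then birth D lo tau A w V j v
     else if v \<in> V \<and> (\<exists>u\<in>A \<union> V - {v}. birth D lo tau A w V j u \<le> j \<and>
        link w D lo u v (tau (Suc j) - tau (birth D lo tau A w V j u))) then Suc j else Suc (Suc j))"

section \<open>Deterministic facts about the exploration\<close>

locale exploration =
  fixes D :: "nat set set" and lo :: real and tau :: "nat \<Rightarrow> real" and A :: "nat set"
  assumes lo: "lo > 0" and tau: "mono tau"
begin

abbreviation "bir \<equiv> birth D lo tau A"
abbreviation "lnk \<equiv> \<lambda>w. link w D lo"

definition "born w V j = {v \<in> A \<union> V. bir w V j v \<le> j}"

lemma birth_stable: "bir w V i v \<le> i \<Longrightarrow> i \<le> j \<Longrightarrow> bir w V j v = bir w V i v"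
proof (induction j)
  case (Suc j)
  show ?case
  proof (cases "i = Suc j")
    case False
    hence "bir w V j v = bir w V i v" "i \<le> j" using Suc by auto
    thus ?thesis using Suc.prems by auto
  qed auto
qed auto

lemma birth_init: "v \<in> A \<Longrightarrow> bir w V j v = 0"
  by (induction j) auto

lemma born_mono: "i \<le> j \<Longrightarrow> born w V i \<subseteq> born w V j"
proof
  fix v assume "i \<le> j" "v \<in> born w V i"
  moreover from this have "bir w V j v = bir w V i v" by (intro birth_stable) (auto simp: born_def)
  ultimately show "v \<in> born w V j" by (auto simp: born_def)
qed

lemma born_0: "A \<inter> V = {} \<Longrightarrow> born w V 0 = A"
  unfolding born_def by auto

text \<open>Positivity of \<open>lo\<close> enters here: a vertex born in round \<open>j\<close>
  itself has had no time to spread, and its threshold \<open>tau j - tau j = 0\<close> lies below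
  \<open>lo\<close>.\<close>

lemma unborn_no_link:
  assumes "v \<in> V" "bir w V j v > j" "u \<in> A \<union> V" "bir w V j u \<le> j"
  shows "\<not> lnk w u v (tau j - tau (bir w V j u))"
proof (cases j)
  case 0
  thus ?thesis using assms lo by (auto simp: link_def split: if_splits)
next
  case (Suc i)
  show ?thesis
  proof (cases "bir w V i u \<le> i")
    case True
    have "bir w V j u = bir w V i u" using birth_stable[OF True, of j] Suc by auto
    moreover have "u \<noteq> v" using assms by auto
    ultimately show ?thesis using assms Suc True by (auto split: if_splits)
  next
    case False
    hence "bir w V j u = j" using assms Suc by (auto split: if_splits)
    thus ?thesis using lo by (auto simp: link_def)
  qed
qed

text \<open>A vertex outside \<open>V1\<close> could influence the others only after being reached,
  and it never is: a link available in an earlier round would still be available at time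
  \<open>tau j\<close>, by \<open>link_mono\<close>.\<close>

lemma birth_restrict:
  assumes V: "V1 \<subseteq> V" "A \<inter> V = {}"
    and nl: "\<And>u v. v \<in> V - V1 \<Longrightarrow> u \<in> A \<union> V1 \<Longrightarrow> bir w V1 j u \<le> j \<Longrightarrow> \<not> lnk w u v (tau j - tau (bir w V1 j u))"
    and "i \<le> j"
  shows "(\<forall>u\<in>A \<union> V1. bir w V i u = bir w V1 i u) \<and> (\<forall>v\<in>V - V1. bir w V i v = Suc i)"
  using \<open>i \<le> j\<close>
proof (induction i)
  case 0
  thus ?case using V by auto
next
  case (Suc i)
  hence IH: "\<And>u. u \<in> A \<union> V1 \<Longrightarrow> bir w V i u = bir w V1 i u" "\<And>v. v \<in> V - V1 \<Longrightarrow> bir w V i v = Suc i" by auto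
  have "(\<exists>u\<in>A \<union> V - {v}. bir w V i u \<le> i \<and> lnk w u v (tau (Suc i) - tau (bir w V i u))) \<longleftrightarrow>
     (\<exists>u\<in>A \<union> V1 - {v}. bir w V1 i u \<le> i \<and> lnk w u v (tau (Suc i) - tau (bir w V1 i u)))" for v
  proof -
    have "u \<in> A \<union> V1" if "u \<in> A \<union> V" "bir w V i u \<le> i" for u
      using that IH(2)[of u] by (cases "u \<in> V - V1") auto
    note in_V1 = this
    show ?thesis
    proof
      assume "\<exists>u\<in>A \<union> V - {v}. bir w V i u \<le> i \<and> lnk w u v (tau (Suc i) - tau (bir w V i u))"
      then obtain u where u: "u \<in> A \<union> V" "u \<noteq> v" "bir w V i u \<le> i" "lnk w u v (tau (Suc i) - tau (bir w V i u))" by blast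
      have u1: "u \<in> A \<union> V1" by (rule in_V1[OF u(1,3)])
      show "\<exists>u\<in>A \<union> V1 - {v}. bir w V1 i u \<le> i \<and> lnk w u v (tau (Suc i) - tau (bir w V1 i u))"
        using u u1 IH(1)[OF u1] by (intro bexI[of _ u]) simp_all
    next
      assume "\<exists>u\<in>A \<union> V1 - {v}. bir w V1 i u \<le> i \<and> lnk w u v (tau (Suc i) - tau (bir w V1 i u))"
      then obtain u where u: "u \<in> A \<union> V1" "u \<noteq> v" "bir w V1 i u \<le> i" "lnk w u v (tau (Suc i) - tau (bir w V1 i u))" by blast
      have "u \<in> A \<union> V" using u(1) V(1) by blast
      thus "\<exists>u\<in>A \<union> V - {v}. bir w V i u \<le> i \<and> lnk w u v (tau (Suc i) - tau (bir w V i u))"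
        using u IH(1)[OF u(1)] by (intro bexI[of _ u]) simp_all
    qed
  qed
  moreover have "\<not> (\<exists>u\<in>A \<union> V1 - {v}. bir w V1 i u \<le> i \<and> lnk w u v (tau (Suc i) - tau (bir w V1 i u)))"
    if v: "v \<in> V - V1" for v
  proof
    assume "\<exists>u\<in>A \<union> V1 - {v}. bir w V1 i u \<le> i \<and> lnk w u v (tau (Suc i) - tau (bir w V1 i u))"
    then obtain u where u: "u \<in> A \<union> V1" "bir w V1 i u \<le> i" "lnk w u v (tau (Suc i) - tau (bir w V1 i u))" by blast
    have b: "bir w V1 j u = bir w V1 i u" using birth_stable[OF u(2), of j] Suc.prems by auto
    have "tau (Suc i) \<le> tau j" using tau Suc.prems by (auto simp: mono_def)
    hence "lnk w u v (tau j - tau (bir w V1 j u))" using u(3) by (auto intro: link_mono simp: b)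
    thus False using nl[OF v u(1)] b u(2) Suc.prems by auto
  qed
  ultimately show ?case using IH V by auto
qed

text \<open>Every vertex that spreads before round \<open>j\<close> is born by then and so belongs
  to \<open>A \<union> V1\<close>; the vertices left out have not yet acted.\<close>

lemma birth_restrict_born:
  assumes V1: "V1 = {v \<in> V. bir w V j v \<le> j}" and "A \<inter> V = {}" "i \<le> j" "u \<in> A \<union> V1"
  shows "bir w V i u = bir w V1 i u"
  using assms(3,4)
proof (induction i arbitrary: u)
  case (Suc i)
  have IH: "bir w V i x = bir w V1 i x" if "x \<in> A \<union> V1" for x using Suc.IH[of x] Suc.prems that by linarith
  have in_V1: "x \<in> A \<union> V1" if "x \<in> A \<union> V" "bir w V i x \<le> i" for x
  proof -
    have "bir w V j x \<le> j" using birth_stable[OF that(2), of j] Suc.prems that by linarith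
    thus ?thesis unfolding V1 using that(1) by blast
  qed
  have sub: "V1 \<subseteq> V" unfolding V1 by blast
  have "(\<exists>x\<in>A \<union> V - {u}. bir w V i x \<le> i \<and> lnk w x u (tau (Suc i) - tau (bir w V i x))) \<longleftrightarrow>
     (\<exists>x\<in>A \<union> V1 - {u}. bir w V1 i x \<le> i \<and> lnk w x u (tau (Suc i) - tau (bir w V1 i x)))" (is "?l \<longleftrightarrow> ?r")
  proof
    assume ?l
    then obtain x where x: "x \<in> A \<union> V" "x \<noteq> u" "bir w V i x \<le> i" "lnk w x u (tau (Suc i) - tau (bir w V i x))" by blast
    have x1: "x \<in> A \<union> V1" by (rule in_V1[OF x(1,3)])
    show ?r using x x1 IH[OF x1] by (intro bexI[of _ x]) simp_all
  next
    assume ?r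
    then obtain x where x: "x \<in> A \<union> V1" "x \<noteq> u" "bir w V1 i x \<le> i" "lnk w x u (tau (Suc i) - tau (bir w V1 i x))" by blast
    have "x \<in> A \<union> V" using x(1) sub by blast
    thus ?l using x IH[OF x(1)] by (intro bexI[of _ x]) simp_all
  qed
  moreover have "u \<in> V \<longleftrightarrow> u \<in> V1" if "u \<notin> A" using Suc.prems(2) that sub by blast
  moreover have "u \<in> A \<Longrightarrow> bir w V1 i u = 0" by (rule birth_init)
  moreover note IH[OF Suc.prems(2)]
  ultimately show ?case by (cases "u \<in> A") simp_all
qed auto

text \<open>Turns an event about the run on all of \<open>V\<close> into one about the run on
  \<open>V1\<close> plus the absence of certain links, by \<open>birth_restrict_born\<close> and
  \<open>unborn_no_link\<close> in one direction and by \<open>birth_restrict\<close> in the other.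
  Only in this form do the conditions at different unreached vertices concern disjoint
  edges.\<close>

lemma history_iff:
  assumes V: "V1 \<subseteq> V" "A \<inter> V = {}"
  shows "(V1 = {v \<in> V. bir w V j v \<le> j} \<and> (\<forall>u\<in>A \<union> V1. bir w V j u = \<beta> u)) \<longleftrightarrow>
    (\<forall>u\<in>A \<union> V1. bir w V1 j u = \<beta> u \<and> \<beta> u \<le> j) \<and>
    (\<forall>v\<in>V - V1. \<forall>u\<in>A \<union> V1. \<not> lnk w u v (tau j - tau (\<beta> u)))" (is "?L \<longleftrightarrow> ?R")
proof
  assume L: ?L
  have 1: "bir w V1 j u = \<beta> u" if "u \<in> A \<union> V1" for u
  proof -
    have V1: "V1 = {v \<in> V. bir w V j v \<le> j}" using L by blast
    have "bir w V j u = \<beta> u" using L that by blast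
    thus ?thesis using birth_restrict_born[OF V1 V(2) order_refl that] by simp
  qed
  have 2: "\<beta> u \<le> j" if u: "u \<in> A \<union> V1" for u
  proof -
    have "u \<in> A \<or> u \<in> {v \<in> V. bir w V j v \<le> j}" using L u by blast
    hence "bir w V j u \<le> j" using birth_init[of u w V j] by (elim disjE) simp_all
    moreover have "bir w V j u = \<beta> u" using L u by blast
    ultimately show ?thesis by simp
  qed
  have 3: "\<not> lnk w u v (tau j - tau (\<beta> u))" if v: "v \<in> V - V1" and u: "u \<in> A \<union> V1" for u v
  proof -
    have b: "bir w V j u = \<beta> u" using L u by blast
    have "v \<in> V" "v \<notin> {v \<in> V. bir w V j v \<le> j}" using L v by blast+
    hence "v \<in> V" "j < bir w V j v" by simp_all
    moreover have "u \<in> A \<union> V" using u V(1) by blast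
    ultimately have "\<not> lnk w u v (tau j - tau (bir w V j u))"
      using 2[OF u] unfolding b[symmetric] by (intro unborn_no_link)
    thus ?thesis by (simp only: b not_False_eq_True)
  qed
  show ?R using 1 2 3 by blast
next
  assume R: ?R
  have *: "(\<forall>u\<in>A \<union> V1. bir w V j u = bir w V1 j u) \<and> (\<forall>v\<in>V - V1. bir w V j v = Suc j)"
    by (rule birth_restrict[OF V _ order_refl]) (use R in auto)
  have "v \<in> V1 \<longleftrightarrow> bir w V j v \<le> j" if v: "v \<in> V" for v
  proof (cases "v \<in> V1")
    case True
    hence "bir w V j v = \<beta> v" "\<beta> v \<le> j" using * R by auto
    thus ?thesis using True by simp
  next
    case False
    hence "bir w V j v = Suc j" using * v by blast
    thus ?thesis using False by simp
  qed
  hence "V1 = {v \<in> V. bir w V j v \<le> j}" using V(1) by blast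
  moreover have "\<forall>u\<in>A \<union> V1. bir w V j u = \<beta> u" using * R by simp
  ultimately show ?L ..
qed

lemma birth_Suc_le_iff:
  assumes V: "V1 = {v \<in> V. bir w V j v \<le> j}" "\<And>u. u \<in> A \<union> V1 \<Longrightarrow> bir w V j u = \<beta> u" "A \<inter> V = {}" "v \<in> V - V1"
  shows "bir w V (Suc j) v \<le> Suc j \<longleftrightarrow> (\<exists>u\<in>A \<union> V1. lnk w u v (tau (Suc j) - tau (\<beta> u)))"
proof -
  have "(\<exists>u\<in>A \<union> V - {v}. bir w V j u \<le> j \<and> lnk w u v (tau (Suc j) - tau (bir w V j u))) \<longleftrightarrow>
    (\<exists>u\<in>A \<union> V1. lnk w u v (tau (Suc j) - tau (\<beta> u)))" (is "?l \<longleftrightarrow> ?r")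
  proof
    assume ?l
    then obtain u where u: "u \<in> A \<union> V" "bir w V j u \<le> j" "lnk w u v (tau (Suc j) - tau (bir w V j u))" by blast
    hence "u \<in> A \<union> V1" unfolding V(1) by blast
    thus ?r using u V(2) by (intro bexI[of _ u]) simp_all
  next
    assume ?r
    then obtain u where u: "u \<in> A \<union> V1" "lnk w u v (tau (Suc j) - tau (\<beta> u))" by blast
    have "u \<in> A \<or> u \<in> {v \<in> V. bir w V j v \<le> j}" using u(1) V(1) by blast
    hence "bir w V j u \<le> j" using birth_init[of u w V j] by (elim disjE) simp_all
    moreover have "u \<in> A \<union> V - {v}" using u(1) assms(3,4) unfolding V(1) by blast
    ultimately show ?l using u V(2)[OF u(1)] by (intro bexI[of _ u]) simp_all
  qed
  moreover have "v \<in> V" "\<not> bir w V j v \<le> j" using assms(4) unfolding V(1) by blast+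
  ultimately show ?thesis by simp
qed

end

section \<open>Link probabilities\<close>

context random_weights
begin

abbreviation "Wt \<omega> \<equiv> (\<lambda>e. W e \<omega>)"

lemma link_pred:
  assumes "{u, v} \<in> K"
  shows "Measurable.pred (edge_algebra K) (\<lambda>\<omega>. link (Wt \<omega>) D lo u v x)"
proof -
  have [measurable]: "W {u, v} \<in> borel_measurable (edge_algebra K)" by (rule W_measurable_edge_algebra) fact
  show ?thesis unfolding link_def by measurable
qed

lemma birth_measurable:
  assumes fin: "finite A" "finite V"
    and K: "\<And>u v. u \<in> A \<union> V \<Longrightarrow> v \<in> V \<Longrightarrow> u \<noteq> v \<Longrightarrow> {u, v} \<in> K"
  shows "(\<lambda>\<omega>. birth D lo tau A (Wt \<omega>) V j v) \<in> measurable (edge_algebra K) (count_space UNIV)"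
proof (induction j arbitrary: v)
  case (Suc j)
  note [measurable] = Suc.IH
  show ?case
  proof (cases "v \<in> V")
    case True
    have [measurable]: "finite (A \<union> V - {v})" using fin by auto
    have [measurable]: "Measurable.pred (edge_algebra K) (\<lambda>\<omega>. birth D lo tau A (Wt \<omega>) V j u \<le> j \<and>
      link (Wt \<omega>) D lo u v (tau (Suc j) - tau (birth D lo tau A (Wt \<omega>) V j u)))" if "u \<in> A \<union> V - {v}" for u
    proof -
      have "{u, v} \<in> K" using K that True by auto
      hence [measurable]: "W {u, v} \<in> borel_measurable (edge_algebra K)" by (rule W_measurable_edge_algebra)
      show ?thesis unfolding link_def by measurable
    qed
    have [measurable]: "Measurable.pred (edge_algebra K) (\<lambda>\<omega>. \<exists>u\<in>A \<union> V - {v}. birth D lo tau A (Wt \<omega>) V j u \<le> j \<and>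
      link (Wt \<omega>) D lo u v (tau (Suc j) - tau (birth D lo tau A (Wt \<omega>) V j u)))"
      using fin by (intro pred_intros_finite) auto
    show ?thesis using True by simp
  next
    case False
    have [simp]: "(\<lambda>\<omega>. birth D lo tau A (Wt \<omega>) V (Suc j) v) = (\<lambda>\<omega>. if birth D lo tau A (Wt \<omega>) V j v \<le> j
        then birth D lo tau A (Wt \<omega>) V j v else Suc (Suc j))"
      using False by (simp cong: if_cong)
    show ?thesis unfolding \<open>_ = _\<close> by measurable
  qed
qed auto

lemma expectation_no_link:
  assumes e: "{u, v} \<in> E" and lo: "0 \<le> lo" and x: "x \<le> 1"
  shows "expectation (\<lambda>\<omega>. of_bool (\<not> link (Wt \<omega>) D lo u v x) :: real) = (if {u, v} \<in> D \<or> x < lo then 1 else 1 - (x - lo))"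
proof (cases "{u, v} \<in> D \<or> x < lo")
  case True
  thus ?thesis by (auto simp: link_def prob_space of_bool_def)
next
  case False
  have m: "{\<omega> \<in> space M. lo \<le> W {u, v} \<omega> \<and> W {u, v} \<omega> \<le> x} \<in> events" using e by auto
  have "expectation (\<lambda>\<omega>. of_bool (\<not> link (Wt \<omega>) D lo u v x)) =
    expectation (\<lambda>\<omega>. 1 - indicator {\<omega> \<in> space M. lo \<le> W {u, v} \<omega> \<and> W {u, v} \<omega> \<le> x} \<omega>)"
    using False by (intro Bochner_Integration.integral_cong) (auto simp: link_def indicator_def)
  also have "\<dots> = 1 - prob {\<omega> \<in> space M. lo \<le> W {u, v} \<omega> \<and> W {u, v} \<omega> \<le> x}"
  proof -
    have "integrable M (indicator {\<omega>\<in>space M. lo \<le> W {u, v} \<omega> \<and> W {u, v} \<omega> \<le> x} :: 'a \<Rightarrow> real)"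
      using m by (intro integrable_real_indicator) (auto simp: less_top[symmetric])
    thus ?thesis using m by (subst Bochner_Integration.integral_diff) (auto simp: prob_space)
  qed
  finally show ?thesis using False prob_W_interval[OF e, of lo x] lo x by auto
qed

lemma of_bool_Ball: "finite U \<Longrightarrow> of_bool (\<forall>u\<in>U. P u) = (\<Prod>u\<in>U. of_bool (P u) :: real)"
  by (induction U rule: finite_induct) auto

lemma depends_no_links:
  assumes "finite U" "\<And>u. u \<in> U \<Longrightarrow> {u, v} \<in> E"
  shows "depends ((\<lambda>u. {u, v}) ` U) (\<lambda>\<omega>. of_bool (\<forall>u\<in>U. \<not> link (Wt \<omega>) D lo u v (x u)))"
proof -
  have "depends (\<Union>u\<in>U. {{u,v}}) (\<lambda>\<omega>. \<Prod>u\<in>U. of_bool (\<not> link (Wt \<omega>) D lo u v (x u)))"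
    using assms by (intro depends_prod depends_of_bool pred_intros_logic link_pred) auto
  moreover have "(\<Union>u\<in>U. {{u,v}}) = (\<lambda>u. {u, v}) ` U" by auto
  ultimately show ?thesis using assms(1) by (simp add: of_bool_Ball)
qed

lemma expectation_no_links:
  assumes "finite U" "\<And>u. u \<in> U \<Longrightarrow> {u, v} \<in> E" "0 \<le> lo" "\<And>u. u \<in> U \<Longrightarrow> x u \<le> 1"
  shows "expectation (\<lambda>\<omega>. of_bool (\<forall>u\<in>U. \<not> link (Wt \<omega>) D lo u v (x u)) :: real) =
    (\<Prod>u\<in>U. if {u, v} \<in> D \<or> x u < lo then 1 else 1 - (x u - lo))"
proof -
  have "expectation (\<lambda>\<omega>. \<Prod>u\<in>U. of_bool (\<not> link (Wt \<omega>) D lo u v (x u)) :: real) =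
     (\<Prod>u\<in>U. expectation (\<lambda>\<omega>. of_bool (\<not> link (Wt \<omega>) D lo u v (x u))))"
  proof (rule expectation_prod[where K="\<lambda>u. {{u,v}}"])
    show "depends {{u, v}} (\<lambda>\<omega>. of_bool (\<not> link (Wt \<omega>) D lo u v (x u)))" if "u \<in> U" for u
      using assms(2)[OF that] by (intro depends_of_bool pred_intros_logic link_pred) auto
  qed (use assms in \<open>auto simp: disjoint_family_on_def doubleton_eq_iff\<close>)
  also have "\<dots> = (\<Prod>u\<in>U. if {u, v} \<in> D \<or> x u < lo then 1 else 1 - (x u - lo))"
    using assms by (intro prod.cong expectation_no_link) auto
  finally show ?thesis using assms(1) by (simp add: of_bool_Ball)
qed

text \<open>A substitute for the memorylessness of exponential weights: a uniform weight not yet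
  found below \<open>x u\<close> is found in the next stretch of length \<open>d\<close> with
  conditional probability at least \<open>d - lo\<close>. The \<open>lo\<close> is lost when
  \<open>x u < lo\<close>, because a link must weigh at least \<open>lo\<close>.\<close>

lemma expectation_no_links_extend:
  assumes U: "finite U" "\<And>u. u \<in> U \<Longrightarrow> {u, v} \<in> E" and lo: "0 \<le> lo" "\<And>u. u \<in> U \<Longrightarrow> x u + d \<le> 1"
    and q: "0 \<le> d - lo" and x: "\<And>u. u \<in> U \<Longrightarrow> 0 \<le> x u"
  shows "expectation (\<lambda>\<omega>. of_bool (\<forall>u\<in>U. \<not> link (Wt \<omega>) D lo u v (x u + d)) :: real) \<le>
    (1 - (d - lo)) ^ card {u \<in> U. {u, v} \<notin> D} * expectation (\<lambda>\<omega>. of_bool (\<forall>u\<in>U. \<not> link (Wt \<omega>) D lo u v (x u)))"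
proof -
  have "expectation (\<lambda>\<omega>. of_bool (\<forall>u\<in>U. \<not> link (Wt \<omega>) D lo u v (x u + d))) =
    (\<Prod>u\<in>U. if {u, v} \<in> D \<or> x u + d < lo then 1 else 1 - (x u + d - lo))"
    using assms by (intro expectation_no_links) auto
  also have "\<dots> \<le> (\<Prod>u\<in>U. (if {u,v} \<in> D then 1 else 1 - (d - lo)) * (if {u, v} \<in> D \<or> x u < lo then 1 else 1 - (x u - lo)))"
  proof (intro prod_mono conjI)
    fix u assume u: "u \<in> U"
    show "0 \<le> (if {u, v} \<in> D \<or> x u + d < lo then 1 else 1 - (x u + d - lo))" using lo(2)[OF u] lo(1) by auto
    have "1 - (x u + d - lo) \<le> (1 - (d - lo)) * (1 - (x u - lo))" if "\<not> x u < lo"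
      using mult_nonneg_nonneg[OF q, of "x u - lo"] that lo by (auto simp: algebra_simps)
    thus "(if {u, v} \<in> D \<or> x u + d < lo then 1 else 1 - (x u + d - lo)) \<le>
      (if {u,v} \<in> D then 1 else 1 - (d - lo)) * (if {u, v} \<in> D \<or> x u < lo then 1 else 1 - (x u - lo))"
      using q x[OF u] by auto
  qed
  also have "\<dots> = (\<Prod>u\<in>U. (if {u,v} \<in> D then 1 else 1 - (d - lo))) * (\<Prod>u\<in>U. if {u, v} \<in> D \<or> x u < lo then 1 else 1 - (x u - lo))"
    by (rule prod.distrib)
  also have "(\<Prod>u\<in>U. (if {u,v} \<in> D then 1 else 1 - (d - lo))) = (1 - (d - lo)) ^ card {u \<in> U. {u, v} \<notin> D}"
    using U(1) by (simp add: prod.If_cases Int_def)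
  also have "(\<Prod>u\<in>U. if {u, v} \<in> D \<or> x u < lo then 1 else 1 - (x u - lo)) =
     expectation (\<lambda>\<omega>. of_bool (\<forall>u\<in>U. \<not> link (Wt \<omega>) D lo u v (x u)))"
  proof (rule expectation_no_links[symmetric])
    show "x u \<le> 1" if "u \<in> U" for u using lo(2)[OF that] lo(1) q by linarith
  qed (use assms in auto)
  finally show ?thesis .
qed

end

text \<open>As \<open>U\<close> and \<open>Z\<close> are disjoint, an edge of \<open>D\<close>
  spoils at most one of the pairs.\<close>

lemma sum_card_pairs_avoiding:
  fixes U Z :: "nat set"
  assumes fin: "finite U" "finite Z" "finite D" and disj: "U \<inter> Z = {}"
  shows "real (card Z) * real (card U) - real (card D) \<le> (\<Sum>v\<in>Z. real (card {u \<in> U. {u, v} \<notin> D}))"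
proof -
  have 1: "card U = card {u \<in> U. {u, v} \<notin> D} + card {u \<in> U. {u, v} \<in> D}" for v
    using fin by (subst card_Un_disjoint[symmetric]) (auto intro!: arg_cong[of _ _ card])
  have "(\<Sum>v\<in>Z. card {u \<in> U. {u, v} \<in> D}) = card (SIGMA v:Z. {u \<in> U. {u, v} \<in> D})"
    using fin by simp
  also have "\<dots> \<le> card D"
  proof (rule card_inj_on_le[where f="\<lambda>(v, u). {u, v}"])
    show "inj_on (\<lambda>(v, u). {u, v}) (SIGMA v:Z. {u \<in> U. {u, v} \<in> D})"
      using disj by (auto simp: inj_on_def doubleton_eq_iff)
  qed (use fin in auto)
  finally have 2: "(\<Sum>v\<in>Z. card {u \<in> U. {u, v} \<in> D}) \<le> card D" .
  have "card Z * card U = (\<Sum>v\<in>Z. card {u \<in> U. {u, v} \<notin> D} + card {u \<in> U. {u, v} \<in> D})"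
    using 1 by simp
  also have "\<dots> \<le> (\<Sum>v\<in>Z. card {u \<in> U. {u, v} \<notin> D}) + card D" using 2 by (simp add: sum.distrib)
  finally have "real (card Z * card U) \<le> real ((\<Sum>v\<in>Z. card {u \<in> U. {u, v} \<notin> D}) + card D)"
    by (rule of_nat_mono)
  thus ?thesis by simp
qed

lemma exp_minus_le_quadratic:
  fixes x :: real
  assumes "x \<ge> 0"
  shows "exp (- x) \<le> 1 - x + x\<^sup>2 / 2"
proof -
  have "(\<lambda>x. 1 - x + x\<^sup>2 / 2 - exp (- x)) 0 \<le> (\<lambda>x. 1 - x + x\<^sup>2 / 2 - exp (- x)) x"
  proof (rule DERIV_nonneg_imp_nondecreasing[OF assms])
    fix y :: real assume "0 \<le> y" "y \<le> x"
    have "((\<lambda>x. 1 - x + x\<^sup>2 / 2 - exp (- x)) has_real_derivative (- 1 + y + exp (- y))) (at y)"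
      by (auto intro!: derivative_eq_intros simp: power2_eq_square)
    moreover have "0 \<le> - 1 + y + exp (- y)" using exp_ge_add_one_self[of "- y"] by simp
    ultimately show "\<exists>d. ((\<lambda>x. 1 - x + x\<^sup>2 / 2 - exp (- x)) has_real_derivative d) (at y) \<and> 0 \<le> d" by blast
  qed
  thus ?thesis by simp
qed

text \<open>A second-order Bonferroni bound. Having \<open>k\<close> instead of \<open>d\<close> in
  the correction term makes it linear in \<open>d\<close>, so that it can be summed over vertices
  with different numbers of admissible edges.\<close>

lemma one_minus_power_ge:
  fixes q :: real
  assumes "0 \<le> q" "q \<le> 1" "d \<le> k"
  shows "q * real d * (1 - q * real k / 2) \<le> 1 - (1 - q) ^ d"
proof -
  have "(1 - q) ^ d \<le> exp (- q) ^ d"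
    using assms exp_ge_add_one_self[of "-q"] by (intro power_mono) auto
  also have "\<dots> = exp (- (q * real d))" by (simp add: exp_of_nat_mult[symmetric] mult.commute)
  also have "\<dots> \<le> 1 - q * real d + (q * real d)\<^sup>2 / 2"
    using assms by (intro exp_minus_le_quadratic) simp
  also have "(q * real d)\<^sup>2 / 2 \<le> q * real d * (q * real k / 2)"
    unfolding power2_eq_square using assms by (simp add: mult_left_mono mult_mono)
  finally show ?thesis by (simp add: algebra_simps)
qed

lemma sum_of_bool_unique_le_1:
  assumes "finite S" "\<And>x y. x \<in> S \<Longrightarrow> y \<in> S \<Longrightarrow> P x \<Longrightarrow> P y \<Longrightarrow> x = y"
  shows "(\<Sum>x\<in>S. of_bool (P x) :: real) \<le> 1"
proof -
  have "(\<Sum>x\<in>S. of_bool (P x) :: real) = real (card {x \<in> S. P x})"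
    using assms(1) by (simp add: of_bool_def sum.If_cases Int_def)
  also have "card {x \<in> S. P x} \<le> 1"
    using assms by (subst card_le_Suc0_iff_eq[simplified One_nat_def[symmetric]]) auto
  finally show ?thesis by simp
qed

context random_weights
begin

text \<open>The proof conditions on the history \<open>(V1, \<beta>)\<close> of the exploration: \<open>V1\<close> is the set of
  vertices reached and \<open>\<beta>\<close> their birth rounds. A history prescribes the weights inside \<open>A \<union> V1\<close>
  and, for an unreached \<open>v\<close>, only lower bounds on the edges to \<open>A \<union> V1\<close>; these groups of edges
  are disjoint, so Chernoff's bound applies conditionally on each history.\<close>

lemma exploration_step:
  assumes expl: "exploration lo tau"
    and A: "A \<subseteq> {1..n}" and V: "V \<subseteq> {1..n}" and AV: "A \<inter> V = {}"
    and D: "finite D"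
    and KG: "KG \<subseteq> E" "\<And>e. e \<in> KG \<Longrightarrow> e \<inter> V = {}" and Q: "Measurable.pred (edge_algebra KG) Q"
    and time: "tau (Suc j) - tau 0 \<le> 1" and q: "q = tau (Suc j) - tau j - lo" "0 \<le> q"
    and \<theta>: "0 < \<theta>" "\<theta> \<le> 1"
    and size: "\<And>k. kmin \<le> k \<Longrightarrow> k \<le> kmax \<Longrightarrow> k \<le> card A + card V \<Longrightarrow> q * real k \<le> 2"
    and bnd: "\<And>k. kmin \<le> k \<Longrightarrow> k \<le> kmax \<Longrightarrow> k \<le> card A + card V \<Longrightarrow>
      \<theta> powr (- g k) * exp (- (1 - \<theta>) * (q * (1 - q * real k / 2) *
        ((real (card V) + real (card A) - real k) * real k - real (card D)))) \<le> b"
    and b: "0 \<le> b"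
  shows "prob_le (\<lambda>\<omega>. Q \<omega> \<and> kmin \<le> card (exploration.born D lo tau A (Wt \<omega>) V j) \<and>
            card (exploration.born D lo tau A (Wt \<omega>) V j) \<le> kmax \<and>
            real (card (exploration.born D lo tau A (Wt \<omega>) V (Suc j))) - real (card (exploration.born D lo tau A (Wt \<omega>) V j))
              < g (card (exploration.born D lo tau A (Wt \<omega>) V j)))
         (expectation (\<lambda>\<omega>. of_bool (Q \<omega>)) * b)"
proof -
  interpret exploration D lo tau A by fact
  have fin: "finite A" "finite V" using A V finite_subset by auto
  have taum: "i \<le> i' \<Longrightarrow> tau i \<le> tau i'" for i i' using tau by (auto simp: mono_def)
  define d where "d = tau (Suc j) - tau j"
  have qd: "q = d - lo" using q d_def by simp
  have d1: "d \<le> 1" using time taum[of 0 j] by (auto simp: d_def)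
  have q1: "q \<le> 1" using qd d1 lo by linarith
  \<comment> \<open>All conceivable histories. The restriction on the size of
    \<open>A \<union> V1\<close> confines them to the cardinalities for which \<open>bnd\<close> is
    assumed.\<close>
  define VS where "VS = {V1. V1 \<subseteq> V \<and> kmin \<le> card (A \<union> V1) \<and> card (A \<union> V1) \<le> kmax}"
  define S where "S = (SIGMA V1:VS. PiE (A \<union> V1) (\<lambda>_. {..j}))"
  have finS: "finite S" unfolding S_def
  proof (rule finite_SigmaI)
    show "finite VS" unfolding VS_def using fin by (auto intro: finite_subset[of _ "Pow V"])
    show "finite (PiE (A \<union> V1) (\<lambda>_. {..j}))" if "V1 \<in> VS" for V1
      using that fin finite_subset[of V1 V] by (intro finite_PiE) (auto simp: VS_def)
  qed
  define core where "core = (\<lambda>(V1, \<beta>) \<omega>. \<forall>u\<in>A \<union> V1. bir (Wt \<omega>) V1 j u = \<beta> u \<and> \<beta> u \<le> j)"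
  define C where "C = (\<lambda>(V1, \<beta>) v \<omega>. \<forall>u\<in>A \<union> V1. \<not> lnk (Wt \<omega>) u v (tau j - tau (\<beta> u)))"
  define N where "N = (\<lambda>(V1, \<beta>) v \<omega>. \<forall>u\<in>A \<union> V1. \<not> lnk (Wt \<omega>) u v (tau j - tau (\<beta> u) + d))"
  \<comment> \<open>On the event of history \<open>x\<close> every \<open>C x v\<close> holds, and
    \<open>N x v\<close> says that \<open>v\<close> is still unreached in round
    \<open>Suc j\<close>. The factor at \<open>v\<close> is then \<open>\<theta>\<close> if
    \<open>v\<close> is newly reached and 1 otherwise, so the product is \<open>\<theta>\<close> to
    the number of new vertices.\<close>
  define trm where "trm x \<omega> = of_bool (Q \<omega>) * (of_bool (core x \<omega>) *
     (\<Prod>v\<in>V - fst x. \<theta> * of_bool (C x v \<omega>) + (1 - \<theta>) * of_bool (N x v \<omega>)))" for x \<omega>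
  define hist where "hist x \<omega> = of_bool (Q \<omega>) * (of_bool (core x \<omega>) *
     (\<Prod>v\<in>V - fst x. of_bool (C x v \<omega>) :: real))" for x \<omega>
  define pQ :: real where "pQ = expectation (\<lambda>\<omega>. of_bool (Q \<omega>))"
  have depQ: "depends KG (\<lambda>\<omega>. of_bool (Q \<omega>))" using KG Q by (intro depends_of_bool)
  have pQ0: "0 \<le> pQ" unfolding pQ_def using depQ by (rule depends_nonneg)
  let ?k = "\<lambda>x. card (A \<union> fst x)"
  have main: "expectation (trm x) * \<theta> powr (- g (?k x)) \<le> b * expectation (hist x) \<and> integrable M (trm x) \<and> integrable M (hist x)
     \<and> expectation (hist x) = pQ * expectation (\<lambda>\<omega>. of_bool (core x \<omega> \<and> (\<forall>v\<in>V - fst x. C x v \<omega>)))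
     \<and> integrable M (\<lambda>\<omega>. of_bool (core x \<omega> \<and> (\<forall>v\<in>V - fst x. C x v \<omega>)) :: real)"
    if "x \<in> S" for x
  proof -
    obtain V1 \<beta> where x: "x = (V1, \<beta>)" by (cases x)
    have V1: "V1 \<subseteq> V" "kmin \<le> card (A \<union> V1)" "card (A \<union> V1) \<le> kmax" and \<beta>: "\<And>u. u \<in> A \<union> V1 \<Longrightarrow> \<beta> u \<le> j"
      using that by (auto simp: x S_def VS_def)
    have finV1: "finite V1" using V1 fin finite_subset by auto
    let ?U = "A \<union> V1" and ?Z = "V - V1"
    let ?k = "card ?U"
    have finU: "finite ?U" using fin finV1 by auto
    have k: "?k = card A + card V1" using fin finV1 AV V1 by (subst card_Un_disjoint) auto
    have kV: "?k \<le> card A + card V" using k card_mono[OF fin(2) V1(1)] by auto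
    have cardZ: "real (card ?Z) = real (card V) + real (card A) - real ?k"
      using k card_Diff_subset[OF finV1 V1(1)] card_mono[OF fin(2) V1(1)] by auto
    define K2 where "K2 = {{u, v} |u v. u \<in> ?U \<and> v \<in> V1 \<and> u \<noteq> v}"
    define Kv where "Kv v = (\<lambda>u. {u, v}) ` ?U" for v
    have edge: "{u, v} \<in> E" if "u \<in> ?U" "v \<in> ?Z" for u v

    proof -
      have "u \<in> {1..n}" "v \<in> {1..n}" "u \<noteq> v" using that A V V1 AV by blast+
      thus ?thesis by (simp only: doubleton_complete_edges_iff) simp
    qed
    have K2E: "K2 \<subseteq> E" 
    proof
      fix e assume "e \<in> K2"
      then obtain u v where "e = {u, v}" "u \<in> A \<union> V1" "v \<in> V1" "u \<noteq> v" unfolding K2_def by blast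
      moreover from this have "u \<in> {1..n}" "v \<in> {1..n}" using A V V1 by blast+
      ultimately show "e \<in> E" by (simp only: doubleton_complete_edges_iff) simp
    qed
    have depcore: "depends K2 (\<lambda>\<omega>. of_bool (core x \<omega>))"
    proof (rule depends_of_bool[OF K2E])
      have [measurable]: "(\<lambda>\<omega>. bir (Wt \<omega>) V1 j u) \<in> measurable (edge_algebra K2) (count_space UNIV)" for u
        using fin finV1 by (intro birth_measurable) (auto simp: K2_def)
      show "Measurable.pred (edge_algebra K2) (core x)"
        unfolding core_def x prod.case using finU by (intro pred_intros_finite) measurable
    qed
    have depC: "depends (Kv v) (\<lambda>\<omega>. of_bool (C x v \<omega>))" if "v \<in> ?Z" for v
      unfolding C_def x prod.case Kv_def using finU edge that by (intro depends_no_links) auto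
    have depN: "depends (Kv v) (\<lambda>\<omega>. of_bool (N x v \<omega>))" if "v \<in> ?Z" for v
      unfolding N_def x prod.case Kv_def using finU edge that by (intro depends_no_links) auto
    have depT: "depends (Kv v) (\<lambda>\<omega>. \<theta> * of_bool (C x v \<omega>) + (1 - \<theta>) * of_bool (N x v \<omega>))" if "v \<in> ?Z" for v
      using depC[OF that] depN[OF that] \<theta> by (intro depends_convex) auto
    have disjKv: "disjoint_family_on Kv ?Z"
      using V1 AV by (auto simp: disjoint_family_on_def Kv_def doubleton_eq_iff)
    have disj2: "K2 \<inter> (\<Union>v\<in>?Z. Kv v) = {}"
      using V1 AV by (auto simp: K2_def Kv_def doubleton_eq_iff)
    have disjG: "KG \<inter> (K2 \<union> (\<Union>v\<in>?Z. Kv v)) = {}"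
    proof -
      have "e \<inter> V \<noteq> {}" if "e \<in> K2 \<union> (\<Union>v\<in>?Z. Kv v)" for e
        using that V1 by (auto simp: K2_def Kv_def)
      thus ?thesis using KG(2) by blast
    qed
    have finZ: "finite ?Z" using fin by auto
    have depP: "depends (\<Union>v\<in>?Z. Kv v) (\<lambda>\<omega>. \<Prod>v\<in>?Z. \<theta> * of_bool (C x v \<omega>) + (1 - \<theta>) * of_bool (N x v \<omega>))"
      by (intro depends_prod finZ depT)
    have depPC: "depends (\<Union>v\<in>?Z. Kv v) (\<lambda>\<omega>. \<Prod>v\<in>?Z. of_bool (C x v \<omega>))"
      by (intro depends_prod finZ depC)
    have E1: "expectation (trm x) = pQ * (expectation (\<lambda>\<omega>. of_bool (core x \<omega>)) *
      (\<Prod>v\<in>?Z. expectation (\<lambda>\<omega>. \<theta> * of_bool (C x v \<omega>) + (1 - \<theta>) * of_bool (N x v \<omega>))))"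
      unfolding trm_def pQ_def x fst_conv
      unfolding x[symmetric]
      by (subst expectation_mult[OF depQ depends_mult[OF depcore depP] disjG],
          subst expectation_mult[OF depcore depP disj2], subst expectation_prod[OF finZ depT disjKv]) auto
    have E2: "expectation (hist x) = pQ * (expectation (\<lambda>\<omega>. of_bool (core x \<omega>)) *
      (\<Prod>v\<in>?Z. expectation (\<lambda>\<omega>. of_bool (C x v \<omega>))))"
      unfolding hist_def pQ_def x fst_conv
      unfolding x[symmetric]
      by (subst expectation_mult[OF depQ depends_mult[OF depcore depPC] disjG],
          subst expectation_mult[OF depcore depPC disj2], subst expectation_prod[OF finZ depC disjKv]) auto
    let ?d = "\<lambda>v. card {u \<in> ?U. {u, v} \<notin> D}"
    have EN: "expectation (\<lambda>\<omega>. of_bool (N x v \<omega>)) \<le> (1 - q) ^ ?d v * expectation (\<lambda>\<omega>. of_bool (C x v \<omega>))"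
      if v: "v \<in> ?Z" for v
      unfolding N_def C_def x prod.case qd
    proof (rule expectation_no_links_extend)
      fix u assume u: "u \<in> ?U"
      have "tau (\<beta> u) \<le> tau j" "tau 0 \<le> tau (\<beta> u)" using \<beta>[OF u] taum by auto
      thus "tau j - tau (\<beta> u) + d \<le> 1" "0 \<le> tau j - tau (\<beta> u)" using time by (auto simp: d_def)
    qed (use finU edge v lo q qd in auto)
    have ET: "expectation (\<lambda>\<omega>. \<theta> * of_bool (C x v \<omega>) + (1 - \<theta>) * of_bool (N x v \<omega>)) \<le>
       exp (- (1 - \<theta>) * (q * (1 - q * real ?k / 2) * real (?d v))) * expectation (\<lambda>\<omega>. of_bool (C x v \<omega>))"
      if v: "v \<in> ?Z" for v
    proof -
      let ?c = "expectation (\<lambda>\<omega>. of_bool (C x v \<omega>))"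
      have "expectation (\<lambda>\<omega>. \<theta> * of_bool (C x v \<omega>) + (1 - \<theta>) * of_bool (N x v \<omega>)) =
        \<theta> * ?c + (1 - \<theta>) * expectation (\<lambda>\<omega>. of_bool (N x v \<omega>))"
        using depends_integrable[OF depC[OF v]] depends_integrable[OF depN[OF v]] by simp
      also have "\<dots> \<le> \<theta> * ?c + (1 - \<theta>) * ((1 - q) ^ ?d v * ?c)"
        using EN[OF v] \<theta> by (intro add_mono mult_left_mono) auto
      also have "\<dots> = (1 + - (1 - \<theta>) * (1 - (1 - q) ^ ?d v)) * ?c" by (simp add: algebra_simps)
      also have "\<dots> \<le> exp (- (1 - \<theta>) * (1 - (1 - q) ^ ?d v)) * ?c"
        by (intro mult_right_mono exp_ge_add_one_self depends_nonneg[OF depC[OF v]])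
      also have "\<dots> \<le> exp (- (1 - \<theta>) * (q * real (?d v) * (1 - q * real ?k / 2))) * ?c"
      proof -
        have "?d v \<le> ?k" by (intro card_mono finU) auto
        moreover have "0 \<le> 1 - \<theta>" using \<theta> by simp
        ultimately have "- (1 - \<theta>) * (1 - (1 - q) ^ ?d v) \<le> - (1 - \<theta>) * (q * real (?d v) * (1 - q * real ?k / 2))"
          unfolding mult_minus_left neg_le_iff_le by (intro mult_left_mono one_minus_power_ge q q1)
        thus ?thesis by (intro mult_right_mono depends_nonneg[OF depC[OF v]]) simp
      qed
      finally show ?thesis by (simp add: mult_ac)
    qed
    have "(\<Prod>v\<in>?Z. expectation (\<lambda>\<omega>. \<theta> * of_bool (C x v \<omega>) + (1 - \<theta>) * of_bool (N x v \<omega>))) \<le>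
       (\<Prod>v\<in>?Z. exp (- (1 - \<theta>) * (q * (1 - q * real ?k / 2) * real (?d v))) * expectation (\<lambda>\<omega>. of_bool (C x v \<omega>)))"
      using ET depT by (intro prod_mono conjI depends_nonneg) auto
    also have "\<dots> = exp (- (1 - \<theta>) * (q * (1 - q * real ?k / 2) * (\<Sum>v\<in>?Z. real (?d v)))) * (\<Prod>v\<in>?Z. expectation (\<lambda>\<omega>. of_bool (C x v \<omega>)))"
      unfolding prod.distrib exp_sum[OF finZ, symmetric] sum_distrib_left ..
    also have "\<dots> \<le> exp (- (1 - \<theta>) * (q * (1 - q * real ?k / 2) *
        ((real (card V) + real (card A) - real ?k) * real ?k - real (card D)))) * (\<Prod>v\<in>?Z. expectation (\<lambda>\<omega>. of_bool (C x v \<omega>)))"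
    proof -
      have "(real (card V) + real (card A) - real ?k) * real ?k - real (card D) \<le> (\<Sum>v\<in>?Z. real (?d v))"
        using sum_card_pairs_avoiding[OF finU finZ D] AV cardZ by auto
      moreover have "0 \<le> q * (1 - q * real ?k / 2)" using q size[OF V1(2,3) kV] by auto
      moreover have "0 \<le> 1 - \<theta>" using \<theta> by simp
      ultimately have "- (1 - \<theta>) * (q * (1 - q * real ?k / 2) * (\<Sum>v\<in>?Z. real (?d v))) \<le>
        - (1 - \<theta>) * (q * (1 - q * real ?k / 2) * ((real (card V) + real (card A) - real ?k) * real ?k - real (card D)))"
        unfolding mult_minus_left neg_le_iff_le by (intro mult_left_mono)
      thus ?thesis by (intro mult_right_mono prod_nonneg depends_nonneg[OF depC]) simp_all
    qed
    finally have P: "(\<Prod>v\<in>?Z. expectation (\<lambda>\<omega>. \<theta> * of_bool (C x v \<omega>) + (1 - \<theta>) * of_bool (N x v \<omega>))) \<le> \<dots>" .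
    let ?e = "exp (- (1 - \<theta>) * (q * (1 - q * real ?k / 2) *
        ((real (card V) + real (card A) - real ?k) * real ?k - real (card D))))"
    have "expectation (trm x) \<le> ?e * expectation (hist x)"
      unfolding E1 E2 using P mult_left_mono[OF P, of "pQ * expectation (\<lambda>\<omega>. of_bool (core x \<omega>))"] pQ0 depends_nonneg[OF depcore]
      by (simp add: mult_ac)
    hence "expectation (trm x) * \<theta> powr (- g ?k) \<le> ?e * expectation (hist x) * \<theta> powr (- g ?k)"
      by (rule mult_right_mono) simp
    hence "expectation (trm x) * \<theta> powr (- g ?k) \<le> (\<theta> powr (- g ?k) * ?e) * expectation (hist x)"
      by (simp only: mult_ac)
    also have "\<dots> \<le> b * expectation (hist x)"
    proof (intro mult_right_mono bnd V1 kV)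
      show "0 \<le> expectation (hist x)" unfolding E2
        by (intro mult_nonneg_nonneg pQ0 depends_nonneg[OF depcore] prod_nonneg) (auto intro: depends_nonneg[OF depC])
    qed
    finally have 1: "expectation (trm x) * \<theta> powr (- g ?k) \<le> b * expectation (hist x)" .
    have 2: "integrable M (trm x)"
      using depends_integrable[OF depends_mult[OF depQ depends_mult[OF depcore depP]]]
      unfolding trm_def[abs_def] x by simp
    have 3: "integrable M (hist x)"
      using depends_integrable[OF depends_mult[OF depQ depends_mult[OF depcore depPC]]]
      unfolding hist_def[abs_def] x by simp
    have eqb: "(\<lambda>\<omega>. of_bool (core x \<omega> \<and> (\<forall>v\<in>V - fst x. C x v \<omega>)) :: real) =
       (\<lambda>\<omega>. of_bool (core x \<omega>) * (\<Prod>v\<in>?Z. of_bool (C x v \<omega>)))"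
      using finZ by (auto simp: x of_bool_Ball[symmetric])
    have 4: "expectation (hist x) = pQ * expectation (\<lambda>\<omega>. of_bool (core x \<omega> \<and> (\<forall>v\<in>V - fst x. C x v \<omega>)))"
      unfolding E2 eqb by (subst expectation_mult[OF depcore depPC disj2], subst expectation_prod[OF finZ depC disjKv]) auto
    have 5: "integrable M (\<lambda>\<omega>. of_bool (core x \<omega> \<and> (\<forall>v\<in>V - fst x. C x v \<omega>)) :: real)"
      unfolding eqb by (rule depends_integrable[OF depends_mult[OF depcore depPC]])
    show ?thesis using 1 2 3 4 5 by (simp add: x)
  qed
  have hist_iff: "core (V1, \<beta>) \<omega> \<and> (\<forall>v\<in>V - V1. C (V1, \<beta>) v \<omega>) \<longleftrightarrow>
     V1 = {v \<in> V. bir (Wt \<omega>) V j v \<le> j} \<and> (\<forall>u\<in>A \<union> V1. bir (Wt \<omega>) V j u = \<beta> u)" if "V1 \<subseteq> V" for V1 \<beta> \<omega>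
    unfolding core_def C_def prod.case using history_iff[OF that AV, of "Wt \<omega>" j \<beta>] by blast
  \<comment> \<open>Histories are mutually exclusive, so their probabilities sum to at most 1; this
    averages the bounds obtained history by history.\<close>
  have unique: "(\<Sum>x\<in>S. of_bool (core x \<omega> \<and> (\<forall>v\<in>V - fst x. C x v \<omega>)) :: real) \<le> 1" for \<omega>
  proof (rule sum_of_bool_unique_le_1[OF finS])
    fix x y assume xy: "x \<in> S" "y \<in> S" "core x \<omega> \<and> (\<forall>v\<in>V - fst x. C x v \<omega>)" "core y \<omega> \<and> (\<forall>v\<in>V - fst y. C y v \<omega>)"
    obtain V1 \<beta> where x: "x = (V1, \<beta>)" by (cases x)
    obtain V2 \<gamma> where y: "y = (V2, \<gamma>)" by (cases y)
    have s: "V1 \<subseteq> V" "\<beta> \<in> PiE (A \<union> V1) (\<lambda>_. {..j})" "V2 \<subseteq> V" "\<gamma> \<in> PiE (A \<union> V2) (\<lambda>_. {..j})"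
      using xy by (auto simp: x y S_def VS_def)
    have hx: "V1 = {v \<in> V. bir (Wt \<omega>) V j v \<le> j} \<and> (\<forall>u\<in>A \<union> V1. bir (Wt \<omega>) V j u = \<beta> u)"
      by (rule iffD1[OF hist_iff[OF s(1)]]) (rule xy(3)[unfolded x fst_conv])
    have hy: "V2 = {v \<in> V. bir (Wt \<omega>) V j v \<le> j} \<and> (\<forall>u\<in>A \<union> V2. bir (Wt \<omega>) V j u = \<gamma> u)"
      by (rule iffD1[OF hist_iff[OF s(3)]]) (rule xy(4)[unfolded y fst_conv])
    have VV: "V2 = V1" by (rule trans[OF conjunct1[OF hy] conjunct1[OF hx, THEN sym]])
    have "\<beta> = \<gamma>"
    proof (rule PiE_ext[OF s(2) s(4)[unfolded VV]])
      fix u assume u: "u \<in> A \<union> V1"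
      show "\<beta> u = \<gamma> u"
        by (rule trans[OF bspec[OF conjunct2[OF hx] u, THEN sym] bspec[OF conjunct2[OF hy[unfolded VV]] u]])
    qed
    thus "x = y" unfolding x y VV by (rule arg_cong)
  qed
  have sumhist_eq: "(\<Sum>x\<in>S. expectation (hist x)) = pQ * (\<Sum>x\<in>S. expectation (\<lambda>\<omega>. of_bool (core x \<omega> \<and> (\<forall>v\<in>V - fst x. C x v \<omega>))))"
    using main by (simp add: sum_distrib_left)
  have "(\<Sum>x\<in>S. expectation (\<lambda>\<omega>. of_bool (core x \<omega> \<and> (\<forall>v\<in>V - fst x. C x v \<omega>)) :: real)) =
     expectation (\<lambda>\<omega>. \<Sum>x\<in>S. of_bool (core x \<omega> \<and> (\<forall>v\<in>V - fst x. C x v \<omega>)))"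
    using main by (intro Bochner_Integration.integral_sum[symmetric]) auto
  also have "\<dots> \<le> expectation (\<lambda>_. 1)"
    using main unique by (intro integral_mono Bochner_Integration.integrable_sum) auto
  finally have "(\<Sum>x\<in>S. expectation (\<lambda>\<omega>. of_bool (core x \<omega> \<and> (\<forall>v\<in>V - fst x. C x v \<omega>)) :: real)) \<le> 1"
    by (simp add: prob_space)
  from mult_left_mono[OF this pQ0] have sumhist: "(\<Sum>x\<in>S. expectation (hist x)) \<le> pQ"
    unfolding sumhist_eq by simp
  show ?thesis
  proof (rule prob_le_markov[where f="\<lambda>\<omega>. \<Sum>x\<in>S. trm x \<omega> * \<theta> powr (- g (?k x))"])
    have trm_nonneg: "0 \<le> trm x \<omega>" for x \<omega>
      unfolding trm_def using \<theta> by (intro mult_nonneg_nonneg prod_nonneg) auto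
    show "integrable M (\<lambda>\<omega>. \<Sum>x\<in>S. trm x \<omega> * \<theta> powr (- g (?k x)))"
      using main by (intro Bochner_Integration.integrable_sum) auto
    show "0 \<le> (\<Sum>x\<in>S. trm x \<omega> * \<theta> powr (- g (?k x)))" for \<omega>
      using trm_nonneg by (intro sum_nonneg) auto
    have "expectation (\<lambda>\<omega>. \<Sum>x\<in>S. trm x \<omega> * \<theta> powr (- g (?k x))) = (\<Sum>x\<in>S. expectation (trm x) * \<theta> powr (- g (?k x)))"
      using main by (subst Bochner_Integration.integral_sum) auto
    also have "\<dots> \<le> (\<Sum>x\<in>S. b * expectation (hist x))" by (rule sum_mono) (rule conjunct1[OF main])
    also have "\<dots> \<le> b * pQ" using sumhist b by (simp add: sum_distrib_left[symmetric] mult_left_mono)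
    finally show "expectation (\<lambda>\<omega>. \<Sum>x\<in>S. trm x \<omega> * \<theta> powr (- g (?k x))) \<le> expectation (\<lambda>\<omega>. of_bool (Q \<omega>)) * b"
      by (simp add: pQ_def mult.commute)
    fix \<omega> assume w: "\<omega> \<in> space M" and bad: "Q \<omega> \<and> kmin \<le> card (born (Wt \<omega>) V j) \<and> card (born (Wt \<omega>) V j) \<le> kmax \<and>
      real (card (born (Wt \<omega>) V (Suc j))) - real (card (born (Wt \<omega>) V j)) < g (card (born (Wt \<omega>) V j))"
    define V1 where "V1 = {v \<in> V. bir (Wt \<omega>) V j v \<le> j}"
    define \<beta> where "\<beta> = (\<lambda>u\<in>A \<union> V1. bir (Wt \<omega>) V j u)"
    have born_eq: "born (Wt \<omega>) V j = A \<union> V1" unfolding born_def V1_def using birth_init by auto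
    have V1V: "V1 \<subseteq> V" by (auto simp: V1_def)
    have "\<forall>u\<in>A \<union> V1. bir (Wt \<omega>) V j u \<le> j" unfolding V1_def using birth_init by auto
    hence xS: "(V1, \<beta>) \<in> S" using bad V1V by (auto simp: S_def VS_def born_eq \<beta>_def)
    have \<beta>u: "bir (Wt \<omega>) V j u = \<beta> u" if "u \<in> A \<union> V1" for u using that by (simp add: \<beta>_def)
    have cc: "core (V1, \<beta>) \<omega>" "\<And>v. v \<in> V - V1 \<Longrightarrow> C (V1, \<beta>) v \<omega>"
      using hist_iff[OF V1V, of \<beta> \<omega>] \<beta>u V1_def by blast+
    have Niff: "N (V1, \<beta>) v \<omega> \<longleftrightarrow> \<not> bir (Wt \<omega>) V (Suc j) v \<le> Suc j" if v: "v \<in> V - V1" for v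
      using birth_Suc_le_iff[OF V1_def \<beta>u AV v] by (simp add: N_def d_def)
    let ?new = "{v \<in> V - V1. bir (Wt \<omega>) V (Suc j) v \<le> Suc j}"
    have "born (Wt \<omega>) V (Suc j) = born (Wt \<omega>) V j \<union> ?new"
    proof
      show "born (Wt \<omega>) V (Suc j) \<subseteq> born (Wt \<omega>) V j \<union> ?new"
        unfolding born_eq unfolding born_def by auto
      show "born (Wt \<omega>) V j \<union> ?new \<subseteq> born (Wt \<omega>) V (Suc j)"
        using born_mono[of j "Suc j" "Wt \<omega>" V] by (auto simp: born_def simp del: birth.simps)
    qed
    hence "card (born (Wt \<omega>) V (Suc j)) = card (born (Wt \<omega>) V j) + card ?new"
      using fin V1V AV finite_subset[OF V1V] unfolding born_eq by (subst card_Un_disjoint[symmetric]) (auto simp del: birth.simps)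
    hence new: "real (card ?new) < g (card (A \<union> V1))" using bad by (simp add: born_eq)
    have "trm (V1, \<beta>) \<omega> = (\<Prod>v\<in>V - V1. if v \<in> ?new then \<theta> else 1)"
      unfolding trm_def using cc bad Niff by (auto intro!: prod.cong simp del: birth.simps)
    also have "\<dots> = \<theta> ^ card ?new"
    proof -
      have "(\<Prod>v\<in>V - V1. if v \<in> B then \<theta> else 1) = \<theta> ^ card B" if "B \<subseteq> V - V1" for B
        using fin that by (simp add: prod.If_cases Int_absorb1)
      from this[OF Collect_subset] show ?thesis .
    qed
    also have "\<dots> = \<theta> powr real (card ?new)" using \<theta> by (simp add: powr_realpow)
    also have "\<dots> \<ge> \<theta> powr (g (card (A \<union> V1)))" using new \<theta> by (intro powr_mono') auto
    finally have "trm (V1, \<beta>) \<omega> * \<theta> powr (- g (card (A \<union> V1))) \<ge> \<theta> powr (g (card (A \<union> V1))) * \<theta> powr (- g (card (A \<union> V1)))"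
      by (intro mult_right_mono) auto
    also have "\<theta> powr (g (card (A \<union> V1))) * \<theta> powr (- g (card (A \<union> V1))) = 1" using \<theta> by (simp flip: powr_add)
    finally have "1 \<le> trm (V1, \<beta>) \<omega> * \<theta> powr (- g (?k (V1, \<beta>)))" by simp
    also have "\<dots> \<le> (\<Sum>x\<in>S. trm x \<omega> * \<theta> powr (- g (?k x)))"
      using trm_nonneg by (intro member_le_sum[OF xS _ finS]) auto
    finally show "1 \<le> (\<Sum>x\<in>S. trm x \<omega> * \<theta> powr (- g (?k x)))" .
  qed
qed

end

section \<open>Links from the explored set to a target\<close>

lemma (in exploration) born_1:
  assumes "A \<inter> V = {}"
  shows "born w V (Suc 0) = A \<union> {v \<in> V. \<exists>u\<in>A. lnk w u v (tau (Suc 0) - tau 0)}"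
  unfolding born_def using assms by (auto split: if_splits)

lemma (in exploration) born_subset: "born w V j \<subseteq> A \<union> V"
  unfolding born_def by auto

context random_weights
begin

text \<open>The edges between \<open>V\<close> and \<open>T\<close> are disjoint from those that
  decide the exploration and hence fresh given its outcome. The link must start in \<open>V\<close>,
  not merely in a born vertex, because an edge from \<open>A\<close> to \<open>T\<close> avoids
  \<open>V\<close> and may belong to \<open>KG\<close>.\<close>

lemma exploration_hit:
  assumes expl: "exploration lo tau"
    and A: "A \<subseteq> {1..n}" and V: "V \<subseteq> {1..n}" and AV: "A \<inter> V = {}"
    and T: "T \<subseteq> {1..n}" "T \<inter> (A \<union> V) = {}"
    and D: "finite D"
    and KG: "KG \<subseteq> E" "\<And>e. e \<in> KG \<Longrightarrow> e \<inter> V = {}" and Q: "Measurable.pred (edge_algebra KG) Q"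
    and x: "lo \<le> x" "x \<le> 1"
  shows "prob_le (\<lambda>\<omega>. Q \<omega> \<and> r \<le> real (card (exploration.born D lo tau A (Wt \<omega>) V j \<inter> V)) \<and>
            (\<forall>u\<in>exploration.born D lo tau A (Wt \<omega>) V j \<inter> V. \<forall>v\<in>T. \<not> link (Wt \<omega>) D lo u v x))
         (expectation (\<lambda>\<omega>. of_bool (Q \<omega>)) * exp (- (x - lo) * (real (card T) * r - real (card D))))"
proof -
  interpret exploration D lo tau A by fact
  have fin: "finite A" "finite V" "finite T" by (rule finite_subset, (rule A V T(1))+, simp)+
  define VS where "VS = {V1. V1 \<subseteq> V \<and> r \<le> real (card V1)}"
  have finVS: "finite VS" unfolding VS_def using fin by (auto intro: finite_subset[of _ "Pow V"])
  define K2 where "K2 = {{u, v} |u v. u \<in> A \<union> V \<and> v \<in> V \<and> u \<noteq> v}"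
  define core where "core V1 \<omega> \<longleftrightarrow> (\<forall>v\<in>V. v \<in> V1 \<longleftrightarrow> bir (Wt \<omega>) V j v \<le> j)" for V1 \<omega>
  define trm where "trm V1 \<omega> = of_bool (Q \<omega>) * (of_bool (core V1 \<omega>) *
     (\<Prod>v\<in>T. of_bool (\<forall>u\<in>V1. \<not> lnk (Wt \<omega>) u v x) :: real))" for V1 \<omega>
  define pQ :: real where "pQ = expectation (\<lambda>\<omega>. of_bool (Q \<omega>))"
  have depQ: "depends KG (\<lambda>\<omega>. of_bool (Q \<omega>))" using KG Q by (intro depends_of_bool)
  have pQ0: "0 \<le> pQ" unfolding pQ_def using depQ by (rule depends_nonneg)
  have K2E: "K2 \<subseteq> E"
  proof
    fix e assume "e \<in> K2"
    then obtain u v where "e = {u, v}" "u \<in> A \<union> V" "v \<in> V" "u \<noteq> v" unfolding K2_def by blast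
    moreover from this have "u \<in> {1..n}" "v \<in> {1..n}" using A V by blast+
    ultimately show "e \<in> E" by (simp only: doubleton_complete_edges_iff) simp
  qed
  have depcore: "depends K2 (\<lambda>\<omega>. of_bool (core V1 \<omega>))" for V1
  proof (rule depends_of_bool[OF K2E])
    have [measurable]: "(\<lambda>\<omega>. bir (Wt \<omega>) V j u) \<in> measurable (edge_algebra K2) (count_space UNIV)" for u
      using fin by (intro birth_measurable) (auto simp: K2_def)
    show "Measurable.pred (edge_algebra K2) (core V1)"
      unfolding core_def using fin by (intro pred_intros_finite) measurable
  qed
  let ?e = "exp (- (x - lo) * (real (card T) * r - real (card D)))"
  have main: "expectation (trm V1) \<le> ?e * pQ * expectation (\<lambda>\<omega>. of_bool (core V1 \<omega>)) \<and> integrable M (trm V1)"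
    if "V1 \<in> VS" for V1
  proof -
    have V1: "V1 \<subseteq> V" "r \<le> real (card V1)" using that by (auto simp: VS_def)
    have finV1: "finite V1" using V1 fin finite_subset by auto
    define Kv where "Kv v = (\<lambda>u. {u, v}) ` V1" for v
    have edge: "{u, v} \<in> E" if "u \<in> V1" "v \<in> T" for u v
    proof -
      have "u \<in> {1..n}" "v \<in> {1..n}" "u \<noteq> v" using that T V V1 by blast+
      thus ?thesis by (simp only: doubleton_complete_edges_iff) simp
    qed
    have depC: "depends (Kv v) (\<lambda>\<omega>. of_bool (\<forall>u\<in>V1. \<not> lnk (Wt \<omega>) u v x))" if "v \<in> T" for v
      unfolding Kv_def using finV1 edge that by (intro depends_no_links) auto
    have disjKv: "disjoint_family_on Kv T"
      using V1 T by (auto simp: disjoint_family_on_def Kv_def doubleton_eq_iff)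
    have disj2: "K2 \<inter> (\<Union>v\<in>T. Kv v) = {}"
      using V1 T by (auto simp: K2_def Kv_def doubleton_eq_iff)
    have disjG: "KG \<inter> (K2 \<union> (\<Union>v\<in>T. Kv v)) = {}"
    proof -
      have "e \<inter> V \<noteq> {}" if "e \<in> K2 \<union> (\<Union>v\<in>T. Kv v)" for e
        using that V1 by (auto simp: K2_def Kv_def)
      thus ?thesis using KG(2) by blast
    qed
    have depP: "depends (\<Union>v\<in>T. Kv v) (\<lambda>\<omega>. \<Prod>v\<in>T. of_bool (\<forall>u\<in>V1. \<not> lnk (Wt \<omega>) u v x))"
      by (intro depends_prod fin depC)
    have E1: "expectation (trm V1) = pQ * (expectation (\<lambda>\<omega>. of_bool (core V1 \<omega>)) *
      (\<Prod>v\<in>T. expectation (\<lambda>\<omega>. of_bool (\<forall>u\<in>V1. \<not> lnk (Wt \<omega>) u v x))))"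
      unfolding trm_def pQ_def
      by (subst expectation_mult[OF depQ depends_mult[OF depcore depP] disjG],
          subst expectation_mult[OF depcore depP disj2], subst expectation_prod[OF fin(3) depC disjKv]) auto
    let ?d = "\<lambda>v. card {u \<in> V1. {u, v} \<notin> D}"
    have EC: "expectation (\<lambda>\<omega>. of_bool (\<forall>u\<in>V1. \<not> lnk (Wt \<omega>) u v x)) \<le> exp (- (x - lo) * real (?d v))" if v: "v \<in> T" for v
    proof -
      have "expectation (\<lambda>\<omega>. of_bool (\<forall>u\<in>V1. \<not> lnk (Wt \<omega>) u v x)) = (\<Prod>u\<in>V1. if {u, v} \<in> D \<or> x < lo then 1 else 1 - (x - lo))"
        using finV1 edge v lo x by (intro expectation_no_links) auto
      also have "\<dots> = (1 - (x - lo)) ^ ?d v" using finV1 x by (simp add: prod.If_cases Int_def)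
      also have "\<dots> \<le> exp (- (x - lo)) ^ ?d v"
      proof (rule power_mono)
        show "1 - (x - lo) \<le> exp (- (x - lo))" using exp_ge_add_one_self[of "- (x - lo)"] by linarith
      qed (use x lo in auto)
      also have "\<dots> = exp (- (x - lo) * real (?d v))" by (simp add: exp_of_nat_mult[symmetric] mult.commute)
      finally show ?thesis .
    qed
    have "(\<Prod>v\<in>T. expectation (\<lambda>\<omega>. of_bool (\<forall>u\<in>V1. \<not> lnk (Wt \<omega>) u v x))) \<le> (\<Prod>v\<in>T. exp (- (x - lo) * real (?d v)))"
      using EC depC by (intro prod_mono conjI depends_nonneg) auto
    also have "\<dots> = exp (- (x - lo) * (\<Sum>v\<in>T. real (?d v)))"
      unfolding exp_sum[OF fin(3), symmetric] sum_distrib_left ..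
    also have "\<dots> \<le> ?e"
    proof -
      have "real (card T) * r - real (card D) \<le> real (card T) * real (card V1) - real (card D)"
        using V1 by (simp add: mult_left_mono)
      also have "\<dots> \<le> (\<Sum>v\<in>T. real (?d v))"
        using V1 T by (intro sum_card_pairs_avoiding finV1 fin D) auto
      finally have "- (x - lo) * (\<Sum>v\<in>T. real (?d v)) \<le> - (x - lo) * (real (card T) * r - real (card D))"
        unfolding mult_minus_left neg_le_iff_le using x by (intro mult_left_mono) auto
      thus ?thesis by simp
    qed
    finally have P: "(\<Prod>v\<in>T. expectation (\<lambda>\<omega>. of_bool (\<forall>u\<in>V1. \<not> lnk (Wt \<omega>) u v x))) \<le> ?e" .
    have "expectation (trm V1) \<le> pQ * (expectation (\<lambda>\<omega>. of_bool (core V1 \<omega>)) * ?e)"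
      unfolding E1 by (intro mult_left_mono P pQ0 depends_nonneg[OF depcore])
    hence 1: "expectation (trm V1) \<le> ?e * pQ * expectation (\<lambda>\<omega>. of_bool (core V1 \<omega>))"
      by (simp only: mult_ac)
    have "integrable M (trm V1)"
      using depends_integrable[OF depends_mult[OF depQ depends_mult[OF depcore depP]]]
      unfolding trm_def[abs_def] by simp
    thus ?thesis using 1 by simp
  qed
  have unique: "(\<Sum>V1\<in>VS. of_bool (core V1 \<omega>) :: real) \<le> 1" for \<omega>
  proof (rule sum_of_bool_unique_le_1[OF finVS])
    fix X Y assume XY: "X \<in> VS" "Y \<in> VS" "core X \<omega>" "core Y \<omega>"
    hence "X \<subseteq> V" "Y \<subseteq> V" "\<forall>v\<in>V. v \<in> X \<longleftrightarrow> v \<in> Y" unfolding VS_def core_def by blast+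
    thus "X = Y" by blast
  qed
  have intcore: "integrable M (\<lambda>\<omega>. of_bool (core V1 \<omega>) :: real)" for V1
    by (rule depends_integrable[OF depcore])
  have "(\<Sum>V1\<in>VS. expectation (\<lambda>\<omega>. of_bool (core V1 \<omega>) :: real)) = expectation (\<lambda>\<omega>. \<Sum>V1\<in>VS. of_bool (core V1 \<omega>))"
    using intcore by (intro Bochner_Integration.integral_sum[symmetric]) auto
  also have "\<dots> \<le> expectation (\<lambda>_. 1)"
    using intcore unique by (intro integral_mono Bochner_Integration.integrable_sum) auto
  finally have sumcore: "(\<Sum>V1\<in>VS. expectation (\<lambda>\<omega>. of_bool (core V1 \<omega>) :: real)) \<le> 1" by (simp add: prob_space)
  show ?thesis
  proof (rule prob_le_markov[where f="\<lambda>\<omega>. \<Sum>V1\<in>VS. trm V1 \<omega>"])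
    have trm_nonneg: "0 \<le> trm V1 \<omega>" for V1 \<omega>
      unfolding trm_def by (intro mult_nonneg_nonneg prod_nonneg) auto
    show "integrable M (\<lambda>\<omega>. \<Sum>V1\<in>VS. trm V1 \<omega>)"
      using main by (intro Bochner_Integration.integrable_sum) auto
    show "0 \<le> (\<Sum>V1\<in>VS. trm V1 \<omega>)" for \<omega> using trm_nonneg by (intro sum_nonneg) auto
    have "expectation (\<lambda>\<omega>. \<Sum>V1\<in>VS. trm V1 \<omega>) = (\<Sum>V1\<in>VS. expectation (trm V1))"
      using main by (subst Bochner_Integration.integral_sum) auto
    also have "\<dots> \<le> (\<Sum>V1\<in>VS. ?e * pQ * expectation (\<lambda>\<omega>. of_bool (core V1 \<omega>)))" using main by (intro sum_mono) auto
    also have "\<dots> = ?e * pQ * (\<Sum>V1\<in>VS. expectation (\<lambda>\<omega>. of_bool (core V1 \<omega>)))" by (rule sum_distrib_left[symmetric])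
    also have "\<dots> \<le> ?e * pQ * 1" using sumcore pQ0 by (intro mult_left_mono) auto
    finally show "expectation (\<lambda>\<omega>. \<Sum>V1\<in>VS. trm V1 \<omega>) \<le> expectation (\<lambda>\<omega>. of_bool (Q \<omega>)) * ?e"
      by (simp add: pQ_def mult.commute)
    fix \<omega> assume bad: "Q \<omega> \<and> r \<le> real (card (born (Wt \<omega>) V j \<inter> V)) \<and> (\<forall>u\<in>born (Wt \<omega>) V j \<inter> V. \<forall>v\<in>T. \<not> lnk (Wt \<omega>) u v x)"
    let ?V1 = "born (Wt \<omega>) V j \<inter> V"
    have VS: "?V1 \<in> VS" using bad by (auto simp: VS_def)
    have "core ?V1 \<omega>" unfolding core_def born_def by blast
    hence "trm ?V1 \<omega> = 1" unfolding trm_def using bad by simp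
    moreover have "trm ?V1 \<omega> \<le> (\<Sum>V1\<in>VS. trm V1 \<omega>)"
      using trm_nonneg by (intro member_le_sum[OF VS _ finVS]) auto
    ultimately show "1 \<le> (\<Sum>V1\<in>VS. trm V1 \<omega>)" by simp
  qed
qed

end

section \<open>Forests of light edges\<close>

text \<open>A forest with roots \<open>R\<close> is a list of pairs of a vertex and its parent, the last vertex added first.\<close>

fun forest :: "nat \<Rightarrow> nat set \<Rightarrow> (nat \<times> nat) list \<Rightarrow> bool" where
  "forest n R [] \<longleftrightarrow> True"
| "forest n R ((x, p) # fs) \<longleftrightarrow> forest n R fs \<and> x \<in> {1..n} \<and> x \<notin> R \<and> x \<notin> fst ` set fs \<and> p \<in> R \<union> fst ` set fs"

definition forest_edges :: "(nat \<times> nat) list \<Rightarrow> nat set set" where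
  "forest_edges fs = (\<lambda>(x, p). {x, p}) ` set fs"

lemma forest_verts: "forest n R fs \<Longrightarrow> fst ` set fs \<subseteq> {1..n} - R \<and> card (fst ` set fs) = length fs"
  by (induction n R fs rule: forest.induct) auto

lemma forest_edges_subset: "forest n R fs \<Longrightarrow> e \<in> forest_edges fs \<Longrightarrow> e \<subseteq> R \<union> fst ` set fs"
  by (induction n R fs rule: forest.induct) (auto simp: forest_edges_def)

lemma forest_edges_complete:
  "forest n R fs \<Longrightarrow> R \<subseteq> {1..n} \<Longrightarrow> forest_edges fs \<subseteq> complete_edges n \<and> card (forest_edges fs) = length fs"
proof (induction n R fs rule: forest.induct)
  case (2 n R x p fs)
  have IH: "forest_edges fs \<subseteq> complete_edges n" "card (forest_edges fs) = length fs" using 2 by auto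
  have p: "p \<in> {1..n}" "x \<noteq> p" using 2 forest_verts[of n R fs] by auto
  have "{x, p} \<notin> forest_edges fs" using forest_edges_subset[of n R fs "{x,p}"] 2 by auto
  moreover have "finite (forest_edges fs)" by (simp add: forest_edges_def)
  moreover have "forest_edges ((x, p) # fs) = insert {x, p} (forest_edges fs)" by (simp add: forest_edges_def)
  moreover have "{x, p} \<in> complete_edges n" using p 2 by (simp add: doubleton_complete_edges_iff)
  ultimately show ?case using IH by simp
qed (auto simp: forest_edges_def)

text \<open>Each insertion has \<open>n\<close> choices for the vertex and at most
  \<open>card R + N\<close> for its parent. A forest is counted once for every admissible order of
  insertion, which the union bounds can afford.\<close>

lemma card_forests:
  assumes "finite R"
  shows "finite {fs. forest n R fs \<and> length fs = N} \<and> card {fs. forest n R fs \<and> length fs = N} \<le> (n * (card R + N)) ^ N"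
proof (induction N)
  case 0
  have "{fs. forest n R fs \<and> length fs = 0} = {[]}" by auto
  thus ?case by simp
next
  case (Suc N)
  let ?F = "\<lambda>N. {fs. forest n R fs \<and> length fs = N}"
  let ?S = "SIGMA fs:?F N. {1..n} \<times> (R \<union> fst ` set fs)"
  have sub: "?F (Suc N) \<subseteq> (\<lambda>(fs, xp). xp # fs) ` ?S"
  proof
    fix gs assume "gs \<in> ?F (Suc N)"
    moreover then obtain x p fs where "gs = (x, p) # fs" by (cases gs) auto
    ultimately show "gs \<in> (\<lambda>(fs, xp). xp # fs) ` ?S" by (intro image_eqI[of _ _ "(fs, (x, p))"]) auto
  qed
  have finS: "finite ?S" using Suc assms by auto
  have "card ?S = (\<Sum>fs\<in>?F N. n * card (R \<union> fst ` set fs))"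
    using Suc assms by (subst card_SigmaI) (auto simp: card_cartesian_product)
  also have "\<dots> \<le> (\<Sum>fs\<in>?F N. n * (card R + N))"
  proof (intro sum_mono mult_le_mono2)
    fix fs assume "fs \<in> ?F N"
    thus "card (R \<union> fst ` set fs) \<le> card R + N"
      using card_Un_le[of R "fst ` set fs"] forest_verts[of n R fs] by auto
  qed
  also have "\<dots> = card (?F N) * (n * (card R + N))" by simp
  also have "\<dots> \<le> (n * (card R + N)) ^ N * (n * (card R + N))" using Suc by (intro mult_le_mono1) auto
  also have "\<dots> \<le> (n * (card R + Suc N)) ^ N * (n * (card R + Suc N))"
    by (intro mult_le_mono power_mono) auto
  finally have "card ?S \<le> (n * (card R + Suc N)) ^ Suc N" by (simp only: power_Suc mult.commute)
  moreover have "card (?F (Suc N)) \<le> card ?S"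
    using card_mono[OF finite_imageI[OF finS] sub] card_image_le[OF finS, of "\<lambda>(fs, xp). xp # fs"] by linarith
  ultimately show ?case using finite_subset[OF sub] finS by auto
qed

context random_weights
begin

definition light :: "(nat \<times> nat) list \<Rightarrow> real \<Rightarrow> 'a \<Rightarrow> bool" where
  "light fs y \<omega> \<longleftrightarrow> (\<forall>e\<in>forest_edges fs. 0 \<le> W e \<omega> \<and> W e \<omega> \<le> y)"

lemma light_pred: "Measurable.pred (edge_algebra (forest_edges fs)) (light fs y)"
proof -
  have "Measurable.pred (edge_algebra (forest_edges fs)) (\<lambda>\<omega>. 0 \<le> W e \<omega> \<and> W e \<omega> \<le> y)" if "e \<in> forest_edges fs" for e
  proof -
    have [measurable]: "W e \<in> borel_measurable (edge_algebra (forest_edges fs))" by (rule W_measurable_edge_algebra) fact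
    show ?thesis by measurable
  qed
  thus ?thesis unfolding light_def by (intro pred_intros_finite) (auto simp: forest_edges_def)
qed

lemma expectation_light:
  assumes fs: "forest n R fs" "R \<subseteq> {1..n}" and y: "0 \<le> y" "y \<le> 1"
  shows "expectation (\<lambda>\<omega>. of_bool (light fs y \<omega>) :: real) = y ^ length fs"
proof -
  have sub: "forest_edges fs \<subseteq> E" and c: "card (forest_edges fs) = length fs"
    using forest_edges_complete[OF fs] by auto
  have fin: "finite (forest_edges fs)" by (simp add: forest_edges_def)
  have "expectation (\<lambda>\<omega>. \<Prod>e\<in>forest_edges fs. of_bool (0 \<le> W e \<omega> \<and> W e \<omega> \<le> y) :: real) =
    (\<Prod>e\<in>forest_edges fs. expectation (\<lambda>\<omega>. of_bool (0 \<le> W e \<omega> \<and> W e \<omega> \<le> y)))"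
  proof (rule expectation_prod[where K="\<lambda>e. {e}", OF fin])
    show "depends {e} (\<lambda>\<omega>. of_bool (0 \<le> W e \<omega> \<and> W e \<omega> \<le> y))" if "e \<in> forest_edges fs" for e
    proof (rule depends_of_bool)
      have [measurable]: "W e \<in> borel_measurable (edge_algebra {e})" by (rule W_measurable_edge_algebra) simp
      show "Measurable.pred (edge_algebra {e}) (\<lambda>\<omega>. 0 \<le> W e \<omega> \<and> W e \<omega> \<le> y)" by measurable
    qed (use that sub in auto)
  qed (auto simp: disjoint_family_on_def)
  also have "\<dots> = (\<Prod>e\<in>forest_edges fs. y)"
  proof (rule prod.cong)
    fix e assume "e \<in> forest_edges fs"
    hence e: "e \<in> E" using sub by auto
    have "expectation (\<lambda>\<omega>. of_bool (0 \<le> W e \<omega> \<and> W e \<omega> \<le> y) :: real) =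
       expectation (indicator {\<omega>\<in>space M. 0 \<le> W e \<omega> \<and> W e \<omega> \<le> y})"
      by (intro Bochner_Integration.integral_cong) (auto simp: indicator_def)
    also have "\<dots> = y" using prob_W_interval[OF e, of 0 y] y e by simp
    finally show "expectation (\<lambda>\<omega>. of_bool (0 \<le> W e \<omega> \<and> W e \<omega> \<le> y) :: real) = y" .
  qed auto
  finally show ?thesis using fin c unfolding light_def of_bool_Ball[OF fin] by simp
qed

end

text \<open>Times in units of \<open>1 / n\<close>. The long initial step \<open>\<kappa>\<close>,
  later a multiple of ln n, enlarges the starting set by a factor of order \<open>\<kappa>\<close>;
  from then on even a short step of length \<open>h\<close> fails only with probability
  \<open>exp (- c * a * \<kappa>)\<close>, the rate that the union bound over forests
  requires.\<close>

definition schedule :: "real \<Rightarrow> real \<Rightarrow> nat \<Rightarrow> nat \<Rightarrow> real" where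
  "schedule \<kappa> h n i = (if i = 0 then 0 else (\<kappa> + real (i - 1) * h) / real n)"

lemma schedule_simps:
  "schedule \<kappa> h n 0 = 0" "schedule \<kappa> h n (Suc i) = (\<kappa> + real i * h) / real n"
  by (simp_all add: schedule_def)

lemma mono_schedule: "0 \<le> \<kappa> \<Longrightarrow> 0 \<le> h \<Longrightarrow> mono (schedule \<kappa> h n)"
  unfolding mono_iff_le_Suc
proof
  fix i assume "0 \<le> \<kappa>" "0 \<le> h"
  thus "schedule \<kappa> h n i \<le> schedule \<kappa> h n (Suc i)"
    by (cases i) (auto simp: schedule_simps intro!: divide_right_mono mult_right_mono)
qed

text \<open>The expected gain of a step is almost \<open>h * k\<close>: the losses through the lower
  limit on links, through saturation and through excluded pairs are absorbed in a factor
  \<open>1 - \<zeta> / 4\<close>. Only \<open>(1 - \<zeta>) * h * k\<close> is demanded. The gap is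
  of order \<open>\<zeta> * h * k\<close>, and a Chernoff parameter with logarithm
  \<open>- \<zeta> / 2\<close> turns it into an exponent of order
  \<open>\<zeta>^2 * h * k\<close>.\<close>

lemma growth_exponent:
  fixes \<zeta> h \<eta> k X :: real
  assumes \<zeta>: "0 < \<zeta>" "\<zeta> \<le> 1/2" and h: "0 < h" "h \<le> 1" and \<eta>: "0 < \<eta>" "\<eta> \<le> \<zeta> * h / 16" and n: "n > 0"
    and k: "1 \<le> k" "k \<le> \<eta> * n" and X: "(1 - 2 * \<eta>) * n * k \<le> X"
  shows "exp (- \<zeta> / 2) powr (- ((1 - \<zeta>) * h * k)) *
    exp (- (1 - exp (- \<zeta> / 2)) * ((h - \<eta>) / n * (1 - (h - \<eta>) / n * k / 2) * X)) \<le> exp (- (h * \<zeta>\<^sup>2 / 128) * k)"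
proof -
  have eh: "\<eta> \<le> \<zeta> / 16" using \<eta> h \<zeta> mult_left_mono[of h 1 \<zeta>] by linarith
  have \<theta>: "1 - exp (- \<zeta> / 2) \<ge> \<zeta> / 2 * (1 - \<zeta> / 4)"
    using exp_minus_le_quadratic[of "\<zeta> / 2"] \<zeta> by (simp add: power2_eq_square algebra_simps)
  have q1: "h * (1 - \<zeta> / 16) \<le> h - \<eta>" using \<eta> by (simp add: algebra_simps)
  have hk: "(h - \<eta>) / n * k / 2 \<le> \<zeta> / 32"
  proof -
    have "(h - \<eta>) / n * k \<le> 1 / n * (\<eta> * n)"
      using h \<eta> k n by (intro mult_mono divide_right_mono) auto
    also have "1 / n * (\<eta> * n) = \<eta>" using n by simp
    finally have le: "(h - \<eta>) / n * k \<le> \<eta>" .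
    have "x / 2 \<le> \<zeta> / 32" if "x \<le> \<eta>" for x using that eh by linarith
    thus ?thesis using le .
  qed
  have "h * (1 - \<zeta> / 4) * k \<le> (h * (1 - \<zeta> / 16)) * (1 - \<zeta> / 32) * ((1 - \<zeta> / 8) * k)"
  proof -
    have "1 - \<zeta> / 4 \<le> (1 - \<zeta> / 16) * (1 - \<zeta> / 32) * (1 - \<zeta> / 8)"
      using \<zeta> mult_nonneg_nonneg[of \<zeta> \<zeta>] mult_left_mono[of \<zeta> "1/2" "\<zeta> * \<zeta>"] by (simp add: algebra_simps)
    hence "(h * k) * (1 - \<zeta> / 4) \<le> (h * k) * ((1 - \<zeta> / 16) * (1 - \<zeta> / 32) * (1 - \<zeta> / 8))"
      using h k by (intro mult_left_mono) auto
    thus ?thesis by (simp add: mult_ac)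
  qed
  also have "\<dots> \<le> (h - \<eta>) * (1 - (h - \<eta>) / n * k / 2) * (X / n)"
  proof (intro mult_mono)
    have "(1 - \<zeta> / 8) * k \<le> (1 - 2 * \<eta>) * k" using eh k by (intro mult_right_mono) auto
    also have "\<dots> \<le> X / n" using X n by (simp add: field_simps)
    finally show "(1 - \<zeta> / 8) * k \<le> X / n" .
    have h0: "0 \<le> h - \<eta>" using h \<zeta> by (intro order.trans[OF _ q1]) auto
    show "0 \<le> h - \<eta>" by (rule h0)
    have "0 \<le> 1 - (h - \<eta>) / n * k / 2" using hk \<zeta> by linarith
    thus "0 \<le> (h - \<eta>) * (1 - (h - \<eta>) / n * k / 2)" using h0 by (rule mult_nonneg_nonneg[rotated])
    show "1 - \<zeta> / 32 \<le> 1 - (h - \<eta>) / n * k / 2" using hk by linarith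
  qed (use q1 \<zeta> k in auto)
  also have "\<dots> = (h - \<eta>) / n * (1 - (h - \<eta>) / n * k / 2) * X" by simp
  finally have Y: "h * (1 - \<zeta> / 4) * k \<le> (h - \<eta>) / n * (1 - (h - \<eta>) / n * k / 2) * X" .
  have "\<zeta> / 2 * (1 - \<zeta> / 4) * (h * (1 - \<zeta> / 4) * k) \<le>
    (1 - exp (- \<zeta> / 2)) * ((h - \<eta>) / n * (1 - (h - \<eta>) / n * k / 2) * X)"
    using \<zeta> h k by (intro mult_mono \<theta> Y) auto
  moreover have "\<zeta> / 2 * ((1 - \<zeta>) * h * k) + (h * \<zeta>\<^sup>2 / 128) * k \<le> \<zeta> / 2 * (1 - \<zeta> / 4) * (h * (1 - \<zeta> / 4) * k)"
  proof -
    have "(\<zeta> * h * k) * ((1 - \<zeta>) / 2 + \<zeta> / 128) \<le> (\<zeta> * h * k) * ((1 - \<zeta> / 4) * (1 - \<zeta> / 4) / 2)"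
      using \<zeta> h k mult_nonneg_nonneg[of \<zeta> \<zeta>] by (intro mult_left_mono) (auto simp: field_simps)
    moreover have "\<zeta> / 2 * ((1 - \<zeta>) * h * k) + (h * \<zeta>\<^sup>2 / 128) * k = (\<zeta> * h * k) * ((1 - \<zeta>) / 2 + \<zeta> / 128)"
      by (simp add: power2_eq_square field_simps)
    moreover have "\<zeta> / 2 * (1 - \<zeta> / 4) * (h * (1 - \<zeta> / 4) * k) = (\<zeta> * h * k) * ((1 - \<zeta> / 4) * (1 - \<zeta> / 4) / 2)"
      by (simp add: field_simps)
    ultimately show ?thesis by (simp only:)
  qed
  ultimately have "\<zeta> / 2 * ((1 - \<zeta>) * h * k) + - (1 - exp (- \<zeta> / 2)) * ((h - \<eta>) / n * (1 - (h - \<eta>) / n * k / 2) * X)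
     \<le> - (h * \<zeta>\<^sup>2 / 128) * k"
    unfolding mult_minus_left by linarith
  moreover have "exp (- \<zeta> / 2) powr (- ((1 - \<zeta>) * h * k)) = exp (\<zeta> / 2 * ((1 - \<zeta>) * h * k))"
    by (simp add: powr_def)
  ultimately show ?thesis by (simp add: exp_add[symmetric])
qed

text \<open>Of the initial step only a constant fraction of the gain \<open>a * \<kappa>\<close> is
  demanded, so the parameter \<open>exp (- 1)\<close> and crude constants suffice.\<close>

lemma first_exponent:
  fixes \<eta> \<kappa> a n X :: real
  assumes "0 < \<eta>" "\<eta> \<le> 1 / 32" "1 \<le> \<kappa>" "0 < n" "0 \<le> a" "\<kappa> * a \<le> n" "15 / 16 * n * a \<le> X"
  shows "exp (- 1) powr (- (a * \<kappa> / 32)) *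
    exp (- (1 - exp (- 1)) * ((\<kappa> / n - \<eta> / n) * (1 - (\<kappa> / n - \<eta> / n) * a / 2) * X)) \<le> exp (- (1 / 16) * (a * \<kappa>))"
proof -
  have e: "1 / 2 \<le> 1 - exp (- 1 :: real)"
  proof -
    have "2 \<le> exp (1::real)" using exp_ge_add_one_self[of 1] by simp
    hence "inverse (exp (1::real)) \<le> inverse 2" by (intro le_imp_inverse_le) auto
    thus ?thesis by (simp add: exp_minus)
  qed
  have q: "31 / 32 * (\<kappa> / n) \<le> \<kappa> / n - \<eta> / n"
    using assms by (simp add: field_simps)
  have q2: "(\<kappa> / n - \<eta> / n) * a \<le> 1"
  proof -
    have "(\<kappa> / n - \<eta> / n) * a \<le> \<kappa> / n * a" using assms by (intro mult_right_mono) auto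
    also have "\<dots> \<le> 1" using assms by (simp add: field_simps)
    finally show ?thesis .
  qed
  have "1/2 * (31 / 32 * (\<kappa> / n) * (1 / 2) * (15 / 16 * n * a)) \<le>
     (1 - exp (- 1)) * ((\<kappa> / n - \<eta> / n) * (1 - (\<kappa> / n - \<eta> / n) * a / 2) * X)"
  proof (intro mult_mono e q)
    have q0: "0 \<le> \<kappa> / n - \<eta> / n" using assms by (intro order.trans[OF _ q]) auto
    show "0 \<le> \<kappa> / n - \<eta> / n" by (rule q0)
    show "0 \<le> (\<kappa> / n - \<eta> / n) * (1 - (\<kappa> / n - \<eta> / n) * a / 2)"
      using q0 q2 by (intro mult_nonneg_nonneg) auto
  qed (use q2 assms in auto)
  moreover have "a * \<kappa> / 32 + 1 / 16 * (a * \<kappa>) \<le> 1/2 * (31 / 32 * (\<kappa> / n) * (1 / 2) * (15 / 16 * n * a))"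
    using assms by (simp add: field_simps)
  ultimately have "a * \<kappa> / 32 + - (1 - exp (- 1)) * ((\<kappa> / n - \<eta> / n) * (1 - (\<kappa> / n - \<eta> / n) * a / 2) * X) \<le> - (1 / 16) * (a * \<kappa>)"
    unfolding mult_minus_left by linarith
  moreover have "exp (- 1) powr (- (a * \<kappa> / 32)) = exp (a * \<kappa> / 32)" by (simp add: powr_def)
  ultimately show ?thesis by (simp add: exp_add[symmetric])
qed

context random_weights
begin

text \<open>The initial step yields \<open>a * \<kappa> / 32\<close> vertices; then every step
  multiplies their number by \<open>1 + (1 - \<zeta>) * h\<close> until it passes
  \<open>\<eta> * n\<close>, which by the choice of \<open>J\<close> happens within \<open>J\<close>
  steps; finally one of the many edges to \<open>T\<close> is a link. The three bounds on
  \<open>c\<close> are the exponents of these three kinds of failure, and \<open>J + 2\<close> is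
  the number of possible failures.\<close>

lemma exploration_connects:
  fixes \<zeta> h \<eta> \<kappa> c :: real and a J :: nat
  assumes A: "A \<subseteq> {1..n}" and V: "V \<subseteq> {1..n}" and AV: "A \<inter> V = {}"
    and T: "T \<subseteq> {1..n}" "T \<inter> (A \<union> V) = {}"
    and D: "finite D"
    and KG: "KG \<subseteq> E" "\<And>e. e \<in> KG \<Longrightarrow> e \<inter> V = {}" and Q: "Measurable.pred (edge_algebra KG) Q"
    and card: "card A = a" "card T = a"
    and \<zeta>: "0 < \<zeta>" "\<zeta> \<le> 1/2" and h: "0 < h" "h \<le> 1" and \<eta>: "0 < \<eta>" "\<eta> \<le> \<zeta> * h / 16"
    and \<kappa>: "1 \<le> \<kappa>" "\<kappa> * real a \<le> real n" "32 \<le> \<kappa> * real a" "2 * real a \<le> \<eta> * real n"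
    and DV: "real (card D) \<le> \<eta> * real a" "(1 - \<eta>) * real n \<le> real (card V)"
    and J: "real n \<le> (1 + (1 - \<zeta>) * h) ^ J" "\<kappa> + real J * h \<le> real n"
    and c: "c \<le> 1 / 16" "c \<le> h * \<zeta>\<^sup>2 / 4096" "c \<le> \<eta> / 8"
  shows "prob_le (\<lambda>\<omega>. Q \<omega> \<and> \<not> (\<exists>u\<in>exploration.born D (\<eta> / n) (schedule \<kappa> h n) A (Wt \<omega>) V (Suc J) \<inter> V. \<exists>v\<in>T.
            link (Wt \<omega>) D (\<eta> / n) u v (\<kappa> / n)))
         (expectation (\<lambda>\<omega>. of_bool (Q \<omega>)) * (real (J + 2) * exp (- c * (real a * \<kappa>))))"
proof -
  let ?tau = "schedule \<kappa> h n"
  have n0: "real n > 0" using \<kappa> by linarith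
  have "0 \<le> real J * h" using h by simp
  hence \<kappa>n: "\<kappa> \<le> real n" using J(2) by linarith
  have n32: "real n \<ge> 32" using \<kappa> by linarith
  have a1: "1 \<le> a" using \<kappa>(3) by (cases a) auto
  have expl: "exploration (\<eta> / n) ?tau"
    using \<eta> n0 \<kappa> h by unfold_locales (auto intro: mono_schedule)
  interpret exploration "D" "\<eta> / n" ?tau A by (rule expl)
  have eh: "\<eta> \<le> \<zeta> / 16" using \<eta> h \<zeta> mult_left_mono[of h 1 \<zeta>] by linarith
  hence e32: "\<eta> \<le> 1 / 32" using \<zeta> by linarith
  have aK: "0 \<le> real a * \<kappa>" using \<kappa> by simp
  define pQ :: real where "pQ = expectation (\<lambda>\<omega>. of_bool (Q \<omega>))"
  have pQ0: "0 \<le> pQ" unfolding pQ_def using depends_nonneg[OF depends_of_bool[OF KG(1) Q]] .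
  let ?B = "exp (- c * (real a * \<kappa>))"
  define b where "b \<omega> i = card (born (Wt \<omega>) V i)" for \<omega> i
  have expmono: "exp (- x * (real a * \<kappa>)) \<le> ?B" if "c \<le> x" for x
    using that aK by (simp add: mult_right_mono)
  have first: "prob_le (\<lambda>\<omega>. Q \<omega> \<and> a \<le> b \<omega> 0 \<and> b \<omega> 0 \<le> a \<and> real (b \<omega> (Suc 0)) - real (b \<omega> 0) < real a * \<kappa> / 32) (pQ * ?B)"
    unfolding b_def pQ_def
  proof (rule exploration_step[OF expl A V AV D KG Q, where \<theta>="exp (-1)" and g="\<lambda>_. real a * \<kappa> / 32" and q="\<kappa> / n - \<eta> / n"])
    show "?tau (Suc 0) - ?tau 0 \<le> 1" using \<kappa>n n0 by (simp add: schedule_simps)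
    show "\<kappa> / n - \<eta> / n = ?tau (Suc 0) - ?tau 0 - \<eta> / n" by (simp add: schedule_simps)
    show "0 \<le> \<kappa> / n - \<eta> / n" using e32 \<kappa> n0 by (simp add: field_simps)
    fix k assume "a \<le> k" "k \<le> a"
    hence k: "k = a" by simp
    have "(\<kappa> / n - \<eta> / n) * real a \<le> \<kappa> / n * real a" using \<eta> n0 by (intro mult_right_mono) auto
    also have "\<dots> \<le> 2" using \<kappa> n0 by (simp add: field_simps)
    finally show "(\<kappa> / n - \<eta> / n) * real k \<le> 2" by (simp add: k)
    have "15 / 16 * real n * real a \<le> real (card V) * real a - real (card D)"
    proof -
      have "(1 - \<eta>) * real n * real a - \<eta> * real a \<le> real (card V) * real a - real (card D)"
        using DV by (intro diff_mono mult_right_mono) auto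
      moreover have "15 / 16 * real n * real a \<le> (1 - \<eta>) * real n * real a - \<eta> * real a"
      proof -
        have "\<eta> * (real n * real a + real a) \<le> 1 / 32 * (real n * real a + real a)" using e32 by (intro mult_right_mono) auto
        moreover have "real a \<le> real n * real a" using n32 mult_right_mono[of 1 "real n" "real a"] by simp
        moreover have "x \<le> 1 / 16 * y" if "x \<le> 1 / 32 * (y + z)" "z \<le> y" for x y z :: real
          using that by (simp add: field_simps)
        ultimately have "\<eta> * (real n * real a + real a) \<le> 1 / 16 * (real n * real a)" by blast
        thus ?thesis by (simp add: algebra_simps)
      qed
      ultimately show ?thesis by linarith
    qed
    from first_exponent[OF \<eta>(1) e32 \<kappa>(1) n0 _ \<kappa>(2) this]
    have "exp (- 1) powr (- (real a * \<kappa> / 32)) * exp (- (1 - exp (- 1)) * ((\<kappa> / n - \<eta> / n) * (1 - (\<kappa> / n - \<eta> / n) * real a / 2) *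
       (real (card V) * real a - real (card D)))) \<le> exp (- (1 / 16) * (real a * \<kappa>))" by simp
    also have "\<dots> \<le> ?B" by (rule expmono) fact
    finally show "exp (- 1) powr (- (real a * \<kappa> / 32)) * exp (- (1 - exp (- 1)) * ((\<kappa> / n - \<eta> / n) * (1 - (\<kappa> / n - \<eta> / n) * real k / 2) *
       ((real (card V) + real (card A) - real k) * real k - real (card D)))) \<le> ?B" by (simp add: k card)
  qed auto
  \<comment> \<open>Growth is claimed only between these sizes: from fewer vertices a step fails too
    often, and beyond \<open>\<eta> * n\<close> saturation lowers the rate.\<close>
  let ?kmin = "nat \<lceil>real a * \<kappa> / 32\<rceil>" and ?kmax = "nat \<lfloor>\<eta> * real n\<rfloor>"
  have step: "prob_le (\<lambda>\<omega>. Q \<omega> \<and> ?kmin \<le> b \<omega> (Suc i) \<and> b \<omega> (Suc i) \<le> ?kmax \<and>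
     real (b \<omega> (Suc (Suc i))) - real (b \<omega> (Suc i)) < (1 - \<zeta>) * h * real (b \<omega> (Suc i))) (pQ * ?B)" if i: "i < J" for i
    unfolding b_def pQ_def
  proof (rule exploration_step[OF expl A V AV D KG Q, where \<theta>="exp (- \<zeta> / 2)" and g="\<lambda>k. (1 - \<zeta>) * h * real k" and q="(h - \<eta>) / n"])
    have "real (Suc i) * h \<le> real J * h" using i h by (intro mult_right_mono) auto
    thus "?tau (Suc (Suc i)) - ?tau 0 \<le> 1" using J n0 by (simp add: schedule_simps)
    show "(h - \<eta>) / n = ?tau (Suc (Suc i)) - ?tau (Suc i) - \<eta> / n"
      using n0 by (simp add: schedule_simps field_simps)
    have "\<zeta> * h / 16 \<le> h" using \<zeta> h mult_right_mono[of \<zeta> 1 h] by simp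
    hence he: "\<eta> \<le> h" using \<eta> by linarith
    thus "0 \<le> (h - \<eta>) / n" by simp
    fix k assume k: "?kmin \<le> k" "k \<le> ?kmax"
    have k1: "real a * \<kappa> / 32 \<le> real k" using k(1) by linarith
    have k2: "real k \<le> \<eta> * real n" using k(2) \<eta> n0 by (simp add: le_nat_iff le_floor_iff)
    have k0: "1 \<le> real k" using k1 \<kappa> by (simp add: mult.commute)
    have "(h - \<eta>) / n * real k \<le> 1 / n * (\<eta> * n)" using he h \<eta> k2 n0 by (intro mult_mono divide_right_mono) auto
    thus "(h - \<eta>) / n * real k \<le> 2" using n0 e32 by simp
    have X: "(1 - 2 * \<eta>) * real n * real k \<le> (real (card V) + real (card A) - real k) * real k - real (card D)"
    proof -
      have "\<eta> * real a \<le> real a * real k" using e32 k0 mult_mono[of \<eta> 1 "real a" "real a * real k"] by (simp add: mult_le_cancel_left1)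
      moreover have "((1 - \<eta>) * real n - \<eta> * real n) * real k \<le> (real (card V) - real k) * real k"
        using DV k2 by (intro mult_right_mono diff_mono) auto
      ultimately show ?thesis using DV(1) card by (simp add: algebra_simps)
    qed
    have "exp (- \<zeta> / 2) powr (- ((1 - \<zeta>) * h * real k)) * exp (- (1 - exp (- \<zeta> / 2)) * ((h - \<eta>) / n * (1 - (h - \<eta>) / n * real k / 2) *
       ((real (card V) + real (card A) - real k) * real k - real (card D)))) \<le> exp (- (h * \<zeta>\<^sup>2 / 128) * real k)"
      by (rule growth_exponent[OF \<zeta> h \<eta> n0 k0 k2 X])
    \<comment> \<open>A step starts from at least \<open>a * \<kappa> / 32\<close> vertices, whence
      4096 = 128 * 32.\<close>
    also have "\<dots> \<le> exp (- (h * \<zeta>\<^sup>2 / 4096) * (real a * \<kappa>))"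
    proof -
      have "(h * \<zeta>\<^sup>2 / 128) * (real a * \<kappa> / 32) \<le> (h * \<zeta>\<^sup>2 / 128) * real k" using k1 h by (intro mult_left_mono) auto
      thus ?thesis by simp
    qed
    also have "\<dots> \<le> ?B" by (rule expmono) fact
    finally show "exp (- \<zeta> / 2) powr (- ((1 - \<zeta>) * h * real k)) * exp (- (1 - exp (- \<zeta> / 2)) * ((h - \<eta>) / n * (1 - (h - \<eta>) / n * real k / 2) *
       ((real (card V) + real (card A) - real k) * real k - real (card D)))) \<le> ?B" .
  qed (use \<zeta> in auto)
  have hit: "prob_le (\<lambda>\<omega>. Q \<omega> \<and> \<eta> * real n / 2 \<le> real (card (born (Wt \<omega>) V (Suc J) \<inter> V)) \<and>
            (\<forall>u\<in>born (Wt \<omega>) V (Suc J) \<inter> V. \<forall>v\<in>T. \<not> lnk (Wt \<omega>) u v (\<kappa> / n))) (pQ * ?B)"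
  proof (rule prob_le_mono[OF exploration_hit[OF expl A V AV T D KG Q, where x="\<kappa> / n" and j="Suc J" and r="\<eta> * real n / 2"]])
    show "\<eta> / n \<le> \<kappa> / n" using e32 \<kappa> n0 by (intro divide_right_mono) auto
    show "\<kappa> / n \<le> 1" using \<kappa>n n0 by simp
    have "\<kappa> / 2 * (1 / n) * (real a * (\<eta> * real n) / 4) \<le> (\<kappa> - \<eta>) * (1 / n) * (real (card T) * (\<eta> * real n / 2) - real (card D))"
    proof (intro mult_mono)
      show "\<kappa> / 2 \<le> \<kappa> - \<eta>" using e32 \<kappa> by linarith
      have "\<eta> * real a * 1 \<le> \<eta> * real a * (real n / 4)" using \<eta> n32 by (intro mult_left_mono) auto
      thus "real a * (\<eta> * real n) / 4 \<le> real (card T) * (\<eta> * real n / 2) - real (card D)"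
        using DV(1) card by (simp add: algebra_simps)
    qed (use \<kappa> \<eta> n0 e32 in auto)
    also have "\<kappa> / 2 * (1 / n) * (real a * (\<eta> * real n) / 4) = \<eta> / 8 * (real a * \<kappa>)" using n0 by simp
    finally have "exp (- (\<kappa> / n - \<eta> / n) * (real (card T) * (\<eta> * real n / 2) - real (card D))) \<le> exp (- (\<eta> / 8) * (real a * \<kappa>))"
      by (simp add: diff_divide_distrib algebra_simps)
    also have "\<dots> \<le> ?B" by (rule expmono) fact
    finally show "expectation (\<lambda>\<omega>. of_bool (Q \<omega>)) * exp (- (\<kappa> / n - \<eta> / n) * (real (card T) * (\<eta> * real n / 2) - real (card D))) \<le> pQ * ?B"
      unfolding pQ_def[symmetric] using pQ0 by (rule mult_left_mono)
  qed auto
  have steps: "prob_le (\<lambda>\<omega>. \<exists>i\<in>{..<J}. Q \<omega> \<and> ?kmin \<le> b \<omega> (Suc i) \<and> b \<omega> (Suc i) \<le> ?kmax \<and>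
     real (b \<omega> (Suc (Suc i))) - real (b \<omega> (Suc i)) < (1 - \<zeta>) * h * real (b \<omega> (Suc i))) (real J * (pQ * ?B))"
    using step pQ0 by (intro prob_le_bex_const) auto
  show ?thesis
  proof (rule prob_le_mono[OF prob_le_disj[OF first prob_le_disj[OF steps hit]]])
    show "pQ * ?B + (real J * (pQ * ?B) + pQ * ?B) \<le> expectation (\<lambda>\<omega>. of_bool (Q \<omega>)) * (real (J + 2) * ?B)"
      by (simp add: pQ_def[symmetric] algebra_simps)
    fix \<omega> assume bad: "Q \<omega> \<and> \<not> (\<exists>u\<in>born (Wt \<omega>) V (Suc J) \<inter> V. \<exists>v\<in>T. lnk (Wt \<omega>) u v (\<kappa> / n))"
    show "(Q \<omega> \<and> a \<le> b \<omega> 0 \<and> b \<omega> 0 \<le> a \<and> real (b \<omega> (Suc 0)) - real (b \<omega> 0) < real a * \<kappa> / 32) \<or>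
      (\<exists>i\<in>{..<J}. Q \<omega> \<and> ?kmin \<le> b \<omega> (Suc i) \<and> b \<omega> (Suc i) \<le> ?kmax \<and>
        real (b \<omega> (Suc (Suc i))) - real (b \<omega> (Suc i)) < (1 - \<zeta>) * h * real (b \<omega> (Suc i))) \<or>
      (Q \<omega> \<and> \<eta> * real n / 2 \<le> real (card (born (Wt \<omega>) V (Suc J) \<inter> V)) \<and>
            (\<forall>u\<in>born (Wt \<omega>) V (Suc J) \<inter> V. \<forall>v\<in>T. \<not> lnk (Wt \<omega>) u v (\<kappa> / n)))"
    proof (rule ccontr)
      assume neg: "\<not> ?thesis"
      have b0: "b \<omega> 0 = a" unfolding b_def born_0[OF AV] card ..
      have b1: "real a * \<kappa> / 32 \<le> real (b \<omega> (Suc 0))" using neg bad b0 by auto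
      have grow: "real (b \<omega> (Suc (Suc i))) \<ge> (1 + (1 - \<zeta>) * h) * real (b \<omega> (Suc i))"
        if "i < J" "real a * \<kappa> / 32 \<le> real (b \<omega> (Suc i))" "real (b \<omega> (Suc i)) \<le> \<eta> * real n" for i
      proof -
        have "?kmin \<le> b \<omega> (Suc i)" using that(2) by linarith
        moreover have "b \<omega> (Suc i) \<le> ?kmax" using that(3) by (simp add: le_nat_floor)
        ultimately have "\<not> real (b \<omega> (Suc (Suc i))) - real (b \<omega> (Suc i)) < (1 - \<zeta>) * h * real (b \<omega> (Suc i))"
          using neg bad that(1) by blast
        thus ?thesis by (simp add: algebra_simps)
      qed
      have bmono: "b \<omega> (Suc i) \<le> b \<omega> (Suc (Suc i))" for i
        unfolding b_def using A V
        by (intro card_mono born_mono) (auto intro: finite_subset[OF born_subset] finite_subset)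
      \<comment> \<open>Having passed \<open>\<eta> * n\<close> is kept as an alternative; it
        persists because the born sets increase.\<close>
      have ge: "real (b \<omega> (Suc i)) > \<eta> * real n \<or> real (b \<omega> (Suc i)) \<ge> real a * \<kappa> / 32 * (1 + (1 - \<zeta>) * h) ^ i" if "i \<le> J" for i
        using that
      proof (induction i)
        case 0
        thus ?case using b1 by simp
      next
        case (Suc i)
        show ?case
        proof (cases "real (b \<omega> (Suc i)) > \<eta> * real n")
          case True
          thus ?thesis using bmono[of i] by linarith
        next
          case False
          hence "real a * \<kappa> / 32 * (1 + (1 - \<zeta>) * h) ^ i \<le> real (b \<omega> (Suc i))" using Suc by auto
          moreover have "real a * \<kappa> / 32 * 1 \<le> real a * \<kappa> / 32 * (1 + (1 - \<zeta>) * h) ^ i"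
            using aK \<zeta> h by (intro mult_left_mono one_le_power) auto
          ultimately have "(1 + (1 - \<zeta>) * h) * real (b \<omega> (Suc i)) \<le> real (b \<omega> (Suc (Suc i)))"
            using Suc.prems False by (intro grow) auto
          moreover have "(1 + (1 - \<zeta>) * h) * (real a * \<kappa> / 32 * (1 + (1 - \<zeta>) * h) ^ i) \<le> (1 + (1 - \<zeta>) * h) * real (b \<omega> (Suc i))"
            using \<open>real a * \<kappa> / 32 * (1 + (1 - \<zeta>) * h) ^ i \<le> real (b \<omega> (Suc i))\<close> \<zeta> h by (intro mult_left_mono) auto
          moreover have "real a * \<kappa> / 32 * (1 + (1 - \<zeta>) * h) ^ Suc i =
            (1 + (1 - \<zeta>) * h) * (real a * \<kappa> / 32 * (1 + (1 - \<zeta>) * h) ^ i)" by simp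
          ultimately show ?thesis by linarith
        qed
      qed
      have "real (b \<omega> (Suc J)) > \<eta> * real n"
      proof -
        have "1 * real n \<le> real a * \<kappa> / 32 * (1 + (1 - \<zeta>) * h) ^ J"
          using \<kappa> J n0 by (intro mult_mono) (auto simp: mult.commute)
        moreover have "\<eta> * real n < 1 * real n" using e32 n0 by (intro mult_strict_right_mono) auto
        ultimately show ?thesis using ge[of J] by linarith
      qed
      moreover have "b \<omega> (Suc J) \<le> card (born (Wt \<omega>) V (Suc J) \<inter> V) + a"
      proof -
        have "born (Wt \<omega>) V (Suc J) \<subseteq> (born (Wt \<omega>) V (Suc J) \<inter> V) \<union> A" using born_subset by blast
        moreover have "finite ((born (Wt \<omega>) V (Suc J) \<inter> V) \<union> A)" using A V finite_subset[of _ "{1..n}"] by auto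
        ultimately have "b \<omega> (Suc J) \<le> card ((born (Wt \<omega>) V (Suc J) \<inter> V) \<union> A)" unfolding b_def by (intro card_mono)
        also have "\<dots> \<le> card (born (Wt \<omega>) V (Suc J) \<inter> V) + a" using card_Un_le card by metis
        finally show ?thesis .
      qed
      ultimately have "\<eta> * real n / 2 \<le> real (card (born (Wt \<omega>) V (Suc J) \<inter> V))" using \<kappa>(4) by linarith
      thus False using neg bad by blast
    qed
  qed
qed

end

text \<open>A small set is listed and the list padded with \<open>None\<close> to length
  \<open>m\<close>.\<close>

lemma finite_card_small_subsets:
  assumes "finite S" "real (card S) \<le> c"
  shows "finite {D. D \<subseteq> S \<and> card D \<le> m} \<and> real (card {D. D \<subseteq> S \<and> card D \<le> m}) \<le> (c + 1) ^ m"
proof -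
  let ?L = "{xs. set xs \<subseteq> insert None (Some ` S) \<and> length xs = m}"
  have fin: "finite (insert None (Some ` S))" using assms by simp
  have sub: "{D. D \<subseteq> S \<and> card D \<le> m} \<subseteq> (\<lambda>xs. {x. Some x \<in> set xs}) ` ?L"
  proof
    fix D assume D: "D \<in> {D. D \<subseteq> S \<and> card D \<le> m}"
    hence "finite D" using assms finite_subset by auto
    then obtain xs where xs: "set xs = D" "length xs = card D" using finite_distinct_list distinct_card by metis
    let ?ys = "map Some xs @ replicate (m - length xs) None"
    have "{x. Some x \<in> set ?ys} = D" using xs by auto
    moreover have "?ys \<in> ?L" using xs D by auto
    ultimately show "D \<in> (\<lambda>xs. {x. Some x \<in> set xs}) ` ?L" by (intro image_eqI[of _ _ ?ys]) auto
  qed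
  have finL: "finite ?L" by (rule finite_lists_length_eq[OF fin])
  have "card {D. D \<subseteq> S \<and> card D \<le> m} \<le> card ?L"
    using card_mono[OF finite_imageI[OF finL] sub] card_image_le[OF finL, of "\<lambda>xs. {x. Some x \<in> set xs}"] by linarith
  also have "\<dots> = card (insert None (Some ` S)) ^ m" by (rule card_lists_length_eq[OF fin])
  also have "card (insert None (Some ` S)) = card S + 1" using assms by (subst card_insert_disjoint) (auto simp: card_image)
  finally have "real (card {D. D \<subseteq> S \<and> card D \<le> m}) \<le> real ((card S + 1) ^ m)" by (rule of_nat_mono)
  also have "\<dots> \<le> (c + 1) ^ m" using assms(2) by (simp add: power_mono)
  finally show ?thesis using finite_subset[OF sub] finL by auto
qed

section \<open>Union bounds over light forests\<close>

context random_weights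
begin

text \<open>Here \<open>y ^ N\<close> cancels the \<open>n ^ N\<close> choices of vertices. For this
  the failure has to be bounded jointly with lightness, which is why \<open>bad\<close> is stated
  relative to the probability of \<open>light fs y\<close>.\<close>

lemma forest_union_bound:
  assumes R: "R \<subseteq> {1..n}" and y: "0 \<le> y" "y \<le> 1" and B: "0 \<le> B" and c: "0 \<le> c"
    and X: "\<And>fs. forest n R fs \<Longrightarrow> length fs = N \<Longrightarrow> finite (X fs) \<and> real (card (X fs)) \<le> c"
    and bad: "\<And>fs x. forest n R fs \<Longrightarrow> length fs = N \<Longrightarrow> x \<in> X fs \<Longrightarrow>
       prob_le (\<lambda>\<omega>. light fs y \<omega> \<and> Bad fs x \<omega>) (expectation (\<lambda>\<omega>. of_bool (light fs y \<omega>)) * B)"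
  shows "prob_le (\<lambda>\<omega>. \<exists>fs x. forest n R fs \<and> length fs = N \<and> x \<in> X fs \<and> light fs y \<omega> \<and> Bad fs x \<omega>)
     ((real (n * (card R + N)) * y) ^ N * c * B)"
proof -
  let ?F = "{fs. forest n R fs \<and> length fs = N}"
  have finR: "finite R" using R finite_subset by auto
  have F: "finite ?F" "card ?F \<le> (n * (card R + N)) ^ N" using card_forests[OF finR] by auto
  have 1: "prob_le (\<lambda>\<omega>. \<exists>x\<in>X fs. light fs y \<omega> \<and> Bad fs x \<omega>) (c * (y ^ N * B))" if fs: "fs \<in> ?F" for fs
  proof (rule prob_le_bex_const)
    show "prob_le (\<lambda>\<omega>. light fs y \<omega> \<and> Bad fs x \<omega>) (y ^ N * B)" if "x \<in> X fs" for x
      using bad[of fs x] that fs expectation_light[OF _ R y, of fs] by auto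
  qed (use X fs y B in auto)
  have "prob_le (\<lambda>\<omega>. \<exists>fs\<in>?F. \<exists>x\<in>X fs. light fs y \<omega> \<and> Bad fs x \<omega>) (real ((n * (card R + N)) ^ N) * (c * (y ^ N * B)))"
  proof (rule prob_le_bex_const)
    show "prob_le (\<lambda>\<omega>. \<exists>x\<in>X fs. light fs y \<omega> \<and> Bad fs x \<omega>) (c * (y ^ N * B))" if "fs \<in> ?F" for fs
      using 1[OF that] .
    show "real (card ?F) \<le> real ((n * (card R + N)) ^ N)" by (rule of_nat_mono) (rule F)
  qed (use F c y B in auto)
  thus ?thesis by (rule prob_le_mono) (auto simp: power_mult_distrib mult_ac)
qed

lemma forest_complement:
  assumes "forest n R fs" "R \<subseteq> {1..n}"
  shows "real (card ({1..n} - R - fst ` set fs)) = real n - real (card R) - real (length fs)"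
proof -
  have v: "fst ` set fs \<subseteq> {1..n} - R" "card (fst ` set fs) = length fs" using forest_verts[OF assms(1)] by auto
  have finR: "finite R" using assms finite_subset by auto
  have "card ({1..n} - R - fst ` set fs) = card ({1..n} - R) - length fs"
    using v by (subst card_Diff_subset) auto
  moreover have "card ({1..n} - R) = n - card R" using assms finR by (subst card_Diff_subset) auto
  moreover have "length fs \<le> card ({1..n} - R)" using card_mono[OF _ v(1)] v(2) by auto
  moreover have "card R \<le> n" using card_mono[OF _ assms(2)] by auto
  ultimately show ?thesis by auto
qed

text \<open>One exploration round with nothing excluded: for \<open>tau i = 2 * lo * i\<close> the
  vertices born in round 1 are those joined to \<open>U\<close> by an edge of weight between
  \<open>lo\<close> and \<open>2 * lo\<close>. Removed edges are discounted afterwards by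
  \<open>card_clean_neighbours\<close>, so they do not enter this union bound; the factor
  \<open>4 ^ a\<close> counts the subsets \<open>U\<close>.\<close>

lemma forest_expansion:
  assumes R: "R \<subseteq> {1..n}" "card R = 2" and y: "0 \<le> y" "y \<le> 1" and los: "0 < lo" "2 * lo \<le> 1" "lo * real a \<le> 1"
    and n: "2 * (2 + 2 * real a) \<le> real n"
  shows "prob_le (\<lambda>\<omega>. \<exists>fs U. forest n R fs \<and> length fs = 2 * a \<and> U \<in> {U. U \<subseteq> fst ` set fs \<and> card U = a} \<and> light fs y \<omega> \<and>
      real (card {v \<in> {1..n} - R - fst ` set fs. \<exists>u\<in>U. lo \<le> W {u, v} \<omega> \<and> W {u, v} \<omega> \<le> 2 * lo}) < real a * real n * lo / 16)
    ((real (n * (2 + 2 * a)) * y) ^ (2 * a) * 4 ^ a * exp (- (real a * real n * lo / 16)))"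
proof (rule forest_union_bound[OF R(1) y, unfolded R(2)])
  fix fs assume fs: "forest n R fs" "length fs = 2 * a"
  have v: "fst ` set fs \<subseteq> {1..n} - R" "card (fst ` set fs) = 2 * a" using forest_verts[OF fs(1)] fs(2) by auto
  let ?X = "{U. U \<subseteq> fst ` set fs \<and> card U = a}"
  have "card ?X \<le> card (Pow (fst ` set fs))" by (intro card_mono) auto
  also have "\<dots> = 4 ^ a" using v by (subst card_Pow) (auto simp: power_mult)
  finally have "real (card ?X) \<le> real (4 ^ a)" by (rule of_nat_mono)
  thus "finite ?X \<and> real (card ?X) \<le> 4 ^ a" by (auto intro: finite_subset[of _ "Pow (fst ` set fs)"])
  fix U assume "U \<in> ?X"
  hence U: "U \<subseteq> fst ` set fs" "card U = a" by auto
  let ?V = "{1..n} - R - fst ` set fs"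
  let ?tau = "\<lambda>i. 2 * lo * real i"
  have expl: "exploration lo ?tau"
    using los by unfold_locales (auto simp: mono_def)
  interpret exploration "{}" lo ?tau U by (rule expl)
  have UV: "U \<inter> ?V = {}" using U by auto
  have V: "real n / 2 \<le> real (card ?V)" using forest_complement[OF fs(1) R(1)] R fs n by simp
  have "prob_le (\<lambda>\<omega>. light fs y \<omega> \<and> a \<le> card (born (Wt \<omega>) ?V 0) \<and> card (born (Wt \<omega>) ?V 0) \<le> a \<and>
      real (card (born (Wt \<omega>) ?V (Suc 0))) - real (card (born (Wt \<omega>) ?V 0)) < real a * real n * lo / 16)
      (expectation (\<lambda>\<omega>. of_bool (light fs y \<omega>)) * exp (- (real a * real n * lo / 16)))"
  proof (rule exploration_step[OF expl _ _ UV _ _ _ light_pred, where \<theta>="exp (-1)" and q=lo and g="\<lambda>_. real a * real n * lo / 16"])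
    show "U \<subseteq> {1..n}" using U v by auto
    show "forest_edges fs \<subseteq> E" using forest_edges_complete[OF fs(1) R(1)] by simp
    show "e \<inter> ?V = {}" if "e \<in> forest_edges fs" for e using forest_edges_subset[OF fs(1) that] by auto
    fix k assume "a \<le> k" "k \<le> a"
    hence k: "k = a" by simp
    show "lo * real k \<le> 2" using los k by simp
    have e: "1 / 2 \<le> 1 - exp (- 1 :: real)"
    proof -
      have "2 \<le> exp (1::real)" using exp_ge_add_one_self[of 1] by simp
      hence "inverse (exp (1::real)) \<le> inverse 2" by (intro le_imp_inverse_le) auto
      thus ?thesis by (simp add: exp_minus)
    qed
    have "1 / 2 * (lo * (1 / 2) * (real n / 2 * real a)) \<le> (1 - exp (- 1)) * (lo * (1 - lo * real a / 2) * (real (card ?V) * real a))"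
      using los V by (intro mult_mono e) auto
    hence "real a * real n * lo / 16 + - (1 - exp (- 1)) * (lo * (1 - lo * real a / 2) * (real (card ?V) * real a)) \<le> - (real a * real n * lo / 16)"
      unfolding mult_minus_left by (simp add: mult_ac)
    moreover have "exp (- 1) powr (- (real a * real n * lo / 16)) = exp (real a * real n * lo / 16)" by (simp add: powr_def)
    ultimately show "exp (- 1) powr (- (real a * real n * lo / 16)) * exp (- (1 - exp (- 1)) * (lo * (1 - lo * real k / 2) *
        ((real (card ?V) + real (card U) - real k) * real k - real (card ({} :: nat set set))))) \<le> exp (- (real a * real n * lo / 16))"
      by (simp add: k U exp_add[symmetric])
  qed (use los in auto)
  thus "prob_le (\<lambda>\<omega>. light fs y \<omega> \<and> real (card {v \<in> ?V. \<exists>u\<in>U. lo \<le> W {u, v} \<omega> \<and> W {u, v} \<omega> \<le> 2 * lo}) < real a * real n * lo / 16)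
      (expectation (\<lambda>\<omega>. of_bool (light fs y \<omega>)) * exp (- (real a * real n * lo / 16)))"
  proof (rule prob_le_mono)
    fix \<omega> assume bad: "light fs y \<omega> \<and> real (card {v \<in> ?V. \<exists>u\<in>U. lo \<le> W {u, v} \<omega> \<and> W {u, v} \<omega> \<le> 2 * lo}) < real a * real n * lo / 16"
    let ?N = "{v \<in> ?V. \<exists>u\<in>U. lo \<le> W {u, v} \<omega> \<and> W {u, v} \<omega> \<le> 2 * lo}"
    have finU: "finite U" using U finite_subset by auto
    have "born (Wt \<omega>) ?V (Suc 0) = U \<union> ?N" unfolding born_1[OF UV] by (auto simp: link_def)
    moreover have "card (U \<union> ?N) = a + card ?N" using U UV finU by (subst card_Un_disjoint) auto
    ultimately show "light fs y \<omega> \<and> a \<le> card (born (Wt \<omega>) ?V 0) \<and> card (born (Wt \<omega>) ?V 0) \<le> a \<and>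
      real (card (born (Wt \<omega>) ?V (Suc 0))) - real (card (born (Wt \<omega>) ?V 0)) < real a * real n * lo / 16"
      using bad born_0[OF UV] U by simp
  qed simp
qed auto

text \<open>Percolation runs through many rounds, so removed edges cannot be discounted afterwards
  as in \<open>forest_expansion\<close>. The excluded set \<open>D\<close> is part of the union
  bound, at the price \<open>(real n ^ 2 + 1) ^ m\<close>.\<close>

lemma forest_connection:
  fixes \<zeta> h \<eta> \<kappa> c :: real and a J m :: nat
  assumes R: "R \<subseteq> {1..n}" "card R = 2" and y: "0 \<le> y" "y \<le> 1"
    and \<zeta>: "0 < \<zeta>" "\<zeta> \<le> 1/2" and h: "0 < h" "h \<le> 1" and \<eta>: "0 < \<eta>" "\<eta> \<le> \<zeta> * h / 16"
    and \<kappa>: "1 \<le> \<kappa>" "\<kappa> * real a \<le> real n" "32 \<le> \<kappa> * real a" "2 + 2 * real a \<le> \<eta> * real n"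
    and m: "real m \<le> \<eta> * real a"
    and J: "real n \<le> (1 + (1 - \<zeta>) * h) ^ J" "\<kappa> + real J * h \<le> real n"
    and c: "c \<le> 1 / 16" "c \<le> h * \<zeta>\<^sup>2 / 4096" "c \<le> \<eta> / 8"
  shows "prob_le (\<lambda>\<omega>. \<exists>fs x. forest n R fs \<and> length fs = 2 * a \<and>
      x \<in> {U. U \<subseteq> fst ` set fs \<and> card U = a} \<times> {T. T \<subseteq> fst ` set fs \<and> card T = a} \<times> {D. D \<subseteq> E \<and> card D \<le> m} \<and>
      light fs y \<omega> \<and> (case x of (U, T, D) \<Rightarrow> U \<inter> T = {} \<and>
        \<not> (\<exists>u\<in>exploration.born D (\<eta> / n) (schedule \<kappa> h n) U (Wt \<omega>) ({1..n} - R - fst ` set fs) (Suc J) \<inter> ({1..n} - R - fst ` set fs).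
             \<exists>v\<in>T. link (Wt \<omega>) D (\<eta> / n) u v (\<kappa> / n))))
    ((real (n * (2 + 2 * a)) * y) ^ (2 * a) * (4 ^ a * (4 ^ a * (real n ^ 2 + 1) ^ m)) * (real (J + 2) * exp (- c * (real a * \<kappa>))))"
proof (rule forest_union_bound[OF R(1) y, unfolded R(2)])
  fix fs assume fs: "forest n R fs" "length fs = 2 * a"
  have v: "fst ` set fs \<subseteq> {1..n} - R" "card (fst ` set fs) = 2 * a" using forest_verts[OF fs(1)] fs(2) by auto
  let ?X = "{U. U \<subseteq> fst ` set fs \<and> card U = a}" and ?Y = "{D. D \<subseteq> E \<and> card D \<le> m}"
  have "card ?X \<le> card (Pow (fst ` set fs))" by (intro card_mono) auto
  also have "\<dots> = 4 ^ a" using v by (subst card_Pow) (auto simp: power_mult)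
  finally have X: "real (card ?X) \<le> real (4 ^ a)" by (rule of_nat_mono)
  have finX: "finite ?X" by (auto intro: finite_subset[of _ "Pow (fst ` set fs)"])
  have "real (card E) \<le> real (n\<^sup>2)" by (rule of_nat_mono[OF card_complete_edges_le])
  hence Y: "finite ?Y \<and> real (card ?Y) \<le> (real n ^ 2 + 1) ^ m"
    by (intro finite_card_small_subsets) auto
  show "finite (?X \<times> ?X \<times> ?Y) \<and> real (card (?X \<times> ?X \<times> ?Y)) \<le> 4 ^ a * (4 ^ a * (real n ^ 2 + 1) ^ m)"
    using X Y finX by (auto simp: card_cartesian_product intro!: mult_mono)
  fix x assume x: "x \<in> ?X \<times> ?X \<times> ?Y"
  obtain U T D where UTD: "x = (U, T, D)" by (cases x) auto
  have U: "U \<subseteq> fst ` set fs" "card U = a" and T: "T \<subseteq> fst ` set fs" "card T = a" and D: "D \<subseteq> E" "card D \<le> m"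
    using x UTD by auto
  let ?V = "{1..n} - R - fst ` set fs"
  have pos: "0 \<le> real (J + 2) * exp (- c * (real a * \<kappa>))" by simp
  show "prob_le (\<lambda>\<omega>. light fs y \<omega> \<and> (case x of (U, T, D) \<Rightarrow> U \<inter> T = {} \<and>
        \<not> (\<exists>u\<in>exploration.born D (\<eta> / n) (schedule \<kappa> h n) U (Wt \<omega>) ?V (Suc J) \<inter> ?V.
             \<exists>v\<in>T. link (Wt \<omega>) D (\<eta> / n) u v (\<kappa> / n))))
     (expectation (\<lambda>\<omega>. of_bool (light fs y \<omega>)) * (real (J + 2) * exp (- c * (real a * \<kappa>))))"
  proof (cases "U \<inter> T = {}")
    case True
    have "prob_le (\<lambda>\<omega>. light fs y \<omega> \<and> \<not> (\<exists>u\<in>exploration.born D (\<eta> / n) (schedule \<kappa> h n) U (Wt \<omega>) ?V (Suc J) \<inter> ?V.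
             \<exists>v\<in>T. link (Wt \<omega>) D (\<eta> / n) u v (\<kappa> / n)))
       (expectation (\<lambda>\<omega>. of_bool (light fs y \<omega>)) * (real (J + 2) * exp (- c * (real a * \<kappa>))))"
    proof (rule exploration_connects[OF _ _ _ _ _ _ _ _ light_pred U(2) T(2) \<zeta> h \<eta> \<kappa>(1-3) _ _ _ J c])
      show "U \<subseteq> {1..n}" "T \<subseteq> {1..n}" using U T v by auto
      show "U \<inter> ?V = {}" "T \<inter> (U \<union> ?V) = {}" using U T True by auto
      show "finite D" using finite_subset[OF D(1)] by simp
      show "forest_edges fs \<subseteq> E" using forest_edges_complete[OF fs(1) R(1)] by simp
      show "e \<inter> ?V = {}" if "e \<in> forest_edges fs" for e using forest_edges_subset[OF fs(1) that] by auto
      show "2 * real a \<le> \<eta> * real n" using \<kappa> by linarith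
      show "real (card D) \<le> \<eta> * real a" using D m by linarith
      show "(1 - \<eta>) * real n \<le> real (card ?V)" using forest_complement[OF fs(1) R(1)] R fs \<kappa> by (simp add: algebra_simps)
    qed auto
    thus ?thesis by (rule prob_le_mono) (auto simp: UTD)
  next
    case False
    have "0 \<le> expectation (\<lambda>\<omega>. of_bool (light fs y \<omega>)) * (real (J + 2) * exp (- c * (real a * \<kappa>)))"
      using expectation_light[OF fs(1) R(1) y] y by simp
    thus ?thesis using False unfolding prob_le_def by (intro bexI[of _ "{}"]) (auto simp: UTD)
  qed
qed auto

end

section \<open>Stars, cuts and cheap paths\<close>

lemma path_edges_simps [simp]:
  "path_edges [] = {}" "path_edges [u] = {}"
  "path_edges (u # v # p) = insert {u, v} (path_edges (v # p))"
proof -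
  show "path_edges [] = {}" "path_edges [u] = {}" by (auto simp: path_edges_def)
  show "path_edges (u # v # p) = insert {u, v} (path_edges (v # p))"
  proof (intro set_eqI iffI)
    fix e assume "e \<in> path_edges (u # v # p)"
    then obtain i where i: "e = {(u # v # p) ! i, (u # v # p) ! Suc i}" "Suc i < length (u # v # p)"
      unfolding path_edges_def by blast
    show "e \<in> insert {u, v} (path_edges (v # p))"
    proof (cases i)
      case (Suc k)
      hence "e = {(v # p) ! k, (v # p) ! Suc k}" "Suc k < length (v # p)" using i by simp_all
      thus ?thesis unfolding path_edges_def by blast
    qed (use i in simp)
  next
    fix e assume "e \<in> insert {u, v} (path_edges (v # p))"
    then consider "e = {u, v}" | i where "e = {(v # p) ! i, (v # p) ! Suc i}" "Suc i < length (v # p)"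
      unfolding path_edges_def by blast
    thus "e \<in> path_edges (u # v # p)"
    proof cases
      case 1
      hence "e = {(u # v # p) ! 0, (u # v # p) ! Suc 0}" "Suc 0 < length (u # v # p)" by simp_all
      thus ?thesis unfolding path_edges_def by blast
    next
      case (2 i)
      hence "e = {(u # v # p) ! Suc i, (u # v # p) ! Suc (Suc i)}" "Suc (Suc i) < length (u # v # p)" by simp_all
      thus ?thesis unfolding path_edges_def by blast
    qed
  qed
qed

lemma finite_path_edges [simp]: "finite (path_edges p)"
  by (induction p rule: induct_list012) auto

lemma path_edges_subset_set: "e \<in> path_edges p \<Longrightarrow> e \<subseteq> set p"
  by (induction p rule: induct_list012) auto

lemma path_edges_complete: "distinct p \<Longrightarrow> set p \<subseteq> {1..n} \<Longrightarrow> path_edges p \<subseteq> complete_edges n"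
  by (induction p rule: induct_list012) (auto simp: doubleton_complete_edges_iff)

lemma card_path_edges: "distinct p \<Longrightarrow> card (path_edges p) = length p - 1"
proof (induction p rule: induct_list012)
  case (3 u v p)
  have "{u, v} \<notin> path_edges (v # p)" using path_edges_subset_set[of "{u,v}" "v # p"] 3 by auto
  thus ?case using 3 by simp
qed auto

lemma path_edges_rev: "path_edges (rev p) = path_edges p"
proof -
  have app: "path_edges (p @ [u, v]) = insert {u, v} (path_edges (p @ [u]))" for p u v
    by (induction p rule: induct_list012) auto
  show ?thesis
  proof (induction p rule: induct_list012)
    case (3 u v p)
    thus ?case using app[of "rev p" v u] by (simp add: insert_commute)
  qed auto
qed

lemma inj_on_star: "inj_on (\<lambda>v. {x, v}) (- {x})"
  by (auto simp: inj_on_def doubleton_eq_iff)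

lemma (in prob_space) prob_le_weaken: "prob_le Q p \<Longrightarrow> p \<le> p' \<Longrightarrow> prob_le Q p'"
  by (rule prob_le_mono)

definition between :: "nat set \<Rightarrow> nat set \<Rightarrow> nat set set" where
  "between U Z = (\<lambda>(u, z). {u, z}) ` (U \<times> Z)"

lemma card_between: "U \<inter> Z = {} \<Longrightarrow> card (between U Z) = card U * card Z"
  unfolding between_def by (subst card_image) (auto simp: inj_on_def doubleton_eq_iff card_cartesian_product)

section \<open>Concentration at stars and across cuts\<close>

context random_weights
begin

lemma star_subset: "x \<in> {1..n} \<Longrightarrow> (\<lambda>v. {x, v}) ` ({1..n} - {x}) \<subseteq> E"
  by (auto simp: doubleton_complete_edges_iff)

lemma star_card:
  "card {v \<in> {1..n} - {x}. P (W {x, v} \<omega>)} = card {e \<in> (\<lambda>v. {x, v}) ` ({1..n} - {x}). P (W e \<omega>)}"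
proof -
  have "{e \<in> (\<lambda>v. {x, v}) ` ({1..n} - {x}). P (W e \<omega>)} = (\<lambda>v. {x, v}) ` {v \<in> {1..n} - {x}. P (W {x, v} \<omega>)}" by auto
  thus ?thesis by (subst card_image[symmetric, of "\<lambda>v. {x, v}"]) (auto intro: inj_on_subset[OF inj_on_star])
qed

lemma card_star: "x \<in> {1..n} \<Longrightarrow> card ((\<lambda>v. {x, v}) ` ({1..n} - {x})) = n - 1"
  by (subst card_image) (auto intro: inj_on_subset[OF inj_on_star])

text \<open>The slack \<open>\<delta> * j\<close> produces geometric decay in \<open>j\<close>, so
  that the bounds can be summed over all \<open>j\<close>; the slack \<open>\<delta> * L\<close>
  produces a common factor that tends to 0 for L = ln n.\<close>

lemma star_upper:
  assumes x: "x \<in> {1..n}" and \<delta>: "0 < \<delta>" "\<delta> \<le> 1" and j: "j \<le> n"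
  shows "prob_le (\<lambda>\<omega>. (1 + \<delta>) * real j + \<delta> * L < real (card {v \<in> {1..n} - {x}. 0 \<le> W {x, v} \<omega> \<and> W {x, v} \<omega> \<le> real j / real n}))
    (exp (- (\<delta>\<^sup>2 / 2 * L)) * exp (- (\<delta>\<^sup>2 / 4)) ^ j)"
proof -
  let ?X = "(\<lambda>v. {x, v}) ` ({1..n} - {x})" and ?r = "(1 + \<delta>) * real j + \<delta> * L"
  have n0: "real n > 0" using x by auto
  have "prob_le (\<lambda>\<omega>. ?r < real (card {v \<in> {1..n} - {x}. 0 \<le> W {x, v} \<omega> \<and> W {x, v} \<omega> \<le> real j / real n}))
    (exp ((exp (\<delta> / 2) - 1) * (real j / real n - 0) * real (card ?X)) * exp (\<delta> / 2) powr (- ?r))"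
  proof (rule chernoff_edges[OF star_subset[OF x]])
    fix \<omega> assume "?r < real (card {v \<in> {1..n} - {x}. 0 \<le> W {x, v} \<omega> \<and> W {x, v} \<omega> \<le> real j / real n})"
    hence "?r < real (card {e \<in> ?X. 0 \<le> W e \<omega> \<and> W e \<omega> \<le> real j / real n})"
      using star_card[of x "\<lambda>w. 0 \<le> w \<and> w \<le> real j / real n" \<omega>] by simp
    thus "exp (\<delta> / 2) powr ?r \<le> exp (\<delta> / 2) powr real (card {e \<in> ?X. 0 \<le> W e \<omega> \<and> W e \<omega> \<le> real j / real n})"
      using \<delta> by (intro powr_mono) auto
  qed (use j n0 in auto)
  moreover have "exp ((exp (\<delta> / 2) - 1) * (real j / real n - 0) * real (card ?X)) * exp (\<delta> / 2) powr (- ?r)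
     \<le> exp (- (\<delta>\<^sup>2 / 2 * L)) * exp (- (\<delta>\<^sup>2 / 4)) ^ j"
  proof -
    have 1: "exp (\<delta> / 2) - 1 \<le> \<delta> / 2 + (\<delta> / 2)\<^sup>2"
      using exp_bound[of "\<delta> / 2"] \<delta> by simp
    have 2: "real j / real n * real (card ?X) \<le> real j"
    proof -
      have "real j / real n * real (card ?X) \<le> real j / real n * real n"
        using card_star[OF x] by (intro mult_left_mono) auto
      thus ?thesis using n0 by simp
    qed
    have "(exp (\<delta> / 2) - 1) * (real j / real n * real (card ?X)) \<le> (\<delta> / 2 + (\<delta> / 2)\<^sup>2) * real j"
      using \<delta> by (intro mult_mono 1 2) auto
    moreover have "(\<delta> / 2 + (\<delta> / 2)\<^sup>2) * real j + - (?r * (\<delta> / 2)) = - (\<delta>\<^sup>2 / 2 * L) + - (\<delta>\<^sup>2 / 4) * real j"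
      by (simp add: power2_eq_square field_simps)
    ultimately have "(exp (\<delta> / 2) - 1) * (real j / real n * real (card ?X)) + - (?r * (\<delta> / 2)) \<le> - (\<delta>\<^sup>2 / 2 * L) + - (\<delta>\<^sup>2 / 4) * real j"
      by linarith
    moreover have "exp (\<delta> / 2) powr (- ?r) = exp (- (?r * (\<delta> / 2)))" unfolding exp_powr_real by (simp add: algebra_simps)
    moreover have "exp (- (\<delta>\<^sup>2 / 4)) ^ j = exp (- (\<delta>\<^sup>2 / 4) * real j)" by (simp add: exp_of_nat_mult[symmetric] mult.commute)
    ultimately show ?thesis by (simp add: exp_add[symmetric] mult.assoc)
  qed
  ultimately show ?thesis by (rule prob_le_weaken)
qed

text \<open>The factor \<open>exp 1\<close> pays for the star having \<open>n - 1\<close> edges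
  instead of \<open>n\<close>.\<close>

lemma star_lower:
  assumes x: "x \<in> {1..n}" and \<delta>: "0 < \<delta>" "\<delta> \<le> 1" and j: "j \<le> n"
  shows "prob_le (\<lambda>\<omega>. real (card {v \<in> {1..n} - {x}. 0 \<le> W {x, v} \<omega> \<and> W {x, v} \<omega> \<le> real j / real n}) < (1 - \<delta>) * real j - \<delta> * L)
    (exp 1 * (exp (- (\<delta>\<^sup>2 * L)) * exp (- (\<delta>\<^sup>2 / 2)) ^ j))"
proof -
  let ?X = "(\<lambda>v. {x, v}) ` ({1..n} - {x})" and ?r = "(1 - \<delta>) * real j - \<delta> * L"
  have n0: "real n > 0" using x by auto
  have "prob_le (\<lambda>\<omega>. real (card {v \<in> {1..n} - {x}. 0 \<le> W {x, v} \<omega> \<and> W {x, v} \<omega> \<le> real j / real n}) < ?r)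
    (exp ((exp (- \<delta>) - 1) * (real j / real n - 0) * real (card ?X)) * exp (- \<delta>) powr (- ?r))"
  proof (rule chernoff_edges[OF star_subset[OF x]])
    fix \<omega> assume "real (card {v \<in> {1..n} - {x}. 0 \<le> W {x, v} \<omega> \<and> W {x, v} \<omega> \<le> real j / real n}) < ?r"
    hence "real (card {e \<in> ?X. 0 \<le> W e \<omega> \<and> W e \<omega> \<le> real j / real n}) < ?r"
      using star_card[of x "\<lambda>w. 0 \<le> w \<and> w \<le> real j / real n" \<omega>] by simp
    thus "exp (- \<delta>) powr ?r \<le> exp (- \<delta>) powr real (card {e \<in> ?X. 0 \<le> W e \<omega> \<and> W e \<omega> \<le> real j / real n})"
      using \<delta> by (intro powr_mono') auto
  qed (use j n0 in auto)
  moreover have "exp ((exp (- \<delta>) - 1) * (real j / real n - 0) * real (card ?X)) * exp (- \<delta>) powr (- ?r)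
     \<le> exp 1 * (exp (- (\<delta>\<^sup>2 * L)) * exp (- (\<delta>\<^sup>2 / 2)) ^ j)"
  proof -
    have 1: "exp (- \<delta>) - 1 \<le> - \<delta> + \<delta>\<^sup>2 / 2" using exp_minus_le_quadratic[of \<delta>] \<delta> by simp
    have d: "\<delta>\<^sup>2 \<le> \<delta>" using \<delta> mult_left_mono[of \<delta> 1 \<delta>] by (simp add: power2_eq_square)
    have 2: "real j - 1 \<le> real j / real n * real (card ?X)"
    proof -
      have c: "real (card ?X) = real n - 1" unfolding card_star[OF x] using x by (auto simp: of_nat_diff)
      have "real j / real n \<le> 1" using j n0 by simp
      moreover have "real j / real n * (real n - 1) = real j - real j / real n" using n0 by (simp add: field_simps)
      ultimately show ?thesis unfolding c by linarith
    qed
    have "(exp (- \<delta>) - 1) * (real j / real n * real (card ?X)) \<le> (- \<delta> + \<delta>\<^sup>2 / 2) * (real j / real n * real (card ?X))"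
      by (intro mult_right_mono 1) auto
    also have "\<dots> \<le> (- \<delta> + \<delta>\<^sup>2 / 2) * (real j - 1)" using d \<delta> by (intro mult_left_mono_neg 2) auto
    also have "\<dots> = (\<delta> - \<delta>\<^sup>2 / 2) + (- \<delta> + \<delta>\<^sup>2 / 2) * real j" by (simp add: field_simps)
    also have "\<dots> \<le> 1 + (- \<delta> + \<delta>\<^sup>2 / 2) * real j"
    proof -
      have "\<delta> - \<delta>\<^sup>2 / 2 \<le> 1" using \<delta> zero_le_power2[of \<delta>] by linarith
      thus ?thesis by (rule add_right_mono)
    qed
    finally have "(exp (- \<delta>) - 1) * (real j / real n * real (card ?X)) \<le> 1 + (- \<delta> + \<delta>\<^sup>2 / 2) * real j" .
    moreover have "(- \<delta> + \<delta>\<^sup>2 / 2) * real j + (?r * \<delta>) = - (\<delta>\<^sup>2 * L) + - (\<delta>\<^sup>2 / 2) * real j"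
      by (simp add: power2_eq_square field_simps)
    ultimately have "(exp (- \<delta>) - 1) * (real j / real n * real (card ?X)) + (?r * \<delta>) \<le> 1 + (- (\<delta>\<^sup>2 * L) + - (\<delta>\<^sup>2 / 2) * real j)"
      by linarith
    moreover have "exp (- \<delta>) powr (- ?r) = exp (?r * \<delta>)" unfolding exp_powr_real by (simp add: algebra_simps)
    moreover have "exp (- (\<delta>\<^sup>2 / 2)) ^ j = exp (- (\<delta>\<^sup>2 / 2) * real j)" by (simp add: exp_of_nat_mult[symmetric] mult.commute)
    ultimately show ?thesis by (simp add: exp_add[symmetric] mult.assoc)
  qed
  ultimately show ?thesis by (rule prob_le_weaken)
qed

lemma sum_geometric_le:
  fixes r :: real
  assumes "0 \<le> r" "r < 1"
  shows "(\<Sum>j\<le>n. r ^ j) \<le> 1 / (1 - r)"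
proof -
  have "(\<Sum>j\<le>n. r ^ j) \<le> (\<Sum>j. r ^ j)"
    using assms by (intro sum_le_suminf summable_geometric) auto
  thus ?thesis using assms by (simp add: suminf_geometric)
qed

lemma star_concentration:
  assumes x: "x \<in> {1..n}" and \<delta>: "0 < \<delta>" "\<delta> \<le> 1" and L: "0 \<le> L"
  shows "prob_le (\<lambda>\<omega>. \<exists>j\<in>{..n}. \<bar>real (card {v \<in> {1..n} - {x}. 0 \<le> W {x, v} \<omega> \<and> W {x, v} \<omega> \<le> real j / real n}) - real j\<bar> > \<delta> * (real j + L))
    (4 * exp (- (\<delta>\<^sup>2 / 2 * L)) / (1 - exp (- (\<delta>\<^sup>2 / 4))))"
proof -
  let ?N = "\<lambda>j \<omega>. real (card {v \<in> {1..n} - {x}. 0 \<le> W {x, v} \<omega> \<and> W {x, v} \<omega> \<le> real j / real n})"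
  let ?r = "exp (- (\<delta>\<^sup>2 / 4))"
  have "prob_le (\<lambda>\<omega>. \<exists>j\<in>{..n}. \<bar>?N j \<omega> - real j\<bar> > \<delta> * (real j + L)) (\<Sum>j\<in>{..n}. 4 * exp (- (\<delta>\<^sup>2 / 2 * L)) * ?r ^ j)"
  proof (rule prob_le_bex)
    fix j assume "j \<in> {..n}"
    hence j: "j \<le> n" by simp
    have r: "exp (- (\<delta>\<^sup>2 / 2)) ^ j \<le> ?r ^ j" by (intro power_mono) auto
    have e3: "exp 1 \<le> (3 :: real)" using exp_le by simp
    have eL: "exp (- (\<delta>\<^sup>2 * L)) \<le> exp (- (\<delta>\<^sup>2 / 2 * L))" using L by (simp add: mult_right_mono)
    have "exp 1 * (exp (- (\<delta>\<^sup>2 * L)) * exp (- (\<delta>\<^sup>2 / 2)) ^ j) \<le> 3 * (exp (- (\<delta>\<^sup>2 / 2 * L)) * ?r ^ j)"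
      by (intro mult_mono e3 eL r) auto
    hence le: "exp (- (\<delta>\<^sup>2 / 2 * L)) * ?r ^ j + exp 1 * (exp (- (\<delta>\<^sup>2 * L)) * exp (- (\<delta>\<^sup>2 / 2)) ^ j) \<le> 4 * exp (- (\<delta>\<^sup>2 / 2 * L)) * ?r ^ j"
      by simp
    show "prob_le (\<lambda>\<omega>. \<bar>?N j \<omega> - real j\<bar> > \<delta> * (real j + L)) (4 * exp (- (\<delta>\<^sup>2 / 2 * L)) * ?r ^ j)"
    proof (rule prob_le_mono[OF prob_le_disj[OF star_upper[OF x \<delta> j, of L] star_lower[OF x \<delta> j, of L]] _ le])
      fix \<omega> assume "\<bar>?N j \<omega> - real j\<bar> > \<delta> * (real j + L)"
      thus "(1 + \<delta>) * real j + \<delta> * L < ?N j \<omega> \<or> ?N j \<omega> < (1 - \<delta>) * real j - \<delta> * L"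
        by (simp only: algebra_simps) linarith
    qed
  qed auto
  moreover have "(\<Sum>j\<in>{..n}. 4 * exp (- (\<delta>\<^sup>2 / 2 * L)) * ?r ^ j) \<le> 4 * exp (- (\<delta>\<^sup>2 / 2 * L)) / (1 - ?r)"
  proof -
    have "4 * exp (- (\<delta>\<^sup>2 / 2 * L)) * (\<Sum>j\<in>{..n}. ?r ^ j) \<le> 4 * exp (- (\<delta>\<^sup>2 / 2 * L)) * (1 / (1 - ?r))"
      using \<delta> by (intro mult_left_mono sum_geometric_le) auto
    thus ?thesis by (simp add: sum_distrib_left)
  qed
  ultimately show ?thesis by (rule prob_le_weaken)
qed

lemma window_count:
  assumes X: "X \<subseteq> E" and y: "0 \<le> y" "2 * y \<le> 1"
  shows "prob_le (\<lambda>\<omega>. real (card {e \<in> X. y \<le> W e \<omega> \<and> W e \<omega> \<le> 2 * y}) < real (card X) * y / 4) (exp (- (real (card X) * y / 4)))"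
proof -
  let ?r = "real (card X) * y / 4"
  have "prob_le (\<lambda>\<omega>. real (card {e \<in> X. y \<le> W e \<omega> \<and> W e \<omega> \<le> 2 * y}) < ?r)
    (exp ((exp (- 1) - 1) * (2 * y - y) * real (card X)) * exp (- 1) powr (- ?r))"
  proof (rule chernoff_edges[OF X])
    fix \<omega> assume "real (card {e \<in> X. y \<le> W e \<omega> \<and> W e \<omega> \<le> 2 * y}) < ?r"
    thus "exp (- 1) powr ?r \<le> exp (- 1) powr real (card {e \<in> X. y \<le> W e \<omega> \<and> W e \<omega> \<le> 2 * y})"
      by (intro powr_mono') auto
  qed (use y in auto)
  moreover have "exp ((exp (- 1) - 1) * (2 * y - y) * real (card X)) * exp (- 1) powr (- ?r) \<le> exp (- ?r)"
  proof -
    have e: "exp (- 1 :: real) - 1 \<le> - (1 / 2)" using exp_minus_le_quadratic[of 1] by simp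
    have "(exp (- 1) - 1) * (y * real (card X)) \<le> - (1 / 2) * (y * real (card X))"
      using y by (intro mult_right_mono e) auto
    hence "(exp (- 1) - 1) * (2 * y - y) * real (card X) + ?r \<le> - ?r" by (simp add: algebra_simps)
    thus ?thesis by (simp add: powr_def exp_add[symmetric])
  qed
  ultimately show ?thesis by (rule prob_le_weaken)
qed

lemma vertex_windows:
  assumes \<rho>: "0 \<le> \<rho>" "\<rho> \<le> 1"
  shows "prob_le (\<lambda>\<omega>. \<exists>u\<in>{1..n}. real (card {v \<in> {1..n} - {u}. \<rho> / 2 \<le> W {u, v} \<omega> \<and> W {u, v} \<omega> \<le> \<rho>}) < (real n - 1) * \<rho> / 8)
    (real n * exp (- ((real n - 1) * \<rho> / 8)))"
proof (rule prob_le_bex_const)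
  fix u assume u: "u \<in> {1..n}"
  have c: "real (card ((\<lambda>v. {u, v}) ` ({1..n} - {u}))) = real n - 1" using card_star[OF u] u by (auto simp: of_nat_diff)
  show "prob_le (\<lambda>\<omega>. real (card {v \<in> {1..n} - {u}. \<rho> / 2 \<le> W {u, v} \<omega> \<and> W {u, v} \<omega> \<le> \<rho>}) < (real n - 1) * \<rho> / 8)
     (exp (- ((real n - 1) * \<rho> / 8)))"
  proof (rule prob_le_mono[OF window_count[OF star_subset[OF u], of "\<rho> / 2"]])
    fix \<omega> assume A: "real (card {v \<in> {1..n} - {u}. \<rho> / 2 \<le> W {u, v} \<omega> \<and> W {u, v} \<omega> \<le> \<rho>}) < (real n - 1) * \<rho> / 8"
    have 2: "2 * (\<rho> / 2) = \<rho>" by simp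
    show "real (card {e \<in> (\<lambda>v. {u, v}) ` ({1..n} - {u}). \<rho> / 2 \<le> W e \<omega> \<and> W e \<omega> \<le> 2 * (\<rho> / 2)}) <
       real (card ((\<lambda>v. {u, v}) ` ({1..n} - {u}))) * (\<rho> / 2) / 4"
      using A unfolding c 2 star_card[of u "\<lambda>w. \<rho> / 2 \<le> w \<and> w \<le> \<rho>"] by simp
  next
    show "exp (- (real (card ((\<lambda>v. {u, v}) ` ({1..n} - {u}))) * (\<rho> / 2) / 4)) \<le> exp (- ((real n - 1) * \<rho> / 8))"
      unfolding c by simp
  qed (use \<rho> in auto)
qed auto

text \<open>\<open>B\<close> is meant to be the set of vertices that \<open>U\<close> can reach by
  usable edges; the estimate concerns edges that leave both. The union over \<open>U\<close> and
  \<open>B\<close> adds \<open>(card U + card B) * ln (n + 1)\<close> to the exponent, and the size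
  hypothesis keeps this within half of the Chernoff exponent \<open>card U * n * y / 64\<close>. The
  condition with 7/8 leaves at least n/16 vertices as other ends.\<close>

lemma set_expansion:
  assumes R: "R \<subseteq> {1..n}" "card R = 2" and y: "0 \<le> y" "2 * y \<le> 1" and n: "32 \<le> n"
  shows "prob_le (\<lambda>\<omega>. \<exists>U B. U \<subseteq> {1..n} - R \<and> B \<subseteq> {1..n} - R \<and> U \<inter> B = {} \<and> U \<noteq> {} \<and>
      real (card U + card B) * ln (real n + 1) \<le> real (card U) * real n * y / 128 \<and> 8 * (card U + card B) \<le> 7 * n \<and>
      real (card {e \<in> between U ({1..n} - R - U - B). y \<le> W e \<omega> \<and> W e \<omega> \<le> 2 * y}) < real (card U) * real n * y / 64)
    ((real n + 1)\<^sup>2 * exp (- (real n * y / 128)))"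
proof -
  let ?Bad = "\<lambda>U B \<omega>. U \<inter> B = {} \<and> real (card U + card B) * ln (real n + 1) \<le> real (card U) * real n * y / 128 \<and> 8 * (card U + card B) \<le> 7 * n \<and>
      real (card {e \<in> between U ({1..n} - R - U - B). y \<le> W e \<omega> \<and> W e \<omega> \<le> 2 * y}) < real (card U) * real n * y / 64"
  let ?S = "\<lambda>a. {U. U \<subseteq> {1..n} - R \<and> card U \<le> a}"
  have finR: "finite R" using R finite_subset by auto
  have cR: "card ({1..n} - R) = n - 2" using R finR by (subst card_Diff_subset) auto
  have S: "finite (?S a)" "real (card (?S a)) \<le> (real n + 1) ^ a" for a
    using finite_card_small_subsets[of "{1..n} - R" "real n" a] cR by auto
  have one: "prob_le (\<lambda>\<omega>. ?Bad U B \<omega>) (exp (- (real (card U) * real n * y / 64)))"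
    if UB: "U \<subseteq> {1..n} - R" "B \<subseteq> {1..n} - R" for U B
  proof (cases "U \<inter> B = {} \<and> 8 * (card U + card B) \<le> 7 * n")
    case True
    let ?Z = "{1..n} - R - U - B"
    have fin: "finite U" "finite B" by (rule finite_subset, rule UB, simp)+
    have "real (card ?Z) = real n - 2 - real (card U) - real (card B)"
    proof -
      have "?Z = ({1..n} - R) - (U \<union> B)" by auto
      hence "card ?Z = (n - 2) - card (U \<union> B)" using UB fin cR by (simp add: card_Diff_subset)
      moreover have "card (U \<union> B) = card U + card B" using True fin by (intro card_Un_disjoint) auto
      moreover have "card (U \<union> B) \<le> n - 2" using UB cR card_mono[of "{1..n} - R" "U \<union> B"] by auto
      ultimately show ?thesis using n by auto
    qed
    moreover have "real (8 * (card U + card B)) \<le> real (7 * n)" using True by (intro of_nat_mono) auto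
    moreover have "32 \<le> real n" using n by simp
    ultimately have cZ: "real n / 16 \<le> real (card ?Z)" by simp
    have cX: "real (card (between U ?Z)) = real (card U) * real (card ?Z)" by (subst card_between) auto
    have le: "real (card U) * real n * y / 64 \<le> real (card (between U ?Z)) * y / 4"
    proof -
      have "real (card U) * (real n / 16) * y \<le> real (card U) * real (card ?Z) * y"
        using cZ y by (intro mult_right_mono mult_left_mono) auto
      thus ?thesis unfolding cX by (simp add: field_simps)
    qed
    have "between U ?Z \<subseteq> E"
    proof
      fix e assume "e \<in> between U ?Z"
      then obtain u z where "e = {u, z}" "u \<in> U" "z \<in> ?Z" by (auto simp: between_def)
      moreover from this have "u \<in> {1..n}" "z \<in> {1..n}" "u \<noteq> z" using UB by auto
      ultimately show "e \<in> E" by (simp only: doubleton_complete_edges_iff) simp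
    qed
    from window_count[OF this y] show ?thesis
    proof (rule prob_le_mono)
      fix \<omega> assume "?Bad U B \<omega>"
      hence "real (card {e \<in> between U ?Z. y \<le> W e \<omega> \<and> W e \<omega> \<le> 2 * y}) < real (card U) * real n * y / 64" by blast
      thus "real (card {e \<in> between U ?Z. y \<le> W e \<omega> \<and> W e \<omega> \<le> 2 * y}) < real (card (between U ?Z)) * y / 4"
        using le by linarith
    qed (use le in simp)
  next
    case False
    thus ?thesis unfolding prob_le_def by (intro bexI[of _ "{}"]) auto
  qed
  have two: "prob_le (\<lambda>\<omega>. \<exists>U\<in>?S a. \<exists>B\<in>?S b. card U = a \<and> card B = b \<and> 1 \<le> card U \<and> ?Bad U B \<omega>) (exp (- (real n * y / 128)))" for a b
  proof (cases "1 \<le> a \<and> real (a + b) * ln (real n + 1) \<le> real a * real n * y / 128")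
    case True
    let ?p = "exp (- (real a * real n * y / 64))"
    have "prob_le (\<lambda>\<omega>. \<exists>U\<in>?S a. \<exists>B\<in>?S b. card U = a \<and> card B = b \<and> 1 \<le> card U \<and> ?Bad U B \<omega>) ((real n + 1) ^ a * ((real n + 1) ^ b * ?p))"
    proof (intro prob_le_bex_const S)
      fix U B assume UB: "U \<in> ?S a" "B \<in> ?S b"
      show "prob_le (\<lambda>\<omega>. card U = a \<and> card B = b \<and> 1 \<le> card U \<and> ?Bad U B \<omega>) ?p"
      proof (cases "card U = a")
        case True
        with one[of U B] UB show ?thesis by (auto elim: prob_le_mono)
      next
        case False
        thus ?thesis unfolding prob_le_def by (intro bexI[of _ "{}"]) auto
      qed
    qed auto
    moreover have "(real n + 1) ^ a * ((real n + 1) ^ b * ?p) \<le> exp (- (real n * y / 128))"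
    proof -
      have "(real n + 1) ^ a * ((real n + 1) ^ b * ?p) = (real n + 1) ^ (a + b) * ?p" by (simp add: power_add)
      also have "(real n + 1) ^ (a + b) = exp (real (a + b) * ln (real n + 1))" by (subst exp_of_nat_mult) simp
      also have "\<dots> * ?p = exp (real (a + b) * ln (real n + 1) - real a * real n * y / 64)" unfolding diff_conv_add_uminus exp_add ..
      also have "\<dots> \<le> exp (- (real n * y / 128))"
      proof -
        have "1 * (real n * y) \<le> real a * (real n * y)" using True y by (intro mult_right_mono) auto
        thus ?thesis using True by simp
      qed
      finally show ?thesis .
    qed
    ultimately show ?thesis by (rule prob_le_weaken)
  next
    case False
    thus ?thesis unfolding prob_le_def by (intro bexI[of _ "{}"]) auto
  qed
  have "prob_le (\<lambda>\<omega>. \<exists>ab\<in>{..n} \<times> {..n}. \<exists>U\<in>?S (fst ab). \<exists>B\<in>?S (snd ab). card U = fst ab \<and> card B = snd ab \<and> 1 \<le> card U \<and> ?Bad U B \<omega>)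
    ((real n + 1)\<^sup>2 * exp (- (real n * y / 128)))"
    using two by (intro prob_le_bex_const) (auto simp: power2_eq_square algebra_simps)
  thus ?thesis
  proof (rule prob_le_mono)
    fix \<omega> assume "\<exists>U B. U \<subseteq> {1..n} - R \<and> B \<subseteq> {1..n} - R \<and> U \<inter> B = {} \<and> U \<noteq> {} \<and>
      real (card U + card B) * ln (real n + 1) \<le> real (card U) * real n * y / 128 \<and> 8 * (card U + card B) \<le> 7 * n \<and>
      real (card {e \<in> between U ({1..n} - R - U - B). y \<le> W e \<omega> \<and> W e \<omega> \<le> 2 * y}) < real (card U) * real n * y / 64"
    then obtain U B where UB: "U \<subseteq> {1..n} - R" "B \<subseteq> {1..n} - R" "U \<noteq> {}" "?Bad U B \<omega>" by blast
    have "finite U" by (rule finite_subset[OF UB(1)]) simp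
    hence "1 \<le> card U" using UB(3) by (simp add: Suc_le_eq card_gt_0_iff)
    moreover have "card U \<le> n" "card B \<le> n" using UB card_mono[of "{1..n} - R" U] card_mono[of "{1..n} - R" B] cR by auto
    ultimately show "\<exists>ab\<in>{..n} \<times> {..n}. \<exists>U\<in>?S (fst ab). \<exists>B\<in>?S (snd ab). card U = fst ab \<and> card B = snd ab \<and> 1 \<le> card U \<and> ?Bad U B \<omega>"
      using UB by (intro bexI[of _ "(card U, card B)"] bexI[of _ U] bexI[of _ B]) auto
  qed simp
qed

text \<open>First moment with exponential tilting: a path of cost at most \<open>z\<close> has
  \<open>exp (l * (z - cost)) \<ge> 1\<close>, and the tilt contributes at most \<open>1 / l\<close>
  per edge against at most \<open>n\<close> choices per vertex, so any \<open>l > n\<close> makes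
  the sum over all lengths geometric. The two end edges enter only through being at most
  \<open>x\<close>, which gives \<open>x^2\<close>.\<close>

lemma cheap_middle:
  assumes st: "s \<in> {1..n}" "t \<in> {1..n}" "s \<noteq> t" and x: "0 \<le> x" "x \<le> 1" and l: "real n < l"
  shows "prob_le (\<lambda>\<omega>. \<exists>q. distinct q \<and> set q \<subseteq> {1..n} - {s, t} \<and> 2 \<le> length q \<and>
      0 \<le> W {s, hd q} \<omega> \<and> W {s, hd q} \<omega> \<le> x \<and> 0 \<le> W {last q, t} \<omega> \<and> W {last q, t} \<omega> \<le> x \<and>
      (\<forall>e\<in>path_edges q. 0 \<le> W e \<omega>) \<and> (\<Sum>e\<in>path_edges q. W e \<omega>) \<le> z)
    (x\<^sup>2 * exp (l * z) * (real n)\<^sup>2 / (l - real n))"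
proof -
  have l0: "l > 0" using l by linarith
  let ?Bad = "\<lambda>q \<omega>. 0 \<le> W {s, hd q} \<omega> \<and> W {s, hd q} \<omega> \<le> x \<and> 0 \<le> W {last q, t} \<omega> \<and> W {last q, t} \<omega> \<le> x \<and>
      (\<forall>e\<in>path_edges q. 0 \<le> W e \<omega>) \<and> (\<Sum>e\<in>path_edges q. W e \<omega>) \<le> z"
  let ?P = "\<lambda>i. {q. distinct q \<and> set q \<subseteq> {1..n} - {s, t} \<and> length q = Suc (Suc i)}"
  have one: "prob_le (?Bad q) (x * (x * (1 / l) ^ Suc i) * exp (l * z))" if q: "q \<in> ?P i" for q i
  proof -
    have dq: "distinct q" "set q \<subseteq> {1..n} - {s, t}" "length q = Suc (Suc i)" using q by auto
    have ne: "q \<noteq> []" using dq by auto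
    have hl: "hd q \<in> {1..n} - {s,t}" "last q \<in> {1..n} - {s,t}" using dq ne hd_in_set last_in_set by blast+
    have pe: "path_edges q \<subseteq> E" "card (path_edges q) = Suc i" using path_edges_complete[of q n] card_path_edges[of q] dq by auto
    have e1: "{s, hd q} \<in> E" "{last q, t} \<in> E" using hl st by (auto simp: doubleton_complete_edges_iff)
    have nin: "{s, hd q} \<notin> path_edges q" "{last q, t} \<notin> path_edges q"
      using path_edges_subset_set[of _ q] dq by fast+
    have ne2: "{s, hd q} \<noteq> {last q, t}" using hl st by (auto simp: doubleton_eq_iff)
    \<comment> \<open>The truncations keep \<open>f\<close> within [0,1], as \<open>depends\<close>
      demands; on the event considered the weights along \<open>q\<close> are nonnegative and the
      truncations have no effect.\<close>
    define f where "f e \<omega> = (if e \<in> path_edges q then min 1 (exp (- l * max 0 (W e \<omega>))) else of_bool (0 \<le> W e \<omega> \<and> W e \<omega> \<le> x))" for e \<omega>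
    let ?J = "insert {s, hd q} (insert {last q, t} (path_edges q))"
    have dep: "depends {e} (f e)" if "e \<in> ?J" for e
    proof -
      have [measurable]: "W e \<in> borel_measurable (edge_algebra {e})" by (rule W_measurable_edge_algebra) simp
      have "f e \<in> borel_measurable (edge_algebra {e})" unfolding f_def by (cases "e \<in> path_edges q") auto
      thus ?thesis using that pe e1 unfolding depends_def f_def by auto
    qed
    have "expectation (\<lambda>\<omega>. \<Prod>e\<in>?J. f e \<omega>) = (\<Prod>e\<in>?J. expectation (f e))"
      using dep by (intro expectation_prod[where K="\<lambda>e. {e}"]) (auto simp: disjoint_family_on_def)
    also have "\<dots> \<le> (\<Prod>e\<in>?J. if e \<in> path_edges q then 1 / l else x)"
    proof (intro prod_mono conjI)
      fix e assume e: "e \<in> ?J"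
      show "0 \<le> expectation (f e)" using dep[OF e] by (rule depends_nonneg)
      have eE: "e \<in> E" using e pe e1 by auto
      show "expectation (f e) \<le> (if e \<in> path_edges q then 1 / l else x)"
      proof (cases "e \<in> path_edges q")
        case True
        have "expectation (f e) \<le> expectation (\<lambda>\<omega>. exp (- l * W e \<omega>))"
          using depends_integrable[OF dep[OF e]] expectation_exp_W(1)[OF eE l0] l0 True
          by (intro integral_mono) (auto simp: f_def intro!: min.coboundedI2)
        also have "\<dots> \<le> 1 / l" by (rule expectation_exp_W(2)[OF eE l0])
        finally show ?thesis using True by simp
      next
        case False
        have "expectation (f e) = expectation (indicator {\<omega>\<in>space M. 0 \<le> W e \<omega> \<and> W e \<omega> \<le> x})"
          using False by (intro Bochner_Integration.integral_cong) (auto simp: f_def indicator_def)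
        also have "\<dots> = x" using prob_W_interval[OF eE, of 0 x] x eE by simp
        finally show ?thesis using False by simp
      qed
    qed
    also have "\<dots> = x * (x * (1 / l) ^ Suc i)" using nin ne2 pe(2) by simp
    finally have Ef: "expectation (\<lambda>\<omega>. \<Prod>e\<in>?J. f e \<omega>) \<le> x * (x * (1 / l) ^ Suc i)" .
    have depP: "depends (\<Union>e\<in>?J. {e}) (\<lambda>\<omega>. \<Prod>e\<in>?J. f e \<omega>)" using dep by (intro depends_prod) auto
    show ?thesis
    proof (rule prob_le_markov)
      show "integrable M (\<lambda>\<omega>. (\<Prod>e\<in>?J. f e \<omega>) * exp (l * z))" using depends_integrable[OF depP] by simp
      show "0 \<le> (\<Prod>e\<in>?J. f e \<omega>) * exp (l * z)" for \<omega> by (intro mult_nonneg_nonneg prod_nonneg) (auto simp: f_def)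
      show "expectation (\<lambda>\<omega>. (\<Prod>e\<in>?J. f e \<omega>) * exp (l * z)) \<le> x * (x * (1 / l) ^ Suc i) * exp (l * z)"
        using mult_right_mono[OF Ef, of "exp (l * z)"] by (simp del: power_Suc prod.insert)
      fix \<omega> assume bad: "?Bad q \<omega>"
      have "(\<Prod>e\<in>?J. f e \<omega>) = (\<Prod>e\<in>path_edges q. f e \<omega>)" using nin ne2 bad by (simp add: f_def)
      also have "\<dots> = (\<Prod>e\<in>path_edges q. exp (- l * W e \<omega>))"
      proof (rule prod.cong)
        fix e assume e: "e \<in> path_edges q"
        hence "0 \<le> W e \<omega>" using bad by blast
        moreover from this have "0 \<le> l * W e \<omega>" using l0 by simp
        ultimately show "f e \<omega> = exp (- l * W e \<omega>)" using e by (simp add: f_def)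
      qed simp
      also have "\<dots> = exp (- l * (\<Sum>e\<in>path_edges q. W e \<omega>))" by (simp add: exp_sum[symmetric] sum_distrib_left sum_negf)
      also have "\<dots> \<ge> exp (- l * z)" using bad l0 by simp
      finally have "exp (- l * z) * exp (l * z) \<le> (\<Prod>e\<in>?J. f e \<omega>) * exp (l * z)" by (intro mult_right_mono) auto
      thus "1 \<le> (\<Prod>e\<in>?J. f e \<omega>) * exp (l * z)" by (simp add: exp_minus)
    qed
  qed
  have count: "finite (?P i)" "real (card (?P i)) \<le> real n ^ Suc (Suc i)" for i
  proof -
    have sub: "?P i \<subseteq> {q. set q \<subseteq> {1..n} \<and> length q = Suc (Suc i)}" by auto
    have fin: "finite {q. set q \<subseteq> {1..n} \<and> length q = Suc (Suc i)}" by (rule finite_lists_length_eq) auto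
    show "finite (?P i)" by (rule finite_subset[OF sub fin])
    have "card (?P i) \<le> n ^ Suc (Suc i)" using card_mono[OF fin sub] card_lists_length_eq[of "{1..n}" "Suc (Suc i)"] by simp
    hence "real (card (?P i)) \<le> real (n ^ Suc (Suc i))" by (rule of_nat_mono)
    thus "real (card (?P i)) \<le> real n ^ Suc (Suc i)" by simp
  qed
  let ?c = "x * x * exp (l * z)"
  have "prob_le (\<lambda>\<omega>. \<exists>i\<in>{..n}. \<exists>q\<in>?P i. ?Bad q \<omega>) (\<Sum>i\<in>{..n}. real n ^ Suc (Suc i) * (x * (x * (1 / l) ^ Suc i) * exp (l * z)))"
    using one count x l0 by (intro prob_le_bex prob_le_bex_const) auto
  moreover have "(\<Sum>i\<in>{..n}. real n ^ Suc (Suc i) * (x * (x * (1 / l) ^ Suc i) * exp (l * z))) \<le> x\<^sup>2 * exp (l * z) * (real n)\<^sup>2 / (l - real n)"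
  proof -
    have "(\<Sum>i\<in>{..n}. real n ^ Suc (Suc i) * (x * (x * (1 / l) ^ Suc i) * exp (l * z))) = (\<Sum>i\<in>{..n}. ?c * (real n)\<^sup>2 / l * (real n / l) ^ i)"
      by (intro sum.cong) (auto simp: power2_eq_square power_divide)
    also have "\<dots> = ?c * (real n)\<^sup>2 / l * (\<Sum>i\<in>{..n}. (real n / l) ^ i)" by (simp add: sum_distrib_left)
    also have "\<dots> \<le> ?c * (real n)\<^sup>2 / l * (1 / (1 - real n / l))"
      using x l l0 by (intro mult_left_mono sum_geometric_le) auto
    also have "1 - real n / l = (l - real n) / l" using l0 by (simp add: field_simps)
    also have "?c * (real n)\<^sup>2 / l * (1 / ((l - real n) / l)) = x\<^sup>2 * exp (l * z) * (real n)\<^sup>2 / (l - real n)"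
      using l0 l by (simp add: power2_eq_square)
    finally show ?thesis .
  qed
  ultimately have "prob_le (\<lambda>\<omega>. \<exists>i\<in>{..n}. \<exists>q\<in>?P i. ?Bad q \<omega>) (x\<^sup>2 * exp (l * z) * (real n)\<^sup>2 / (l - real n))"
    by (rule prob_le_weaken)
  thus ?thesis
  proof (rule prob_le_mono)
    fix \<omega> assume "\<exists>q. distinct q \<and> set q \<subseteq> {1..n} - {s, t} \<and> 2 \<le> length q \<and> ?Bad q \<omega>"
    then obtain q where q: "distinct q" "set q \<subseteq> {1..n} - {s, t}" "2 \<le> length q" "?Bad q \<omega>" by blast
    have "length q \<le> n" using q(1,2) distinct_card[of q] card_mono[of "{1..n}" "set q"] by auto
    moreover obtain i where "length q = Suc (Suc i)" using q(3) by (metis One_nat_def Suc_1 Suc_le_D Suc_le_mono)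
    ultimately show "\<exists>i\<in>{..n}. \<exists>q\<in>?P i. ?Bad q \<omega>" using q by (intro bexI[of _ i] bexI[of _ q]) auto
  qed simp
qed

text \<open>Paths with a single inner vertex: their middle part has no edges and escapes
  \<open>cheap_middle\<close>.\<close>

lemma cheap_two_paths:
  assumes st: "s \<in> {1..n}" "t \<in> {1..n}" "s \<noteq> t" and x: "0 \<le> x" "x \<le> 1"
  shows "prob_le (\<lambda>\<omega>. \<exists>u\<in>{1..n} - {s, t}. 0 \<le> W {s, u} \<omega> \<and> W {s, u} \<omega> \<le> x \<and> 0 \<le> W {u, t} \<omega> \<and> W {u, t} \<omega> \<le> x) (real n * x\<^sup>2)"
proof (rule prob_le_bex_const)
  fix u assume u: "u \<in> {1..n} - {s, t}"
  have e: "{s, u} \<in> E" "{u, t} \<in> E" "{s, u} \<noteq> {u, t}" using u st by (auto simp: doubleton_complete_edges_iff doubleton_eq_iff)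
  have dep: "depends {e} (\<lambda>\<omega>. of_bool (0 \<le> W e \<omega> \<and> W e \<omega> \<le> x))" if "e \<in> E" for e
  proof (rule depends_of_bool)
    have [measurable]: "W e \<in> borel_measurable (edge_algebra {e})" by (rule W_measurable_edge_algebra) simp
    show "Measurable.pred (edge_algebra {e}) (\<lambda>\<omega>. 0 \<le> W e \<omega> \<and> W e \<omega> \<le> x)" by measurable
  qed (use that in auto)
  have E: "expectation (\<lambda>\<omega>. of_bool (0 \<le> W e \<omega> \<and> W e \<omega> \<le> x) :: real) = x" if "e \<in> E" for e
  proof -
    have "expectation (\<lambda>\<omega>. of_bool (0 \<le> W e \<omega> \<and> W e \<omega> \<le> x) :: real) = expectation (indicator {\<omega>\<in>space M. 0 \<le> W e \<omega> \<and> W e \<omega> \<le> x})"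
      by (intro Bochner_Integration.integral_cong) (auto simp: indicator_def)
    also have "\<dots> = x" using prob_W_interval[OF that, of 0 x] x that by simp
    finally show ?thesis .
  qed
  show "prob_le (\<lambda>\<omega>. 0 \<le> W {s, u} \<omega> \<and> W {s, u} \<omega> \<le> x \<and> 0 \<le> W {u, t} \<omega> \<and> W {u, t} \<omega> \<le> x) (x\<^sup>2)"
    using depends_integrable[OF depends_mult[OF dep[OF e(1)] dep[OF e(2)]]] e E
    by (intro prob_le_markov[where f="\<lambda>\<omega>. of_bool (0 \<le> W {s, u} \<omega> \<and> W {s, u} \<omega> \<le> x) * of_bool (0 \<le> W {u, t} \<omega> \<and> W {u, t} \<omega> \<le> x)"])
       (auto simp: expectation_mult[OF dep dep] power2_eq_square)
next
  show "real (card ({1..n} - {s, t})) \<le> real n" using card_mono[of "{1..n}" "{1..n} - {s, t}"] by simp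
qed (use x in auto)

lemma cheap_edge: "e \<in> E \<Longrightarrow> 0 \<le> x \<Longrightarrow> x \<le> 1 \<Longrightarrow> prob_le (\<lambda>\<omega>. 0 \<le> W e \<omega> \<and> W e \<omega> \<le> x) x"
  using prob_W_interval[of e 0 x] unfolding prob_le_def
  by (intro bexI[of _ "{\<omega>\<in>space M. 0 \<le> W e \<omega> \<and> W e \<omega> \<le> x}"]) auto

end

section \<open>Paths avoiding removed edges\<close>

lemma finite_st_paths [simp]: "finite (st_paths n s t)"
proof (rule finite_subset)
  show "st_paths n s t \<subseteq> {p. set p \<subseteq> {1..n} \<and> length p \<le> n}"
  proof
    fix p assume "p \<in> st_paths n s t"
    hence "distinct p" "set p \<subseteq> {1..n}" by (auto simp: st_paths_def)
    thus "p \<in> {p. set p \<subseteq> {1..n} \<and> length p \<le> n}"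
      using distinct_card[of p] card_mono[of "{1..n}" "set p"] by simp
  qed
qed (rule finite_lists_length_le, simp)

lemma st_path_edges_complete: "p \<in> st_paths n s t \<Longrightarrow> path_edges p \<subseteq> complete_edges n"
  unfolding st_paths_def using path_edges_complete by blast

lemma path_cost_Cons:
  "distinct (u # v # p) \<Longrightarrow> path_cost w (u # v # p) = w {u, v} + path_cost w (v # p)"
  using path_edges_subset_set[of "{u,v}" "v # p"] unfolding path_cost_def by (subst path_edges_simps, subst sum.insert) auto

lemma path_edges_snoc: "p \<noteq> [] \<Longrightarrow> path_edges (p @ [x]) = insert {last p, x} (path_edges p)"
  by (induction p rule: induct_list012) auto

lemma path_edges_append_subset: "path_edges p \<subseteq> path_edges (p @ q)"
proof (induction p rule: induct_list012)
  case (2 u) thus ?case by (cases q) auto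
qed auto

lemma path_cost_mono:
  assumes "path_edges p \<subseteq> path_edges q" "\<And>e. e \<in> path_edges q \<Longrightarrow> 0 \<le> w e"
  shows "path_cost w p \<le> path_cost w q"
  unfolding path_cost_def using assms by (intro sum_mono2) auto

lemma path_cost_nonneg: "(\<And>e. e \<in> path_edges q \<Longrightarrow> 0 \<le> w e) \<Longrightarrow> 0 \<le> path_cost w q"
  unfolding path_cost_def by (rule sum_nonneg) auto

text \<open>Distance at most \<open>c\<close> after deletion of \<open>D\<close>, phrased without a
  minimum that might not exist.\<close>

definition conn :: "(nat set \<Rightarrow> real) \<Rightarrow> nat set set \<Rightarrow> nat \<Rightarrow> real \<Rightarrow> nat \<Rightarrow> nat \<Rightarrow> bool" where
  "conn w D n c u v \<longleftrightarrow> (\<exists>p\<in>st_paths n u v. path_edges p \<inter> D = {} \<and> path_cost w p \<le> c)"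

locale nonneg_weights =
  fixes w :: "nat set \<Rightarrow> real" and n :: nat
  assumes nonneg: "\<And>e. e \<in> complete_edges n \<Longrightarrow> 0 \<le> w e"
begin

lemma conn_refl: "u \<in> {1..n} \<Longrightarrow> 0 \<le> c \<Longrightarrow> conn w D n c u u"
  unfolding conn_def by (intro bexI[of _ "[u]"]) (auto simp: st_paths_def path_cost_def)

lemma conn_mono: "conn w D n c u v \<Longrightarrow> c \<le> d \<Longrightarrow> conn w D n d u v"
  unfolding conn_def by force

text \<open>If \<open>x\<close> already lies on the path, the path is cut there instead; this keeps
  it simple and, the weights being nonnegative, does not raise its cost.\<close>

lemma conn_extend:
  assumes "conn w D n c u v" "x \<in> {1..n}" "{v, x} \<notin> D" "w {v, x} \<le> d" "v \<noteq> x"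
  shows "conn w D n (c + d) u x"
proof -
  obtain p where p: "p \<in> st_paths n u v" "path_edges p \<inter> D = {}" "path_cost w p \<le> c"
    using assms(1) unfolding conn_def by blast
  have p': "p \<noteq> []" "distinct p" "set p \<subseteq> {1..n}" "hd p = u" "last p = v" using p(1) by (auto simp: st_paths_def)
  have vn: "v \<in> {1..n}" using p' last_in_set by blast
  have d0: "0 \<le> d" using assms nonneg[of "{v, x}"] vn by (simp add: doubleton_complete_edges_iff)
  have nonp: "\<And>e. e \<in> path_edges p \<Longrightarrow> 0 \<le> w e" using st_path_edges_complete[OF p(1)] nonneg by auto
  show ?thesis
  proof (cases "x \<in> set p")
    case True
    then obtain a b where ab: "p = a @ x # b" by (meson split_list)
    have sub: "path_edges (a @ [x]) \<subseteq> path_edges p"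
      using path_edges_append_subset[of "a @ [x]" b] by (simp add: ab)
    have "a @ [x] \<in> st_paths n u x" using p' by (auto simp: st_paths_def ab hd_append split: if_splits)
    moreover have "path_cost w (a @ [x]) \<le> c + d"
    proof -
      have "path_cost w (a @ [x]) \<le> path_cost w p" by (rule path_cost_mono[OF sub]) (rule nonp)
      thus ?thesis using p(3) d0 by linarith
    qed
    ultimately show ?thesis unfolding conn_def using sub p(2) by blast
  next
    case False
    have "{v, x} \<notin> path_edges p" using path_edges_subset_set[of "{v,x}" p] False by auto
    hence "path_cost w (p @ [x]) = w {v, x} + path_cost w p"
      unfolding path_cost_def path_edges_snoc[OF p'(1)] p'(5) by simp
    moreover have "p @ [x] \<in> st_paths n u x" using p' assms(2) False by (auto simp: st_paths_def)
    moreover have "path_edges (p @ [x]) \<inter> D = {}" using p(2) assms(3) unfolding path_edges_snoc[OF p'(1)] p'(5) by auto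
    ultimately show ?thesis unfolding conn_def using p(3) assms(4) by (intro bexI[of _ "p @ [x]"]) auto
  qed
qed

lemma conn_sym:
  assumes "conn w D n c u v"
  shows "conn w D n c v u"
proof -
  obtain p where p: "p \<in> st_paths n u v" "path_edges p \<inter> D = {}" "path_cost w p \<le> c"
    using assms(1) unfolding conn_def by blast
  hence "rev p \<in> st_paths n v u" by (auto simp: st_paths_def hd_rev last_rev)
  thus ?thesis using p unfolding conn_def path_cost_def by (intro bexI[of _ "rev p"]) (auto simp: path_edges_rev)
qed

lemma conn_trans:
  assumes "conn w D n c u v" "conn w D n d v x"
  shows "conn w D n (c + d) u x"
proof -
  obtain q where q: "q \<in> st_paths n v x" "path_edges q \<inter> D = {}" "path_cost w q \<le> d"
    using assms(2) unfolding conn_def by blast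
  have "conn w D n (c + path_cost w q) u (last q)"
    if "q \<noteq> []" "distinct q" "set q \<subseteq> {1..n}" "path_edges q \<inter> D = {}" "conn w D n c u (hd q)" for q c
    using that
  proof (induction q arbitrary: c rule: induct_list012)
    case (2 a)
    thus ?case by (simp add: path_cost_def)
  next
    case (3 a b q)
    have "conn w D n (c + w {a, b}) u b" using 3 by (intro conn_extend[where v=a]) auto
    hence "conn w D n (c + w {a, b} + path_cost w (b # q)) u (last (b # q))" using 3 by (intro "3.IH"(2)) auto
    thus ?case using path_cost_Cons[of a b q w] 3 by (simp add: algebra_simps)
  qed auto
  from this[of q c] have "conn w D n (c + path_cost w q) u x" using q assms(1) by (auto simp: st_paths_def)
  thus ?thesis using q(3) by (auto elim: conn_mono)
qed

text \<open>Birth times dominate distances, since every link weighs at most the time that has passed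
  since the birth of its source. \<open>D'\<close> need only contain the removed edges of weight at
  least \<open>lo\<close>, because links are never lighter.\<close>

lemma born_conn:
  assumes "exploration lo tau" and AV: "A \<union> V \<subseteq> {1..n}"
    and D: "\<And>e. e \<notin> D' \<Longrightarrow> lo \<le> w e \<Longrightarrow> e \<notin> D"
  shows "v \<in> A \<union> V \<Longrightarrow> birth D' lo tau A w V j v \<le> j \<Longrightarrow> \<exists>u\<in>A. conn w D n (tau (birth D' lo tau A w V j v) - tau 0) u v"
proof (induction j arbitrary: v)
  case 0
  hence v: "v \<in> A" by (auto split: if_splits)
  thus ?case using AV by (intro bexI[of _ v] conn_refl) auto
next
  case (Suc j)
  show ?case
  proof (cases "birth D' lo tau A w V j v \<le> j")
    case True
    thus ?thesis using Suc by auto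
  next
    case False
    then obtain u where u: "u \<in> A \<union> V" "u \<noteq> v" "birth D' lo tau A w V j u \<le> j"
      "link w D' lo u v (tau (Suc j) - tau (birth D' lo tau A w V j u))" "birth D' lo tau A w V (Suc j) v = Suc j"
      using Suc.prems by (auto split: if_splits)
    obtain a where a: "a \<in> A" "conn w D n (tau (birth D' lo tau A w V j u) - tau 0) a u" using Suc.IH[OF u(1,3)] by blast
    have "conn w D n ((tau (birth D' lo tau A w V j u) - tau 0) + (tau (Suc j) - tau (birth D' lo tau A w V j u))) a v"
      using u AV Suc.prems(1) D by (intro conn_extend[OF a(2)]) (auto simp: link_def)
    thus ?thesis using a(1) u(5) by auto
  qed
qed

end

lemma st_paths_cases:
  assumes "p \<in> st_paths n s t" "s \<noteq> t"
  obtains "p = [s, t]" | q where "p = s # q @ [t]" "q \<noteq> []" "distinct q" "set q \<subseteq> {1..n} - {s, t}"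
proof -
  have p: "p \<noteq> []" "distinct p" "set p \<subseteq> {1..n}" "hd p = s" "last p = t" using assms by (auto simp: st_paths_def)
  obtain r where r: "p = s # r" using p by (cases p) auto
  have "r \<noteq> []" "last r = t" using p assms(2) r by (auto split: if_splits)
  then obtain q where "r = q @ [t]" by (metis append_butlast_last_id)
  thus ?thesis using that p r by (cases "q = []") auto
qed

lemma path_edges_middle:
  assumes "q \<noteq> []"
  shows "path_edges (s # q @ [t]) = insert {s, hd q} (insert {last q, t} (path_edges q))"
proof -
  have "path_edges (s # q @ [t]) = insert {s, hd q} (path_edges (q @ [t]))" using assms by (cases q) auto
  thus ?thesis using path_edges_snoc[OF assms] by simp
qed

lemma path_cost_middle:
  assumes "s \<noteq> t" "q \<noteq> []" "distinct q" "set q \<subseteq> {1..n} - {s, t}"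
  shows "path_cost w (s # q @ [t]) = w {s, hd q} + path_cost w q + w {last q, t}"
proof -
  have hl: "hd q \<in> {1..n} - {s,t}" "last q \<in> {1..n} - {s,t}" using assms hd_in_set last_in_set by blast+
  have nin: "{s, hd q} \<notin> path_edges q" "{last q, t} \<notin> path_edges q"
    using path_edges_subset_set[of _ q] assms by fast+
  have "{s, hd q} \<noteq> {last q, t}" using hl assms by (auto simp: doubleton_eq_iff)
  thus ?thesis unfolding path_cost_def path_edges_middle[OF assms(2)] using nin by simp
qed

lemma star_edge_of_path:
  assumes "p \<in> st_paths n s t" "s \<noteq> t"
  shows "\<exists>v\<in>{1..n} - {s}. {x. {s, x} \<in> path_edges p} = {v}"
  using assms
proof (cases rule: st_paths_cases)
  case 1
  have "t \<in> {1..n}" using assms(1) 1 by (auto simp: st_paths_def)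
  thus ?thesis using 1 assms(2) by (intro bexI[of _ t]) (auto simp: doubleton_eq_iff)
next
  case (2 q)
  have hl: "hd q \<in> {1..n} - {s,t}" "last q \<in> {1..n} - {s,t}" using 2 hd_in_set last_in_set by blast+
  have "{s, x} \<notin> path_edges q" for x using path_edges_subset_set[of "{s, x}" q] 2(4) by auto
  hence "{x. {s, x} \<in> path_edges p} = {hd q}"
    unfolding 2(1) path_edges_middle[OF 2(2)] using hl assms(2) by (auto simp: doubleton_eq_iff)
  thus ?thesis using hl by auto
qed

lemma st_paths_rev: "p \<in> st_paths n s t \<Longrightarrow> rev p \<in> st_paths n t s"
  by (auto simp: st_paths_def hd_rev last_rev)

section \<open>The paths before the k-th one and their edges at the terminals\<close>

definition removed :: "(nat \<Rightarrow> nat list) \<Rightarrow> nat \<Rightarrow> nat set set" where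
  "removed P k = (\<Union>i\<in>{1..<k}. path_edges (P i))"

definition disjoint_paths :: "nat \<Rightarrow> nat \<Rightarrow> nat \<Rightarrow> (nat \<Rightarrow> nat list) \<Rightarrow> nat \<Rightarrow> bool" where
  "disjoint_paths n s t P k \<longleftrightarrow> (\<forall>i\<in>{1..<k}. P i \<in> st_paths n s t) \<and> disjoint_family_on (\<lambda>i. path_edges (P i)) {1..<k}"

lemma finite_removed [simp]: "finite (removed P k)"
  by (simp add: removed_def)

lemma sum_removed:
  assumes "disjoint_paths n s t P k"
  shows "(\<Sum>e\<in>removed P k. w e) = (\<Sum>i\<in>{1..<k}. path_cost w (P i))"
  unfolding removed_def path_cost_def using assms
  by (subst sum.UNION_disjoint) (auto simp: disjoint_paths_def disjoint_family_on_def)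

lemma removed_complete: "disjoint_paths n s t P k \<Longrightarrow> removed P k \<subseteq> complete_edges n"
  unfolding removed_def disjoint_paths_def using st_path_edges_complete by blast

text \<open>A path leaves \<open>s\<close> by exactly one edge, and disjoint paths leave by
  different ones.\<close>

lemma star_removed:
  assumes P: "disjoint_paths n s t P k" and "s \<noteq> t"
  shows "\<exists>f. (\<forall>i\<in>{1..<k}. {x. {s, x} \<in> path_edges (P i)} = {f i}) \<and> inj_on f {1..<k} \<and>
    f ` {1..<k} \<subseteq> {1..n} - {s} \<and> {x. {s, x} \<in> removed P k} = f ` {1..<k}"
proof -
  have "\<forall>i\<in>{1..<k}. \<exists>v. v \<in> {1..n} - {s} \<and> {x. {s, x} \<in> path_edges (P i)} = {v}"
    using star_edge_of_path[of _ n s t] assms unfolding disjoint_paths_def by blast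
  then obtain f where f: "\<forall>i\<in>{1..<k}. f i \<in> {1..n} - {s} \<and> {x. {s, x} \<in> path_edges (P i)} = {f i}" by (rule bchoice[THEN exE])
  have "inj_on f {1..<k}"
  proof (rule inj_onI)
    fix i j assume ij: "i \<in> {1..<k}" "j \<in> {1..<k}" "f i = f j"
    have "{s, f i} \<in> path_edges (P i)" "{s, f j} \<in> path_edges (P j)" using f ij(1,2) by blast+
    hence "path_edges (P i) \<inter> path_edges (P j) \<noteq> {}" using ij(3) by auto
    thus "i = j" using P ij unfolding disjoint_paths_def disjoint_family_on_def by blast
  qed
  moreover have "{x. {s, x} \<in> removed P k} = f ` {1..<k}"
  proof -
    have "{x. {s, x} \<in> removed P k} = (\<Union>i\<in>{1..<k}. {x. {s, x} \<in> path_edges (P i)})" unfolding removed_def by blast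
    also have "\<dots> = (\<Union>i\<in>{1..<k}. {f i})" using f by (intro SUP_cong) auto
    finally show ?thesis by auto
  qed
  ultimately show ?thesis using f by (intro exI[of _ f]) blast
qed

lemma disjoint_paths_rev:
  "disjoint_paths n s t P k \<Longrightarrow> disjoint_paths n t s (\<lambda>i. rev (P i)) k"
  unfolding disjoint_paths_def by (auto simp: path_edges_rev st_paths_rev)

lemma removed_rev: "removed (\<lambda>i. rev (P i)) k = removed P k"
  unfolding removed_def by (simp add: path_edges_rev)

lemma card_star_removed:
  assumes "disjoint_paths n s t P k" "s \<noteq> t" "1 \<le> k" "x \<in> {s, t}"
  shows "finite {v. {x, v} \<in> removed P k} \<and> card {v. {x, v} \<in> removed P k} = k - 1"
proof -
  have *: "finite {v. {s, v} \<in> removed P k} \<and> card {v. {s, v} \<in> removed P k} = k - 1"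
    if d: "disjoint_paths n s t P k" and st: "s \<noteq> t" for s t P
  proof -
    obtain f where "inj_on f {1..<k}" "{x. {s, x} \<in> removed P k} = f ` {1..<k}"
      using star_removed[OF d st] by blast
    thus ?thesis by (simp add: card_image)
  qed
  show ?thesis
    using *[OF assms(1,2)] *[OF disjoint_paths_rev[OF assms(1)]] assms(2,4) removed_rev by auto
qed

lemma card_heavy_le:
  fixes w :: "'e \<Rightarrow> real"
  assumes "finite D" "\<And>e. e \<in> D \<Longrightarrow> 0 \<le> w e" "(\<Sum>e\<in>D. w e) \<le> B" "0 < y"
  shows "real (card {e \<in> D. y \<le> w e}) \<le> B / y"
proof -
  have "real (card {e \<in> D. y \<le> w e}) * y = (\<Sum>e\<in>{e \<in> D. y \<le> w e}. y)" by simp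
  also have "\<dots> \<le> (\<Sum>e\<in>{e \<in> D. y \<le> w e}. w e)" by (rule sum_mono) auto
  also have "\<dots> \<le> (\<Sum>e\<in>D. w e)" using assms by (intro sum_mono2) auto
  finally show ?thesis using assms by (simp add: field_simps)
qed

lemma successive_cheapest_paths_disjoint:
  assumes "successive_cheapest_paths n s t w P k"
  shows "disjoint_paths n s t P (Suc k)"
  unfolding disjoint_paths_def disjoint_family_on_def
proof (intro conjI ballI impI)
  have *: "P j \<in> st_paths n s t" "\<And>i. i \<in> {1..<j} \<Longrightarrow> path_edges (P j) \<inter> path_edges (P i) = {}" if "j \<in> {1..k}" for j
    using assms that unfolding successive_cheapest_paths_def is_arg_min_def by blast+
  show "P i \<in> st_paths n s t" if "i \<in> {1..<Suc k}" for i using *(1)[of i] that by auto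
  fix i j assume ij: "i \<in> {1..<Suc k}" "j \<in> {1..<Suc k}" "i \<noteq> j"
  show "path_edges (P i) \<inter> path_edges (P j) = {}"
  proof (cases "i < j")
    case True
    have "path_edges (P j) \<inter> path_edges (P i) = {}" by (rule *(2)) (use ij True in auto)
    thus ?thesis by blast
  next
    case False
    show ?thesis by (rule *(2)) (use ij False in auto)
  qed
qed

lemma successive_cheapest_paths_mono:
  "successive_cheapest_paths n s t w P k \<Longrightarrow> j \<le> k \<Longrightarrow> successive_cheapest_paths n s t w P j"
  unfolding successive_cheapest_paths_def by auto

lemma successive_cheapest_paths_extend:
  assumes P: "successive_cheapest_paths n s t w P k" and c: "conn w (removed P (Suc k)) n c s t"
  shows "\<exists>Q. successive_cheapest_paths n s t w (P(Suc k := Q)) (Suc k)"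
proof -
  let ?A = "{p \<in> st_paths n s t. \<forall>i\<in>{1..<Suc k}. path_edges p \<inter> path_edges (P i) = {}}"
  have "finite ?A" by simp
  moreover have "?A \<noteq> {}" using c unfolding conn_def removed_def by blast
  ultimately have "\<exists>Q. is_arg_min (path_cost w) (\<lambda>x. x \<in> ?A) Q" by (rule ex_is_arg_min_if_finite)
  then obtain Q where Q: "is_arg_min (path_cost w) (\<lambda>x. x \<in> ?A) Q" ..
  have "successive_cheapest_paths n s t w (P(Suc k := Q)) (Suc k)"
    unfolding successive_cheapest_paths_def
  proof
    fix j assume j: "j \<in> {1..Suc k}"
    have upd: "\<And>i. i \<in> {1..<j} \<Longrightarrow> (P(Suc k := Q)) i = P i" using j by auto
    show "is_arg_min (path_cost w) (\<lambda>p. p \<in> st_paths n s t \<and> (\<forall>i\<in>{1..<j}. path_edges p \<inter> path_edges ((P(Suc k := Q)) i) = {})) ((P(Suc k := Q)) j)"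
    proof (cases "j = Suc k")
      case True
      thus ?thesis using Q upd by simp
    next
      case False
      hence "j \<in> {1..k}" using j by auto
      thus ?thesis using P False upd unfolding successive_cheapest_paths_def by simp
    qed
  qed
  thus ?thesis ..
qed

lemma successive_cheapest_paths_cost_le:
  assumes P: "successive_cheapest_paths n s t w P k" and k: "1 \<le> k" and c: "conn w (removed P k) n c s t"
  shows "path_cost w (P k) \<le> c"
proof -
  obtain p where p: "p \<in> st_paths n s t" "path_edges p \<inter> removed P k = {}" "path_cost w p \<le> c"
    using c unfolding conn_def by blast
  have "is_arg_min (path_cost w) (\<lambda>p. p \<in> st_paths n s t \<and> (\<forall>i\<in>{1..<k}. path_edges p \<inter> path_edges (P i) = {})) (P k)"
    using P k unfolding successive_cheapest_paths_def by auto
  moreover have "p \<in> st_paths n s t \<and> (\<forall>i\<in>{1..<k}. path_edges p \<inter> path_edges (P i) = {})"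
    using p(1,2) unfolding removed_def by blast
  ultimately show ?thesis using p(3) unfolding is_arg_min_linorder by fastforce
qed

text \<open>\<open>P j\<close> was already admissible when \<open>P i\<close> was chosen.\<close>

lemma successive_cheapest_paths_cost_mono:
  assumes P: "successive_cheapest_paths n s t w P k" and ij: "1 \<le> i" "i \<le> j" "j \<le> k"
  shows "path_cost w (P i) \<le> path_cost w (P j)"
proof (rule successive_cheapest_paths_cost_le[OF successive_cheapest_paths_mono[OF P] ij(1)])
  have "is_arg_min (path_cost w) (\<lambda>p. p \<in> st_paths n s t \<and> (\<forall>i\<in>{1..<j}. path_edges p \<inter> path_edges (P i) = {})) (P j)"
    using P ij unfolding successive_cheapest_paths_def by auto
  hence "P j \<in> st_paths n s t" "path_edges (P j) \<inter> removed P i = {}"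
    using ij unfolding is_arg_min_def removed_def by auto
  thus "conn w (removed P i) n (path_cost w (P j)) s t" unfolding conn_def by blast
qed (use ij in simp)

section \<open>Growing neighbourhoods of the terminals\<close>

lemma forest_add:
  assumes "finite C" "forest n R fs" "C \<subseteq> {1..n}" "C \<inter> (R \<union> fst ` set fs) = {}" "\<forall>x\<in>C. f x \<in> R \<union> fst ` set fs"
  shows "\<exists>fs'. forest n R fs' \<and> fst ` set fs' = fst ` set fs \<union> C \<and> length fs' = length fs + card C \<and>
    forest_edges fs' = forest_edges fs \<union> (\<lambda>x. {x, f x}) ` C"
  using assms
proof (induction C)
  case empty
  thus ?case by (intro exI[of _ fs]) auto
next
  case (insert x C)
  then obtain fs' where fs': "forest n R fs'" "fst ` set fs' = fst ` set fs \<union> C" "length fs' = length fs + card C"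
    "forest_edges fs' = forest_edges fs \<union> (\<lambda>x. {x, f x}) ` C" by auto
  have "f x \<in> R \<union> fst ` set fs'" using insert.prems(4) fs'(2) by auto
  hence "forest n R ((x, f x) # fs')" using fs' insert by auto
  moreover have "forest_edges ((x, f x) # fs') = insert {x, f x} (forest_edges fs')" by (simp add: forest_edges_def)
  ultimately show ?case using fs' insert.hyps by (intro exI[of _ "(x, f x) # fs'"]) auto
qed

text \<open>A vertex whose window edges to \<open>U\<close> are all removed is charged to one of
  them, a removed edge of weight at least \<open>lo\<close>. Since \<open>X\<close> avoids
  \<open>U\<close>, different vertices are charged to different edges.\<close>

lemma card_clean_neighbours:
  assumes fin: "finite X" "finite D" and UX: "U \<inter> X = {}"
  shows "card {v \<in> X. \<exists>u\<in>U. lo \<le> w {u, v} \<and> w {u, v} \<le> hi} \<le>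
    card {v \<in> X. \<exists>u\<in>U. lo \<le> w {u, v} \<and> w {u, v} \<le> hi \<and> {u, v} \<notin> D} + card {e \<in> D. lo \<le> (w e :: real)}" (is "card ?N \<le> card ?N' + card ?H")
proof -
  have "\<forall>v\<in>?N - ?N'. \<exists>u. u \<in> U \<and> {u, v} \<in> ?H" by blast
  from bchoice[OF this] obtain f where f: "\<And>v. v \<in> ?N - ?N' \<Longrightarrow> f v \<in> U \<and> {f v, v} \<in> ?H" by blast
  have "card (?N - ?N') \<le> card ?H"
  proof (rule card_inj_on_le[where f="\<lambda>v. {f v, v}"])
    show "inj_on (\<lambda>v. {f v, v}) (?N - ?N')"
    proof (rule inj_onI)
      fix v v' assume v: "v \<in> ?N - ?N'" "v' \<in> ?N - ?N'" "{f v, v} = {f v', v'}"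
      have "f v' \<in> U" using f[OF v(2)] by blast
      moreover have "v \<in> X" using v(1) by blast
      ultimately have "v \<noteq> f v'" using UX by blast
      thus "v = v'" using v(3) by (auto simp: doubleton_eq_iff)
    qed
    show "(\<lambda>v. {f v, v}) ` (?N - ?N') \<subseteq> ?H" using f by blast
    show "finite ?H" using fin by simp
  qed
  moreover have "card ?N \<le> card (?N - ?N') + card ?N'"
  proof -
    have "?N \<subseteq> (?N - ?N') \<union> ?N'" by blast
    hence "card ?N \<le> card ((?N - ?N') \<union> ?N')" using fin by (intro card_mono) auto
    thus ?thesis using card_Un_le order.trans by blast
  qed
  ultimately show ?thesis by linarith
qed

context nonneg_weights
begin

text \<open>The forest certifies that \<open>U\<close> and \<open>T\<close> are among the sets
  covered by the union bounds; being close to the terminals would not by itself limit their number.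
  By cardinality the two sets exhaust the vertices of the forest.\<close>

definition grown :: "nat set set \<Rightarrow> nat \<Rightarrow> nat \<Rightarrow> real \<Rightarrow> nat \<Rightarrow> real \<Rightarrow> bool" where
  "grown D s t Y a c \<longleftrightarrow> (\<exists>fs U T. forest n {s, t} fs \<and> length fs = 2 * a \<and> (\<forall>e\<in>forest_edges fs. 0 \<le> w e \<and> w e \<le> Y) \<and>
     U \<subseteq> fst ` set fs \<and> T \<subseteq> fst ` set fs \<and> U \<inter> T = {} \<and> card U = a \<and> card T = a \<and>
     (\<forall>u\<in>U. conn w D n c s u) \<and> (\<forall>v\<in>T. conn w D n c t v))"

text \<open>The demand on \<open>q\<close> accounts for \<open>r\<close> removed edges, for the
  opposite terminal, and for \<open>2 * a\<close> further neighbours, so that the set at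
  \<open>t\<close> can still be chosen disjoint from the one chosen at \<open>s\<close>.\<close>

lemma grown_init:
  assumes st: "s \<in> {1..n}" "t \<in> {1..n}" "s \<noteq> t" and Y: "0 \<le> Y"
    and many: "\<And>x. x \<in> {s, t} \<Longrightarrow> q \<le> card {v \<in> {1..n} - {x}. w {x, v} \<le> Y}"
    and D: "\<And>x. x \<in> {s, t} \<Longrightarrow> finite {v. {x, v} \<in> D} \<and> card {v. {x, v} \<in> D} \<le> r"
    and q: "r + 1 + 2 * a \<le> q"
  shows "grown D s t Y a Y"
proof -
  define C where "C x y = {v \<in> {1..n} - {x}. w {x, v} \<le> Y} - {v. {x, v} \<in> D} - {y}" for x y
  have C: "2 * a \<le> card (C x y)" "finite (C x y)" if "x \<in> {s, t}" for x y
  proof -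
    let ?A = "{v \<in> {1..n} - {x}. w {x, v} \<le> Y}" and ?B = "{v. {x, v} \<in> D}"
    have 1: "card ?A - card ?B \<le> card (?A - ?B)" using D[OF that] by (intro diff_card_le_card_Diff) auto
    have "card (?A - ?B) - card {y} \<le> card (?A - ?B - {y})" by (intro diff_card_le_card_Diff) auto
    hence 2: "card (?A - ?B) - 1 \<le> card (?A - ?B - {y})" by (simp only: card_1_singleton_iff card.insert card.empty finite.emptyI empty_iff simp_thms if_False One_nat_def)
    have "2 * a \<le> z" if "A - B \<le> m" "m - 1 \<le> z" "q \<le> A" "B \<le> r" for A B m z :: nat
      using that q by arith
    from this[OF 1 2 many[OF that] conjunct2[OF D[OF that]]] show "2 * a \<le> card (C x y)" unfolding C_def .
    show "finite (C x y)" unfolding C_def by simp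
  qed
  obtain S where S: "S \<subseteq> C s t" "card S = a" "finite S"
    using obtain_subset_with_card_n[of a "C s t"] C[of s t] by auto
  have "a \<le> card (C t s - S)" using diff_card_le_card_Diff[OF S(3), of "C t s"] C[of t s] S by auto
  then obtain T where T: "T \<subseteq> C t s - S" "card T = a" "finite T" using obtain_subset_with_card_n by metis
  have Ss: "S \<subseteq> {1..n}" "S \<inter> {s, t} = {}" "\<And>v. v \<in> S \<Longrightarrow> w {s, v} \<le> Y \<and> {s, v} \<notin> D" using S unfolding C_def by auto
  have Ts: "T \<subseteq> {1..n}" "T \<inter> {s, t} = {}" "\<And>v. v \<in> T \<Longrightarrow> w {t, v} \<le> Y \<and> {t, v} \<notin> D" "T \<inter> S = {}" using T unfolding C_def by auto
  obtain fs1 where fs1: "forest n {s, t} fs1" "fst ` set fs1 = S" "length fs1 = a" "forest_edges fs1 = (\<lambda>x. {x, s}) ` S"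
  proof -
    have "S \<inter> ({s, t} \<union> fst ` set []) = {}" "\<forall>x\<in>S. s \<in> {s, t} \<union> fst ` set []" using Ss by auto
    from forest_add[where f="\<lambda>_. s" and fs="[]", OF S(3) _ Ss(1) this] show ?thesis using that S(2) by (auto simp: forest_edges_def)
  qed
  obtain fs2 where fs2: "forest n {s, t} fs2" "fst ` set fs2 = S \<union> T" "length fs2 = a + a"
    "forest_edges fs2 = (\<lambda>x. {x, s}) ` S \<union> (\<lambda>x. {x, t}) ` T"
  proof -
    have "T \<inter> ({s, t} \<union> fst ` set fs1) = {}" "\<forall>x\<in>T. t \<in> {s, t} \<union> fst ` set fs1" using Ts fs1(2) by auto
    from forest_add[where f="\<lambda>_. t", OF T(3) fs1(1) Ts(1) this] show ?thesis using that fs1(2-4) T(2) by auto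
  qed
  have light: "0 \<le> w e \<and> w e \<le> Y" if e: "e \<in> forest_edges fs2" for e
  proof
    show "0 \<le> w e" using forest_edges_complete[OF fs2(1)] st e by (intro nonneg) auto
    show "w e \<le> Y" using e Ss(3) Ts(3) unfolding fs2(4) by (auto simp: insert_commute)
  qed
  have "conn w D n (0 + Y) s u" if "u \<in> S" for u
    using Ss that st by (intro conn_extend[where v=s] conn_refl) auto
  moreover have "conn w D n (0 + Y) t u" if "u \<in> T" for u
    using Ts that st by (intro conn_extend[where v=t] conn_refl) auto
  ultimately show ?thesis unfolding grown_def using fs2 light S T Ts(4)
    by (intro exI[of _ fs2] exI[of _ S] exI[of _ T]) auto
qed

text \<open>Both sides expand away from the old forest. At most \<open>m\<close> new neighbours are
  lost to removed edges, and \<open>2 * b\<close> clean ones allow the two additions to be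
  disjoint.\<close>

lemma grown_step:
  assumes g: "grown D s t Y a c" and st: "s \<in> {1..n}" "t \<in> {1..n}" and lo: "0 < lo" "2 * lo \<le> Y"
    and D: "finite D" "card {e \<in> D. lo \<le> w e} \<le> m" and q: "m + 2 * b \<le> q"
    and expand: "\<And>fs U. forest n {s, t} fs \<Longrightarrow> length fs = 2 * a \<Longrightarrow> \<forall>e\<in>forest_edges fs. 0 \<le> w e \<and> w e \<le> Y \<Longrightarrow>
       U \<subseteq> fst ` set fs \<Longrightarrow> card U = a \<Longrightarrow>
       q \<le> card {v \<in> {1..n} - {s, t} - fst ` set fs. \<exists>u\<in>U. lo \<le> w {u, v} \<and> w {u, v} \<le> 2 * lo}"
  shows "grown D s t Y (a + b) (c + 2 * lo)"
proof -
  obtain fs U T where fs: "forest n {s, t} fs" "length fs = 2 * a" "\<forall>e\<in>forest_edges fs. 0 \<le> w e \<and> w e \<le> Y"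
    and UT: "U \<subseteq> fst ` set fs" "T \<subseteq> fst ` set fs" "U \<inter> T = {}" "card U = a" "card T = a"
    and c': "\<forall>u\<in>U. conn w D n c s u" "\<forall>v\<in>T. conn w D n c t v"
    using g unfolding grown_def by (elim exE conjE) (rule that; assumption)
  have c: "\<And>u. u \<in> U \<Longrightarrow> conn w D n c s u" "\<And>v. v \<in> T \<Longrightarrow> conn w D n c t v" using c' by blast+
  let ?X = "{1..n} - {s, t} - fst ` set fs"
  define N where "N U = {v \<in> ?X. \<exists>u\<in>U. lo \<le> w {u, v} \<and> w {u, v} \<le> 2 * lo \<and> {u, v} \<notin> D}" for U
  have N: "2 * b \<le> card (N A)" if "A \<subseteq> fst ` set fs" "card A = a" for A
  proof -
    have "q \<le> card (N A) + card {e \<in> D. lo \<le> w e}"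
      using expand[OF fs that] card_clean_neighbours[of ?X D A lo w "2 * lo"] D that unfolding N_def by fastforce
    thus ?thesis using D q by linarith
  qed
  have finN: "finite (N A)" for A unfolding N_def by simp
  obtain S1 where S1: "S1 \<subseteq> N U" "card S1 = b" "finite S1"
    using obtain_subset_with_card_n[of b "N U"] N[OF UT(1,4)] finN by auto
  have "b \<le> card (N T - S1)" using diff_card_le_card_Diff[OF S1(3), of "N T"] N[OF UT(2,5)] S1 by auto
  then obtain T1 where T1: "T1 \<subseteq> N T - S1" "card T1 = b" "finite T1" using obtain_subset_with_card_n by metis
  define f where "f A v = (SOME u. u \<in> A \<and> lo \<le> w {u, v} \<and> w {u, v} \<le> 2 * lo \<and> {u, v} \<notin> D)" for A v
  have f: "f A v \<in> A \<and> lo \<le> w {f A v, v} \<and> w {f A v, v} \<le> 2 * lo \<and> {f A v, v} \<notin> D" if "v \<in> N A" for A v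
    unfolding f_def by (rule someI_ex) (use that in \<open>auto simp: N_def\<close>)
  have NX: "N A \<subseteq> {1..n}" "N A \<inter> ({s, t} \<union> fst ` set fs) = {}" for A unfolding N_def by auto
  have S1X: "S1 \<subseteq> {1..n}" "S1 \<inter> ({s, t} \<union> fst ` set fs) = {}" using S1 NX by blast+
  have T1X: "T1 \<subseteq> {1..n}" "T1 \<inter> ({s, t} \<union> fst ` set fs) = {}" "T1 \<inter> S1 = {}" using T1 NX by blast+
  have "\<forall>x\<in>S1. f U x \<in> {s, t} \<union> fst ` set fs" using f[of _ U] S1(1) UT(1) by blast
  from forest_add[OF S1(3) fs(1) S1X this]
  obtain fs1 where fs1: "forest n {s, t} fs1" "fst ` set fs1 = fst ` set fs \<union> S1" "length fs1 = 2 * a + b"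
    "forest_edges fs1 = forest_edges fs \<union> (\<lambda>x. {x, f U x}) ` S1" using fs(2) S1(2) by auto
  have "\<forall>x\<in>T1. f T x \<in> {s, t} \<union> fst ` set fs1" using f[of _ T] T1(1) UT(2) fs1(2) by blast
  moreover have "T1 \<inter> ({s, t} \<union> fst ` set fs1) = {}" using T1X fs1(2) by blast
  ultimately obtain fs2 where fs2: "forest n {s, t} fs2" "fst ` set fs2 = fst ` set fs \<union> S1 \<union> T1" "length fs2 = 2 * a + b + b"
    "forest_edges fs2 = forest_edges fs \<union> (\<lambda>x. {x, f U x}) ` S1 \<union> (\<lambda>x. {x, f T x}) ` T1"
    using forest_add[OF T1(3) fs1(1) T1X(1), of "f T"] fs1 T1(2) by auto
  have light: "0 \<le> w e \<and> w e \<le> Y" if e: "e \<in> forest_edges fs2" for e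
  proof
    show "0 \<le> w e" using forest_edges_complete[OF fs2(1)] st e by (intro nonneg) auto
    consider "e \<in> forest_edges fs" | x where "x \<in> S1" "e = {x, f U x}" | x where "x \<in> T1" "e = {x, f T x}"
      using e unfolding fs2(4) by blast
    thus "w e \<le> Y"
    proof cases
      case 1 thus ?thesis using fs(3) by blast
    next
      case (2 x)
      hence "x \<in> N U" using S1(1) by blast
      hence "w {f U x, x} \<le> 2 * lo" using f by blast
      thus ?thesis using lo 2(2) by (simp add: insert_commute)
    next
      case (3 x)
      hence "x \<in> N T" using T1(1) by blast
      hence "w {f T x, x} \<le> 2 * lo" using f by blast
      thus ?thesis using lo 3(2) by (simp add: insert_commute)
    qed
  qed
  have cS: "conn w D n (c + 2 * lo) s u" if "u \<in> U \<union> S1" for u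
  proof (cases "u \<in> U")
    case True
    thus ?thesis using c(1)[OF True] lo by (intro conn_mono[OF c(1)]) auto
  next
    case False
    hence u: "u \<in> N U" "u \<in> S1" using that S1(1) by auto
    have fu: "f U u \<in> U" "w {f U u, u} \<le> 2 * lo" "{f U u, u} \<notin> D" using f[OF u(1)] by auto
    have "u \<in> {1..n}" using u(2) S1X(1) by blast
    moreover have "f U u \<noteq> u"
    proof -
      have "f U u \<in> fst ` set fs" by (rule subsetD[OF UT(1) fu(1)])
      moreover have "u \<notin> fst ` set fs" using u(2) S1X(2) by (auto dest: IntI)
      ultimately show ?thesis by metis
    qed
    ultimately show ?thesis by (rule conn_extend[OF c(1)[OF fu(1)] _ fu(3,2)])
  qed
  have cT: "conn w D n (c + 2 * lo) t u" if "u \<in> T \<union> T1" for u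
  proof (cases "u \<in> T")
    case True
    thus ?thesis using lo by (intro conn_mono[OF c(2)]) auto
  next
    case False
    hence u: "u \<in> N T" "u \<in> T1" using that T1(1) by auto
    have fu: "f T u \<in> T" "w {f T u, u} \<le> 2 * lo" "{f T u, u} \<notin> D" using f[OF u(1)] by auto
    have "u \<in> {1..n}" using u(2) T1X(1) by blast
    moreover have "f T u \<noteq> u"
    proof -
      have "f T u \<in> fst ` set fs" by (rule subsetD[OF UT(2) fu(1)])
      moreover have "u \<notin> fst ` set fs" using u(2) T1X(2) by (auto dest: IntI)
      ultimately show ?thesis by metis
    qed
    ultimately show ?thesis by (rule conn_extend[OF c(2)[OF fu(1)] _ fu(3,2)])
  qed
  have finUT: "finite U" "finite T" using UT finite_subset[of _ "fst ` set fs"] by auto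
  have d: "U \<inter> S1 = {}" "T \<inter> T1 = {}" "U \<inter> T1 = {}" "S1 \<inter> T = {}" using UT(1,2) S1X(2) T1X(2) by blast+
  have "card (U \<union> S1) = a + b" using card_Un_disjoint[OF finUT(1) S1(3) d(1)] UT(4) S1(2) by simp
  moreover have "card (T \<union> T1) = a + b" using card_Un_disjoint[OF finUT(2) T1(3) d(2)] UT(5) T1(2) by simp
  moreover have "(U \<union> S1) \<inter> (T \<union> T1) = {}" using d UT(3) T1X(3) by blast
  moreover have "U \<union> S1 \<subseteq> fst ` set fs2" "T \<union> T1 \<subseteq> fst ` set fs2" using UT fs2(2) by blast+
  moreover have "length fs2 = 2 * (a + b)" using fs2(3) by simp
  moreover have "\<forall>e\<in>forest_edges fs2. 0 \<le> w e \<and> w e \<le> Y" by (rule ballI) (rule light)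
  moreover have "\<forall>u\<in>U \<union> S1. conn w D n (c + 2 * lo) s u" by (rule ballI) (rule cS)
  moreover have "\<forall>v\<in>T \<union> T1. conn w D n (c + 2 * lo) t v" by (rule ballI) (rule cT)
  ultimately show ?thesis unfolding grown_def using fs2(1)
    by - (rule exI[of _ fs2], rule exI[of _ "U \<union> S1"], rule exI[of _ "T \<union> T1"], intro conjI; assumption)
qed

lemma grown_connect:
  assumes g: "grown D s t Y a c"
    and x: "\<And>fs U T. forest n {s, t} fs \<Longrightarrow> length fs = 2 * a \<Longrightarrow> \<forall>e\<in>forest_edges fs. 0 \<le> w e \<and> w e \<le> Y \<Longrightarrow>
       U \<subseteq> fst ` set fs \<Longrightarrow> T \<subseteq> fst ` set fs \<Longrightarrow> U \<inter> T = {} \<Longrightarrow> card U = a \<Longrightarrow> card T = a \<Longrightarrow> \<exists>u\<in>U. \<exists>v\<in>T. conn w D n x u v"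
  shows "conn w D n (2 * c + x) s t"
proof -
  obtain fs U T where fs: "forest n {s, t} fs" "length fs = 2 * a" "\<forall>e\<in>forest_edges fs. 0 \<le> w e \<and> w e \<le> Y"
    and UT: "U \<subseteq> fst ` set fs" "T \<subseteq> fst ` set fs" "U \<inter> T = {}" "card U = a" "card T = a"
    and c': "\<forall>u\<in>U. conn w D n c s u" "\<forall>v\<in>T. conn w D n c t v"
    using g unfolding grown_def by (elim exE conjE) (rule that; assumption)
  have c: "\<And>u. u \<in> U \<Longrightarrow> conn w D n c s u" "\<And>v. v \<in> T \<Longrightarrow> conn w D n c t v" using c' by blast+
  obtain u v where uv: "u \<in> U" "v \<in> T" "conn w D n x u v" using x[OF fs UT] by blast
  have "conn w D n (c + x + c) s t" 
    by (rule conn_trans[OF conn_trans[OF c(1)[OF uv(1)] uv(3)] conn_sym[OF c(2)[OF uv(2)]]])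
  thus ?thesis by (simp add: algebra_simps)
qed

text \<open>Let \<open>B\<close> consist of the vertices outside \<open>A\<close> joined to
  \<open>A\<close> by a usable edge of weight between \<open>y\<close> and \<open>2 * y\<close> or
  lighter vertices of that window do not occur. Every window edge from \<open>A\<close> that leaves
  \<open>A \<union> B\<close> and avoids the terminals is removed, and there are too few removed
  edges for the conclusion of \<open>F\<close>. So one of its two size conditions fails, and either
  failure means that \<open>A \<union> B\<close> is large.\<close>

lemma window_growth:
  assumes F: "\<And>U B. U \<subseteq> {1..n} - {s, t} \<Longrightarrow> B \<subseteq> {1..n} - {s, t} \<Longrightarrow> U \<inter> B = {} \<Longrightarrow> U \<noteq> {} \<Longrightarrow>
      real (card U + card B) * ln (real n + 1) \<le> real (card U) * real n * y / 128 \<Longrightarrow> 8 * (card U + card B) \<le> 7 * n \<Longrightarrow>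
      real (card U) * real n * y / 64 \<le> real (card {e \<in> between U ({1..n} - {s, t} - U - B). y \<le> w e \<and> w e \<le> 2 * y})"
    and A: "A \<subseteq> {1..n} - {s, t}" "A \<noteq> {}" and D: "finite D" "real (card {e \<in> D. y \<le> w e}) < real (card A) * real n * y / 64"
    and c: "\<And>v. v \<in> A \<Longrightarrow> conn w D n c x v" and y: "0 \<le> y" and n: "1 \<le> n"
  shows "\<exists>A'. A \<subseteq> A' \<and> A' \<subseteq> {1..n} - {s, t} \<and> (\<forall>v\<in>A'. conn w D n (c + 2 * y) x v) \<and>
    (7 * n < 8 * card A' \<or> real (card A) * (real n * y / (128 * ln (real n + 1))) \<le> real (card A'))"
proof -
  define B where "B = {z \<in> {1..n} - {s, t} - A. \<exists>u\<in>A. w {u, z} \<le> 2 * y \<and> y \<le> w {u, z} \<and> {u, z} \<notin> D}"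
  have fin: "finite A" "finite B" using A finite_subset[of A "{1..n}"] by (auto simp: B_def)
  have cB: "conn w D n (c + 2 * y) x v" if v: "v \<in> A \<union> B" for v
  proof (cases "v \<in> A")
    case True
    thus ?thesis using y by (intro conn_mono[OF c]) auto
  next
    case False
    then obtain u where u: "u \<in> A" "w {u, v} \<le> 2 * y" "{u, v} \<notin> D" "v \<in> {1..n}" using v by (auto simp: B_def)
    thus ?thesis using False by (intro conn_extend[OF c[OF u(1)]]) auto
  qed
  have disj: "A \<inter> B = {}" by (auto simp: B_def)
  have cardAB: "card (A \<union> B) = card A + card B" by (rule card_Un_disjoint[OF fin disj])
  have "\<not> (real (card A + card B) * ln (real n + 1) \<le> real (card A) * real n * y / 128 \<and> 8 * (card A + card B) \<le> 7 * n)"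
  proof
    assume small: "real (card A + card B) * ln (real n + 1) \<le> real (card A) * real n * y / 128 \<and> 8 * (card A + card B) \<le> 7 * n"
    have "real (card A) * real n * y / 64 \<le> real (card {e \<in> between A ({1..n} - {s, t} - A - B). y \<le> w e \<and> w e \<le> 2 * y})"
      using small by (intro F A disj) (auto simp: B_def)
    also have "\<dots> \<le> real (card {e \<in> D. y \<le> w e})"
    proof (intro of_nat_mono card_mono)
      show "{e \<in> between A ({1..n} - {s, t} - A - B). y \<le> w e \<and> w e \<le> 2 * y} \<subseteq> {e \<in> D. y \<le> w e}"
        unfolding between_def B_def by auto
    qed (use D in auto)
    finally show False using D(2) by linarith
  qed
  hence "7 * n < 8 * card (A \<union> B) \<or> real (card A) * (real n * y / (128 * ln (real n + 1))) \<le> real (card (A \<union> B))"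
  proof -
    have ln0: "0 < ln (real n + 1)" using n by simp
    assume *: "\<not> (real (card A + card B) * ln (real n + 1) \<le> real (card A) * real n * y / 128 \<and> 8 * (card A + card B) \<le> 7 * n)"
    show ?thesis
    proof (cases "8 * (card A + card B) \<le> 7 * n")
      case True
      hence "real (card A) * real n * y / 128 \<le> real (card A + card B) * ln (real n + 1)" using * by linarith
      hence "real (card A) * (real n * y / 128) / ln (real n + 1) \<le> real (card A + card B)"
        using ln0 by (simp add: pos_divide_le_eq)
      thus ?thesis unfolding cardAB by simp
    qed (use cardAB in auto)
  qed
  thus ?thesis using A cB by (intro exI[of _ "A \<union> B"]) (auto simp: B_def)
qed

lemma window_iterate:
  assumes F: "\<And>U B. U \<subseteq> {1..n} - {s, t} \<Longrightarrow> B \<subseteq> {1..n} - {s, t} \<Longrightarrow> U \<inter> B = {} \<Longrightarrow> U \<noteq> {} \<Longrightarrow>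
      real (card U + card B) * ln (real n + 1) \<le> real (card U) * real n * y / 128 \<Longrightarrow> 8 * (card U + card B) \<le> 7 * n \<Longrightarrow>
      real (card U) * real n * y / 64 \<le> real (card {e \<in> between U ({1..n} - {s, t} - U - B). y \<le> w e \<and> w e \<le> 2 * y})"
    and A: "A \<subseteq> {1..n} - {s, t}" "A \<noteq> {}" and D: "finite D" "real (card {e \<in> D. y \<le> w e}) < real (card A) * real n * y / 64"
    and c: "\<And>v. v \<in> A \<Longrightarrow> conn w D n c x v" and y: "0 \<le> y" and n: "1 \<le> n"
    and \<rho>: "\<rho> = real n * y / (128 * ln (real n + 1))" "1 \<le> \<rho>" "real n < \<rho> ^ r"
  shows "\<exists>A'. A' \<subseteq> {1..n} - {s, t} \<and> (\<forall>v\<in>A'. conn w D n (c + 2 * real r * y) x v) \<and> 7 * n < 8 * card A'"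
proof -
  have finA: "finite B" if "B \<subseteq> {1..n} - {s, t}" for B using that finite_subset[of B "{1..n}"] by auto
  have "\<exists>A'. A \<subseteq> A' \<and> A' \<subseteq> {1..n} - {s, t} \<and> (\<forall>v\<in>A'. conn w D n (c + 2 * real i * y) x v) \<and>
    (7 * n < 8 * card A' \<or> real (card A) * \<rho> ^ i \<le> real (card A'))" for i
  proof (induction i)
    case 0
    thus ?case using A c by (intro exI[of _ A]) auto
  next
    case (Suc i)
    then obtain A' where A': "A \<subseteq> A'" "A' \<subseteq> {1..n} - {s, t}" "\<And>v. v \<in> A' \<Longrightarrow> conn w D n (c + 2 * real i * y) x v"
      "7 * n < 8 * card A' \<or> real (card A) * \<rho> ^ i \<le> real (card A')" by blast
    have AA: "card A \<le> card A'" using A'(1) finA[OF A'(2)] by (rule card_mono[rotated])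
    have D': "real (card {e \<in> D. y \<le> w e}) < real (card A') * real n * y / 64"
    proof -
      have "real (card A) * real n * y / 64 \<le> real (card A') * real n * y / 64"
        using AA y by (intro divide_right_mono mult_right_mono) auto
      thus ?thesis using D(2) by linarith
    qed
    have "A' \<noteq> {}" using A A'(1) by blast
    from window_growth[OF F A'(2) this D(1) D' A'(3) y n]
    obtain A'' where A'': "A' \<subseteq> A''" "A'' \<subseteq> {1..n} - {s, t}" "\<forall>v\<in>A''. conn w D n (c + 2 * real i * y + 2 * y) x v"
      "7 * n < 8 * card A'' \<or> real (card A') * \<rho> \<le> real (card A'')" unfolding \<rho>(1) by blast
    have "7 * n < 8 * card A'' \<or> real (card A) * \<rho> ^ Suc i \<le> real (card A'')"
    proof (cases "7 * n < 8 * card A'")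
      case True
      thus ?thesis using card_mono[OF finA[OF A''(2)] A''(1)] by linarith
    next
      case False
      hence "real (card A) * \<rho> ^ i * \<rho> \<le> real (card A') * \<rho>" using A'(4) \<rho>(2) by (intro mult_right_mono) auto
      thus ?thesis using A''(4) by (auto simp: mult_ac)
    qed
    moreover have "c + 2 * real i * y + 2 * y = c + 2 * real (Suc i) * y" by (simp add: algebra_simps)
    hence "\<forall>v\<in>A''. conn w D n (c + 2 * real (Suc i) * y) x v" using A''(3) by (simp only:)
    moreover have "A \<subseteq> A''" using A'(1) A''(1) by blast
    ultimately show ?case using A''(2) by blast
  qed
  from this[of r] obtain A' where A': "A' \<subseteq> {1..n} - {s, t}" "\<forall>v\<in>A'. conn w D n (c + 2 * real r * y) x v"
    "7 * n < 8 * card A' \<or> real (card A) * \<rho> ^ r \<le> real (card A')" by blast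
  have "7 * n < 8 * card A'"
  proof (rule ccontr)
    assume "\<not> 7 * n < 8 * card A'"
    hence le: "real (card A) * \<rho> ^ r \<le> real (card A')" using A'(3) by blast
    have "1 \<le> real (card A)" using A finA[OF A(1)] by (simp add: Suc_le_eq card_gt_0_iff)
    hence "1 * \<rho> ^ r \<le> real (card A) * \<rho> ^ r" using \<rho> by (intro mult_right_mono) auto
    moreover have "card A' \<le> n" using card_mono[of "{1..n}" A'] A'(1) by auto
    ultimately show False using le \<rho>(3) by linarith
  qed
  thus ?thesis using A' by blast
qed

text \<open>Each round multiplies a set by \<open>\<rho>\<close>, so after \<open>r\<close> rounds
  each terminal is close to more than 7/8 of all vertices, and two such sets intersect.\<close>

lemma window_meet:
  assumes F: "\<And>U B. U \<subseteq> {1..n} - {s, t} \<Longrightarrow> B \<subseteq> {1..n} - {s, t} \<Longrightarrow> U \<inter> B = {} \<Longrightarrow> U \<noteq> {} \<Longrightarrow>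
      real (card U + card B) * ln (real n + 1) \<le> real (card U) * real n * y / 128 \<Longrightarrow> 8 * (card U + card B) \<le> 7 * n \<Longrightarrow>
      real (card U) * real n * y / 64 \<le> real (card {e \<in> between U ({1..n} - {s, t} - U - B). y \<le> w e \<and> w e \<le> 2 * y})"
    and A: "\<And>x. x \<in> {s, t} \<Longrightarrow> A x \<subseteq> {1..n} - {s, t} \<and> A x \<noteq> {} \<and> real (card {e \<in> D. y \<le> w e}) < real (card (A x)) * real n * y / 64
       \<and> (\<forall>v\<in>A x. conn w D n c x v)"
    and D: "finite D" and y: "0 \<le> y" and n: "1 \<le> n"
    and \<rho>: "\<rho> = real n * y / (128 * ln (real n + 1))" "1 \<le> \<rho>" "real n < \<rho> ^ r"
  shows "conn w D n (2 * c + 4 * real r * y) s t"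
proof -
  have "\<exists>A'. A' \<subseteq> {1..n} - {s, t} \<and> (\<forall>v\<in>A'. conn w D n (c + 2 * real r * y) x v) \<and> 7 * n < 8 * card A'" if "x \<in> {s, t}" for x
    using A[OF that] by (intro window_iterate[OF F _ _ D _ _ y n \<rho>, of "A x"]) auto
  from this[of s] this[of t] obtain B C where B: "B \<subseteq> {1..n} - {s, t}" "\<forall>v\<in>B. conn w D n (c + 2 * real r * y) s v" "7 * n < 8 * card B"
    and C: "C \<subseteq> {1..n} - {s, t}" "\<forall>v\<in>C. conn w D n (c + 2 * real r * y) t v" "7 * n < 8 * card C" by auto
  have "B \<inter> C \<noteq> {}"
  proof
    assume "B \<inter> C = {}"
    moreover have "finite B" "finite C" using finite_subset[OF B(1)] finite_subset[OF C(1)] by simp_all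
    ultimately have "card (B \<union> C) = card B + card C" by (intro card_Un_disjoint) auto
    moreover have "card (B \<union> C) \<le> n" using B(1) C(1) card_mono[of "{1..n}" "B \<union> C"] by auto
    ultimately show False using B(3) C(3) by linarith
  qed
  then obtain v where v: "v \<in> B" "v \<in> C" by blast
  have "conn w D n ((c + 2 * real r * y) + (c + 2 * real r * y)) s t"
    by (rule conn_trans[OF bspec[OF B(2) v(1)] conn_sym[OF bspec[OF C(2) v(2)]]])
  thus ?thesis by (simp add: algebra_simps)
qed

end

text \<open>The i-th smallest value on \<open>Z\<close> is at least
  \<open>(i - \<beta>) / \<alpha>\<close>, because \<open>few\<close> limits the number of values
  below it. The induction removes a maximal element.\<close>

lemma star_sum_ge:
  fixes f :: "'v \<Rightarrow> real"
  assumes fin: "finite S" and \<alpha>: "0 < \<alpha>" and few: "\<And>v. v \<in> S \<Longrightarrow> real (card {u \<in> S. f u \<le> f v}) \<le> \<alpha> * f v + \<beta>"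
    and Z: "Z \<subseteq> S"
  shows "(real (card Z))\<^sup>2 / 2 - real (card Z) * \<beta> \<le> \<alpha> * (\<Sum>v\<in>Z. f v)"
proof -
  have "finite Z" using fin Z finite_subset by auto
  hence "real (card Z) * (real (card Z) + 1) / 2 - real (card Z) * \<beta> \<le> \<alpha> * (\<Sum>v\<in>Z. f v)"
    using Z
  proof (induction "card Z" arbitrary: Z)
    case 0
    thus ?case by simp
  next
    case (Suc k)
    hence "Z \<noteq> {}" by auto
    then obtain v where v: "v \<in> Z" "\<And>u. u \<in> Z \<Longrightarrow> f u \<le> f v"
    proof -
      have "Max (f ` Z) \<in> f ` Z" using Suc.prems(1) \<open>Z \<noteq> {}\<close> by (intro Max_in) auto
      then obtain v where "v \<in> Z" "Max (f ` Z) = f v" by blast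
      thus ?thesis using that[of v] Max_ge[of "f ` Z"] Suc.prems(1) by fastforce
    qed
    have "card Z \<le> card {u \<in> S. f u \<le> f v}" using v Suc.prems fin by (intro card_mono) auto
    hence le: "real (card Z) \<le> \<alpha> * f v + \<beta>" using few[of v] v(1) Suc.prems(2) by (meson of_nat_mono order.trans subsetD)
    have ck: "card (Z - {v}) = k" using Suc v by simp
    have IH: "real k * (real k + 1) / 2 - real k * \<beta> \<le> \<alpha> * (\<Sum>u\<in>Z - {v}. f u)"
      using Suc.hyps(1)[of "Z - {v}"] Suc.prems ck by auto
    have "(\<Sum>u\<in>Z. f u) = f v + (\<Sum>u\<in>Z - {v}. f u)" using v Suc.prems by (intro sum.remove) auto
    hence "\<alpha> * (\<Sum>u\<in>Z. f u) = \<alpha> * f v + \<alpha> * (\<Sum>u\<in>Z - {v}. f u)" by (simp add: algebra_simps)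
    also have "\<dots> \<ge> (real (Suc k) - \<beta>) + (real k * (real k + 1) / 2 - real k * \<beta>)"
      using le IH Suc.hyps(2) by (intro add_mono) auto
    finally show ?case unfolding Suc.hyps(2)[symmetric] by (simp add: field_simps)
  qed
  moreover have "(real (card Z))\<^sup>2 / 2 \<le> real (card Z) * (real (card Z) + 1) / 2" by (simp add: power2_eq_square algebra_simps)
  ultimately show ?thesis by linarith
qed

section \<open>Estimates with high probability\<close>

text \<open>The forests and subsets contribute at most \<open>K ^ (8 * a)\<close>, which half of the
  exponent \<open>a * \<delta> * K / 16\<close> compensates once \<open>K\<close> is large compared
  with \<open>ln K\<close>.\<close>

lemma expand_bound:
  fixes K \<delta> :: real and a :: nat
  assumes K: "16 \<le> K" "256 * ln K \<le> \<delta> * K" and \<delta>: "0 < \<delta>" and a: "\<delta> * K / 2 \<le> real a" "real a \<le> K\<^sup>2"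
  shows "(2 * K * (2 + 2 * real a)) ^ (2 * a) * 4 ^ a * exp (- (real a * (\<delta> * K) / 16)) \<le> exp (- (\<delta>\<^sup>2 * K\<^sup>2 / 64))"
proof -
  have K0: "K > 0" using K by linarith
  have "8 * K * (1 + real a) \<le> 8 * K * (1 + K\<^sup>2)" using a K0 by (intro mult_left_mono) auto
  also have "\<dots> \<le> 16 * K ^ 3"
  proof -
    have "K * 1 \<le> K * K\<^sup>2" using K by (intro mult_left_mono) (auto intro: one_le_power)
    thus ?thesis by (simp add: power3_eq_cube power2_eq_square algebra_simps)
  qed
  also have "\<dots> \<le> K * K ^ 3" using K by (intro mult_right_mono) auto
  finally have le: "8 * K * (1 + real a) \<le> K ^ 4" by (simp add: power_numeral_reduce)
  have "(2 * K * (2 + 2 * real a)) ^ (2 * a) * 4 ^ a = (8 * K * (1 + real a)) ^ (2 * a)"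
  proof -
    have "(4::real) ^ a = 2 ^ (2 * a)" by (simp add: power_mult)
    moreover have "2 * K * (2 + 2 * real a) * 2 = 8 * K * (1 + real a)" by (simp add: algebra_simps)
    ultimately show ?thesis by (simp only: power_mult_distrib[symmetric])
  qed
  also have "\<dots> \<le> (K ^ 4) ^ (2 * a)" using le K0 by (intro power_mono) auto
  also have "\<dots> = exp (real (8 * a) * ln K)"
    using K0 by (subst exp_of_nat_mult) (simp add: power_mult[symmetric] mult.commute)
  also have "\<dots> \<le> exp (real a * (\<delta> * K) / 32)"
  proof -
    have "real a * (256 * ln K) \<le> real a * (\<delta> * K)" using K by (intro mult_left_mono) auto
    thus ?thesis by simp
  qed
  finally have "(2 * K * (2 + 2 * real a)) ^ (2 * a) * 4 ^ a * exp (- (real a * (\<delta> * K) / 16)) \<le>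
     exp (real a * (\<delta> * K) / 32) * exp (- (real a * (\<delta> * K) / 16))" by (intro mult_right_mono) auto
  also have "\<dots> = exp (- (real a * (\<delta> * K) / 32))" by (simp add: exp_add[symmetric])
  also have "\<dots> \<le> exp (- (\<delta>\<^sup>2 * K\<^sup>2 / 64))"
  proof -
    have "\<delta> * K / 2 * (\<delta> * K) \<le> real a * (\<delta> * K)" using a K0 \<delta> by (intro mult_right_mono) auto
    thus ?thesis by (simp add: power2_eq_square algebra_simps)
  qed
  finally show ?thesis .
qed

text \<open>One quarter of the exponent \<open>c1 * a * L\<close> pays for the forests, at most
  \<open>K ^ (10 * a)\<close>, by \<open>ln K \<le> 2 * \<gamma> * L\<close>; another quarter pays
  for the excluded edges, at most \<open>n ^ (3 * m)\<close>. The remaining half is at least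
  \<open>5 * L\<close>, one \<open>L\<close> of which covers \<open>J + 2\<close>.\<close>

lemma connect_bound:
  fixes K L c1 \<gamma> :: real and a m n J :: nat
  assumes K: "32 \<le> K" "ln K \<le> 2 * \<gamma> * L" and a: "real a \<le> K ^ 3" and L: "L = ln (real n)" "2 \<le> n"
    and \<gamma>: "80 * \<gamma> \<le> c1" and m: "12 * real m \<le> c1 * real a" and c1: "0 < c1" "10 \<le> c1 * real a" and J: "real (J + 2) \<le> real n"
  shows "(2 * K * (2 + 2 * real a)) ^ (2 * a) * (4 ^ a * (4 ^ a * (real n ^ 2 + 1) ^ m)) * (real (J + 2) * exp (- (c1 * real a * L))) \<le> 1 / real n ^ 4"
proof -
  have K0: "K > 0" using K by linarith
  have n0: "real n > 0" using L by simp
  have L0: "L > 0" using L by simp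
  have "16 * K * (1 + real a) \<le> 16 * K * (1 + K ^ 3)" using a K0 by (intro mult_left_mono) auto
  also have "\<dots> \<le> 32 * K ^ 4"
  proof -
    have "K * 1 \<le> K * K ^ 3" using K by (intro mult_left_mono) (auto intro: one_le_power)
    thus ?thesis by (simp add: power_numeral_reduce algebra_simps)
  qed
  also have "\<dots> \<le> K * K ^ 4" using K by (intro mult_right_mono) auto
  finally have le: "16 * K * (1 + real a) \<le> K ^ 5" by (simp add: power_numeral_reduce)
  have "(2 * K * (2 + 2 * real a)) ^ (2 * a) * (4 ^ a * 4 ^ a) = (16 * K * (1 + real a)) ^ (2 * a)"
  proof -
    have "(4::real) ^ a * 4 ^ a = 4 ^ (2 * a)" by (simp add: power_mult power2_eq_square power_mult_distrib[symmetric])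
    moreover have "2 * K * (2 + 2 * real a) * 4 = 16 * K * (1 + real a)" by (simp add: algebra_simps)
    ultimately show ?thesis by (simp only: power_mult_distrib[symmetric])
  qed
  also have "\<dots> \<le> (K ^ 5) ^ (2 * a)" using le K0 by (intro power_mono) auto
  also have "\<dots> = exp (real (10 * a) * ln K)"
    using K0 by (subst exp_of_nat_mult) (simp add: power_mult[symmetric] mult.commute)
  also have "\<dots> \<le> exp (c1 * real a * L / 4)"
  proof -
    have "real (10 * a) * ln K \<le> real (10 * a) * (2 * \<gamma> * L)" using K by (intro mult_left_mono) auto
    also have "\<dots> = (80 * \<gamma>) * (real a * L) / 4" by simp
    also have "\<dots> \<le> c1 * (real a * L) / 4" using \<gamma> L0 by (intro divide_right_mono mult_right_mono) auto
    finally show ?thesis by (simp add: mult_ac)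
  qed
  finally have A: "(2 * K * (2 + 2 * real a)) ^ (2 * a) * (4 ^ a * 4 ^ a) \<le> exp (c1 * real a * L / 4)" .
  have "(real n ^ 2 + 1) ^ m \<le> (real n ^ 3) ^ m"
  proof (rule power_mono)
    have "real n ^ 2 + 1 \<le> 2 * real n ^ 2" using L(2) by (simp add: one_le_power)
    also have "\<dots> \<le> real n * real n ^ 2" using L(2) by (intro mult_right_mono) auto
    finally show "real n ^ 2 + 1 \<le> real n ^ 3" by (simp add: power_numeral_reduce)
  qed auto
  also have "\<dots> = exp (real (3 * m) * L)"
    unfolding L(1) using n0 by (subst exp_of_nat_mult) (simp add: power_mult[symmetric])
  also have "\<dots> \<le> exp (c1 * real a * L / 4)"
  proof -
    have "12 * real m * L \<le> c1 * real a * L" using m L0 by (intro mult_right_mono) auto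
    thus ?thesis by simp
  qed
  finally have B: "(real n ^ 2 + 1) ^ m \<le> exp (c1 * real a * L / 4)" .
  have "(2 * K * (2 + 2 * real a)) ^ (2 * a) * (4 ^ a * (4 ^ a * (real n ^ 2 + 1) ^ m)) * (real (J + 2) * exp (- (c1 * real a * L)))
     = ((2 * K * (2 + 2 * real a)) ^ (2 * a) * (4 ^ a * 4 ^ a)) * (real n ^ 2 + 1) ^ m * (real (J + 2) * exp (- (c1 * real a * L)))"
    by (simp only: mult.assoc)
  also have "\<dots> \<le> exp (c1 * real a * L / 4) * exp (c1 * real a * L / 4) * (real n * exp (- (c1 * real a * L)))"
    using A B J by (intro mult_mono) auto
  also have "\<dots> = real n * exp (- (c1 * real a * L / 2))"
    by (simp add: exp_add[symmetric])
  also have "\<dots> \<le> real n * exp (- (5 * L))"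
  proof -
    have "10 * L \<le> c1 * real a * L" using c1 L0 by (intro mult_right_mono) auto
    thus ?thesis by (intro mult_left_mono) auto
  qed
  also have "exp (- (5 * L)) = 1 / real n ^ 5"
  proof -
    have "exp (5 * L) = real n ^ 5" unfolding L(1) using n0 exp_of_nat_mult[of 5 "ln (real n)"] by simp
    thus ?thesis by (simp add: exp_minus divide_inverse)
  qed
  also have "real n * (1 / real n ^ 5) = 1 / real n ^ 4" using n0 by (simp add: power_numeral_reduce)
  finally show ?thesis .
qed

section \<open>Statements with high probability\<close>

locale random_weights_seq =
  fixes M :: "nat \<Rightarrow> 'a measure" and W :: "nat \<Rightarrow> nat set \<Rightarrow> 'a \<Rightarrow> real" and s t :: "nat \<Rightarrow> nat"
  assumes rw: "\<And>n. random_weights (M n) n (W n)"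
    and st: "\<And>n. n \<ge> 2 \<Longrightarrow> s n \<in> {1..n} \<and> t n \<in> {1..n} \<and> s n \<noteq> t n"
begin

sublocale random_weights "M n" n "W n" for n by (rule rw)

abbreviation "Wn n \<omega> \<equiv> (\<lambda>e. W n e \<omega>)"

abbreviation "unit_weights n \<omega> \<equiv> \<forall>e\<in>complete_edges n. 0 \<le> W n e \<omega> \<and> W n e \<omega> \<le> 1"

abbreviation "paths_between n \<omega> \<equiv> successive_cheapest_paths n (s n) (t n) (Wn n \<omega>)"

abbreviation "cheap_so_far n \<omega> P k \<equiv> (\<Sum>i\<in>{1..<k}. path_cost (Wn n \<omega>) (P i)) \<le> 4 * real k * (real k + ln (real n)) / n"

abbreviation "next_path_le \<epsilon> n \<omega> P k \<equiv>
  conn (Wn n \<omega>) (removed P k) n ((1 + \<epsilon>) * (2 * real k + ln (real n)) / n) (s n) (t n)"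

text \<open>Formulated with outer probabilities: the events range over all paths, forests and edge
  sets, and their measurability is never examined.\<close>

definition whp :: "(nat \<Rightarrow> 'a \<Rightarrow> bool) \<Rightarrow> bool" where
  "whp Q \<longleftrightarrow> (\<exists>p. p \<longlonglongrightarrow> 0 \<and> (\<forall>\<^sub>F n in sequentially. prob_le n (\<lambda>\<omega>. \<not> Q n \<omega>) (p n)))"

lemma whpI:
  assumes "p \<longlonglongrightarrow> 0" "\<forall>\<^sub>F n in sequentially. prob_le n (\<lambda>\<omega>. \<not> Q n \<omega>) (p n)"
  shows "whp Q"
  using assms unfolding whp_def by blast

lemma whp_conj:
  assumes "whp Q" "whp Q'"
  shows "whp (\<lambda>n \<omega>. Q n \<omega> \<and> Q' n \<omega>)"
proof -
  obtain p p' where p: "p \<longlonglongrightarrow> 0" "\<forall>\<^sub>F n in sequentially. prob_le n (\<lambda>\<omega>. \<not> Q n \<omega>) (p n)"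
    and p': "p' \<longlonglongrightarrow> 0" "\<forall>\<^sub>F n in sequentially. prob_le n (\<lambda>\<omega>. \<not> Q' n \<omega>) (p' n)"
    using assms unfolding whp_def by blast
  have "\<forall>\<^sub>F n in sequentially. prob_le n (\<lambda>\<omega>. \<not> (Q n \<omega> \<and> Q' n \<omega>)) (p n + p' n)"
    using p(2) p'(2)
  proof eventually_elim
    case (elim n)
    show ?case by (rule prob_le_mono[OF prob_le_disj[OF elim]]) auto
  qed
  moreover have "(\<lambda>n. p n + p' n) \<longlonglongrightarrow> 0" using tendsto_add[OF p(1) p'(1)] by simp
  ultimately show ?thesis by (rule whpI[rotated])
qed

lemma whp_mono:
  assumes "whp Q" "\<forall>\<^sub>F n in sequentially. \<forall>\<omega>\<in>space (M n). Q n \<omega> \<longrightarrow> Q' n \<omega>"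
  shows "whp Q'"
proof -
  obtain p where p: "p \<longlonglongrightarrow> 0" "\<forall>\<^sub>F n in sequentially. prob_le n (\<lambda>\<omega>. \<not> Q n \<omega>) (p n)"
    using assms unfolding whp_def by blast
  have "\<forall>\<^sub>F n in sequentially. prob_le n (\<lambda>\<omega>. \<not> Q' n \<omega>) (p n)"
    using p(2) assms(2)
  proof eventually_elim
    case (elim n)
    show ?case by (rule prob_le_mono[OF elim(1)]) (use elim(2) in auto)
  qed
  thus ?thesis using p(1) by (rule whpI[rotated])
qed

lemma whp_weights: "whp (\<lambda>n \<omega>. unit_weights n \<omega>)"
proof (rule whpI[of "\<lambda>_. 0"])
  show "\<forall>\<^sub>F n in sequentially. prob_le n (\<lambda>\<omega>. \<not> unit_weights n \<omega>) 0"
  proof (rule always_eventually, rule allI)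
    fix n show "prob_le n (\<lambda>\<omega>. \<not> unit_weights n \<omega>) 0"
      by (rule prob_le_mono[OF weights_in_unit]) (auto simp: not_le)
  qed
qed simp

lemma whp_star:
  assumes \<delta>: "0 < \<delta>" "\<delta> \<le> 1"
  shows "whp (\<lambda>n \<omega>. \<forall>x\<in>{s n, t n}. \<forall>j\<in>{..n}.
    \<bar>real (card {v \<in> {1..n} - {x}. 0 \<le> W n {x, v} \<omega> \<and> W n {x, v} \<omega> \<le> real j / real n}) - real j\<bar> \<le> \<delta> * (real j + ln (real n)))"
proof (rule whpI)
  let ?p = "\<lambda>n. 4 * exp (- (\<delta>\<^sup>2 / 2 * ln (real n))) / (1 - exp (- (\<delta>\<^sup>2 / 4)))"
  have d2: "\<delta>\<^sup>2 / 2 > 0" using \<delta> by simp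
  have "(\<lambda>n. exp (- (\<delta>\<^sup>2 / 2 * ln (real n)))) \<longlonglongrightarrow> 0"
  proof -
    have "((\<lambda>n. exp (- (c * ln (real n)))) \<longlongrightarrow> 0) sequentially" if "c > 0" for c :: real
      using that by real_asymp
    thus ?thesis using d2 by blast
  qed
  hence "(\<lambda>n. 4 * exp (- (\<delta>\<^sup>2 / 2 * ln (real n))) / (1 - exp (- (\<delta>\<^sup>2 / 4)))) \<longlonglongrightarrow> 4 * 0 / (1 - exp (- (\<delta>\<^sup>2 / 4)))"
    using \<delta> by (intro tendsto_intros) auto
  hence p: "?p \<longlonglongrightarrow> 0" by simp
  show "(\<lambda>n. 2 * ?p n) \<longlonglongrightarrow> 0" using tendsto_mult_left[OF p, of 2] by simp
  show "\<forall>\<^sub>F n in sequentially. prob_le n (\<lambda>\<omega>. \<not> (\<forall>x\<in>{s n, t n}. \<forall>j\<in>{..n}.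
    \<bar>real (card {v \<in> {1..n} - {x}. 0 \<le> W n {x, v} \<omega> \<and> W n {x, v} \<omega> \<le> real j / real n}) - real j\<bar> \<le> \<delta> * (real j + ln (real n)))) (2 * ?p n)"
    using eventually_ge_at_top[of 2]
  proof eventually_elim
    case (elim n)
    have sn: "x \<in> {1..n}" if "x \<in> {s n, t n}" for x using st[OF elim] that by auto
    have "prob_le n (\<lambda>\<omega>. \<exists>x\<in>{s n, t n}. \<exists>j\<in>{..n}. \<bar>real (card {v \<in> {1..n} - {x}. 0 \<le> W n {x, v} \<omega> \<and> W n {x, v} \<omega> \<le> real j / real n}) - real j\<bar> > \<delta> * (real j + ln (real n))) (2 * ?p n)"
    proof (rule prob_le_bex_const)
      show "prob_le n (\<lambda>\<omega>. \<exists>j\<in>{..n}. \<bar>real (card {v \<in> {1..n} - {x}. 0 \<le> W n {x, v} \<omega> \<and> W n {x, v} \<omega> \<le> real j / real n}) - real j\<bar> > \<delta> * (real j + ln (real n))) (?p n)"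
        if "x \<in> {s n, t n}" for x
        using elim by (intro star_concentration sn that \<delta>) auto
      show "real (card {s n, t n}) \<le> 2" using st[OF elim] by simp
      show "0 \<le> ?p n" using \<delta> by (intro divide_nonneg_nonneg) auto
    qed simp
    thus ?case by (rule prob_le_mono) (auto simp: not_le)
  qed
qed

lemma whp_windows:
  assumes \<rho>: "0 < \<rho>" "\<rho> \<le> 1"
  shows "whp (\<lambda>n \<omega>. \<forall>u\<in>{1..n}. (real n - 1) * \<rho> / 8 \<le> real (card {v \<in> {1..n} - {u}. \<rho> / 2 \<le> W n {u, v} \<omega> \<and> W n {u, v} \<omega> \<le> \<rho>}))"
proof (rule whpI)
  show "(\<lambda>n. real n * exp (- ((real n - 1) * \<rho> / 8))) \<longlonglongrightarrow> 0" using \<rho>(1) by real_asymp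
  show "\<forall>\<^sub>F n in sequentially. prob_le n (\<lambda>\<omega>. \<not> (\<forall>u\<in>{1..n}. (real n - 1) * \<rho> / 8 \<le> real (card {v \<in> {1..n} - {u}. \<rho> / 2 \<le> W n {u, v} \<omega> \<and> W n {u, v} \<omega> \<le> \<rho>})))
     (real n * exp (- ((real n - 1) * \<rho> / 8)))"
  proof (rule always_eventually, rule allI)
    fix n show "prob_le n (\<lambda>\<omega>. \<not> (\<forall>u\<in>{1..n}. (real n - 1) * \<rho> / 8 \<le> real (card {v \<in> {1..n} - {u}. \<rho> / 2 \<le> W n {u, v} \<omega> \<and> W n {u, v} \<omega> \<le> \<rho>})))
     (real n * exp (- ((real n - 1) * \<rho> / 8)))"
      using \<rho> by (intro prob_le_mono[OF vertex_windows[of \<rho> n]]) (auto simp: not_le)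
  qed
qed

lemma eventually_ln_ge: "\<forall>\<^sub>F n in sequentially. c \<le> ln (real n)"
proof -
  have "filterlim (\<lambda>n. ln (real n)) at_top sequentially" by real_asymp
  thus ?thesis by (simp add: filterlim_at_top)
qed

text \<open>In a statement about all \<open>k\<close>, the quantity \<open>K = k + ln n\<close> is large because \<open>ln n\<close> is.\<close>

lemma eventually_all_k:
  assumes "eventually P (at_top :: real filter)"
  shows "\<forall>\<^sub>F n in sequentially. \<forall>k :: nat. P (real k + ln (real n))"
proof -
  obtain K0 where "\<And>K. K \<ge> K0 \<Longrightarrow> P K" using assms unfolding eventually_at_top_linorder by blast
  thus ?thesis using eventually_ln_ge[of K0] by (auto elim!: eventually_mono)
qed

lemma eventually_small_K:
  assumes "0 < \<gamma>" "\<gamma> \<le> 1 / 10"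
  shows "\<forall>\<^sub>F n in sequentially. \<forall>k :: nat. real k \<le> real n powr \<gamma> \<longrightarrow>
     real k + ln (real n) \<le> real n powr (2 * \<gamma>) \<and> real k + ln (real n) \<le> 2 * real n powr (1 / 10) \<and> k \<le> n"
proof -
  have 1: "\<forall>\<^sub>F n in sequentially. real n powr \<gamma> + ln (real n) \<le> real n powr (2 * \<gamma>)" using assms(1) by real_asymp
  have 2: "\<forall>\<^sub>F n in sequentially. ln (real n) \<le> real n powr (1 / 10)" by real_asymp
  show ?thesis using 1 2 eventually_ge_at_top[of 1]
  proof eventually_elim
    case (elim n)
    have a: "real n powr \<gamma> \<le> real n powr (1 / 10)" using assms elim by (intro powr_mono) auto
    have "real n powr (1 / 10) \<le> real n powr 1" using elim by (intro powr_mono) auto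
    hence "real n powr (1 / 10) \<le> real n" using elim by simp
    thus ?case using elim a by auto
  qed
qed

text \<open>The range of \<open>a\<close> covers the two expansions to be made, from order
  \<open>K\<close> and from order \<open>K^2\<close> vertices.\<close>

abbreviation "forests_expand \<delta> \<gamma> n \<omega> \<equiv>
  \<forall>k K a. real k \<le> real n powr \<gamma> \<longrightarrow> K = real k + ln (real n) \<longrightarrow> \<delta> * K / 2 \<le> real a \<longrightarrow> real a \<le> K\<^sup>2 \<longrightarrow>
   (\<forall>fs U. forest n {s n, t n} fs \<longrightarrow> length fs = 2 * a \<longrightarrow> (\<forall>e\<in>forest_edges fs. 0 \<le> W n e \<omega> \<and> W n e \<omega> \<le> 2 * K / n) \<longrightarrow>
    U \<subseteq> fst ` set fs \<longrightarrow> card U = a \<longrightarrow>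
    real a * (\<delta> * K) / 16 \<le> real (card {v \<in> {1..n} - {s n, t n} - fst ` set fs. \<exists>u\<in>U. \<delta> * K / n \<le> W n {u, v} \<omega> \<and> W n {u, v} \<omega> \<le> 2 * (\<delta> * K / n)}))"

text \<open>There are at most (n + 1)^2 pairs of \<open>k\<close> and \<open>a\<close>, while a
  single failure has probability at most exp(-c (ln n)^2), which is smaller than any power of
  n.\<close>

lemma whp_expand:
  assumes \<delta>: "0 < \<delta>" "\<delta> \<le> 1" and \<gamma>: "0 < \<gamma>" "\<gamma> \<le> 1 / 10"
  shows "whp (\<lambda>n \<omega>. forests_expand \<delta> \<gamma> n \<omega>)"
proof (rule whpI)
  let ?p = "\<lambda>n. (real n + 1) ^ 2 * exp (- (\<delta>\<^sup>2 * (ln (real n))\<^sup>2 / 64))"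
  show "?p \<longlonglongrightarrow> 0"
  proof -
    have "((\<lambda>n. (real n + 1) ^ 2 * exp (- (c * (ln (real n))\<^sup>2 / 64))) \<longlongrightarrow> 0) sequentially" if "c > 0" for c :: real
      using that by real_asymp
    thus ?thesis using \<delta> by simp
  qed
  have Kbig: "\<forall>\<^sub>F n in sequentially. \<forall>k :: nat. 16 \<le> real k + ln (real n) \<and> 256 * ln (real k + ln (real n)) \<le> \<delta> * (real k + ln (real n))"
  proof (rule eventually_all_k)
    have "\<forall>\<^sub>F K in at_top. 256 * ln K \<le> \<delta> * (K::real)" using \<delta>(1) by real_asymp
    thus "\<forall>\<^sub>F K in at_top. 16 \<le> K \<and> 256 * ln K \<le> \<delta> * (K::real)" using eventually_ge_at_top[of "16::real"] by eventually_elim auto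
  qed
  have nbig: "\<forall>\<^sub>F n in sequentially. (2 * real n powr (1 / 10)) ^ 3 \<le> real n \<and> 2 * (2 + 2 * (2 * real n powr (1 / 10)) ^ 2) \<le> real n \<and> 4 * real n powr (1 / 10) \<le> real n"
    by (intro eventually_conj; real_asymp)
  show "\<forall>\<^sub>F n in sequentially. prob_le n (\<lambda>\<omega>. \<not> forests_expand \<delta> \<gamma> n \<omega>) (?p n)"
    using Kbig nbig eventually_small_K[OF \<gamma>] eventually_ge_at_top[of 2]
  proof eventually_elim
    case (elim n)
    let ?K = "\<lambda>k :: nat. real k + ln (real n)"
    let ?Bad = "\<lambda>k a \<omega>. \<exists>fs U. forest n {s n, t n} fs \<and> length fs = 2 * a \<and> U \<in> {U. U \<subseteq> fst ` set fs \<and> card U = a} \<and> light n fs (2 * ?K k / n) \<omega> \<and>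
      real (card {v \<in> {1..n} - {s n, t n} - fst ` set fs. \<exists>u\<in>U. \<delta> * ?K k / n \<le> W n {u, v} \<omega> \<and> W n {u, v} \<omega> \<le> 2 * (\<delta> * ?K k / n)}) < real a * real n * (\<delta> * ?K k / n) / 16"
    let ?I = "{(k, a). k \<le> n \<and> a \<le> n \<and> real k \<le> real n powr \<gamma> \<and> \<delta> * ?K k / 2 \<le> real a \<and> real a \<le> (?K k)\<^sup>2}"
    have stn: "{s n, t n} \<subseteq> {1..n}" "card {s n, t n} = 2" using st[OF elim(4)] by auto
    have n0: "real n > 0" using elim(4) by simp
    have L0: "0 \<le> ln (real n)" using elim(4) by simp
    note e2 = conjunct1[OF elim(2)] conjunct1[OF conjunct2[OF elim(2)]] conjunct2[OF conjunct2[OF elim(2)]]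
    have one: "prob_le n (?Bad k a) (exp (- (\<delta>\<^sup>2 * (ln (real n))\<^sup>2 / 64)))" if ka: "(k, a) \<in> ?I" for k a
    proof -
      let ?k = "?K k"
      have a: "real k \<le> real n powr \<gamma>" "\<delta> * ?k / 2 \<le> real a" "real a \<le> ?k\<^sup>2" using ka by auto
      have K: "16 \<le> ?k" "256 * ln ?k \<le> \<delta> * ?k" "?k \<le> 2 * real n powr (1 / 10)" using elim(1,3) a(1) by auto
      have K0: "0 \<le> ?k" using K by linarith
      have k3: "?k ^ 3 \<le> real n" using K power_mono[OF K(3) K0, of 3] e2(1) by linarith
      have k2: "2 * (2 + 2 * real a) \<le> real n" 
      proof -
        have "real a \<le> (2 * real n powr (1 / 10))\<^sup>2" by (rule order.trans[OF a(3) power_mono[OF K(3) K0]])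
        hence "2 * (2 + 2 * real a) \<le> 2 * (2 + 2 * (2 * real n powr (1 / 10))\<^sup>2)" by (simp only: mult_le_cancel_left_pos add_le_cancel_left zero_less_numeral)
        thus ?thesis using e2(2) by linarith
      qed
      have "2 * x \<le> z" if "x \<le> 2 * y" "4 * y \<le> z" for x y z :: real using that by linarith
      from this[OF K(3) e2(3)] have k1: "2 * ?k \<le> real n" .
      have "prob_le n (?Bad k a) ((real (n * (2 + 2 * a)) * (2 * ?k / n)) ^ (2 * a) * 4 ^ a * exp (- (real a * real n * (\<delta> * ?k / n) / 16)))"
      proof (rule forest_expansion[OF stn])
        show "0 \<le> 2 * ?k / n" "2 * ?k / n \<le> 1" "0 < \<delta> * ?k / n" using K n0 k1 \<delta> by auto
        have "2 * (\<delta> * ?k) \<le> 2 * ?k" 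
          using mult_left_mono[OF mult_right_mono[OF \<delta>(2) K0], of 2] by (simp only: mult_1_left zero_le_numeral simp_thms)
        thus "2 * (\<delta> * ?k / n) \<le> 1" using k1 n0 by simp
        have "\<delta> * ?k * real a \<le> 1 * ?k * ?k\<^sup>2" using \<delta> K a by (intro mult_mono) auto
        hence "\<delta> * ?k * real a \<le> real n" using k3 by (simp add: power2_eq_square power3_eq_cube)
        thus "\<delta> * ?k / n * real a \<le> 1" using n0 by simp
      qed (use k2 in auto)
      moreover have "(real (n * (2 + 2 * a)) * (2 * ?k / n)) ^ (2 * a) * 4 ^ a * exp (- (real a * real n * (\<delta> * ?k / n) / 16)) \<le> exp (- (\<delta>\<^sup>2 * (ln (real n))\<^sup>2 / 64))"
      proof -
        have "real (n * (2 + 2 * a)) * (2 * x / n) = 2 * x * (2 + 2 * real a)" for x using n0 by (simp add: field_simps)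
        note this[of ?k]
        moreover have "real a * real n * (\<delta> * ?k / n) = real a * (\<delta> * ?k)" using n0 by simp
        ultimately have "(real (n * (2 + 2 * a)) * (2 * ?k / n)) ^ (2 * a) * 4 ^ a * exp (- (real a * real n * (\<delta> * ?k / n) / 16)) \<le> exp (- (\<delta>\<^sup>2 * ?k\<^sup>2 / 64))"
          using expand_bound[OF K(1,2) \<delta>(1) a(2,3)] by (simp only:)
        also have "\<dots> \<le> exp (- (\<delta>\<^sup>2 * (ln (real n))\<^sup>2 / 64))"
        proof -
          have "(ln (real n))\<^sup>2 \<le> ?k\<^sup>2" using L0 by (intro power_mono) auto
          thus ?thesis by (simp add: mult_left_mono)
        qed
        finally show ?thesis .
      qed
      ultimately show ?thesis by (rule prob_le_weaken)
    qed
    have I: "finite ?I" "real (card ?I) \<le> (real n + 1)\<^sup>2"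
    proof -
      have sub: "?I \<subseteq> {..n} \<times> {..n}" by auto
      thus "finite ?I" by (rule finite_subset) auto
      have "card ?I \<le> card ({..n} \<times> {..n})" by (rule card_mono[OF _ sub]) auto
      hence "real (card ?I) \<le> real ((n + 1) * (n + 1))" by (intro of_nat_mono) (simp add: card_cartesian_product)
      thus "real (card ?I) \<le> (real n + 1)\<^sup>2" by (simp add: power2_eq_square algebra_simps)
    qed
    have "prob_le n (\<lambda>\<omega>. \<exists>i\<in>?I. ?Bad (fst i) (snd i) \<omega>) (?p n)"
    proof (rule prob_le_bex_const[OF I(1) _ I(2)])
      show "prob_le n (?Bad (fst i) (snd i)) (exp (- (\<delta>\<^sup>2 * (ln (real n))\<^sup>2 / 64)))" if "i \<in> ?I" for i
        using one[of "fst i" "snd i"] that by simp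
    qed simp
    thus ?case
    proof (rule prob_le_mono)
      fix \<omega> assume "\<not> forests_expand \<delta> \<gamma> n \<omega>"
      then obtain k a fs U where *: "real k \<le> real n powr \<gamma>" "\<delta> * ?K k / 2 \<le> real a" "real a \<le> (?K k)\<^sup>2"
        "forest n {s n, t n} fs" "length fs = 2 * a" "\<forall>e\<in>forest_edges fs. 0 \<le> W n e \<omega> \<and> W n e \<omega> \<le> 2 * ?K k / n"
        "U \<subseteq> fst ` set fs" "card U = a"
        "\<not> real a * (\<delta> * ?K k) / 16 \<le> real (card {v \<in> {1..n} - {s n, t n} - fst ` set fs. \<exists>u\<in>U. \<delta> * ?K k / n \<le> W n {u, v} \<omega> \<and> W n {u, v} \<omega> \<le> 2 * (\<delta> * ?K k / n)})"
        by blast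
      have "2 * a = card (fst ` set fs)" using forest_verts[OF *(4)] *(5) by simp
      also have "\<dots> \<le> n" using card_mono[of "{1..n}" "fst ` set fs"] forest_verts[OF *(4)] by auto
      finally have "a \<le> n" by simp
      hence "(k, a) \<in> ?I" using * elim(3) by auto
      moreover have "?Bad k a \<omega>"
      proof (intro exI conjI)
        show "light n fs (2 * ?K k / n) \<omega>" unfolding light_def using *(6) .
        have "real a * real n * (\<delta> * ?K k / n) = real a * (\<delta> * ?K k)" using n0 by simp
        thus "real (card {v \<in> {1..n} - {s n, t n} - fst ` set fs. \<exists>u\<in>U. \<delta> * ?K k / n \<le> W n {u, v} \<omega> \<and> W n {u, v} \<omega> \<le> 2 * (\<delta> * ?K k / n)}) < real a * real n * (\<delta> * ?K k / n) / 16"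
          using *(9) by simp
      qed (use * in auto)
      ultimately show "\<exists>i\<in>?I. ?Bad (fst i) (snd i) \<omega>" by (intro bexI[of _ "(k, a)"]) (simp_all only: fst_conv snd_conv)
    qed simp
  qed
qed

end

definition growth_steps :: "real \<Rightarrow> nat \<Rightarrow> nat" where
  "growth_steps g n = nat \<lceil>ln (real n) / ln (1 + g)\<rceil>"

lemma growth_steps:
  assumes "0 < g" "1 \<le> n"
  shows "real n \<le> (1 + g) ^ growth_steps g n" "real (growth_steps g n) \<le> ln (real n) / ln (1 + g) + 1"
proof -
  have l: "0 < ln (1 + g)" using assms by simp
  have "ln (real n) / ln (1 + g) \<le> real (growth_steps g n)" unfolding growth_steps_def by linarith
  hence "ln (real n) \<le> real (growth_steps g n) * ln (1 + g)" using l by (simp add: pos_divide_le_eq)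
  hence "exp (ln (real n)) \<le> exp (real (growth_steps g n) * ln (1 + g))" by simp
  thus "real n \<le> (1 + g) ^ growth_steps g n" using assms by (simp add: exp_of_nat_mult)
  have "0 \<le> ln (real n) / ln (1 + g)" using l assms by (intro divide_nonneg_pos) auto
  thus "real (growth_steps g n) \<le> ln (real n) / ln (1 + g) + 1" unfolding growth_steps_def by linarith
qed

context random_weights_seq
begin

abbreviation "forest_linked \<eta> \<kappa> h \<zeta> n \<omega> fs U T D \<equiv>
  (\<exists>u\<in>exploration.born D (\<eta> / n) (schedule (\<kappa> * ln (real n)) h n) U (Wn n \<omega>) ({1..n} - {s n, t n} - fst ` set fs)
    (Suc (growth_steps ((1 - \<zeta>) * h) n)) \<inter> ({1..n} - {s n, t n} - fst ` set fs).
  \<exists>v\<in>T. link (Wn n \<omega>) D (\<eta> / n) u v (\<kappa> * ln (real n) / n))"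

text \<open>When the earlier paths cost at most \<open>4 * k * K / n\<close> in total, at most
  \<open>4 * K^2 / \<eta>\<close> of their edges weigh \<open>\<eta> / n\<close> or more. The lower
  bound on \<open>a\<close> makes this a small fraction of \<open>a\<close>.\<close>

abbreviation "forests_link \<eta> \<kappa> h \<zeta> \<gamma> C n \<omega> \<equiv>
  \<forall>k K a. real k \<le> real n powr \<gamma> \<longrightarrow> K = real k + ln (real n) \<longrightarrow> C * K\<^sup>2 \<le> real a \<longrightarrow> real a \<le> K ^ 3 \<longrightarrow>
    (\<forall>fs U T D. forest n {s n, t n} fs \<longrightarrow> length fs = 2 * a \<longrightarrow> (\<forall>e\<in>forest_edges fs. 0 \<le> W n e \<omega> \<and> W n e \<omega> \<le> 2 * K / n) \<longrightarrow>
       U \<subseteq> fst ` set fs \<longrightarrow> T \<subseteq> fst ` set fs \<longrightarrow> U \<inter> T = {} \<longrightarrow> card U = a \<longrightarrow> card T = a \<longrightarrow>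
       D \<subseteq> complete_edges n \<longrightarrow> real (card D) \<le> 4 * K\<^sup>2 / \<eta> \<longrightarrow> forest_linked \<eta> \<kappa> h \<zeta> n \<omega> fs U T D)"

lemma whp_connect:
  fixes \<zeta> h \<eta> \<kappa>1 c0 \<gamma> C :: real
  assumes \<zeta>: "0 < \<zeta>" "\<zeta> \<le> 1/2" and h: "0 < h" "h \<le> 1" and \<eta>: "0 < \<eta>" "\<eta> \<le> \<zeta> * h / 16" and \<kappa>1: "0 < \<kappa>1"
    and c0: "0 < c0" "c0 \<le> 1 / 16" "c0 \<le> h * \<zeta>\<^sup>2 / 4096" "c0 \<le> \<eta> / 8"
    and \<gamma>: "0 < \<gamma>" "\<gamma> \<le> 1 / 10" "80 * \<gamma> \<le> c0 * \<kappa>1"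
    and C: "4 / \<eta>\<^sup>2 \<le> C" "48 / (\<eta> * (c0 * \<kappa>1)) \<le> C"
  shows "whp (\<lambda>n \<omega>. forests_link \<eta> \<kappa>1 h \<zeta> \<gamma> C n \<omega>)"
proof (rule whpI)
  define g where "g = (1 - \<zeta>) * h"
  have g0: "0 < g" using \<zeta> h by (simp add: g_def)
  hence lg0: "0 < ln (1 + g)" by simp
  have C0: "0 < C" using C(1) \<eta> by (meson divide_pos_pos less_le_trans zero_less_numeral zero_less_power)
  let ?p = "\<lambda>n. (real n + 1) ^ 2 * (1 / real n ^ 4)"
  show "?p \<longlonglongrightarrow> 0" by real_asymp
  have Kbig: "\<forall>\<^sub>F n in sequentially. \<forall>k :: nat. 32 \<le> real k + ln (real n) \<and> 32 \<le> C * (real k + ln (real n))\<^sup>2 \<and> 10 \<le> c0 * \<kappa>1 * (C * (real k + ln (real n))\<^sup>2)"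
  proof (rule eventually_all_k)
    have "\<forall>\<^sub>F K in at_top. 32 \<le> C * (K::real)\<^sup>2" using C0 by real_asymp
    moreover have "\<forall>\<^sub>F K in at_top. 10 \<le> c * (C * (K::real)\<^sup>2)" if "c > 0" for c using C0 that by real_asymp
    ultimately show "\<forall>\<^sub>F K in at_top. 32 \<le> K \<and> 32 \<le> C * (K::real)\<^sup>2 \<and> 10 \<le> c0 * \<kappa>1 * (C * K\<^sup>2)"
      using eventually_ge_at_top[of "32::real"] c0 \<kappa>1 by (intro eventually_conj) auto
  qed
  have n1: "\<forall>\<^sub>F n in sequentially. 1 \<le> \<kappa>1 * ln (real n)" using \<kappa>1 by real_asymp
  have n2: "\<forall>\<^sub>F n in sequentially. \<kappa>1 * ln (real n) * (2 * real n powr (1 / 10)) ^ 3 \<le> real n" using \<kappa>1 by real_asymp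
  have n3: "\<forall>\<^sub>F n in sequentially. 2 + 2 * (2 * real n powr (1 / 10)) ^ 3 \<le> \<eta> * real n" using \<eta>(1) by real_asymp
  have n4: "\<forall>\<^sub>F n in sequentially. \<kappa>1 * ln (real n) + (ln (real n) / ln (1 + g) + 1) * h \<le> real n"
  proof -
    have "\<forall>\<^sub>F n in sequentially. \<kappa>1 * ln (real n) + (ln (real n) / x + 1) * h \<le> real n" if "x > 0" for x
      using that \<kappa>1 h(1) by real_asymp
    thus ?thesis using lg0 by blast
  qed
  have n5: "\<forall>\<^sub>F n in sequentially. ln (real n) / ln (1 + g) + 1 + 2 \<le> real n"
  proof -
    have "\<forall>\<^sub>F n in sequentially. ln (real n) / x + 1 + 2 \<le> real n" if "x > 0" for x using that by real_asymp
    thus ?thesis using lg0 by blast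
  qed
  have n6: "\<forall>\<^sub>F n in sequentially. 4 * real n powr (1 / 10) \<le> real n" by real_asymp
  show "\<forall>\<^sub>F n in sequentially. prob_le n (\<lambda>\<omega>. \<not> forests_link \<eta> \<kappa>1 h \<zeta> \<gamma> C n \<omega>) (?p n)"
    using Kbig n1 n2 n3 n4 n5 n6 eventually_small_K[OF \<gamma>(1,2)] eventually_ge_at_top[of 2]
  proof eventually_elim
    case (elim n)
    let ?K = "\<lambda>k :: nat. real k + ln (real n)" and ?J = "growth_steps g n" and ?\<kappa> = "\<kappa>1 * ln (real n)"
    define m where "m k = nat \<lfloor>4 * (?K k)\<^sup>2 / \<eta>\<rfloor>" for k
    define X where "X a k fs = {U. U \<subseteq> fst ` set fs \<and> card U = a} \<times> {T. T \<subseteq> fst ` set fs \<and> card T = a} \<times> {D. D \<subseteq> complete_edges n \<and> card D \<le> m k}"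
      for a k and fs :: "(nat \<times> nat) list"
    define Bad where "Bad k a \<omega> \<longleftrightarrow> (\<exists>fs x. forest n {s n, t n} fs \<and> length fs = 2 * a \<and> x \<in> X a k fs \<and> light n fs (2 * ?K k / n) \<omega> \<and>
        (case x of (U, T, D) \<Rightarrow> U \<inter> T = {} \<and> \<not> forest_linked \<eta> \<kappa>1 h \<zeta> n \<omega> fs U T D))" for k a \<omega>
    let ?I = "{(k, a). k \<le> n \<and> a \<le> n \<and> real k \<le> real n powr \<gamma> \<and> C * (?K k)\<^sup>2 \<le> real a \<and> real a \<le> ?K k ^ 3}"
    have stn: "{s n, t n} \<subseteq> {1..n}" "card {s n, t n} = 2" using st[OF elim(9)] by auto
    have n0: "real n > 0" using elim(9) by simp
    have L0: "0 < ln (real n)" using elim(9) by simp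
    have gs: "real n \<le> (1 + g) ^ ?J" "real ?J \<le> ln (real n) / ln (1 + g) + 1" using growth_steps[OF g0, of n] elim(9) by auto
    have one: "prob_le n (Bad k a) (1 / real n ^ 4)" if ka: "(k, a) \<in> ?I" for k a
    proof -
      define kk where "kk = ?K k"
      have a: "real k \<le> real n powr \<gamma>" "C * kk\<^sup>2 \<le> real a" "real a \<le> kk ^ 3" using ka by (auto simp: kk_def)
      have K: "32 \<le> kk" "32 \<le> C * kk\<^sup>2" "10 \<le> c0 * \<kappa>1 * (C * kk\<^sup>2)" using elim(1) by (auto simp: kk_def)
      have K': "kk \<le> 2 * real n powr (1 / 10)" "kk \<le> real n powr (2 * \<gamma>)" using elim(8) a(1) by (auto simp: kk_def)
      have K0: "0 < kk" using K by linarith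
      have a3: "real a \<le> (2 * real n powr (1 / 10)) ^ 3"
        using a(3) power_mono[OF K'(1), of 3] K0 by linarith
      have c1: "0 < c0 * \<kappa>1" using c0 \<kappa>1 by simp
      have lnK: "ln kk \<le> 2 * \<gamma> * ln (real n)"
      proof -
        have "ln kk \<le> ln (real n powr (2 * \<gamma>))" using K' K0 n0 by (subst ln_le_cancel_iff) auto
        thus ?thesis using n0 by (simp add: ln_powr)
      qed
      have mk: "real (m k) \<le> 4 * kk\<^sup>2 / \<eta>" unfolding m_def kk_def[symmetric] using \<eta> K0 by (simp add: of_nat_floor)
      have m1: "real (m k) \<le> \<eta> * real a"
      proof -
        have "4 * kk\<^sup>2 / \<eta> = \<eta> * (4 / \<eta>\<^sup>2 * kk\<^sup>2)" using \<eta> by (simp add: power2_eq_square field_simps)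
        also have "\<dots> \<le> \<eta> * (C * kk\<^sup>2)" using C \<eta> by (intro mult_left_mono mult_right_mono) auto
        also have "\<dots> \<le> \<eta> * real a" using a \<eta> by (intro mult_left_mono) auto
        finally show ?thesis using mk by linarith
      qed
      have m2: "12 * real (m k) \<le> (c0 * \<kappa>1) * real a"
      proof -
        have "12 * (4 * kk\<^sup>2 / \<eta>) = (c0 * \<kappa>1) * (48 / (\<eta> * (c0 * \<kappa>1)) * kk\<^sup>2)" using \<eta> c1 c0 \<kappa>1 by (simp add: field_simps)
        also have "\<dots> \<le> (c0 * \<kappa>1) * (C * kk\<^sup>2)" using C c1 by (intro mult_left_mono mult_right_mono) auto
        also have "\<dots> \<le> (c0 * \<kappa>1) * real a" using a c1 by (intro mult_left_mono) auto
        finally show ?thesis using mk by linarith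
      qed
      have a10: "10 \<le> (c0 * \<kappa>1) * real a"
      proof -
        have "c0 * \<kappa>1 * (C * kk\<^sup>2) \<le> (c0 * \<kappa>1) * real a" using a c1 by (intro mult_left_mono) auto
        thus ?thesis using K(3) by linarith
      qed
      have k1: "2 * kk \<le> real n" using K'(1) elim(7) by linarith
      have "prob_le n (Bad k a) ((real (n * (2 + 2 * a)) * (2 * kk / n)) ^ (2 * a) * (4 ^ a * (4 ^ a * (real n ^ 2 + 1) ^ m k)) * (real (?J + 2) * exp (- c0 * (real a * ?\<kappa>))))"
        unfolding Bad_def X_def kk_def[symmetric] g_def
      proof (rule forest_connection[OF stn _ _ \<zeta> h \<eta>])
        show "0 \<le> 2 * kk / n" "2 * kk / n \<le> 1" using K0 n0 k1 by auto
        show "1 \<le> ?\<kappa>" by (rule elim(2))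
        have "?\<kappa> * real a \<le> ?\<kappa> * (2 * real n powr (1 / 10)) ^ 3" using a3 elim(2) by (intro mult_left_mono) auto
        thus "?\<kappa> * real a \<le> real n" using elim(3) by linarith
        have "1 * 32 \<le> ?\<kappa> * real a" using elim(2) a(2) K(2) by (intro mult_mono) auto
        thus "32 \<le> ?\<kappa> * real a" by simp
        show "2 + 2 * real a \<le> \<eta> * real n" using a3 elim(4) by linarith
        show "real (m k) \<le> \<eta> * real a" by (rule m1)
        show "real n \<le> (1 + (1 - \<zeta>) * h) ^ growth_steps ((1 - \<zeta>) * h) n" using gs(1) by (simp add: g_def)
        have "real ?J * h \<le> (ln (real n) / ln (1 + g) + 1) * h" using gs(2) h by (intro mult_right_mono) auto
        thus "?\<kappa> + real (growth_steps ((1 - \<zeta>) * h) n) * h \<le> real n" using elim(5) by (simp add: g_def)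
      qed (use c0 in auto)
      moreover have "(real (n * (2 + 2 * a)) * (2 * kk / n)) ^ (2 * a) * (4 ^ a * (4 ^ a * (real n ^ 2 + 1) ^ m k)) * (real (?J + 2) * exp (- c0 * (real a * ?\<kappa>))) \<le> 1 / real n ^ 4"
      proof -
        have "real (n * (2 + 2 * a)) * (2 * x / n) = 2 * x * (2 + 2 * real a)" for x using n0 by (simp add: field_simps)
        note this[of kk]
        moreover have "- c0 * (real a * ?\<kappa>) = - (c0 * \<kappa>1 * real a * ln (real n))" by simp
        moreover have "real (?J + 2) \<le> real n" using gs(2) elim(6) by simp
        ultimately show ?thesis
          using connect_bound[OF K(1) lnK a(3) refl elim(9) \<gamma>(3) m2 c1 a10, of ?J] by (simp only:)
      qed
      ultimately show ?thesis by (rule prob_le_weaken)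
    qed
    have I: "finite ?I" "real (card ?I) \<le> (real n + 1)\<^sup>2"
    proof -
      have sub: "?I \<subseteq> {..n} \<times> {..n}" by auto
      thus "finite ?I" by (rule finite_subset) auto
      have "card ?I \<le> card ({..n} \<times> {..n})" by (rule card_mono[OF _ sub]) auto
      hence "real (card ?I) \<le> real ((n + 1) * (n + 1))" by (intro of_nat_mono) (simp add: card_cartesian_product)
      thus "real (card ?I) \<le> (real n + 1)\<^sup>2" by (simp add: power2_eq_square algebra_simps)
    qed
    have "prob_le n (\<lambda>\<omega>. \<exists>i\<in>?I. Bad (fst i) (snd i) \<omega>) (?p n)"
    proof (rule prob_le_bex_const[OF I(1) _ I(2)])
      show "prob_le n (Bad (fst i) (snd i)) (1 / real n ^ 4)" if "i \<in> ?I" for i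
        using one[of "fst i" "snd i"] that by simp
    qed simp
    thus ?case
    proof (rule prob_le_mono)
      fix \<omega> assume "\<not> forests_link \<eta> \<kappa>1 h \<zeta> \<gamma> C n \<omega>"
      then obtain k a fs U T D where *: "real k \<le> real n powr \<gamma>" "C * (?K k)\<^sup>2 \<le> real a" "real a \<le> ?K k ^ 3"
        "forest n {s n, t n} fs" "length fs = 2 * a" "\<forall>e\<in>forest_edges fs. 0 \<le> W n e \<omega> \<and> W n e \<omega> \<le> 2 * ?K k / n"
        "U \<subseteq> fst ` set fs" "T \<subseteq> fst ` set fs" "U \<inter> T = {}" "card U = a" "card T = a" "D \<subseteq> complete_edges n" "real (card D) \<le> 4 * (?K k)\<^sup>2 / \<eta>"
        "\<not> forest_linked \<eta> \<kappa>1 h \<zeta> n \<omega> fs U T D"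
        by blast
      have "2 * a = card (fst ` set fs)" using forest_verts[OF *(4)] *(5) by simp
      also have "\<dots> \<le> n" using card_mono[of "{1..n}" "fst ` set fs"] forest_verts[OF *(4)] by auto
      finally have "a \<le> n" by simp
      hence I: "(k, a) \<in> ?I" using *(1-3) elim(8) by auto
      have "card D \<le> m k" unfolding m_def using *(13) by (simp add: le_nat_floor)
      hence "(U, T, D) \<in> X a k fs" unfolding X_def using *(7-12) by blast
      moreover have "light n fs (2 * ?K k / n) \<omega>" unfolding light_def using *(6) .
      ultimately have "Bad k a \<omega>" unfolding Bad_def using *(4,5,9,14)
        by (intro exI[of _ fs] exI[of _ "(U, T, D)"]) (simp only: prod.case simp_thms)
      thus "\<exists>i\<in>?I. Bad (fst i) (snd i) \<omega>" by (intro bexI[OF _ I]) (simp only: fst_conv snd_conv)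
    qed simp
  qed
qed

abbreviation "sets_expand d \<gamma> n \<omega> \<equiv>
  \<forall>k y U B. real n powr \<gamma> \<le> real k \<longrightarrow> k \<le> n \<longrightarrow> y = d * real k / n \<longrightarrow>
    U \<subseteq> {1..n} - {s n, t n} \<longrightarrow> B \<subseteq> {1..n} - {s n, t n} \<longrightarrow> U \<inter> B = {} \<longrightarrow> U \<noteq> {} \<longrightarrow>
    real (card U + card B) * ln (real n + 1) \<le> real (card U) * real n * y / 128 \<longrightarrow> 8 * (card U + card B) \<le> 7 * n \<longrightarrow>
    real (card U) * real n * y / 64 \<le> real (card {e \<in> between U ({1..n} - {s n, t n} - U - B). y \<le> W n e \<omega> \<and> W n e \<omega> \<le> 2 * y})"

lemma whp_window:
  assumes d: "0 < d" "2 * d \<le> 1" and \<gamma>: "0 < \<gamma>"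
  shows "whp (\<lambda>n \<omega>. sets_expand d \<gamma> n \<omega>)"
proof (rule whpI)
  let ?p = "\<lambda>n. (real n + 1) * ((real n + 1)\<^sup>2 * exp (- (d * real n powr \<gamma> / 128)))"
  show "?p \<longlonglongrightarrow> 0" using d(1) \<gamma> by real_asymp
  show "\<forall>\<^sub>F n in sequentially. prob_le n (\<lambda>\<omega>. \<not> sets_expand d \<gamma> n \<omega>) (?p n)"
    using eventually_ge_at_top[of 32]
  proof eventually_elim
    case (elim n)
    have stn: "{s n, t n} \<subseteq> {1..n}" "card {s n, t n} = 2" using st[of n] elim by auto
    have n0: "real n > 0" using elim by simp
    let ?Bad = "\<lambda>y \<omega>. \<exists>U B. U \<subseteq> {1..n} - {s n, t n} \<and> B \<subseteq> {1..n} - {s n, t n} \<and> U \<inter> B = {} \<and> U \<noteq> {} \<and>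
      real (card U + card B) * ln (real n + 1) \<le> real (card U) * real n * y / 128 \<and> 8 * (card U + card B) \<le> 7 * n \<and>
      real (card {e \<in> between U ({1..n} - {s n, t n} - U - B). y \<le> W n e \<omega> \<and> W n e \<omega> \<le> 2 * y}) < real (card U) * real n * y / 64"
    let ?I = "{k. k \<le> n \<and> real n powr \<gamma> \<le> real k}"
    have "prob_le n (\<lambda>\<omega>. \<exists>k\<in>?I. ?Bad (d * real k / n) \<omega>) (?p n)"
    proof (rule prob_le_bex_const)
      fix k assume k: "k \<in> ?I"
      show "prob_le n (?Bad (d * real k / n)) ((real n + 1)\<^sup>2 * exp (- (d * real n powr \<gamma> / 128)))"
      proof (rule prob_le_weaken[OF set_expansion[OF stn _ _ elim]])
        show "0 \<le> d * real k / n" using d by simp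
        have "(2 * d) * real k \<le> 1 * real n" using k d by (intro mult_mono) auto
        thus "2 * (d * real k / n) \<le> 1" using n0 by simp
        have "d * real n powr \<gamma> \<le> d * real k" using k d by (intro mult_left_mono) auto
        thus "(real n + 1)\<^sup>2 * exp (- (real n * (d * real k / n) / 128)) \<le> (real n + 1)\<^sup>2 * exp (- (d * real n powr \<gamma> / 128))"
          using n0 by (intro mult_left_mono) auto
      qed
    next
      have "card ?I \<le> card {..n}" by (intro card_mono) auto
      thus "real (card ?I) \<le> real n + 1" by simp
    qed auto
    thus ?case
    proof (rule prob_le_mono)
      fix \<omega> assume "\<not> sets_expand d \<gamma> n \<omega>"
      then obtain k where k: "k \<in> ?I" "?Bad (d * real k / n) \<omega>" unfolding not_all not_imp not_le by blast
      thus "\<exists>k\<in>?I. ?Bad (d * real k / n) \<omega>" by blast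
    qed simp
  qed
qed

abbreviation "no_cheap_path C \<epsilon> n \<omega> \<equiv>
  (\<forall>q. distinct q \<longrightarrow> set q \<subseteq> {1..n} - {s n, t n} \<longrightarrow> 2 \<le> length q \<longrightarrow>
      0 \<le> W n {s n, hd q} \<omega> \<longrightarrow> W n {s n, hd q} \<omega> \<le> C * ln (real n) / n \<longrightarrow> 0 \<le> W n {last q, t n} \<omega> \<longrightarrow> W n {last q, t n} \<omega> \<le> C * ln (real n) / n \<longrightarrow>
      (\<forall>e\<in>path_edges q. 0 \<le> W n e \<omega>) \<longrightarrow> (1 - \<epsilon>) * ln (real n) / n < path_cost (Wn n \<omega>) q) \<and>
    (\<forall>u\<in>{1..n} - {s n, t n}. 0 \<le> W n {s n, u} \<omega> \<longrightarrow> W n {s n, u} \<omega> \<le> C * ln (real n) / n \<longrightarrow> 0 \<le> W n {u, t n} \<omega> \<longrightarrow>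
      C * ln (real n) / n < W n {u, t n} \<omega>) \<and>
    (0 \<le> W n {s n, t n} \<omega> \<longrightarrow> C * ln (real n) / n < W n {s n, t n} \<omega>)"

text \<open>\<open>cheap_middle\<close> is applied with l = (1 + \<epsilon>) n and z = (1 -
  \<epsilon>) ln n / n. Then exp(l z) = n^(1 - \<epsilon>^2), and after division by the remaining
  power of n the bound is of order (ln n)^2 n^(-\<epsilon>^2), the squared logarithm coming from the
  two end edges.\<close>

lemma whp_no_cheap:
  assumes C: "0 < C" and \<epsilon>: "0 < \<epsilon>" "\<epsilon> < 1"
  shows "whp (\<lambda>n \<omega>. no_cheap_path C \<epsilon> n \<omega>)"
proof (rule whpI)
  let ?x = "\<lambda>n. C * ln (real n) / real n" and ?l = "\<lambda>n. (1 + \<epsilon>) * real n" and ?z = "\<lambda>n. (1 - \<epsilon>) * ln (real n) / real n"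
  let ?p = "\<lambda>n. C\<^sup>2 / \<epsilon> * ((ln (real n))\<^sup>2 * real n powr (- (\<epsilon>\<^sup>2))) + (real n * (?x n)\<^sup>2 + ?x n)"
  have "(\<lambda>n. C\<^sup>2 / \<epsilon> * ((ln (real n))\<^sup>2 * real n powr (- (\<epsilon>\<^sup>2)))) \<longlonglongrightarrow> C\<^sup>2 / \<epsilon> * 0"
  proof (rule tendsto_mult_left)
    have "((\<lambda>n. (ln (real n))\<^sup>2 * real n powr (- c)) \<longlongrightarrow> 0) sequentially" if "c > 0" for c :: real using that by real_asymp
    thus "(\<lambda>n. (ln (real n))\<^sup>2 * real n powr (- (\<epsilon>\<^sup>2))) \<longlonglongrightarrow> 0" using \<epsilon> by simp
  qed
  moreover have "(\<lambda>n. real n * (?x n)\<^sup>2 + ?x n) \<longlonglongrightarrow> 0" using C by real_asymp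
  ultimately have "?p \<longlonglongrightarrow> C\<^sup>2 / \<epsilon> * 0 + 0" by (rule tendsto_add)
  thus "?p \<longlonglongrightarrow> 0" by simp
  have x1: "\<forall>\<^sub>F n in sequentially. ?x n \<le> 1" using C by real_asymp
  show "\<forall>\<^sub>F n in sequentially. prob_le n (\<lambda>\<omega>. \<not> no_cheap_path C \<epsilon> n \<omega>) (?p n)"
    using x1 eventually_ge_at_top[of 2]
  proof eventually_elim
    case (elim n)
    have n0: "real n > 0" using elim by simp
    have L0: "0 \<le> ln (real n)" using elim by simp
    have x0: "0 \<le> ?x n" using C L0 n0 by simp
    have stn: "s n \<in> {1..n}" "t n \<in> {1..n}" "s n \<noteq> t n" using st[OF elim(2)] by auto
    have e: "{s n, t n} \<in> complete_edges n" using stn by (simp add: doubleton_complete_edges_iff)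
    have l: "real n < ?l n" using \<epsilon> n0 by simp
    have eq: "(?x n)\<^sup>2 * exp (?l n * ?z n) * (real n)\<^sup>2 / (?l n - real n) = C\<^sup>2 / \<epsilon> * ((ln (real n))\<^sup>2 * real n powr (- (\<epsilon>\<^sup>2)))"
    proof -
      have "?l n * ?z n = (1 - \<epsilon>\<^sup>2) * ln (real n)" using n0 by (simp add: power2_eq_square field_simps)
      hence "exp (?l n * ?z n) = real n powr (1 - \<epsilon>\<^sup>2)" using n0 by (simp add: powr_def)
      also have "\<dots> = real n * real n powr (- (\<epsilon>\<^sup>2))" using n0 by (simp add: powr_add[of "real n" 1 "- (\<epsilon>\<^sup>2)", simplified])
      finally have E: "exp (?l n * ?z n) = real n * real n powr (- (\<epsilon>\<^sup>2))" .
      have "?l n - real n = \<epsilon> * real n" by (simp add: algebra_simps)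
      thus ?thesis unfolding E using n0 \<epsilon> by (simp add: power2_eq_square)
    qed
    show ?case
    proof (rule prob_le_mono[OF prob_le_disj[OF cheap_middle[OF stn x0 elim(1) l, of "?z n", unfolded eq] prob_le_disj[OF cheap_two_paths[OF stn x0 elim(1)] cheap_edge[OF e x0 elim(1)]]]])
      fix \<omega> assume "\<not> no_cheap_path C \<epsilon> n \<omega>"
      thus "(\<exists>q. distinct q \<and> set q \<subseteq> {1..n} - {s n, t n} \<and> 2 \<le> length q \<and>
      0 \<le> W n {s n, hd q} \<omega> \<and> W n {s n, hd q} \<omega> \<le> ?x n \<and> 0 \<le> W n {last q, t n} \<omega> \<and> W n {last q, t n} \<omega> \<le> ?x n \<and>
      (\<forall>e\<in>path_edges q. 0 \<le> W n e \<omega>) \<and> (\<Sum>e\<in>path_edges q. W n e \<omega>) \<le> ?z n) \<or>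
      (\<exists>u\<in>{1..n} - {s n, t n}. 0 \<le> W n {s n, u} \<omega> \<and> W n {s n, u} \<omega> \<le> ?x n \<and> 0 \<le> W n {u, t n} \<omega> \<and> W n {u, t n} \<omega> \<le> ?x n) \<or>
      (0 \<le> W n {s n, t n} \<omega> \<and> W n {s n, t n} \<omega> \<le> ?x n)"
        unfolding path_cost_def not_le[symmetric] by blast
    qed simp
  qed
qed

end

section \<open>Reconnecting the terminals\<close>

context nonneg_weights
begin

lemma grown_mono_light: "grown D s t Y a c \<Longrightarrow> Y \<le> Y' \<Longrightarrow> grown D s t Y' a c"
proof -
  assume g: "grown D s t Y a c" and Y: "Y \<le> Y'"
  from g obtain fs U T where *: "forest n {s, t} fs" "length fs = 2 * a" "\<forall>e\<in>forest_edges fs. 0 \<le> w e \<and> w e \<le> Y"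
    "U \<subseteq> fst ` set fs" "T \<subseteq> fst ` set fs" "U \<inter> T = {}" "card U = a" "card T = a"
    "\<forall>u\<in>U. conn w D n c s u" "\<forall>v\<in>T. conn w D n c t v"
    unfolding grown_def by (elim exE conjE) (rule that; assumption)
  have "\<forall>e\<in>forest_edges fs. 0 \<le> w e \<and> w e \<le> Y'" using *(3) Y by force
  thus "grown D s t Y' a c" unfolding grown_def using *(1,2,4-10)
    by - (rule exI[of _ fs], rule exI[of _ U], rule exI[of _ T], intro conjI; assumption)
qed

text \<open>The sides grow to about \<delta> K, then (\<delta> K)^2 / 100, then (\<delta> K)^3 /
  10000 vertices. At most 4 K / \<delta> removed edges weigh \<delta> K / n or more, and about
  (\<delta> K)^2 / 16 new neighbours can spare that many once \<delta>^3 K is large. The third size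
  is for the link, which has to cope with removed edges down to a weight of order 1/n, possibly of
  order K^2 in number.\<close>

lemma small_k_path:
  fixes K L \<delta> C z :: real and k :: nat
  assumes st: "s \<in> {1..n}" "t \<in> {1..n}" "s \<noteq> t" and k: "1 \<le> k" and K: "K = real k + L" "0 \<le> L"
    and \<delta>: "0 < \<delta>" "\<delta> \<le> 1 / 100" and big: "200 \<le> \<delta> ^ 3 * K" "20000 * C \<le> \<delta> ^ 3 * K"
    and star: "\<And>x. x \<in> {s, t} \<Longrightarrow> real k + 2 * \<delta> * K \<le> real (card {v \<in> {1..n} - {x}. w {x, v} \<le> (real k + 4 * \<delta> * K) / n})"
    and P: "disjoint_paths n s t P k" and cost: "(\<Sum>i\<in>{1..<k}. path_cost w (P i)) \<le> 4 * real k * K / n"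
    and expand: "\<And>a fs U. \<delta> * K / 2 \<le> real a \<Longrightarrow> real a \<le> K\<^sup>2 \<Longrightarrow> forest n {s, t} fs \<Longrightarrow> length fs = 2 * a \<Longrightarrow>
       \<forall>e\<in>forest_edges fs. 0 \<le> w e \<and> w e \<le> 2 * K / n \<Longrightarrow> U \<subseteq> fst ` set fs \<Longrightarrow> card U = a \<Longrightarrow>
       real a * (\<delta> * K) / 16 \<le> real (card {v \<in> {1..n} - {s, t} - fst ` set fs. \<exists>u\<in>U. \<delta> * K / n \<le> w {u, v} \<and> w {u, v} \<le> 2 * (\<delta> * K / n)})"
    and connect: "\<And>a fs U T. C * K\<^sup>2 \<le> real a \<Longrightarrow> real a \<le> K ^ 3 \<Longrightarrow> forest n {s, t} fs \<Longrightarrow> length fs = 2 * a \<Longrightarrow>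
       \<forall>e\<in>forest_edges fs. 0 \<le> w e \<and> w e \<le> 2 * K / n \<Longrightarrow> U \<subseteq> fst ` set fs \<Longrightarrow> T \<subseteq> fst ` set fs \<Longrightarrow> U \<inter> T = {} \<Longrightarrow>
       card U = a \<Longrightarrow> card T = a \<Longrightarrow> \<exists>u\<in>U. \<exists>v\<in>T. conn w (removed P k) n z u v"
  shows "conn w (removed P k) n (2 * ((real k + 4 * \<delta> * K) / n + 4 * (\<delta> * K / n)) + z) s t"
proof -
  let ?D = "removed P k"
  have n0: "real n > 0" using st by auto
  have d1: "\<delta> \<le> 1" using \<delta> by simp
  have d3: "\<delta> ^ 3 \<le> 1" using \<delta> by (intro power_le_one) auto
  have K0: "0 < K" using big(1) \<delta> by (metis not_le mult_nonneg_nonpos order.trans zero_le_power less_imp_le numeral_le_iff zero_less_numeral leD)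
  have K200: "200 \<le> K" using big(1) mult_right_mono[OF d3 less_imp_le[OF K0]] by linarith
  have dK: "200 \<le> \<delta> * K"
  proof -
    have "\<delta> ^ 3 \<le> \<delta> ^ 1" using \<delta> by (intro power_decreasing) auto
    from mult_right_mono[OF this less_imp_le[OF K0]] have "\<delta> ^ 3 * K \<le> \<delta> ^ 1 * K" .
    thus ?thesis using big(1) unfolding power_one_right by linarith
  qed
  have d2K: "200 \<le> \<delta>\<^sup>2 * K"
  proof -
    have "\<delta> ^ 3 \<le> \<delta> ^ 2" using \<delta> by (intro power_decreasing) auto
    from mult_right_mono[OF this less_imp_le[OF K0]] have "\<delta> ^ 3 * K \<le> \<delta> ^ 2 * K" .
    thus ?thesis using big(1) unfolding power_one_right by linarith
  qed
  define A where "A = \<delta> * K"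
  have A: "200 \<le> A" "A \<le> K" using dK d1 K0 by (auto simp: A_def)
  have heavy: "4 * K / \<delta> \<le> A\<^sup>2 / 50"
  proof -
    have "200 * K \<le> (\<delta> ^ 3 * K) * K" using big(1) K0 by (intro mult_right_mono) auto
    thus ?thesis using \<delta> by (simp add: A_def power2_eq_square power3_eq_cube field_simps)
  qed
  have A2: "A\<^sup>2 * 200 \<le> A ^ 3" using A by (simp add: power2_eq_square power3_eq_cube mult_left_mono)
  define a1 where "a1 = nat \<lfloor>A\<rfloor>"
  define b1 where "b1 = nat \<lfloor>A\<^sup>2 / 100\<rfloor>"
  define b2 where "b2 = nat \<lfloor>A ^ 3 / 10000\<rfloor>"
  define m where "m = card {e \<in> ?D. \<delta> * K / n \<le> w e}"
  have AA: "A * 200 \<le> A\<^sup>2" using A by (simp add: power2_eq_square)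
  have a1: "real a1 \<le> A" "A - 1 \<le> real a1" using A unfolding a1_def by linarith+
  have b1: "real b1 \<le> A\<^sup>2 / 100" "A\<^sup>2 / 100 - 1 \<le> real b1" using A AA unfolding b1_def by linarith+
  have b2: "real b2 \<le> A ^ 3 / 10000" "A ^ 3 / 10000 - 1 \<le> real b2" using A AA A2 unfolding b2_def by linarith+
  have nonD: "0 \<le> w e" if "e \<in> ?D" for e using removed_complete[OF P] that nonneg by blast
  have m: "real m \<le> 4 * K / \<delta>"
  proof -
    have "real m \<le> (4 * real k * K / n) / (\<delta> * K / n)"
      unfolding m_def using nonD sum_removed[OF P, of w] cost dK n0
      by (intro card_heavy_le) auto
    also have "\<dots> = 4 * real k / \<delta>" using n0 K0 \<delta> by simp
    also have "\<dots> \<le> 4 * K / \<delta>" using K \<delta> by (intro divide_right_mono) auto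
    finally show ?thesis .
  qed
  have K1: "real k \<le> K" using K by simp
  have Y0: "(real k + 4 * \<delta> * K) / n \<le> 2 * K / n"
  proof -
    have "\<delta> * K \<le> 1 / 100 * K" using \<delta> K0 by (intro mult_right_mono) auto
    hence "real k + 4 * \<delta> * K \<le> 2 * K" using K1 K0 by linarith
    thus ?thesis using n0 by (intro divide_right_mono) auto
  qed
  have "grown ?D s t ((real k + 4 * \<delta> * K) / n) a1 ((real k + 4 * \<delta> * K) / n)"
  proof (rule grown_init[OF st])
    show "0 \<le> (real k + 4 * \<delta> * K) / n" using K0 \<delta> by (intro divide_nonneg_nonneg) auto
    show "k + 2 * a1 \<le> card {v \<in> {1..n} - {x}. w {x, v} \<le> (real k + 4 * \<delta> * K) / n}" if "x \<in> {s, t}" for x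
    proof -
      have "real k + 2 * real a1 \<le> real k + 2 * \<delta> * K" using a1 by (simp add: A_def)
      hence "real (k + 2 * a1) \<le> real (card {v \<in> {1..n} - {x}. w {x, v} \<le> (real k + 4 * \<delta> * K) / n})" using star[OF that] by simp
      thus ?thesis by (simp only: of_nat_le_iff)
    qed
    show "finite {v. {x, v} \<in> ?D} \<and> card {v. {x, v} \<in> ?D} \<le> k - 1" if "x \<in> {s, t}" for x
      using card_star_removed[OF P st(3) k that] by simp
    show "k - 1 + 1 + 2 * a1 \<le> k + 2 * a1" using k by simp
  qed
  hence g1: "grown ?D s t (2 * K / n) a1 ((real k + 4 * \<delta> * K) / n)" by (rule grown_mono_light[OF _ Y0])
  have lo: "0 < \<delta> * K / n" "2 * (\<delta> * K / n) \<le> 2 * K / n" using n0 dK A by (auto simp: A_def divide_right_mono)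
  have fD: "finite ?D" "card {e \<in> ?D. \<delta> * K / n \<le> w e} \<le> m" by (auto simp: m_def)
  have g2: "grown ?D s t (2 * K / n) (a1 + b1) ((real k + 4 * \<delta> * K) / n + 2 * (\<delta> * K / n))"
  proof (rule grown_step[OF g1 st(1,2) lo fD order_refl])
    fix fs U assume fs: "forest n {s, t} fs" "length fs = 2 * a1" "\<forall>e\<in>forest_edges fs. 0 \<le> w e \<and> w e \<le> 2 * K / n" "U \<subseteq> fst ` set fs" "card U = a1"
    have "real m + 2 * real b1 \<le> A\<^sup>2 / 50 + A\<^sup>2 / 50" using m heavy b1 by linarith
    also have "\<dots> \<le> (A - 1) * A / 16"
    proof -
      have "(A - 1) * A / 16 = (A\<^sup>2 - A) / 16" by (simp add: power2_eq_square algebra_simps)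
      thus ?thesis using AA A by simp
    qed
    also have "\<dots> \<le> real a1 * A / 16" using a1 A by (intro divide_right_mono mult_right_mono) auto
    also have "\<dots> \<le> real (card {v \<in> {1..n} - {s, t} - fst ` set fs. \<exists>u\<in>U. \<delta> * K / n \<le> w {u, v} \<and> w {u, v} \<le> 2 * (\<delta> * K / n)})"
      unfolding A_def
    proof (rule expand[OF _ _ fs])
      show "\<delta> * K / 2 \<le> real a1" using a1 A by (simp add: A_def)
      have "real a1 \<le> K * 1" using a1 A by simp
      also have "\<dots> \<le> K * K" using K200 by (intro mult_left_mono) auto
      finally show "real a1 \<le> K\<^sup>2" by (simp add: power2_eq_square)
    qed
    finally have "real (m + 2 * b1) \<le> real (card {v \<in> {1..n} - {s, t} - fst ` set fs. \<exists>u\<in>U. \<delta> * K / n \<le> w {u, v} \<and> w {u, v} \<le> 2 * (\<delta> * K / n)})" by simp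
    thus "m + 2 * b1 \<le> card {v \<in> {1..n} - {s, t} - fst ` set fs. \<exists>u\<in>U. \<delta> * K / n \<le> w {u, v} \<and> w {u, v} \<le> 2 * (\<delta> * K / n)}" by (simp only: of_nat_le_iff)
  qed
  have AK2: "A\<^sup>2 \<le> K\<^sup>2" and AK3: "A ^ 3 \<le> K ^ 3" using A by (auto intro: power_mono)
  have KK: "K * 200 \<le> K\<^sup>2" "K\<^sup>2 * 200 \<le> K ^ 3" using K200 by (auto simp: power2_eq_square power3_eq_cube)
  have g3: "grown ?D s t (2 * K / n) (a1 + b1 + b2) ((real k + 4 * \<delta> * K) / n + 2 * (\<delta> * K / n) + 2 * (\<delta> * K / n))"
  proof (rule grown_step[OF g2 st(1,2) lo fD order_refl])
    fix fs U assume fs: "forest n {s, t} fs" "length fs = 2 * (a1 + b1)" "\<forall>e\<in>forest_edges fs. 0 \<le> w e \<and> w e \<le> 2 * K / n" "U \<subseteq> fst ` set fs" "card U = a1 + b1"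
    have "real m + 2 * real b2 \<le> A\<^sup>2 / 50 + A ^ 3 / 5000" using m heavy b2 by linarith
    also have "\<dots> \<le> (A\<^sup>2 / 100 + (A - 2)) * A / 16"
    proof -
      have "(A\<^sup>2 / 100 + (A - 2)) * A / 16 = A ^ 3 / 1600 + (A\<^sup>2 - 2 * A) / 16" by (simp add: power2_eq_square power3_eq_cube field_simps)
      moreover have "p / 50 + q / 5000 \<le> q / 1600 + (p - 2 * x) / 16" if "p * 200 \<le> q" "x * 200 \<le> p" "200 \<le> x" for p q x :: real
        using that by (simp add: field_simps)
      ultimately show ?thesis using A2 AA A(1) by (simp only:)
    qed
    also have "\<dots> \<le> real (a1 + b1) * A / 16" using a1 b1 A by (intro divide_right_mono mult_right_mono) auto
    also have "\<dots> \<le> real (card {v \<in> {1..n} - {s, t} - fst ` set fs. \<exists>u\<in>U. \<delta> * K / n \<le> w {u, v} \<and> w {u, v} \<le> 2 * (\<delta> * K / n)})"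
      unfolding A_def
    proof (rule expand[OF _ _ fs])
      show "\<delta> * K / 2 \<le> real (a1 + b1)" using a1 A by (simp add: A_def)
      show "real (a1 + b1) \<le> K\<^sup>2" unfolding of_nat_add using a1 b1 A AK2 KK by linarith
    qed
    finally have "real (m + 2 * b2) \<le> real (card {v \<in> {1..n} - {s, t} - fst ` set fs. \<exists>u\<in>U. \<delta> * K / n \<le> w {u, v} \<and> w {u, v} \<le> 2 * (\<delta> * K / n)})" by simp
    thus "m + 2 * b2 \<le> card {v \<in> {1..n} - {s, t} - fst ` set fs. \<exists>u\<in>U. \<delta> * K / n \<le> w {u, v} \<and> w {u, v} \<le> 2 * (\<delta> * K / n)}" by (simp only: of_nat_le_iff)
  qed
  have "conn w ?D n (2 * ((real k + 4 * \<delta> * K) / n + 2 * (\<delta> * K / n) + 2 * (\<delta> * K / n)) + z) s t"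
  proof (rule grown_connect[OF g3 connect])
    have "C * K\<^sup>2 * 20000 \<le> A ^ 3"
    proof -
      have "20000 * C * K\<^sup>2 \<le> \<delta> ^ 3 * K * K\<^sup>2" using big(2) by (intro mult_right_mono) auto
      thus ?thesis by (simp add: A_def power_mult_distrib power2_eq_square power3_eq_cube mult_ac)
    qed
    thus "C * K\<^sup>2 \<le> real (a1 + b1 + b2)" unfolding of_nat_add using b2 A2 AA A a1 by linarith
    show "real (a1 + b1 + b2) \<le> K ^ 3" unfolding of_nat_add using a1 b1 b2 A AK2 AK3 KK K200 by linarith
  qed
  thus ?thesis by (simp add: algebra_simps)
qed

lemma exploration_conn:
  assumes expl: "exploration lo tau" and U: "U \<subseteq> {1..n}" and V: "V \<subseteq> {1..n}" and T: "T \<subseteq> {1..n}" "T \<inter> V = {}"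
    and D: "\<And>e. e \<notin> D' \<Longrightarrow> lo \<le> w e \<Longrightarrow> e \<notin> D"
    and hit: "\<exists>u\<in>exploration.born D' lo tau U w V j \<inter> V. \<exists>v\<in>T. link w D' lo u v x"
  shows "\<exists>u\<in>U. \<exists>v\<in>T. conn w D n (tau j - tau 0 + x) u v"
proof -
  interpret exploration D' lo tau U by (rule expl)
  obtain u v where uv: "u \<in> born w V j" "u \<in> V" "v \<in> T" "link w D' lo u v x" using hit by blast
  have "u \<in> U \<union> V" "bir w V j u \<le> j" using uv by (auto simp: born_def)
  from born_conn[OF expl _ D this] obtain r where r: "r \<in> U" "conn w D n (tau (bir w V j u) - tau 0) r u" using U V by blast
  have "tau (bir w V j u) \<le> tau j" using \<open>bir w V j u \<le> j\<close> tau by (auto simp: mono_def)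
  hence "conn w D n (tau j - tau 0) r u" by (intro conn_mono[OF r(2)]) auto
  hence "conn w D n (tau j - tau 0 + x) r v"
    using uv T D by (intro conn_extend) (auto simp: link_def)
  thus ?thesis using r uv by blast
qed

end

text \<open>Growth by factors 1 + g in steps of length h reaches n after time h ln n / ln(1 + g).
  With both parameters equal to \<epsilon>/16, discretisation costs at most a factor 1 +
  \<epsilon>/4, because ln(1 + g) is at least g - g^2.\<close>

lemma growth_rate:
  fixes \<epsilon> :: real
  assumes "0 < \<epsilon>" "\<epsilon> \<le> 1"
  shows "\<epsilon> / 16 \<le> (1 + \<epsilon> / 4) * ln (1 + (1 - \<epsilon> / 16) * (\<epsilon> / 16))"
proof -
  let ?h = "\<epsilon> / 16" let ?g = "(1 - ?h) * ?h"
  have g: "0 \<le> ?g" "?g \<le> ?h" "?h \<le> 1" using assms by (auto simp: mult_left_le_one_le)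
  have "?h * (1 - \<epsilon> / 8) \<le> ?g * (1 - ?h)"
    using assms by (simp add: field_simps power2_eq_square)
  also have "\<dots> \<le> ?g * (1 - ?g)" using g by (intro mult_left_mono) auto
  also have "\<dots> = ?g - ?g\<^sup>2" by (simp add: power2_eq_square algebra_simps)
  also have "\<dots> \<le> ln (1 + ?g)" using g by (intro ln_one_plus_pos_lower_bound) auto
  finally have le: "?h * (1 - \<epsilon> / 8) \<le> ln (1 + ?g)" .
  have "1 \<le> (1 + \<epsilon> / 4) * (1 - \<epsilon> / 8)"
    using assms mult_left_mono[of \<epsilon> 1 \<epsilon>] by (simp add: field_simps)
  hence "?h * 1 \<le> ?h * ((1 + \<epsilon> / 4) * (1 - \<epsilon> / 8))" using assms by (intro mult_left_mono) auto
  also have "\<dots> = (1 + \<epsilon> / 4) * (?h * (1 - \<epsilon> / 8))" by simp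
  also have "\<dots> \<le> (1 + \<epsilon> / 4) * ln (1 + ?g)" using le assms by (intro mult_left_mono) auto
  finally show ?thesis by simp
qed

text \<open>Concentration is recorded only at integer multiples of \<open>1 / n\<close>.
  Monotonicity interpolates, at the price of an additive 1 in \<open>star_ok_ge\<close> and
  \<open>1 + d\<close> in \<open>star_ok_le\<close>.\<close>

definition star_ok :: "(nat set \<Rightarrow> real) \<Rightarrow> nat \<Rightarrow> nat \<Rightarrow> real \<Rightarrow> bool" where
  "star_ok w n x d \<longleftrightarrow> (\<forall>j\<in>{..n}.
    \<bar>real (card {v \<in> {1..n} - {x}. 0 \<le> w {x, v} \<and> w {x, v} \<le> real j / real n}) - real j\<bar> \<le> d * (real j + ln (real n)))"

lemma star_ok_ge:
  assumes ok: "star_ok w n x d" and d: "0 \<le> d" "d \<le> 1" and y: "0 \<le> y" "y \<le> real n" and n: "1 \<le> n"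
  shows "y - 1 - d * (y + ln (real n)) \<le> real (card {v \<in> {1..n} - {x}. w {x, v} \<le> y / n})"
proof -
  define j where "j = nat \<lfloor>y\<rfloor>"
  have j: "real j \<le> y" "y - 1 \<le> real j" using y unfolding j_def by linarith+
  have jn: "j \<in> {..n}" using j y by (simp del: of_nat_le_iff add: of_nat_le_iff[where 'a=real, symmetric])
  have "y - 1 - d * (y + ln (real n)) \<le> real j - d * (real j + ln (real n))"
  proof -
    have "d * real j \<le> d * y" using j d by (intro mult_left_mono) auto
    thus ?thesis using j by (simp add: algebra_simps)
  qed
  also have "\<dots> \<le> real (card {v \<in> {1..n} - {x}. 0 \<le> w {x, v} \<and> w {x, v} \<le> real j / real n})"
    using bspec[OF ok[unfolded star_ok_def] jn] by linarith
  also have "\<dots> \<le> real (card {v \<in> {1..n} - {x}. w {x, v} \<le> y / n})"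
  proof (intro of_nat_mono card_mono)
    have "real j / n \<le> y / n" using j by (intro divide_right_mono) auto
    thus "{v \<in> {1..n} - {x}. 0 \<le> w {x, v} \<and> w {x, v} \<le> real j / real n} \<subseteq> {v \<in> {1..n} - {x}. w {x, v} \<le> y / n}" by auto
  qed auto
  finally show ?thesis .
qed

lemma star_ok_le:
  assumes ok: "star_ok w n x d" and d: "0 \<le> d" and y: "0 \<le> y" "y \<le> 1" and n: "1 \<le> n"
    and nonneg: "\<And>v. v \<in> {1..n} - {x} \<Longrightarrow> 0 \<le> w {x, v}"
  shows "real (card {v \<in> {1..n} - {x}. w {x, v} \<le> y}) \<le> (1 + d) * real n * y + ((1 + d) + d * ln (real n))"
proof -
  define j where "j = nat \<lceil>real n * y\<rceil>"
  have ny: "0 \<le> real n * y" "real n * y \<le> real n" using y by (auto simp: mult_left_le)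
  have j: "real n * y \<le> real j" "real j \<le> real n * y + 1" using ny unfolding j_def by linarith+
  have "\<lceil>real n * y\<rceil> \<le> int n" using ny by (simp add: ceiling_le_iff)
  hence jn: "j \<in> {..n}" unfolding j_def using ny by simp
  have "real (card {v \<in> {1..n} - {x}. w {x, v} \<le> y}) \<le> real (card {v \<in> {1..n} - {x}. 0 \<le> w {x, v} \<and> w {x, v} \<le> real j / real n})"
  proof (intro of_nat_mono card_mono)
    have "y \<le> real j / n" using j(1) n by (simp add: field_simps)
    thus "{v \<in> {1..n} - {x}. w {x, v} \<le> y} \<subseteq> {v \<in> {1..n} - {x}. 0 \<le> w {x, v} \<and> w {x, v} \<le> real j / real n}"
      using nonneg by auto
  qed auto
  also have "\<dots> \<le> real j + d * (real j + ln (real n))" using bspec[OF ok[unfolded star_ok_def] jn] by linarith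
  also have "\<dots> \<le> (1 + d) * real n * y + ((1 + d) + d * ln (real n))"
  proof -
    have "(1 + d) * real j \<le> (1 + d) * (real n * y + 1)" using j d by (intro mult_left_mono) auto
    thus ?thesis by (simp add: algebra_simps)
  qed
  finally show ?thesis .
qed

text \<open>Half of the surplus \<open>4 * d * K\<close> in the threshold survives the deviation and
  the rounding, and provides the unremoved edges at a terminal.\<close>

lemma small_K_arith:
  fixes d K :: real
  assumes "0 \<le> L" "K = k + L" "0 < d" "10 \<le> d * K" "d \<le> 1 / 100" "0 \<le> k"
  shows "k + 2 * d * K \<le> (k + 4 * d * K) - 1 - d / 10 * ((k + 4 * d * K) + L)"
proof -
  have "4 * d * K \<le> K" using assms mult_right_mono[of "4 * d" 1 K] by auto
  hence "d / 10 * ((k + 4 * d * K) + L) \<le> d / 10 * (2 * K)" using assms by (intro mult_left_mono) auto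
  thus ?thesis using assms(4) by (simp add: algebra_simps)
qed

section \<open>Upper bound in the three ranges of k\<close>

context random_weights_seq
begin

lemma whp_star_ok:
  assumes "0 < \<delta>" "\<delta> \<le> 1"
  shows "whp (\<lambda>n \<omega>. \<forall>x\<in>{s n, t n}. star_ok (Wn n \<omega>) n x \<delta>)"
  unfolding star_ok_def by (rule whp_star[OF assms])

lemma whp_small_k:
  assumes \<epsilon>: "0 < \<epsilon>" "\<epsilon> \<le> 1"
  shows "\<exists>\<gamma>>0. whp (\<lambda>n \<omega>. \<forall>k P. 1 \<le> k \<longrightarrow> real k \<le> real n powr \<gamma> \<longrightarrow> disjoint_paths n (s n) (t n) P k \<longrightarrow>
    cheap_so_far n \<omega> P k \<longrightarrow>
    next_path_le \<epsilon> n \<omega> P k)"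
proof -
  \<comment> \<open>The order of choice matters: \<open>\<epsilon>\<close> fixes
    \<open>\<delta>\<close>, \<open>h\<close>, \<open>\<eta>\<close> and \<open>\<kappa>1\<close>,
    these fix the failure exponent \<open>c0 * \<kappa>1\<close>, and only then are the range
    \<open>\<gamma>\<close> and the forest size \<open>C\<close> chosen. Beyond 2k the final cost,
    times n, contains 16 \<delta> K for the neighbourhoods, 2 \<kappa>1 ln n for the first and last
    percolation steps, and at most (1 + \<epsilon>/4) ln n + 1 for the growth steps.\<close>
  define \<delta> where "\<delta> = \<epsilon> / 100"
  define h where "h = \<epsilon> / 16"
  define \<eta> where "\<eta> = h * h / 16"
  define \<kappa>1 where "\<kappa>1 = \<epsilon> / 16"
  define c0 where "c0 = min (1 / 16) (min (h * h\<^sup>2 / 4096) (\<eta> / 8))"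
  define \<gamma> where "\<gamma> = min (1 / 10) (c0 * \<kappa>1 / 80)"
  define C where "C = max (4 / \<eta>\<^sup>2) (48 / (\<eta> * (c0 * \<kappa>1)))"
  define g where "g = (1 - h) * h"
  have h: "0 < h" "h \<le> 1 / 2" "h \<le> 1" using \<epsilon> by (auto simp: h_def)
  have \<eta>: "0 < \<eta>" "\<eta> \<le> h * h / 16" using h by (auto simp: \<eta>_def)
  have \<kappa>1: "0 < \<kappa>1" using \<epsilon> by (simp add: \<kappa>1_def)
  have c0: "0 < c0" "c0 \<le> 1 / 16" "c0 \<le> h * h\<^sup>2 / 4096" "c0 \<le> \<eta> / 8" using h \<eta> by (auto simp: c0_def)
  have \<gamma>: "0 < \<gamma>" "\<gamma> \<le> 1 / 10" "80 * \<gamma> \<le> c0 * \<kappa>1" using c0 \<kappa>1 by (auto simp: \<gamma>_def)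
  have C: "4 / \<eta>\<^sup>2 \<le> C" "48 / (\<eta> * (c0 * \<kappa>1)) \<le> C" by (auto simp: C_def)
  have \<delta>: "0 < \<delta>" "\<delta> \<le> 1 / 100" "\<delta> \<le> 1" using \<epsilon> by (auto simp: \<delta>_def)
  have g0: "0 < g" using h by (simp add: g_def)
  have star: "whp (\<lambda>n \<omega>. \<forall>x\<in>{s n, t n}. star_ok (Wn n \<omega>) n x (\<delta> / 10))" using \<delta> by (intro whp_star_ok) auto
  have Kbig: "\<forall>\<^sub>F n in sequentially. \<forall>k :: nat. 200 \<le> \<delta> ^ 3 * (real k + ln (real n)) \<and> 20000 * C \<le> \<delta> ^ 3 * (real k + ln (real n)) \<and> 10 \<le> \<delta> * (real k + ln (real n))"
  proof (rule eventually_all_k)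
    have "\<forall>\<^sub>F K in at_top. x \<le> c * (K::real)" if "c > 0" for x c using that by real_asymp
    thus "\<forall>\<^sub>F K in at_top. 200 \<le> \<delta> ^ 3 * (K::real) \<and> 20000 * C \<le> \<delta> ^ 3 * K \<and> 10 \<le> \<delta> * K" using \<delta> by (intro eventually_conj) auto
  qed
  have n3: "\<forall>\<^sub>F n in sequentially. 4 * real n powr (1 / 10) \<le> real n" by real_asymp
  \<comment> \<open>Absorbs the additive 1 that comes from rounding up the number of growth
    steps.\<close>
  have n4: "\<forall>\<^sub>F n in sequentially. 5 / (2 * \<epsilon>) \<le> ln (real n)" by (rule eventually_ln_ge)
  have "whp (\<lambda>n \<omega>. \<forall>k P. 1 \<le> k \<longrightarrow> real k \<le> real n powr \<gamma> \<longrightarrow> disjoint_paths n (s n) (t n) P k \<longrightarrow>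
    cheap_so_far n \<omega> P k \<longrightarrow>
    next_path_le \<epsilon> n \<omega> P k)"
  proof (rule whp_mono[OF whp_conj[OF whp_weights whp_conj[OF star whp_conj[OF whp_expand[OF \<delta>(1,3) \<gamma>(1,2)]
        whp_connect[OF h(1,2) h(1,3) \<eta> \<kappa>1 c0 \<gamma> C]]]]])
    show "\<forall>\<^sub>F n in sequentially. \<forall>\<omega>\<in>space (M n).
      unit_weights n \<omega> \<and> (\<forall>x\<in>{s n, t n}. star_ok (Wn n \<omega>) n x (\<delta> / 10)) \<and>
      forests_expand \<delta> \<gamma> n \<omega> \<and>
      forests_link \<eta> \<kappa>1 h h \<gamma> C n \<omega> \<longrightarrow>
      (\<forall>k P. 1 \<le> k \<longrightarrow> real k \<le> real n powr \<gamma> \<longrightarrow> disjoint_paths n (s n) (t n) P k \<longrightarrow>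
        cheap_so_far n \<omega> P k \<longrightarrow>
        next_path_le \<epsilon> n \<omega> P k)"
      using Kbig n3 n4 eventually_small_K[OF \<gamma>(1,2)] eventually_ge_at_top[of 2]
    proof eventually_elim
      case (elim n)
      have n0: "real n > 0" using elim(5) by simp
      define L where "L = ln (real n)"
      have L: "0 \<le> L" "5 / (2 * \<epsilon>) \<le> L" using elim(3,5) by (auto simp: L_def)
      have stn: "s n \<in> {1..n}" "t n \<in> {1..n}" "s n \<noteq> t n" using st[OF elim(5)] by auto
      show ?case
      proof (intro ballI impI allI, elim conjE)
        fix \<omega> k P
        assume weights: "unit_weights n \<omega>"
          and star: "\<forall>x\<in>{s n, t n}. star_ok (Wn n \<omega>) n x (\<delta> / 10)"
          and expand: "forests_expand \<delta> \<gamma> n \<omega>"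
          and connect: "forests_link \<eta> \<kappa>1 h h \<gamma> C n \<omega>"
          and k: "1 \<le> k" "real k \<le> real n powr \<gamma>" and P: "disjoint_paths n (s n) (t n) P k"
          and cost: "cheap_so_far n \<omega> P k"
        interpret nonneg_weights "Wn n \<omega>" n using weights by unfold_locales auto
        define K where "K = real k + L"
        have KL: "K = real k + ln (real n)" by (simp add: K_def L_def)
        have big: "200 \<le> \<delta> ^ 3 * K" "20000 * C \<le> \<delta> ^ 3 * K" "10 \<le> \<delta> * K" using elim(1) unfolding KL by blast+
        have K0: "0 < K" using k L by (simp add: K_def)
        have K2: "2 * K \<le> real n"
        proof -
          have "K \<le> 2 * real n powr (1 / 10)" using elim(4) k(2) unfolding KL by blast
          thus ?thesis using elim(2) by linarith
        qed
        define J where "J = growth_steps g n"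
        let ?tau = "schedule (\<kappa>1 * L) h n"
        define z where "z = ?tau (Suc J) - ?tau 0 + \<kappa>1 * L / n"
        have expl: "exploration (\<eta> / n) ?tau"
          using \<eta> n0 \<kappa>1 h L by unfold_locales (auto intro!: mono_schedule)
        have "conn (Wn n \<omega>) (removed P k) n (2 * ((real k + 4 * \<delta> * K) / n + 4 * (\<delta> * K / n)) + z) (s n) (t n)"
        proof (rule small_k_path[OF stn k(1) K_def L(1) \<delta>(1,2) big(1,2) _ P])
          show "(\<Sum>i\<in>{1..<k}. path_cost (Wn n \<omega>) (P i)) \<le> 4 * real k * K / n" using cost by (simp add: KL)
          show "real k + 2 * \<delta> * K \<le> real (card {v \<in> {1..n} - {x}. W n {x, v} \<omega> \<le> (real k + 4 * \<delta> * K) / n})" if x: "x \<in> {s n, t n}" for x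
          proof -
            have "real k + 2 * \<delta> * K \<le> (real k + 4 * \<delta> * K) - 1 - \<delta> / 10 * ((real k + 4 * \<delta> * K) + L)"
              by (rule small_K_arith[OF L(1) K_def \<delta>(1) big(3) \<delta>(2)]) simp
            also have "\<dots> \<le> real (card {v \<in> {1..n} - {x}. W n {x, v} \<omega> \<le> (real k + 4 * \<delta> * K) / n})"
              unfolding L_def
            proof (rule star_ok_ge[OF bspec[OF star x]])
              have "4 * \<delta> * K \<le> 1 * K" using \<delta> K0 by (intro mult_right_mono) auto
              thus "real k + 4 * \<delta> * K \<le> real n" using K2 L K_def by linarith
            qed (use \<delta> K0 elim(5) in auto)
            finally show ?thesis .
          qed
          show "real a * (\<delta> * K) / 16 \<le> real (card {v \<in> {1..n} - {s n, t n} - fst ` set fs. \<exists>u\<in>U. \<delta> * K / n \<le> W n {u, v} \<omega> \<and> W n {u, v} \<omega> \<le> 2 * (\<delta> * K / n)})"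
            if "\<delta> * K / 2 \<le> real a" "real a \<le> K\<^sup>2" "forest n {s n, t n} fs" "length fs = 2 * a"
              "\<forall>e\<in>forest_edges fs. 0 \<le> W n e \<omega> \<and> W n e \<omega> \<le> 2 * K / n" "U \<subseteq> fst ` set fs" "card U = a" for a fs U
            using expand k(2) KL that by blast
          fix a fs U T
          assume a: "C * K\<^sup>2 \<le> real a" "real a \<le> K ^ 3" and fs: "forest n {s n, t n} fs" "length fs = 2 * a"
            "\<forall>e\<in>forest_edges fs. 0 \<le> W n e \<omega> \<and> W n e \<omega> \<le> 2 * K / n"
            and UT: "U \<subseteq> fst ` set fs" "T \<subseteq> fst ` set fs" "U \<inter> T = {}" "card U = a" "card T = a"
          define D' where "D' = {e \<in> removed P k. \<eta> / n \<le> W n e \<omega>}"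
          have D'E: "D' \<subseteq> complete_edges n" using removed_complete[OF P] by (auto simp: D'_def)
          have "real (card D') \<le> (4 * real k * K / n) / (\<eta> / n)"
            unfolding D'_def using removed_complete[OF P] nonneg sum_removed[OF P, of "Wn n \<omega>"] cost n0 \<eta>
            by (intro card_heavy_le) (auto simp: KL)
          also have "\<dots> = 4 * (real k * K) / \<eta>" using n0 \<eta> by simp
          also have "\<dots> \<le> 4 * (K * K) / \<eta>" using K_def L K0 \<eta> by (intro divide_right_mono mult_left_mono mult_right_mono) auto
          finally have D'c: "real (card D') \<le> 4 * K\<^sup>2 / \<eta>" by (simp add: power2_eq_square)
          have fv: "fst ` set fs \<subseteq> {1..n} - {s n, t n}" using forest_verts[OF fs(1)] by simp
          show "\<exists>u\<in>U. \<exists>v\<in>T. conn (Wn n \<omega>) (removed P k) n z u v"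
            unfolding z_def
          proof (rule exploration_conn[OF expl, where V="{1..n} - {s n, t n} - fst ` set fs" and D'=D'])
            show "U \<subseteq> {1..n}" "T \<subseteq> {1..n}" "T \<inter> ({1..n} - {s n, t n} - fst ` set fs) = {}" using UT fv by blast+
            show "e \<notin> removed P k" if "e \<notin> D'" "\<eta> / n \<le> W n e \<omega>" for e using that by (simp add: D'_def)
            show "\<exists>u\<in>exploration.born D' (\<eta> / n) ?tau U (Wn n \<omega>) ({1..n} - {s n, t n} - fst ` set fs) (Suc J) \<inter> ({1..n} - {s n, t n} - fst ` set fs).
              \<exists>v\<in>T. link (Wn n \<omega>) D' (\<eta> / n) u v (\<kappa>1 * L / n)"
              using connect k(2) KL a fs UT D'E D'c unfolding J_def g_def L_def by blast
          qed auto
        qed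
        moreover have "2 * ((real k + 4 * \<delta> * K) / n + 4 * (\<delta> * K / n)) + z \<le> (1 + \<epsilon>) * (2 * real k + L) / n"
        proof -
          have J: "real J \<le> L / ln (1 + g) + 1" unfolding J_def L_def using elim(5) by (intro growth_steps(2)[OF g0]) auto
          have lg: "0 < ln (1 + g)" using g0 by simp
          have gr: "h \<le> (1 + \<epsilon> / 4) * ln (1 + g)" using growth_rate[OF \<epsilon>] by (simp add: h_def g_def)
          have "real J * h \<le> (L / ln (1 + g) + 1) * h" using J h by (intro mult_right_mono) auto
          also have "\<dots> = L * (h / ln (1 + g)) + h" by (simp add: algebra_simps)
          also have "\<dots> \<le> L * (1 + \<epsilon> / 4) + 1" using gr lg L h by (intro add_mono mult_left_mono) (auto simp: pos_divide_le_eq)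
          finally have Jh: "real J * h \<le> L * (1 + \<epsilon> / 4) + 1" .
          have "5 / 2 \<le> L * \<epsilon>" using L(2) \<epsilon> by (simp add: field_simps)
          hence fin: "2 * (real k + 4 * \<delta> * K + 4 * (\<delta> * K)) + (\<kappa>1 * L + real J * h + \<kappa>1 * L) \<le> (1 + \<epsilon>) * (2 * real k + L)"
          proof -
            have l: "2 * (real k + 4 * \<delta> * K + 4 * (\<delta> * K)) + (\<kappa>1 * L + real J * h + \<kappa>1 * L) =
              2 * real k + 4 / 25 * (\<epsilon> * real k) + 57 / 200 * (L * \<epsilon>) + real J * h"
              unfolding \<delta>_def \<kappa>1_def K_def by (simp add: field_simps)
            have r: "(1 + \<epsilon>) * (2 * real k + L) = 2 * real k + L + 2 * (\<epsilon> * real k) + L * \<epsilon>" by (simp add: algebra_simps)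
            have "L * (1 + \<epsilon> / 4) = L + L * \<epsilon> / 4" by (simp add: algebra_simps)
            moreover have "0 \<le> \<epsilon> * real k" using \<epsilon> by simp
            ultimately show ?thesis unfolding l r using Jh \<open>5 / 2 \<le> L * \<epsilon>\<close> by linarith
          qed
          have "2 * ((real k + 4 * \<delta> * K) / n + 4 * (\<delta> * K / n)) + z = (2 * (real k + 4 * \<delta> * K + 4 * (\<delta> * K)) + (\<kappa>1 * L + real J * h + \<kappa>1 * L)) / n"
            unfolding z_def schedule_simps by (simp add: add_divide_distrib)
          also have "\<dots> \<le> (1 + \<epsilon>) * (2 * real k + L) / n" using fin n0 by (intro divide_right_mono) auto
          finally show ?thesis .
        qed
        ultimately show "next_path_le \<epsilon> n \<omega> P k"
          unfolding L_def by (rule conn_mono)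
      qed
    qed
  qed
  thus ?thesis using \<gamma>(1) by blast
qed

end

lemma (in nonneg_weights) conn_edge:
  assumes "u \<in> {1..n}" "v \<in> {1..n}" "u \<noteq> v" "{u, v} \<notin> D" "w {u, v} \<le> c"
  shows "conn w D n c u v"
  using conn_extend[OF conn_refl[of u 0 D], of v c] assms by simp

lemma card_star_minus:
  assumes D: "finite {v. {x, v} \<in> D}" "card {v. {x, v} \<in> D} \<le> r" and S: "finite S"
  shows "real (card S) - real r - 1 \<le> real (card (S - {v. {x, v} \<in> D} - {y}))"
proof -
  have "card S \<le> card ((S - {v. {x, v} \<in> D} - {y}) \<union> {v. {x, v} \<in> D} \<union> {y})"
    using D S by (intro card_mono) auto
  also have "\<dots> \<le> card (S - {v. {x, v} \<in> D} - {y}) + card {v. {x, v} \<in> D} + card {y}"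
    using card_Un_le[of "(S - {v. {x, v} \<in> D} - {y}) \<union> {v. {x, v} \<in> D}" "{y}"] card_Un_le[of "S - {v. {x, v} \<in> D} - {y}" "{v. {x, v} \<in> D}"]
    by linarith
  finally show ?thesis using D(2) by simp
qed

context random_weights_seq
begin

lemma whp_medium_k:
  fixes \<epsilon> \<gamma> :: real
  assumes \<epsilon>: "0 < \<epsilon>" "\<epsilon> \<le> 1" and \<gamma>: "0 < \<gamma>"
  shows "whp (\<lambda>n \<omega>. \<forall>k P. 1 \<le> k \<longrightarrow> real n powr \<gamma> \<le> real k \<longrightarrow> real k \<le> (1 - \<epsilon>) * n \<longrightarrow> disjoint_paths n (s n) (t n) P k \<longrightarrow>
    cheap_so_far n \<omega> P k \<longrightarrow>
    next_path_le \<epsilon> n \<omega> P k)"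
proof -
  define \<delta> where "\<delta> = \<epsilon> / 100"
  \<comment> \<open>A round multiplies a set by at least n^(\<gamma>/2), so more than 2/\<gamma>
    rounds exceed n. Dividing \<open>\<delta>\<close> by \<open>r\<close> keeps the cost of all
    rounds at both terminals, 4 r y, at 4 \<delta> k / n.\<close>
  define r where "r = nat \<lceil>2 / \<gamma>\<rceil> + 1"
  define d where "d = \<delta> / real r"
  have r: "1 \<le> r" "2 / \<gamma> + 1 \<le> real r" using \<gamma> unfolding r_def by linarith+
  have \<delta>: "0 < \<delta>" "\<delta> \<le> 1 / 100" using \<epsilon> by (auto simp: \<delta>_def)
  have d: "0 < d" "2 * d \<le> 1" "real r * d = \<delta>"
  proof -
    show "0 < d" "real r * d = \<delta>" using \<delta> r by (auto simp: d_def)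
    have "d \<le> \<delta> / 1" unfolding d_def using \<delta> r by (intro divide_left_mono) auto
    thus "2 * d \<le> 1" using \<delta> by simp
  qed
  have star: "whp (\<lambda>n \<omega>. \<forall>x\<in>{s n, t n}. star_ok (Wn n \<omega>) n x (\<delta> / 10))" using \<delta> by (intro whp_star_ok) auto
  have n1: "\<forall>\<^sub>F n in sequentially. ln (real n) \<le> real n powr \<gamma>" using \<gamma> by real_asymp
  have n2: "\<forall>\<^sub>F n in sequentially. 10 / \<delta> \<le> real n powr \<gamma>" using \<gamma> by real_asymp
  \<comment> \<open>Makes the at most 8 k / d heavy removed edges fewer than |A| d k / 64, where A
    has at least 2 \<delta> k vertices.\<close>
  have n3: "\<forall>\<^sub>F n in sequentially. 512 / (\<delta> * d\<^sup>2) \<le> real n powr \<gamma>" using \<gamma> by real_asymp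
  have n4: "\<forall>\<^sub>F n in sequentially. real n powr (\<gamma> / 2) \<le> d * real n powr \<gamma> / (128 * ln (real n + 1))" using \<gamma> d(1) by real_asymp
  show ?thesis
  proof (rule whp_mono[OF whp_conj[OF whp_weights whp_conj[OF star whp_window[OF d(1,2) \<gamma>]]]])
    show "\<forall>\<^sub>F n in sequentially. \<forall>\<omega>\<in>space (M n).
      unit_weights n \<omega> \<and> (\<forall>x\<in>{s n, t n}. star_ok (Wn n \<omega>) n x (\<delta> / 10)) \<and>
      sets_expand d \<gamma> n \<omega> \<longrightarrow>
      (\<forall>k P. 1 \<le> k \<longrightarrow> real n powr \<gamma> \<le> real k \<longrightarrow> real k \<le> (1 - \<epsilon>) * n \<longrightarrow> disjoint_paths n (s n) (t n) P k \<longrightarrow>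
    cheap_so_far n \<omega> P k \<longrightarrow>
    next_path_le \<epsilon> n \<omega> P k)"
      using n1 n2 n3 n4 eventually_ge_at_top[of 2]
    proof eventually_elim
      case (elim n)
      have n0: "real n > 0" using elim(5) by simp
      define L where "L = ln (real n)"
      have L: "0 \<le> L" using elim(5) by (auto simp: L_def)
      have stn: "s n \<in> {1..n}" "t n \<in> {1..n}" "s n \<noteq> t n" using st[OF elim(5)] by auto
      show ?case
      proof (intro ballI impI allI, elim conjE)
        fix \<omega> k P
        assume weights: "unit_weights n \<omega>"
          and star: "\<forall>x\<in>{s n, t n}. star_ok (Wn n \<omega>) n x (\<delta> / 10)"
          and window: "sets_expand d \<gamma> n \<omega>"
          and k: "1 \<le> k" "real n powr \<gamma> \<le> real k" "real k \<le> (1 - \<epsilon>) * n" and P: "disjoint_paths n (s n) (t n) P k"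
          and cost: "cheap_so_far n \<omega> P k"
        interpret nonneg_weights "Wn n \<omega>" n using weights by unfold_locales auto
        define K where "K = real k + L"
        have KL: "K = real k + ln (real n)" by (simp add: K_def L_def)
        have k0: "0 < real k" using k by simp
        have K: "K \<le> 2 * real k" "real k \<le> K" "0 < K" using elim(1) k k0 L unfolding K_def L_def by linarith+
        have kn: "real k \<le> real n"
        proof -
          have "(1 - \<epsilon>) * real n \<le> 1 * real n" using \<epsilon> by (intro mult_right_mono) auto
          thus ?thesis using k(3) by simp
        qed
        define y where "y = d * real k / n"
        have y0: "0 < y" using d k0 n0 by (simp add: y_def)
        have dk: "10 \<le> \<delta> * K"
        proof -
          have "10 / \<delta> \<le> K" using elim(2) k(2) K by linarith
          thus ?thesis using \<delta> by (simp add: field_simps)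
        qed
        define c where "c = (real k + 4 * \<delta> * K) / n"
        define A where "A x = {v \<in> {1..n} - {x}. W n {x, v} \<omega> \<le> c} - {v. {x, v} \<in> removed P k} - {if x = s n then t n else s n}" for x
        have A: "A x \<subseteq> {1..n} - {s n, t n}" "2 * \<delta> * real k \<le> real (card (A x))" "\<forall>v\<in>A x. conn (Wn n \<omega>) (removed P k) n c x v" if x: "x \<in> {s n, t n}" for x
        proof -
          show "A x \<subseteq> {1..n} - {s n, t n}" using x unfolding A_def by auto
          have D: "finite {v. {x, v} \<in> removed P k}" "card {v. {x, v} \<in> removed P k} \<le> k - 1"
            using card_star_removed[OF P stn(3) k(1) x] by auto
          have "real k + 2 * \<delta> * K \<le> (real k + 4 * \<delta> * K) - 1 - \<delta> / 10 * ((real k + 4 * \<delta> * K) + L)"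
            by (rule small_K_arith[OF L(1) K_def \<delta>(1) dk \<delta>(2)]) simp
          also have "\<dots> \<le> real (card {v \<in> {1..n} - {x}. W n {x, v} \<omega> \<le> c})"
            unfolding L_def c_def
          proof (rule star_ok_ge[OF bspec[OF star x]])
            \<comment> \<open>This is where k must stay below (1 - \<epsilon>) n: the threshold for
              edges at a terminal may not exceed the largest weight 1.\<close>
            have "4 * \<delta> * K \<le> 4 * \<delta> * (2 * real n)" using \<delta> K kn by (intro mult_left_mono) auto
            also have "\<dots> \<le> \<epsilon> * real n" using \<epsilon> by (simp add: \<delta>_def)
            finally show "real k + 4 * \<delta> * K \<le> real n" using k(3) by (simp add: algebra_simps)
          qed (use \<delta> K elim(5) in auto)
          finally have "real k + 2 * \<delta> * K \<le> real (card {v \<in> {1..n} - {x}. W n {x, v} \<omega> \<le> c})" .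
          moreover have "real (card {v \<in> {1..n} - {x}. W n {x, v} \<omega> \<le> c}) - real (k - 1) - 1 \<le> real (card (A x))"
            unfolding A_def by (rule card_star_minus[OF D]) simp
          moreover have "real (k - 1) = real k - 1" using k(1) by (simp add: of_nat_diff)
          moreover have "2 * \<delta> * real k \<le> 2 * \<delta> * K" using \<delta> K by (intro mult_left_mono) auto
          ultimately show "2 * \<delta> * real k \<le> real (card (A x))" by linarith
          show "\<forall>v\<in>A x. conn (Wn n \<omega>) (removed P k) n c x v"
            using x stn unfolding A_def by (auto intro!: conn_edge)
        qed
        have heavy: "real (card {e \<in> removed P k. y \<le> W n e \<omega>}) \<le> 8 * real k / d"
        proof -
          have "real (card {e \<in> removed P k. y \<le> W n e \<omega>}) \<le> (4 * real k * K / n) / y"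
            using removed_complete[OF P] nonneg sum_removed[OF P, of "Wn n \<omega>"] cost y0
            by (intro card_heavy_le) (auto simp: KL)
          also have "\<dots> = 4 * K / d" using n0 k0 d by (simp add: y_def)
          also have "\<dots> \<le> 8 * real k / d" using K d by (intro divide_right_mono) auto
          finally show ?thesis .
        qed
        have kbig: "512 \<le> real k * (\<delta> * d\<^sup>2)"
        proof -
          have "512 / (\<delta> * d\<^sup>2) \<le> real k" using elim(3) k(2) by linarith
          thus ?thesis using \<delta> d by (simp add: pos_divide_le_eq)
        qed
        have heavyA: "real (card {e \<in> removed P k. y \<le> W n e \<omega>}) < real (card (A x)) * real n * y / 64" if x: "x \<in> {s n, t n}" for x
        proof -
          have "8 * real k / d < 2 * \<delta> * real k * (d * real k) / 64"
          proof -
            have "512 * (real k * 2) \<le> real k * (\<delta> * d\<^sup>2) * (real k * 2)" using kbig k0 by (intro mult_right_mono) auto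
            moreover have "0 < real k" by (rule k0)
            ultimately have "512 * real k < real k * (\<delta> * d\<^sup>2) * (real k * 2)" by linarith
            thus ?thesis using d by (simp add: field_simps power2_eq_square)
          qed
          also have "\<dots> \<le> real (card (A x)) * (d * real k) / 64" using A(2)[OF x] d by (intro divide_right_mono mult_right_mono) auto
          also have "\<dots> = real (card (A x)) * real n * y / 64" using n0 by (simp add: y_def)
          finally show ?thesis using heavy by linarith
        qed
        have "conn (Wn n \<omega>) (removed P k) n (2 * c + 4 * real r * y) (s n) (t n)"
        proof (rule window_meet[where A=A and \<rho>="real n * y / (128 * ln (real n + 1))"])
          show "real (card U) * real n * y / 64 \<le> real (card {e \<in> between U ({1..n} - {s n, t n} - U - B). y \<le> W n e \<omega> \<and> W n e \<omega> \<le> 2 * y})"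
            if "U \<subseteq> {1..n} - {s n, t n}" "B \<subseteq> {1..n} - {s n, t n}" "U \<inter> B = {}" "U \<noteq> {}"
              "real (card U + card B) * ln (real n + 1) \<le> real (card U) * real n * y / 128" "8 * (card U + card B) \<le> 7 * n" for U B
            using window[rule_format, OF k(2) _ y_def that] kn by simp
          show "A x \<subseteq> {1..n} - {s n, t n} \<and> A x \<noteq> {} \<and> real (card {e \<in> removed P k. y \<le> W n e \<omega>}) < real (card (A x)) * real n * y / 64
            \<and> (\<forall>v\<in>A x. conn (Wn n \<omega>) (removed P k) n c x v)" if x: "x \<in> {s n, t n}" for x
          proof -
            have "0 < 2 * \<delta> * real k" using \<delta> k0 by simp
            hence "A x \<noteq> {}" using A(2)[OF x] by auto
            thus ?thesis using A[OF x] heavyA[OF x] by blast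
          qed
          have \<rho>: "real n powr (\<gamma> / 2) \<le> real n * y / (128 * ln (real n + 1))"
          proof -
            have "real n powr (\<gamma> / 2) \<le> d * real n powr \<gamma> / (128 * ln (real n + 1))" by (rule elim(4))
            also have "\<dots> \<le> d * real k / (128 * ln (real n + 1))" using k(2) d by (intro divide_right_mono mult_left_mono) auto
            also have "\<dots> = real n * y / (128 * ln (real n + 1))" using n0 by (simp add: y_def)
            finally show ?thesis .
          qed
          have "1 \<le> real n powr (\<gamma> / 2)" using elim(5) \<gamma> by (intro ge_one_powr_ge_zero) auto
          thus "1 \<le> real n * y / (128 * ln (real n + 1))" using \<rho> by linarith
          have "real n powr 1 < real n powr (\<gamma> / 2 * real r)"
          proof (rule powr_less_mono)
            have "\<gamma> / 2 * (2 / \<gamma> + 1) \<le> \<gamma> / 2 * real r" using r \<gamma> by (intro mult_left_mono) auto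
            moreover have "\<gamma> / 2 * (2 / \<gamma> + 1) = 1 + \<gamma> / 2" using \<gamma> by (simp add: field_simps)
            ultimately show "1 < \<gamma> / 2 * real r" using \<gamma> by linarith
          qed (use elim(5) in auto)
          also have "real n powr (\<gamma> / 2 * real r) = (real n powr (\<gamma> / 2)) powr real r" by (rule powr_powr[symmetric])
          also have "\<dots> = (real n powr (\<gamma> / 2)) ^ r" using n0 by (intro powr_realpow) auto
          finally have "real n < (real n powr (\<gamma> / 2)) ^ r" using n0 by simp
          also have "\<dots> \<le> (real n * y / (128 * ln (real n + 1))) ^ r" using \<rho> by (intro power_mono) auto
          finally show "real n < (real n * y / (128 * ln (real n + 1))) ^ r" .
        qed (use y0 elim(5) in auto)
        moreover have "2 * c + 4 * real r * y \<le> (1 + \<epsilon>) * (2 * real k + L) / n"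
        proof -
          have "2 * c + 4 * real r * y = (2 * (real k + 4 * \<delta> * K) + 4 * (real r * d) * real k) / n"
            by (simp add: c_def y_def add_divide_distrib)
          also have "\<dots> \<le> (1 + \<epsilon>) * (2 * real k + L) / n"
          proof (intro divide_right_mono)
            have l: "2 * (real k + 4 * \<delta> * K) + 4 * (real r * d) * real k = 2 * real k + 3 / 25 * (\<epsilon> * real k) + 2 / 25 * (L * \<epsilon>)"
              unfolding d(3) K_def \<delta>_def by (simp add: field_simps)
            have r: "(1 + \<epsilon>) * (2 * real k + L) = 2 * real k + L + 2 * (\<epsilon> * real k) + L * \<epsilon>" by (simp add: algebra_simps)
            have "0 \<le> \<epsilon> * real k" "0 \<le> L * \<epsilon>" using \<epsilon> L by auto
            thus "2 * (real k + 4 * \<delta> * K) + 4 * (real r * d) * real k \<le> (1 + \<epsilon>) * (2 * real k + L)" unfolding l r using L by linarith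
          qed (use n0 in simp)
          finally show ?thesis .
        qed
        ultimately show "next_path_le \<epsilon> n \<omega> P k"
          unfolding L_def by (rule conn_mono)
      qed
    qed
  qed
qed

end

text \<open>The edges of the removed paths at \<open>s\<close> and at \<open>t\<close> alone cost almost as much as the
  paths themselves, which leaves little weight for the edges avoiding \<open>s\<close> and \<open>t\<close>.\<close>

lemma (in nonneg_weights) removed_middle_le:
  assumes st: "s \<in> {1..n}" "t \<in> {1..n}" "s \<noteq> t" and k: "1 \<le> k" and P: "disjoint_paths n s t P k"
    and d: "0 < d" and ok: "\<And>x. x \<in> {s, t} \<Longrightarrow> star_ok w n x d"
    and le1: "\<And>e. e \<in> complete_edges n \<Longrightarrow> w e \<le> 1"
  shows "(\<Sum>e\<in>{e \<in> removed P k. s \<notin> e \<and> t \<notin> e}. w e) + ((real k - 2)\<^sup>2 - 2 * real k * ((1 + d) + d * ln (real n))) / ((1 + d) * real n)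
    \<le> (\<Sum>i\<in>{1..<k}. path_cost w (P i))"
proof -
  let ?D = "removed P k" and ?\<beta> = "(1 + d) + d * ln (real n)" and ?\<alpha> = "(1 + d) * real n"
  have n0: "real n > 0" using st by auto
  have \<alpha>0: "0 < ?\<alpha>" using n0 d by simp
  have \<beta>0: "0 \<le> ?\<beta>" using d n0 by simp
  have edge: "{x, v} \<in> complete_edges n" if "x \<in> {s, t}" "v \<in> {1..n} - {x}" for x v
    using that st by (auto simp: doubleton_complete_edges_iff)
  have sum_ge: "((real k - 2)\<^sup>2 / 2 - real k * ?\<beta>) / ?\<alpha> \<le> (\<Sum>v\<in>Z. w {x, v})"
    if x: "x \<in> {s, t}" and Z: "Z \<subseteq> {1..n} - {x}" "k - 2 \<le> card Z" "card Z \<le> k" for x Z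
  proof -
    have "(real (card Z))\<^sup>2 / 2 - real (card Z) * ?\<beta> \<le> ?\<alpha> * (\<Sum>v\<in>Z. w {x, v})"
    proof (rule star_sum_ge[OF _ \<alpha>0 _ Z(1)])
      fix v assume v: "v \<in> {1..n} - {x}"
      show "real (card {u \<in> {1..n} - {x}. w {x, u} \<le> w {x, v}}) \<le> ?\<alpha> * w {x, v} + ?\<beta>"
        using d nonneg le1 edge[OF x] v n0 by (intro star_ok_le[OF ok[OF x]]) auto
    qed simp
    moreover have "(real k - 2)\<^sup>2 / 2 - real k * ?\<beta> \<le> (real (card Z))\<^sup>2 / 2 - real (card Z) * ?\<beta>"
    proof -
      have "real (card Z) * ?\<beta> \<le> real k * ?\<beta>" using \<beta>0 Z(3) by (intro mult_right_mono) auto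
      \<comment> \<open>For k = 1 the left square equals 1 although \<open>Z\<close> may be empty;
        that case is paid for by \<open>?\<beta> \<ge> 1\<close>.\<close>
      moreover have "(real k - 2)\<^sup>2 \<le> (real (card Z))\<^sup>2 \<or> k = 1"
      proof (cases "2 \<le> k")
        case True
        hence "0 \<le> real k - 2" "real k - 2 \<le> real (card Z)" using Z(2) by (auto simp: of_nat_diff[symmetric] simp del: of_nat_diff)
        thus ?thesis by (auto intro: power_mono)
      qed (use k in auto)
      moreover have "(real k - 2)\<^sup>2 / 2 \<le> real k * ?\<beta> - real (card Z) * ?\<beta> + (real (card Z))\<^sup>2 / 2" if k1: "k = 1"
      proof (cases "card Z = 0")
        case True
        have "1 \<le> ?\<beta>" using n0 d st by simp
        thus ?thesis using True k1 by simp
      next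
        case False
        hence "1 \<le> (real (card Z))\<^sup>2" by (simp add: one_le_power)
        thus ?thesis using k1 \<open>real (card Z) * ?\<beta> \<le> real k * ?\<beta>\<close> by simp
      qed
      ultimately show ?thesis by force
    qed
    ultimately have "(real k - 2)\<^sup>2 / 2 - real k * ?\<beta> \<le> ?\<alpha> * (\<Sum>v\<in>Z. w {x, v})" by linarith
    thus ?thesis using \<alpha>0 by (simp add: pos_divide_le_eq mult.commute)
  qed
  define Zs where "Zs = {v. {s, v} \<in> ?D}"
  \<comment> \<open>Leaving out \<open>s\<close> prevents the edge \<open>{s, t}\<close> from being
    counted at both terminals.\<close>
  define Zt where "Zt = {v. {t, v} \<in> ?D} - {s}"
  have Zs: "finite Zs" "card Zs = k - 1" using card_star_removed[OF P st(3) k(1), of s] by (auto simp: Zs_def)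
  have Zt: "finite Zt" "k - 2 \<le> card Zt" "card Zt \<le> k"
  proof -
    have t: "finite {v. {t, v} \<in> ?D}" "card {v. {t, v} \<in> ?D} = k - 1" using card_star_removed[OF P st(3) k(1), of t] by auto
    thus "finite Zt" by (simp add: Zt_def)
    have "card {v. {t, v} \<in> ?D} - card {s} \<le> card Zt" unfolding Zt_def by (intro diff_card_le_card_Diff) auto
    thus "k - 2 \<le> card Zt" using t by simp
    have "card Zt \<le> card {v. {t, v} \<in> ?D}" unfolding Zt_def using t by (intro card_mono) auto
    thus "card Zt \<le> k" using t by simp
  qed
  have ZsX: "Zs \<subseteq> {1..n} - {s}" "Zt \<subseteq> {1..n} - {t}"
  proof -
    have "v \<in> {1..n} - {x}" if "{x, v} \<in> ?D" for x v
      using subsetD[OF removed_complete[OF P] that] by (simp only: doubleton_complete_edges_iff) blast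
    thus "Zs \<subseteq> {1..n} - {s}" "Zt \<subseteq> {1..n} - {t}" unfolding Zs_def Zt_def by blast+
  qed
  let ?Es = "(\<lambda>v. {s, v}) ` Zs" and ?Et = "(\<lambda>v. {t, v}) ` Zt" and ?Em = "{e \<in> ?D. s \<notin> e \<and> t \<notin> e}"
  have inj: "inj_on (\<lambda>v. {x, v}) Z" for x :: nat and Z by (auto simp: inj_on_def doubleton_eq_iff)
  have disj: "?Es \<inter> ?Et = {}" "(?Es \<union> ?Et) \<inter> ?Em = {}"
  proof -
    show "?Es \<inter> ?Et = {}"
    proof (rule ccontr)
      assume "?Es \<inter> ?Et \<noteq> {}"
      then obtain u v where "{s, u} = {t, v}" "v \<in> Zt" by blast
      thus False using st by (auto simp: doubleton_eq_iff Zt_def)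
    qed
    show "(?Es \<union> ?Et) \<inter> ?Em = {}" by blast
  qed
  have sub: "?Es \<union> ?Et \<union> ?Em \<subseteq> ?D" by (auto simp: Zs_def Zt_def)
  have "(\<Sum>v\<in>Zs. w {s, v}) + (\<Sum>v\<in>Zt. w {t, v}) + (\<Sum>e\<in>?Em. w e) = (\<Sum>e\<in>?Es \<union> ?Et \<union> ?Em. w e)"
    using Zs Zt disj by (simp add: sum.union_disjoint sum.reindex[OF inj])
  also have "\<dots> \<le> (\<Sum>e\<in>?D. w e)"
    using removed_complete[OF P] nonneg sub by (intro sum_mono2) auto
  also have "\<dots> = (\<Sum>i\<in>{1..<k}. path_cost w (P i))" by (rule sum_removed[OF P])
  finally have "(\<Sum>v\<in>Zs. w {s, v}) + (\<Sum>v\<in>Zt. w {t, v}) + (\<Sum>e\<in>?Em. w e) \<le> (\<Sum>i\<in>{1..<k}. path_cost w (P i))" .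
  moreover have "((real k - 2)\<^sup>2 / 2 - real k * ?\<beta>) / ?\<alpha> \<le> (\<Sum>v\<in>Zs. w {s, v})" using Zs ZsX by (intro sum_ge) auto
  moreover have "((real k - 2)\<^sup>2 / 2 - real k * ?\<beta>) / ?\<alpha> \<le> (\<Sum>v\<in>Zt. w {t, v})" using Zt ZsX by (intro sum_ge) auto
  moreover have "((real k - 2)\<^sup>2 - 2 * real k * ?\<beta>) / ?\<alpha> = ((real k - 2)\<^sup>2 / 2 - real k * ?\<beta>) / ?\<alpha> + ((real k - 2)\<^sup>2 / 2 - real k * ?\<beta>) / ?\<alpha>"
    by (simp add: add_divide_distrib[symmetric] algebra_simps)
  ultimately show ?thesis by linarith
qed

context random_weights_seq
begin

text \<open>All but few of the paths being removed, the stars at \<open>s\<close> and \<open>t\<close> are nearly exhausted;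
  a single remaining edge of weight at most \<open>1\<close> leads from either of them to a vertex which still has
  many neighbours at distance at most \<open>\<epsilon> / 4\<close>.\<close>

lemma whp_large_k:
  fixes \<epsilon> :: real
  assumes \<epsilon>: "0 < \<epsilon>" "\<epsilon> \<le> 1"
  shows "\<exists>\<tau>>0. \<tau> \<le> 1 / 2 \<and> whp (\<lambda>n \<omega>. \<forall>k P. (1 - \<tau>) * real n \<le> real k \<longrightarrow> k < n \<longrightarrow> disjoint_paths n (s n) (t n) P k \<longrightarrow>
    (\<Sum>i\<in>{1..<k}. path_cost (Wn n \<omega>) (P i)) \<le> (1 + \<tau>) * n \<longrightarrow>
    next_path_le \<epsilon> n \<omega> P k)"
proof -
  \<comment> \<open>The path found will cost at most 2 (1 + \<rho>) + 12 d, which is below 2 +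
    \<epsilon>. The square in \<open>\<tau>\<close> is needed because removed edges that avoid the
    terminals and weigh \<rho>/2 or more number at most 7 \<tau> n / (\<rho>/2), and this must be a
    small fraction of the \<rho> n / 8 window edges at a vertex.\<close>
  define \<rho> d \<tau> where "\<rho> = \<epsilon> / 4" and "d = \<epsilon> / 100" and "\<tau> = \<rho>\<^sup>2 / 1000"
  have \<rho>: "0 < \<rho>" "\<rho> \<le> 1" and d: "0 < d" "2 * d \<le> 1" using \<epsilon> by (auto simp: \<rho>_def d_def)
  have \<tau>: "0 < \<tau>" "\<tau> \<le> \<epsilon> / 1000" "\<tau> \<le> 1 / 1000"
  proof -
    have "\<rho>\<^sup>2 \<le> \<rho>" using \<rho> by (simp add: power2_eq_square mult_left_le)
    thus "\<tau> \<le> \<epsilon> / 1000" using \<epsilon> by (simp add: \<tau>_def \<rho>_def)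
    thus "\<tau> \<le> 1 / 1000" using \<epsilon> by simp
  qed (use \<rho> in \<open>simp add: \<tau>_def\<close>)
  have star: "whp (\<lambda>n \<omega>. \<forall>x\<in>{s n, t n}. star_ok (Wn n \<omega>) n x \<tau>)" using \<tau> by (intro whp_star_ok) auto
  have half: "(0::real) < 1 / 2" by simp
  have n1: "\<forall>\<^sub>F n in sequentially. 4 \<le> \<tau> * real n" using \<tau>(1) by real_asymp
  have n2: "\<forall>\<^sub>F n in sequentially. 2 * (2 + ln (real n)) \<le> \<tau> * real n" using \<tau>(1) by real_asymp
  have n3: "\<forall>\<^sub>F n in sequentially. 60 \<le> \<rho> * real n" using \<rho>(1) by real_asymp
  have n4: "\<forall>\<^sub>F n in sequentially. real n powr (1 / 2) \<le> d * real n / (256 * ln (real n + 1))" using d(1) by real_asymp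
  have n5: "\<forall>\<^sub>F n in sequentially. 8192 < \<rho> * d\<^sup>2 * real n" using \<rho>(1) d(1) by real_asymp
  have n6: "\<forall>\<^sub>F n in sequentially. real n powr (1 / 2) \<le> real n / 2" by real_asymp
  have "whp (\<lambda>n \<omega>. \<forall>k P. (1 - \<tau>) * real n \<le> real k \<longrightarrow> k < n \<longrightarrow> disjoint_paths n (s n) (t n) P k \<longrightarrow>
    (\<Sum>i\<in>{1..<k}. path_cost (Wn n \<omega>) (P i)) \<le> (1 + \<tau>) * n \<longrightarrow>
    next_path_le \<epsilon> n \<omega> P k)"
  proof (rule whp_mono[OF whp_conj[OF whp_conj[OF whp_weights whp_conj[OF star whp_windows[OF \<rho>]]] whp_window[OF d half]]])
    show "\<forall>\<^sub>F n in sequentially. \<forall>\<omega>\<in>space (M n).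
      (unit_weights n \<omega> \<and> (\<forall>x\<in>{s n, t n}. star_ok (Wn n \<omega>) n x \<tau>) \<and>
       (\<forall>u\<in>{1..n}. (real n - 1) * \<rho> / 8 \<le> real (card {v \<in> {1..n} - {u}. \<rho> / 2 \<le> W n {u, v} \<omega> \<and> W n {u, v} \<omega> \<le> \<rho>}))) \<and>
      sets_expand d (1 / 2) n \<omega> \<longrightarrow>
      (\<forall>k P. (1 - \<tau>) * real n \<le> real k \<longrightarrow> k < n \<longrightarrow> disjoint_paths n (s n) (t n) P k \<longrightarrow>
        (\<Sum>i\<in>{1..<k}. path_cost (Wn n \<omega>) (P i)) \<le> (1 + \<tau>) * n \<longrightarrow>
        next_path_le \<epsilon> n \<omega> P k)"
      using n1 n2 n3 n4 n5 n6 eventually_ge_at_top[of 2]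
    proof eventually_elim
      case (elim n)
      have n0: "real n > 0" using elim(7) by simp
      define L where "L = ln (real n)"
      have L: "0 \<le> L" using elim(7) by (auto simp: L_def)
      have stn: "s n \<in> {1..n}" "t n \<in> {1..n}" "s n \<noteq> t n" using st[OF elim(7)] by auto
      show ?case
      proof (intro ballI impI allI, elim conjE)
        fix \<omega> k P
        assume weights: "unit_weights n \<omega>"
          and star: "\<forall>x\<in>{s n, t n}. star_ok (Wn n \<omega>) n x \<tau>"
          and nbrs: "\<forall>u\<in>{1..n}. (real n - 1) * \<rho> / 8 \<le> real (card {v \<in> {1..n} - {u}. \<rho> / 2 \<le> W n {u, v} \<omega> \<and> W n {u, v} \<omega> \<le> \<rho>})"
          and window: "sets_expand d (1 / 2) n \<omega>"
          and k: "(1 - \<tau>) * real n \<le> real k" "k < n" and P: "disjoint_paths n (s n) (t n) P k"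
          and cost: "(\<Sum>i\<in>{1..<k}. path_cost (Wn n \<omega>) (P i)) \<le> (1 + \<tau>) * n"
        interpret nonneg_weights "Wn n \<omega>" n using weights by unfold_locales auto
        let ?D = "removed P k" and ?w = "Wn n \<omega>"
        have kn: "real n / 2 \<le> real k" "(1 - 2 * \<tau>) * real n \<le> real k - 2"
        proof -
          have a: "(1 - \<tau>) * real n = real n - \<tau> * real n" "(1 - 2 * \<tau>) * real n = real n - 2 * (\<tau> * real n)" by (simp_all add: algebra_simps)
          have b: "\<tau> * real n \<le> 1 / 1000 * real n" using \<tau> by (intro mult_right_mono) auto
          show "real n / 2 \<le> real k" using k(1) b unfolding a by linarith
          show "(1 - 2 * \<tau>) * real n \<le> real k - 2" using k(1) elim(1) unfolding a by linarith
        qed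
        have k0: "1 \<le> k" using kn n0 by simp
        \<comment> \<open>So close to n the bound to be proved leaves room for one edge of weight up
          to 1 at each terminal, and \<epsilon> to spare.\<close>
        have target: "2 + \<epsilon> \<le> (1 + \<epsilon>) * (2 * real k + L) / n"
        proof -
          have "(2 + \<epsilon>) * real n \<le> ((1 + \<epsilon>) * (2 * (1 - \<tau>))) * real n"
          proof (rule mult_right_mono)
            have "\<tau> * \<epsilon> \<le> \<epsilon> / 1000 * 1" using \<tau> \<epsilon> by (intro mult_mono) auto
            moreover have "(1 + \<epsilon>) * (2 * (1 - \<tau>)) = 2 + 2 * \<epsilon> - 2 * \<tau> - 2 * (\<tau> * \<epsilon>)" by (simp add: algebra_simps)
            ultimately show "2 + \<epsilon> \<le> (1 + \<epsilon>) * (2 * (1 - \<tau>))" using \<tau> \<epsilon> by linarith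
          qed simp
          also have "\<dots> = (1 + \<epsilon>) * (2 * ((1 - \<tau>) * real n))" by simp
          also have "\<dots> \<le> (1 + \<epsilon>) * (2 * real k + L)" using k(1) L \<epsilon> by (intro mult_left_mono) linarith+
          finally show ?thesis using n0 by (simp add: pos_le_divide_eq)
        qed
        show "conn ?w ?D n ((1 + \<epsilon>) * (2 * real k + ln (real n)) / n) (s n) (t n)"
        proof (cases "{s n, t n} \<in> ?D")
          case False
          have "W n {s n, t n} \<omega> \<le> 1" using weights stn by (auto simp: doubleton_complete_edges_iff)
          hence "conn ?w ?D n 1 (s n) (t n)" using stn False by (intro conn_edge) auto
          thus ?thesis using target \<epsilon> unfolding L_def by (elim conn_mono) linarith
        next
          case stD: True
          define mid where "mid = (\<Sum>e\<in>{e \<in> ?D. s n \<notin> e \<and> t n \<notin> e}. W n e \<omega>)"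
          \<comment> \<open>After multiplication by (1 + \<tau>) n, the allowed total (1 + \<tau>)^2
            n^2 exceeds the part ((1 - 2 \<tau>) n)^2 spent at the terminals by at most 6 \<tau>
            n^2; the logarithmic errors cost at most another \<tau> n^2.\<close>
          have mid: "mid \<le> 7 * \<tau> * n"
          proof -
            have "mid + ((real k - 2)\<^sup>2 - 2 * real n * ((1 + \<tau>) + \<tau> * L)) / ((1 + \<tau>) * real n) \<le> (1 + \<tau>) * n"
            proof -
              have "real k * ((1 + \<tau>) + \<tau> * L) \<le> real n * ((1 + \<tau>) + \<tau> * L)" using \<tau> L k(2) by (intro mult_right_mono) auto
              hence "((real k - 2)\<^sup>2 - 2 * real n * ((1 + \<tau>) + \<tau> * L)) / ((1 + \<tau>) * real n) \<le> ((real k - 2)\<^sup>2 - 2 * real k * ((1 + \<tau>) + \<tau> * L)) / ((1 + \<tau>) * real n)"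
                using \<tau> n0 by (intro divide_right_mono) auto
              moreover have "mid + ((real k - 2)\<^sup>2 - 2 * real k * ((1 + \<tau>) + \<tau> * L)) / ((1 + \<tau>) * real n) \<le> (\<Sum>i\<in>{1..<k}. path_cost ?w (P i))"
                unfolding mid_def L_def using weights by (intro removed_middle_le[OF stn k0 P \<tau>(1) bspec[OF star]]) auto
              ultimately show ?thesis using cost by linarith
            qed
            hence "(1 + \<tau>) * real n * (mid + ((real k - 2)\<^sup>2 - 2 * real n * ((1 + \<tau>) + \<tau> * L)) / ((1 + \<tau>) * real n)) \<le> (1 + \<tau>) * real n * ((1 + \<tau>) * n)"
              using \<tau> n0 by (intro mult_left_mono) auto
            moreover have "(1 + \<tau>) * real n * (mid + ((real k - 2)\<^sup>2 - 2 * real n * ((1 + \<tau>) + \<tau> * L)) / ((1 + \<tau>) * real n)) =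
              (1 + \<tau>) * real n * mid + ((real k - 2)\<^sup>2 - 2 * real n * ((1 + \<tau>) + \<tau> * L))"
              using \<tau> n0 by (simp add: distrib_left)
            moreover have "((1 - 2 * \<tau>) * real n)\<^sup>2 \<le> (real k - 2)\<^sup>2" using kn \<tau> by (intro power_mono) auto
            moreover have "2 * real n * ((1 + \<tau>) + \<tau> * L) \<le> \<tau> * (real n)\<^sup>2"
            proof -
              have "\<tau> * L \<le> 1 * L" using \<tau> L by (intro mult_right_mono) auto
              hence "(1 + \<tau>) + \<tau> * L \<le> 2 + L" using \<tau> by linarith
              hence "2 * ((1 + \<tau>) + \<tau> * L) \<le> 2 * (2 + L)" by (rule mult_left_mono) simp
              hence "2 * ((1 + \<tau>) + \<tau> * L) \<le> \<tau> * real n" using elim(2) unfolding L_def by (rule order.trans)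
              hence "real n * (2 * ((1 + \<tau>) + \<tau> * L)) \<le> real n * (\<tau> * real n)" by (rule mult_left_mono) simp
              thus ?thesis by (simp add: power2_eq_square algebra_simps)
            qed
            moreover have "(1 + \<tau>) * real n * ((1 + \<tau>) * n) - ((1 - 2 * \<tau>) * real n)\<^sup>2 = 6 * (\<tau> * (real n)\<^sup>2) - 3 * (\<tau> * real n)\<^sup>2"
              by (simp add: power2_eq_square algebra_simps)
            moreover have "0 \<le> (\<tau> * real n)\<^sup>2" by simp
            ultimately have a: "(1 + \<tau>) * real n * mid \<le> 7 * (\<tau> * (real n)\<^sup>2)" by linarith
            have m0: "0 \<le> mid" unfolding mid_def using removed_complete[OF P] nonneg by (intro sum_nonneg) auto
            have "0 \<le> \<tau> * (real n * mid)" using m0 \<tau> by simp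
            hence "real n * mid \<le> real n * (7 * \<tau> * n)" using a by (simp add: algebra_simps power2_eq_square)
            thus ?thesis using n0 by simp
          qed
          have heavy_mid: "real (card {e \<in> {e \<in> ?D. s n \<notin> e \<and> t n \<notin> e}. \<rho> / 2 \<le> W n e \<omega>}) \<le> 14 / 1000 * (\<rho> * n)"
          proof -
            have "real (card {e \<in> {e \<in> ?D. s n \<notin> e \<and> t n \<notin> e}. \<rho> / 2 \<le> W n e \<omega>}) \<le> (7 * \<tau> * n) / (\<rho> / 2)"
              using removed_complete[OF P] nonneg mid \<rho> by (intro card_heavy_le) (auto simp: mid_def)
            also have "\<dots> = 14 / 1000 * (\<rho> * n)" using \<rho> by (simp add: \<tau>_def power2_eq_square)
            finally show ?thesis .
          qed
          have "\<exists>A. A \<subseteq> {1..n} - {s n, t n} \<and> \<rho> * n / 16 \<le> real (card A) \<and> (\<forall>v\<in>A. conn ?w ?D n (1 + \<rho>) x v)" if x: "x \<in> {s n, t n}" for x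
          proof -
            have xn: "x \<in> {1..n}" using x stn by auto
            have Dx: "finite {v. {x, v} \<in> ?D}" "card {v. {x, v} \<in> ?D} = k - 1"
              using card_star_removed[OF P stn(3) k0 x] by auto
            \<comment> \<open>Only k - 1 of the n - 1 edges at \<open>x\<close> have been removed,
              so one is left; its other end is not a terminal, since \<open>{s n, t n}\<close> is
              among the removed edges in this case.\<close>
            have "\<not> {1..n} - {x} \<subseteq> {v. {x, v} \<in> ?D}"
            proof
              assume "{1..n} - {x} \<subseteq> {v. {x, v} \<in> ?D}"
              hence "card ({1..n} - {x}) \<le> k - 1" using Dx card_mono[OF Dx(1)] by metis
              thus False using k(2) k0 xn by simp
            qed
            then obtain u where u: "u \<in> {1..n}" "u \<noteq> x" "{x, u} \<notin> ?D" by blast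
            have ust: "u \<notin> {s n, t n}" using u x stD by (auto simp: insert_commute)
            define N where "N = {v \<in> {1..n} - {u}. \<rho> / 2 \<le> W n {u, v} \<omega> \<and> W n {u, v} \<omega> \<le> \<rho>}"
            define H where "H = {e \<in> {e \<in> ?D. s n \<notin> e \<and> t n \<notin> e}. \<rho> / 2 \<le> W n e \<omega>}"
            define R where "R = {v \<in> N - {s n, t n}. {u, v} \<in> ?D}"
            have N: "finite N" "(real n - 1) * \<rho> / 8 \<le> real (card N)" using bspec[OF nbrs u(1)] by (simp_all add: N_def)
            have fD: "finite ?D" using removed_complete[OF P] finite_subset finite_complete_edges by blast
            have "card R = card ((\<lambda>v. {u, v}) ` R)" by (rule card_image[symmetric]) (auto simp: inj_on_def doubleton_eq_iff)
            also have "\<dots> \<le> card H"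
            proof (rule card_mono)
              show "finite H" unfolding H_def using fD by simp
              show "(\<lambda>v. {u, v}) ` R \<subseteq> H" using ust unfolding R_def H_def N_def by auto
            qed
            finally have cR: "card R \<le> card H" .
            have "N \<subseteq> (N - {s n, t n} - R) \<union> {s n, t n} \<union> R" by blast
            hence "card N \<le> card ((N - {s n, t n} - R) \<union> {s n, t n} \<union> R)" using N(1) by (intro card_mono) (auto simp: R_def)
            also have "\<dots> \<le> card (N - {s n, t n} - R) + card {s n, t n} + card R"
              by (rule order.trans[OF card_Un_le add_right_mono[OF card_Un_le]])
            also have "card {s n, t n} = 2" using stn by simp
            finally have "real (card N) \<le> real (card (N - {s n, t n} - R)) + 2 + real (card H)" using cR by linarith
            moreover have "(real n - 1) * \<rho> / 8 = \<rho> * n / 8 - \<rho> / 8" by (simp add: algebra_simps diff_divide_distrib)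
            ultimately have "\<rho> * n / 16 \<le> real (card (N - {s n, t n} - R))"
              using N(2) heavy_mid elim(3) \<rho> unfolding H_def by linarith
            moreover have "conn ?w ?D n (1 + \<rho>) x v" if v: "v \<in> N - {s n, t n} - R" for v
            proof (rule conn_trans)
              have "W n {x, u} \<omega> \<le> 1" using weights xn u by (auto simp: doubleton_complete_edges_iff)
              thus "conn ?w ?D n 1 x u" using u xn by (intro conn_edge) auto
              show "conn ?w ?D n \<rho> u v" using v u unfolding N_def R_def by (intro conn_edge) auto
            qed
            moreover have "N - {s n, t n} - R \<subseteq> {1..n} - {s n, t n}" unfolding N_def by blast
            ultimately show ?thesis by blast
          qed
          then obtain A where A: "\<And>x. x \<in> {s n, t n} \<Longrightarrow> A x \<subseteq> {1..n} - {s n, t n} \<and> \<rho> * n / 16 \<le> real (card (A x)) \<and> (\<forall>v\<in>A x. conn ?w ?D n (1 + \<rho>) x v)"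
            by metis
          define y where "y = d * real k / n"
          have y: "0 < y" "d / 2 \<le> y" "y \<le> d"
          proof -
            have "d * (real n / 2) \<le> d * real k" "d * real k \<le> d * real n" using d kn k(2) by (auto intro!: mult_left_mono)
            thus "d / 2 \<le> y" "y \<le> d" using n0 by (auto simp: y_def field_simps)
            thus "0 < y" using d by linarith
          qed
          have heavy: "real (card {e \<in> ?D. y \<le> W n e \<omega>}) \<le> 4 * real n / d"
          proof -
            have "real (card {e \<in> ?D. y \<le> W n e \<omega>}) \<le> ((1 + \<tau>) * n) / y"
              using removed_complete[OF P] nonneg sum_removed[OF P, of ?w] cost y by (intro card_heavy_le) auto
            also have "\<dots> \<le> (2 * real n) / (d / 2)"
            proof (rule frac_le)
              show "(1 + \<tau>) * real n \<le> 2 * real n" using \<tau> mult_right_mono[of "1 + \<tau>" 2 "real n"] by simp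
            qed (use y d in auto)
            finally show ?thesis by simp
          qed
          have heavyA: "real (card {e \<in> ?D. y \<le> W n e \<omega>}) < real (card (A x)) * real n * y / 64" if x: "x \<in> {s n, t n}" for x
          proof -
            have "8192 * real n < \<rho> * d\<^sup>2 * real n * n" using elim(5) n0 by (intro mult_strict_right_mono) auto
            hence "4 * real n / d < \<rho> * n / 16 * n * (d / 2) / 64" using d by (simp add: field_simps power2_eq_square)
            also have "\<dots> \<le> real (card (A x)) * real n * y / 64"
              using A[OF x] y d \<rho> by (intro divide_right_mono mult_mono) auto
            finally show ?thesis using heavy by linarith
          qed
          have k\<gamma>: "real n powr (1 / 2) \<le> real k" using elim(6) kn by linarith
          \<comment> \<open>Three rounds suffice, because each multiplies a set by at least
            n^(1/2).\<close>
          have "conn ?w ?D n (2 * (1 + \<rho>) + 4 * real (3::nat) * y) (s n) (t n)"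
          proof (rule window_meet[where A=A and \<rho>="real n * y / (128 * ln (real n + 1))"])
            show "real (card U) * real n * y / 64 \<le> real (card {e \<in> between U ({1..n} - {s n, t n} - U - B). y \<le> W n e \<omega> \<and> W n e \<omega> \<le> 2 * y})"
              if "U \<subseteq> {1..n} - {s n, t n}" "B \<subseteq> {1..n} - {s n, t n}" "U \<inter> B = {}" "U \<noteq> {}"
                "real (card U + card B) * ln (real n + 1) \<le> real (card U) * real n * y / 128" "8 * (card U + card B) \<le> 7 * n" for U B
              using window[rule_format, OF k\<gamma> _ y_def that] k(2) by simp
            show "A x \<subseteq> {1..n} - {s n, t n} \<and> A x \<noteq> {} \<and> real (card {e \<in> ?D. y \<le> W n e \<omega>}) < real (card (A x)) * real n * y / 64
              \<and> (\<forall>v\<in>A x. conn ?w ?D n (1 + \<rho>) x v)" if x: "x \<in> {s n, t n}" for x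
            proof -
              have "0 < real (card (A x))" using A[OF x] elim(3) by linarith
              hence "A x \<noteq> {}" by auto
              thus ?thesis using A[OF x] heavyA[OF x] by blast
            qed
            have \<rho>: "real n powr (1 / 2) \<le> real n * y / (128 * ln (real n + 1))"
            proof -
              have "d * real n / (256 * ln (real n + 1)) = real n * (d / 2) / (128 * ln (real n + 1))" by simp
              also have "\<dots> \<le> real n * y / (128 * ln (real n + 1))" using y n0 by (intro divide_right_mono mult_left_mono) auto
              finally show ?thesis using elim(4) by linarith
            qed
            have n1: "1 \<le> real n powr (1 / 2)" using elim(7) by (intro ge_one_powr_ge_zero) auto
            thus "1 \<le> real n * y / (128 * ln (real n + 1))" using \<rho> by linarith
            have "real n powr 1 < real n powr (1 / 2 * real (3::nat))" using elim(7) by (intro powr_less_mono) auto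
            also have "\<dots> = (real n powr (1 / 2)) powr real (3::nat)" by (rule powr_powr[symmetric])
            also have "\<dots> = (real n powr (1 / 2)) ^ 3" using n0 by (intro powr_realpow) auto
            also have "\<dots> \<le> (real n * y / (128 * ln (real n + 1))) ^ 3" using \<rho> by (intro power_mono) auto
            finally show "real n < (real n * y / (128 * ln (real n + 1))) ^ 3" using n0 by simp
            show "finite ?D" using removed_complete[OF P] finite_subset finite_complete_edges by blast
          qed (use y elim(7) in auto)
          moreover have "2 * (1 + \<rho>) + 4 * real (3::nat) * y \<le> 2 + \<epsilon>" using y(3) \<epsilon> by (simp add: \<rho>_def d_def)
          ultimately show ?thesis using target unfolding L_def by (elim conn_mono) linarith
        qed
      qed
    qed
  qed
  thus ?thesis using \<tau> by (intro exI[of _ \<tau>]) auto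
qed

end

section \<open>Bounds for the path costs\<close>

text \<open>Existence and cost bounds need a joint induction: reconnection presupposes that the
  earlier paths were cheap, and their bounds hold for every choice of them.\<close>

lemma successive_cheapest_paths_exist_le:
  assumes conn: "\<And>k P. 1 \<le> k \<Longrightarrow> k < n \<Longrightarrow> disjoint_paths n s t P k \<Longrightarrow> \<forall>i\<in>{1..<k}. path_cost w (P i) \<le> c i \<Longrightarrow>
      conn w (removed P k) n (c k) s t"
    and "k < n"
  shows "(\<exists>P. successive_cheapest_paths n s t w P k) \<and>
    (\<forall>P. successive_cheapest_paths n s t w P k \<longrightarrow> (\<forall>i\<in>{1..k}. path_cost w (P i) \<le> c i))"
  using \<open>k < n\<close>
proof (induction k)
  case 0
  show ?case by (auto simp: successive_cheapest_paths_def)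
next
  case (Suc k)
  have IH: "\<exists>P. successive_cheapest_paths n s t w P k" "\<And>P. successive_cheapest_paths n s t w P k \<Longrightarrow> \<forall>i\<in>{1..k}. path_cost w (P i) \<le> c i"
    using Suc by auto
  have c: "conn w (removed P (Suc k)) n (c (Suc k)) s t" if "successive_cheapest_paths n s t w P k" for P
    using IH(2)[OF that] successive_cheapest_paths_disjoint[OF that] Suc(2) by (intro conn) (auto simp: atLeastLessThanSuc_atLeastAtMost)
  show ?case
  proof (intro conjI allI impI ballI)
    show "\<exists>P. successive_cheapest_paths n s t w P (Suc k)"
      using IH(1) successive_cheapest_paths_extend[OF _ c] by blast
    fix P i assume P: "successive_cheapest_paths n s t w P (Suc k)" and i: "i \<in> {1..Suc k}"
    have P': "successive_cheapest_paths n s t w P k" using successive_cheapest_paths_mono[OF P] by simp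
    show "path_cost w (P i) \<le> c i"
    proof (cases "i = Suc k")
      case True
      thus ?thesis using successive_cheapest_paths_cost_le[OF P _ c[OF P']] by simp
    next
      case False
      thus ?thesis using IH(2)[OF P'] i by auto
    qed
  qed
qed

section \<open>Upper bound for all k simultaneously\<close>

context random_weights_seq
begin

lemma whp_cost_le:
  fixes \<epsilon> :: real
  assumes \<epsilon>: "0 < \<epsilon>" "\<epsilon> \<le> 1"
  shows "whp (\<lambda>n \<omega>. \<forall>k<n. (\<exists>P. paths_between n \<omega> P k) \<and>
    (\<forall>P. paths_between n \<omega> P k \<longrightarrow>
      (\<forall>i\<in>{1..k}. path_cost (Wn n \<omega>) (P i) \<le> (1 + \<epsilon>) * (2 * real i + ln (real n)) / n)))"
proof -
  obtain \<tau> where \<tau>: "\<tau> > 0" "\<tau> \<le> 1 / 2" and large: "whp (\<lambda>n \<omega>. \<forall>k P. (1 - \<tau>) * real n \<le> real k \<longrightarrow> k < n \<longrightarrow> disjoint_paths n (s n) (t n) P k \<longrightarrow>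
    (\<Sum>i\<in>{1..<k}. path_cost (Wn n \<omega>) (P i)) \<le> (1 + \<tau>) * n \<longrightarrow>
    next_path_le \<epsilon> n \<omega> P k)"
    using whp_large_k[OF \<epsilon>] by blast
  \<comment> \<open>The last range admits precision \<open>\<epsilon>\<close> only if the earlier
    paths cost at most (1 + \<tau>) n in total, where \<open>\<tau>\<close> depends on
    \<open>\<epsilon>\<close>; the earlier ranges are therefore treated with the finer precision
    \<open>\<delta>\<close>.\<close>
  define \<delta> where "\<delta> = min \<epsilon> (\<tau> / 8)"
  have \<delta>: "0 < \<delta>" "\<delta> \<le> 1" "\<delta> \<le> \<epsilon>" "8 * \<delta> \<le> \<tau>" using \<epsilon> \<tau> by (auto simp: \<delta>_def)
  obtain \<gamma> where \<gamma>: "\<gamma> > 0" and small: "whp (\<lambda>n \<omega>. \<forall>k P. 1 \<le> k \<longrightarrow> real k \<le> real n powr \<gamma> \<longrightarrow> disjoint_paths n (s n) (t n) P k \<longrightarrow>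
    cheap_so_far n \<omega> P k \<longrightarrow>
    next_path_le \<delta> n \<omega> P k)"
    using whp_small_k[OF \<delta>(1,2)] by blast
  have n1: "\<forall>\<^sub>F n in sequentially. 2 * ln (real n) + 6 \<le> \<delta> * real n" using \<delta>(1) by real_asymp
  show ?thesis
  proof (rule whp_mono[OF whp_conj[OF small whp_conj[OF whp_medium_k[OF \<delta>(1,2) \<gamma>] large]]])
    show "\<forall>\<^sub>F n in sequentially. \<forall>\<omega>\<in>space (M n).
      (\<forall>k P. 1 \<le> k \<longrightarrow> real k \<le> real n powr \<gamma> \<longrightarrow> disjoint_paths n (s n) (t n) P k \<longrightarrow>
        cheap_so_far n \<omega> P k \<longrightarrow>
        next_path_le \<delta> n \<omega> P k) \<and>
      (\<forall>k P. 1 \<le> k \<longrightarrow> real n powr \<gamma> \<le> real k \<longrightarrow> real k \<le> (1 - \<delta>) * real n \<longrightarrow> disjoint_paths n (s n) (t n) P k \<longrightarrow>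
        cheap_so_far n \<omega> P k \<longrightarrow>
        next_path_le \<delta> n \<omega> P k) \<and>
      (\<forall>k P. (1 - \<tau>) * real n \<le> real k \<longrightarrow> k < n \<longrightarrow> disjoint_paths n (s n) (t n) P k \<longrightarrow>
        (\<Sum>i\<in>{1..<k}. path_cost (Wn n \<omega>) (P i)) \<le> (1 + \<tau>) * n \<longrightarrow>
        next_path_le \<epsilon> n \<omega> P k) \<longrightarrow>
      (\<forall>k<n. (\<exists>P. paths_between n \<omega> P k) \<and>
        (\<forall>P. paths_between n \<omega> P k \<longrightarrow>
          (\<forall>i\<in>{1..k}. path_cost (Wn n \<omega>) (P i) \<le> (1 + \<epsilon>) * (2 * real i + ln (real n)) / n)))"
      using n1 eventually_ge_at_top[of 2]
    proof eventually_elim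
      case (elim n)
      have n0: "real n > 0" using elim(2) by simp
      define L where "L = ln (real n)"
      have L: "0 \<le> L" "L \<le> real n" "2 * L + 6 \<le> \<delta> * real n" using elim ln_le_minus_one[of "real n"] by (auto simp: L_def)
      define c where "c k = (if real k \<le> (1 - \<delta>) * real n then 1 + \<delta> else 1 + \<epsilon>) * (2 * real k + L) / n" for k :: nat
      have c_le: "c k \<le> (1 + \<epsilon>) * (2 * real k + L) / n" for k
        unfolding c_def using \<delta> L n0 by (intro divide_right_mono mult_right_mono) auto
      show ?case
      proof (intro ballI impI, elim conjE)
        fix \<omega>
        assume small: "\<forall>k P. 1 \<le> k \<longrightarrow> real k \<le> real n powr \<gamma> \<longrightarrow> disjoint_paths n (s n) (t n) P k \<longrightarrow>
            cheap_so_far n \<omega> P k \<longrightarrow>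
            next_path_le \<delta> n \<omega> P k"
          and medium: "\<forall>k P. 1 \<le> k \<longrightarrow> real n powr \<gamma> \<le> real k \<longrightarrow> real k \<le> (1 - \<delta>) * real n \<longrightarrow> disjoint_paths n (s n) (t n) P k \<longrightarrow>
            cheap_so_far n \<omega> P k \<longrightarrow>
            next_path_le \<delta> n \<omega> P k"
          and large: "\<forall>k P. (1 - \<tau>) * real n \<le> real k \<longrightarrow> k < n \<longrightarrow> disjoint_paths n (s n) (t n) P k \<longrightarrow>
            (\<Sum>i\<in>{1..<k}. path_cost (Wn n \<omega>) (P i)) \<le> (1 + \<tau>) * n \<longrightarrow>
            next_path_le \<epsilon> n \<omega> P k"
        have step: "conn (Wn n \<omega>) (removed P k) n (c k) (s n) (t n)"
          if k: "1 \<le> k" "k < n" and P: "disjoint_paths n (s n) (t n) P k" and le: "\<forall>i\<in>{1..<k}. path_cost (Wn n \<omega>) (P i) \<le> c i" for k P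
        proof (cases "real k \<le> (1 - \<delta>) * real n")
          case True
          have "(\<Sum>i\<in>{1..<k}. path_cost (Wn n \<omega>) (P i)) \<le> (\<Sum>i\<in>{1..<k}. 4 * (real k + L) / n)"
          proof (rule sum_mono)
            fix i assume i: "i \<in> {1..<k}"
            have "path_cost (Wn n \<omega>) (P i) \<le> (1 + \<epsilon>) * (2 * real i + L) / n" using le i c_le order.trans by blast
            also have "\<dots> \<le> 2 * (2 * real k + L) / n" using i \<epsilon> L n0 by (intro divide_right_mono mult_mono) auto
            also have "\<dots> \<le> 4 * (real k + L) / n" using L n0 by (intro divide_right_mono) auto
            finally show "path_cost (Wn n \<omega>) (P i) \<le> 4 * (real k + L) / n" .
          qed
          also have "\<dots> = real (k - 1) * (4 * (real k + L) / n)" by simp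
          also have "\<dots> \<le> real k * (4 * (real k + L) / n)" using L n0 by (intro mult_right_mono) auto
          also have "\<dots> = 4 * real k * (real k + ln (real n)) / n" by (simp add: L_def)
          finally have cost: "cheap_so_far n \<omega> P k" .
          have "next_path_le \<delta> n \<omega> P k"
          proof (cases "real k \<le> real n powr \<gamma>")
            case True
            thus ?thesis using small k(1) P cost by blast
          next
            case False
            hence "real n powr \<gamma> \<le> real k" by simp
            thus ?thesis using medium k(1) \<open>real k \<le> (1 - \<delta>) * real n\<close> P cost by blast
          qed
          thus ?thesis using True by (simp add: c_def L_def)
        next
          case False
          \<comment> \<open>The earlier paths beyond the fine range: at most \<delta> n + 1 of them,
            for which the crude bound 6 is good enough, since
            \<open>8 * \<delta> \<le> \<tau>\<close> absorbs their contribution.\<close>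
          define S where "S = {i \<in> {1..<k}. (1 - \<delta>) * real n < real i}"
          have S: "S \<subseteq> {1..<k}" "finite S" by (auto simp: S_def)
          have cS: "real (card S) \<le> \<delta> * n + 1"
          proof (cases "S = {}")
            case False
            define m where "m = nat \<lfloor>(1 - \<delta>) * real n\<rfloor>"
            have m0: "0 \<le> (1 - \<delta>) * real n" using \<delta> by simp
            have m: "real m \<le> (1 - \<delta>) * real n" "(1 - \<delta>) * real n \<le> real m + 1" using m0 unfolding m_def by linarith+
            have "S \<subseteq> {m<..<n}" using k(2) m(1) unfolding S_def by auto
            hence "card S \<le> n - Suc m" using card_mono[of "{m<..<n}" S] by simp
            moreover have "m < n" using \<open>S \<subseteq> {m<..<n}\<close> False by auto
            ultimately have "real (card S) \<le> real n - real m" by linarith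
            thus ?thesis using m(2) by (simp add: algebra_simps)
          qed (use \<delta> in simp)
          have "(\<Sum>i\<in>{1..<k}. path_cost (Wn n \<omega>) (P i)) \<le> (\<Sum>i\<in>{1..<k}. (1 + \<delta>) * (2 * real i + L) / n + of_bool (i \<in> S) * 6)"
          proof (rule sum_mono)
            fix i assume i: "i \<in> {1..<k}"
            show "path_cost (Wn n \<omega>) (P i) \<le> (1 + \<delta>) * (2 * real i + L) / n + of_bool (i \<in> S) * 6"
            proof (cases "i \<in> S")
              case True
              have "path_cost (Wn n \<omega>) (P i) \<le> (1 + \<epsilon>) * (2 * real i + L) / n" using le i c_le order.trans by blast
              also have "\<dots> \<le> 2 * (2 * real n + real n) / n" using i k \<epsilon> L n0 by (intro divide_right_mono mult_mono) auto
              also have "\<dots> = 6" using n0 by simp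
              finally show ?thesis using True \<delta> L by (simp add: add_increasing)
            next
              case False
              thus ?thesis using bspec[OF le i] i unfolding S_def c_def by auto
            qed
          qed
          also have "\<dots> = (1 + \<delta>) / n * (\<Sum>i\<in>{1..<k}. 2 * real i + L) + 6 * real (card S)"
          proof -
            have "(\<Sum>i\<in>{1..<k}. of_bool (i \<in> S) * 6) = (\<Sum>i\<in>S. 6 :: real)" using S by (intro sum.mono_neutral_cong_right) auto
            moreover have "(\<Sum>i\<in>{1..<k}. (1 + \<delta>) * (2 * real i + L) / n) = (1 + \<delta>) / n * (\<Sum>i\<in>{1..<k}. 2 * real i + L)"
              by (subst sum_distrib_left) simp
            ultimately show ?thesis unfolding sum.distrib[of "\<lambda>i. (1 + \<delta>) * (2 * real i + L) / n"] by simp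
          qed
          also have "(\<Sum>i\<in>{1..<k}. 2 * real i + L) = (real k - 1) * (real k + L)"
            using k(1) by (induction k rule: dec_induct) (auto simp: algebra_simps)
          also have "(1 + \<delta>) / n * ((real k - 1) * (real k + L)) + 6 * real (card S) \<le> (1 + \<delta>) / n * (real n * (real n + L)) + 6 * (\<delta> * n + 1)"
            using k L \<delta> n0 cS by (intro add_mono mult_left_mono mult_mono) auto
          also have "\<dots> = n + 7 * (\<delta> * n) + L + \<delta> * L + 6" using n0 by (simp add: field_simps)
          also have "\<dots> \<le> (1 + \<tau>) * n"
          proof -
            have "\<delta> * L \<le> 1 * L" using \<delta> L by (intro mult_right_mono) auto
            moreover have "8 * \<delta> * n \<le> \<tau> * n" using \<delta> by (intro mult_right_mono) auto
            moreover have "(1 + \<tau>) * n = n + \<tau> * n" by (simp add: algebra_simps)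
            ultimately show ?thesis using L(3) by linarith
          qed
          finally have cost: "(\<Sum>i\<in>{1..<k}. path_cost (Wn n \<omega>) (P i)) \<le> (1 + \<tau>) * n" .
          have "(1 - \<tau>) * real n \<le> (1 - \<delta>) * real n" using \<delta> by (intro mult_right_mono) auto
          hence "(1 - \<tau>) * real n \<le> real k" using False by linarith
          hence "next_path_le \<epsilon> n \<omega> P k" using large k(2) P cost by blast
          thus ?thesis using False by (simp add: c_def L_def)
        qed
        have "(\<exists>P. paths_between n \<omega> P k) \<and>
            (\<forall>P. paths_between n \<omega> P k \<longrightarrow> (\<forall>i\<in>{1..k}. path_cost (Wn n \<omega>) (P i) \<le> c i))" if "k < n" for k
          by (rule successive_cheapest_paths_exist_le[OF step that])
        thus "\<forall>k<n. (\<exists>P. paths_between n \<omega> P k) \<and>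
          (\<forall>P. paths_between n \<omega> P k \<longrightarrow>
            (\<forall>i\<in>{1..k}. path_cost (Wn n \<omega>) (P i) \<le> (1 + \<epsilon>) * (2 * real i + ln (real n)) / n))"
          using c_le unfolding L_def by (meson order.trans)
      qed
    qed
  qed
qed

end

text \<open>If \<open>P\<^sub>k\<close> were too cheap, then so would be all \<open>P\<^sub>i\<close> with \<open>i \<le> k\<close>, and the total cost of
  \<open>P\<^sub>1, \<dots>, P\<^sub>k\<close> would be too small for the edges they use at \<open>s\<close> and at \<open>t\<close> and, when \<open>k\<close> is
  at most of order \<open>ln n\<close>, for the cheap edges between.\<close>

lemma (in nonneg_weights) path_cost_ge:
  fixes \<epsilon> L :: real
  assumes st: "s \<in> {1..n}" "t \<in> {1..n}" "s \<noteq> t" and \<epsilon>: "0 < \<epsilon>" "\<epsilon> \<le> 1" and d: "d = \<epsilon>\<^sup>2 / 48"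
    and L: "L = ln (real n)" "96 / \<epsilon>\<^sup>2 < L" and k: "1 \<le> k"
    and P: "successive_cheapest_paths n s t w P k"
    and ok: "\<And>x. x \<in> {s, t} \<Longrightarrow> star_ok w n x d"
    and le1: "\<And>e. e \<in> complete_edges n \<Longrightarrow> w e \<le> 1"
    and cost: "\<And>i. i \<in> {1..k} \<Longrightarrow> path_cost w (P i) \<le> (1 + d) * (2 * real i + L) / n"
    and mid: "\<And>q. distinct q \<Longrightarrow> set q \<subseteq> {1..n} - {s, t} \<Longrightarrow> 2 \<le> length q \<Longrightarrow>
      w {s, hd q} \<le> (8 / \<epsilon>\<^sup>2 + 1) * L / n \<Longrightarrow> w {last q, t} \<le> (8 / \<epsilon>\<^sup>2 + 1) * L / n \<Longrightarrow> (1 - d) * L / n < path_cost w q"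
    and common: "\<And>u. u \<in> {1..n} - {s, t} \<Longrightarrow> w {s, u} \<le> (8 / \<epsilon>\<^sup>2 + 1) * L / n \<Longrightarrow> (8 / \<epsilon>\<^sup>2 + 1) * L / n < w {u, t}"
    and direct: "(8 / \<epsilon>\<^sup>2 + 1) * L / n < w {s, t}"
  shows "(1 - \<epsilon>) * (2 * real k + L) / n \<le> path_cost w (P k)"
proof (rule ccontr)
  assume "\<not> ?thesis"
  hence Xk: "path_cost w (P k) < (1 - \<epsilon>) * (2 * real k + L) / n" by simp
  have n0: "real n > 0" using st by auto
  have \<epsilon>2: "0 < \<epsilon>\<^sup>2" "\<epsilon>\<^sup>2 \<le> \<epsilon>" using \<epsilon> by (auto simp: power2_eq_square mult_left_le)
  have d0: "0 < d" "d \<le> 1" using \<epsilon>2 \<epsilon> by (auto simp: d)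
  have L0: "0 < L" using L(2) \<epsilon>2 by (smt (verit) divide_pos_pos)
  have k0: "1 \<le> real k" using k by simp
  have disj: "disjoint_paths n s t P (Suc k)" by (rule successive_cheapest_paths_disjoint[OF P])
  have pk: "P i \<in> st_paths n s t" if "i \<in> {1..k}" for i using disj that unfolding disjoint_paths_def by auto
  have mono: "path_cost w (P i) \<le> path_cost w (P k)" if "i \<in> {1..k}" for i
    using successive_cheapest_paths_cost_mono[OF P, of i k] that by simp
  let ?\<Sigma> = "\<Sum>i\<in>{1..k}. path_cost w (P i)" and ?\<beta> = "(1 + d) + d * L"
  define Mid where "Mid = (\<Sum>e\<in>{e \<in> removed P (Suc k). s \<notin> e \<and> t \<notin> e}. w e)"
  have lower: "Mid * n + (1 - d) * (real k)\<^sup>2 - 2 * real k - 4 * real k * ?\<beta> \<le> ?\<Sigma> * n"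
  proof -
    have gen: "real n * (x + y / ((1 + d) * real n)) = x * n + y / (1 + d)" for x y :: real using n0 d0 by (simp add: distrib_left)
    have "Mid + ((real (Suc k) - 2)\<^sup>2 - 2 * real (Suc k) * ?\<beta>) / ((1 + d) * real n) \<le> ?\<Sigma>"
      using removed_middle_le[OF st _ disj d0(1) ok le1] unfolding Mid_def L(1) by (simp add: atLeastLessThanSuc_atLeastAtMost)
    hence "n * (Mid + ((real k - 1)\<^sup>2 - 2 * real (Suc k) * ?\<beta>) / ((1 + d) * real n)) \<le> n * ?\<Sigma>" by (intro mult_left_mono) auto
    hence a: "Mid * n + ((real k - 1)\<^sup>2 - 2 * real (Suc k) * ?\<beta>) / (1 + d) \<le> ?\<Sigma> * n"
      unfolding gen by (simp add: mult.commute)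
    have b: "2 * real (Suc k) * ?\<beta> / (1 + d) \<le> 4 * real k * ?\<beta>"
    proof -
      have "2 * real (Suc k) * ?\<beta> / (1 + d) \<le> 2 * real (Suc k) * ?\<beta> / 1" using d0 L0 by (intro divide_left_mono) auto
      also have "\<dots> \<le> 4 * real k * ?\<beta>" using d0 L0 k0 by (subst div_by_1, intro mult_right_mono) auto
      finally show ?thesis .
    qed
    have c: "(1 - d) * (real k)\<^sup>2 - 2 * real k \<le> (real k - 1)\<^sup>2 / (1 + d)"
    proof -
      have "(1 - d) * (1 + d) * (real k - 1)\<^sup>2 \<le> 1 * (real k - 1)\<^sup>2" by (intro mult_right_mono) (auto simp: algebra_simps)
      hence "(1 - d) * (real k - 1)\<^sup>2 \<le> (real k - 1)\<^sup>2 / (1 + d)" using d0 by (simp add: pos_le_divide_eq mult_ac)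
      moreover have "(1 - d) * (real k - 1)\<^sup>2 = (1 - d) * (real k)\<^sup>2 - 2 * real k + 2 * d * real k + (1 - d)"
        by (simp add: power2_eq_square algebra_simps)
      moreover have "0 \<le> 2 * d * real k" using d0 by simp
      ultimately show ?thesis using d0 by linarith
    qed
    from a b c show ?thesis unfolding diff_divide_distrib by linarith
  qed
  \<comment> \<open>Costs increase along the sequence, so the last \<epsilon> k / 2 paths cost no
    more than P k. Their individual upper bounds, times n, are still at least 2k + L - \<epsilon> k,
    so each saves \<epsilon>/2 (2k + L) against its bound; the total saving is quadratic in
    \<epsilon>.\<close>
  have upper: "?\<Sigma> * n \<le> (1 + d) * (real k * (real k + 1 + L)) - (\<epsilon> / 2 * real k) * (\<epsilon> / 2 * (2 * real k + L))"
  proof -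
    define m where "m = nat \<lceil>\<epsilon> / 2 * real k\<rceil>"
    have \<epsilon>k: "0 < \<epsilon> / 2 * real k" "\<epsilon> / 2 * real k \<le> real k / 2" using \<epsilon> k0 by auto
    have m: "\<epsilon> / 2 * real k \<le> real m" "real m \<le> \<epsilon> / 2 * real k + 1" using \<epsilon>k unfolding m_def by linarith+
    have mk: "m \<le> k" using m(2) \<epsilon>k k0 by (cases "k = 1") (use m_def \<epsilon>k in \<open>auto simp: nat_le_iff ceiling_le_iff\<close>)
    have "?\<Sigma> * n = (\<Sum>i\<in>{1..k}. path_cost w (P i) * n)" by (simp add: sum_distrib_right)
    also have "\<dots> \<le> (\<Sum>i\<in>{1..k}. (1 + d) * (2 * real i + L) - of_bool (i \<in> {k - m<..k}) * (\<epsilon> / 2 * (2 * real k + L)))"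
    proof (rule sum_mono)
      fix i assume i: "i \<in> {1..k}"
      have u: "path_cost w (P i) * n \<le> (1 + d) * (2 * real i + L)" using cost[OF i] n0 by (simp add: pos_le_divide_eq)
      have v: "path_cost w (P i) * n \<le> (1 - \<epsilon>) * (2 * real k + L)"
      proof -
        have "path_cost w (P i) \<le> (1 - \<epsilon>) * (2 * real k + L) / n" using mono[OF i] Xk by linarith
        thus ?thesis using n0 by (simp add: pos_le_divide_eq)
      qed
      show "path_cost w (P i) * n \<le> (1 + d) * (2 * real i + L) - of_bool (i \<in> {k - m<..k}) * (\<epsilon> / 2 * (2 * real k + L))"
      proof (cases "i \<in> {k - m<..k}")
        case True
        hence "real k \<le> real i + \<epsilon> / 2 * real k" using m(2) mk by (simp add: of_nat_diff) linarith
        hence "(2 * real k + L) - \<epsilon> * real k \<le> 1 * (2 * real i + L)" by simp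
        also have "\<dots> \<le> (1 + d) * (2 * real i + L)" using d0 L0 by (intro mult_right_mono) auto
        finally have "(2 * real k + L) - \<epsilon> * real k \<le> (1 + d) * (2 * real i + L)" .
        moreover have "0 \<le> L * \<epsilon>" using \<epsilon> L0 by simp
        ultimately show ?thesis using True v by (simp add: algebra_simps)
      next
        case False
        thus ?thesis using u by (simp only: of_bool_eq mult_zero_left diff_zero)
      qed
    qed
    also have "\<dots> = (1 + d) * (\<Sum>i\<in>{1..k}. 2 * real i + L) - real m * (\<epsilon> / 2 * (2 * real k + L))"
    proof -
      have "(\<Sum>i\<in>{1..k}. of_bool (i \<in> {k - m<..k}) * (\<epsilon> / 2 * (2 * real k + L))) = (\<Sum>i\<in>{k - m<..k}. \<epsilon> / 2 * (2 * real k + L))"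
        using mk by (intro sum.mono_neutral_cong_right) auto
      also have "\<dots> = real m * (\<epsilon> / 2 * (2 * real k + L))" using mk by simp
      finally show ?thesis unfolding sum_subtractf sum_distrib_left by simp
    qed
    also have "(\<Sum>i\<in>{1..k}. 2 * real i + L) = real k * (real k + 1 + L)"
      by (induction k) (auto simp: algebra_simps)
    also have "(1 + d) * (real k * (real k + 1 + L)) - real m * (\<epsilon> / 2 * (2 * real k + L)) \<le>
        (1 + d) * (real k * (real k + 1 + L)) - (\<epsilon> / 2 * real k) * (\<epsilon> / 2 * (2 * real k + L))"
      using m(1) \<epsilon> L0 by (intro diff_left_mono mult_right_mono) auto
    finally show ?thesis .
  qed
  have Mid0: "0 \<le> Mid" unfolding Mid_def using removed_complete[OF disj] nonneg by (intro sum_nonneg) auto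
  \<comment> \<open>The value \<epsilon>^2 / 48 of \<open>d\<close> comes from here. The saving
    contains 12 d L k; the concentration errors use 5 d L k, the terms linear in k at most 12 k and
    hence, by the lower bound on L, less than 6 d L k. The remaining d L k turns L k into (1 - d) L
    k.\<close>
  have key: "Mid * n + \<epsilon>\<^sup>2 / 2 * (real k)\<^sup>2 < \<epsilon>\<^sup>2 / 24 * (real k)\<^sup>2 + (1 - d) * (L * real k)"
  proof -
    have "12 < \<epsilon>\<^sup>2 / 8 * L" using L(2) \<epsilon>2 by (simp add: field_simps)
    hence "12 * real k < \<epsilon>\<^sup>2 / 8 * L * real k" using k0 by (intro mult_strict_right_mono) auto
    moreover have "d * real k \<le> 1 * real k" using d0 k0 by (intro mult_right_mono) auto
    moreover have "Mid * n + (1 - d) * (real k)\<^sup>2 - 2 * real k - 4 * real k * ?\<beta> \<le>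
        (1 + d) * (real k * (real k + 1 + L)) - (\<epsilon> / 2 * real k) * (\<epsilon> / 2 * (2 * real k + L))"
      using lower upper by linarith
    ultimately show ?thesis unfolding d by (simp add: power2_eq_square algebra_simps add_divide_distrib)
  qed
  \<comment> \<open>Beyond k = 4 L / \<epsilon>^2 the term \<epsilon>^2 k^2 is at least 4 L k and
    contradicts \<open>key\<close> by itself. Up to it every path costs at most (2k + L)/n, hence at
    most (8/\<epsilon>^2 + 1) L/n, the bound under which the hypotheses on cheap middle parts
    apply.\<close>
  show False
  proof (cases "real k \<le> 4 / \<epsilon>\<^sup>2 * L")
    case True
    have Xsmall: "path_cost w (P i) \<le> (8 / \<epsilon>\<^sup>2 + 1) * L / n" if "i \<in> {1..k}" for i
    proof -
      have "path_cost w (P i) \<le> (1 - \<epsilon>) * (2 * real k + L) / n" using mono[OF that] Xk by linarith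
      also have "\<dots> \<le> 1 * (2 * (4 / \<epsilon>\<^sup>2 * L) + L) / n" using True L0 \<epsilon> n0 by (intro divide_right_mono mult_mono) auto
      also have "\<dots> = (8 / \<epsilon>\<^sup>2 + 1) * L / n" by (simp add: algebra_simps)
      finally show ?thesis .
    qed
    let ?m = "\<lambda>i. {e \<in> path_edges (P i). s \<notin> e \<and> t \<notin> e}"
    have middle: "(1 - d) * L / n \<le> (\<Sum>e\<in>?m i. w e)" if i: "i \<in> {1..k}" for i
      using pk[OF i] st(3)
    proof (cases rule: st_paths_cases)
      case 1
      thus ?thesis using Xsmall[OF i] direct by (simp add: path_cost_def)
    next
      case (2 q)
      have hl: "hd q \<in> {1..n} - {s, t}" "last q \<in> {1..n} - {s, t}" using 2 hd_in_set last_in_set by blast+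
      have qE: "path_edges q \<subseteq> complete_edges n" using path_edges_middle[OF 2(2), of s t] st_path_edges_complete[OF pk[OF i]] 2(1) by auto
      have c: "path_cost w (P i) = w {s, hd q} + path_cost w q + w {last q, t}" using path_cost_middle[OF st(3) 2(2-4)] 2(1) by simp
      have nn: "0 \<le> w {s, hd q}" "0 \<le> w {last q, t}" "0 \<le> path_cost w q"
        using nonneg hl st qE by (auto simp: doubleton_complete_edges_iff intro!: path_cost_nonneg)
      hence sm: "w {s, hd q} \<le> (8 / \<epsilon>\<^sup>2 + 1) * L / n" "w {last q, t} \<le> (8 / \<epsilon>\<^sup>2 + 1) * L / n" using Xsmall[OF i] c by linarith+
      have "2 \<le> length q"
      proof (rule ccontr)
        assume "\<not> 2 \<le> length q"
        then obtain u where "q = [u]" using 2(2) by (cases q) (auto simp: Suc_le_eq)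
        thus False using common[OF hl(1) sm(1)] sm(2) by simp
      qed
      hence "(1 - d) * L / n < path_cost w q" using mid 2 sm by blast
      also have "path_cost w q \<le> (\<Sum>e\<in>?m i. w e)"
        unfolding path_cost_def
      proof (rule sum_mono2)
        show "path_edges q \<subseteq> ?m i" using path_edges_subset_set[of _ q] 2(4) path_edges_middle[OF 2(2), of s t] 2(1) by auto
        show "0 \<le> w e" if "e \<in> ?m i - path_edges q" for e using that nonneg st_path_edges_complete[OF pk[OF i]] by auto
      qed simp
      finally show ?thesis by simp
    qed
    have "real k * ((1 - d) * L / n) \<le> (\<Sum>i\<in>{1..k}. \<Sum>e\<in>?m i. w e)" using sum_mono[of "{1..k}" "\<lambda>_. (1 - d) * L / n", OF middle] by simp
    also have "\<dots> = (\<Sum>e\<in>(\<Union>i\<in>{1..k}. ?m i). w e)"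
    proof (rule sum.UNION_disjoint[symmetric])
      have "path_edges (P i) \<inter> path_edges (P j) = {}" if "i \<in> {1..k}" "j \<in> {1..k}" "i \<noteq> j" for i j
        using disj that unfolding disjoint_paths_def disjoint_family_on_def atLeastLessThanSuc_atLeastAtMost by blast
      thus "\<forall>i\<in>{1..k}. \<forall>j\<in>{1..k}. i \<noteq> j \<longrightarrow> ?m i \<inter> ?m j = {}" by blast
    qed auto
    also have "(\<Union>i\<in>{1..k}. ?m i) = {e \<in> removed P (Suc k). s \<notin> e \<and> t \<notin> e}"
      unfolding removed_def atLeastLessThanSuc_atLeastAtMost by blast
    finally have "real k * ((1 - d) * L / n) * n \<le> Mid * n" unfolding Mid_def by (intro mult_right_mono) auto
    hence "(1 - d) * (L * real k) \<le> Mid * n" using n0 by (simp add: mult_ac)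
    moreover have "0 < \<epsilon>\<^sup>2 * (real k)\<^sup>2" "0 < \<epsilon>\<^sup>2 * (L * real k)" using \<epsilon>2 k0 L0 by auto
    ultimately show False using key by linarith
  next
    case False
    hence "4 * L \<le> \<epsilon>\<^sup>2 * real k" using \<epsilon>2 by (simp add: field_simps)
    hence "4 * L * real k \<le> \<epsilon>\<^sup>2 * real k * real k" by (rule mult_right_mono) simp
    hence "4 * (L * real k) \<le> \<epsilon>\<^sup>2 * (real k)\<^sup>2" by (simp add: power2_eq_square mult_ac)
    moreover have "0 \<le> Mid * n" "0 \<le> \<epsilon>\<^sup>2 * (real k)\<^sup>2" using Mid0 by simp_all
    moreover have "0 < \<epsilon>\<^sup>2 * (L * real k)" using \<epsilon>2 k0 L0 by auto
    moreover have "(1 - d) * (L * real k) \<le> 1 * (L * real k)" using d0 L0 by (intro mult_right_mono) auto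
    ultimately show False using key by linarith
  qed
qed

section \<open>Measurability and convergence\<close>

lemma successive_cheapest_paths_cong:
  assumes "\<And>i. i \<in> {1..k} \<Longrightarrow> P i = Q i"
  shows "successive_cheapest_paths n s t w P k = successive_cheapest_paths n s t w Q k"
  using assms unfolding successive_cheapest_paths_def by (intro ball_cong refl arg_cong2[where f="is_arg_min (path_cost w)"] ext) auto

text \<open>Only the first \<open>k\<close> paths of a sequence matter, so the quantifiers over all sequences range
  over a finite set.\<close>

lemma successive_cheapest_paths_finite_range:
  fixes n s t k defines "F \<equiv> PiE {1..k} (\<lambda>_. st_paths n s t)"
  shows "finite F"
    and "(\<exists>P. successive_cheapest_paths n s t w P k) \<longleftrightarrow> (\<exists>P\<in>F. successive_cheapest_paths n s t w P k)"
    and "1 \<le> k \<Longrightarrow> (\<forall>P. successive_cheapest_paths n s t w P k \<longrightarrow> R (P k)) \<longleftrightarrow> (\<forall>P\<in>F. successive_cheapest_paths n s t w P k \<longrightarrow> R (P k))"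
proof -
  show "finite F" unfolding F_def by (intro finite_PiE) auto
  have *: "restrict P {1..k} \<in> F" "successive_cheapest_paths n s t w (restrict P {1..k}) k" if P: "successive_cheapest_paths n s t w P k" for P
  proof -
    show "restrict P {1..k} \<in> F" using P unfolding F_def successive_cheapest_paths_def is_arg_min_def by auto
    show "successive_cheapest_paths n s t w (restrict P {1..k}) k" using P successive_cheapest_paths_cong[of k P "restrict P {1..k}"] by simp
  qed
  show "(\<exists>P. successive_cheapest_paths n s t w P k) \<longleftrightarrow> (\<exists>P\<in>F. successive_cheapest_paths n s t w P k)" using * by blast
  show "(\<forall>P. successive_cheapest_paths n s t w P k \<longrightarrow> R (P k)) \<longleftrightarrow> (\<forall>P\<in>F. successive_cheapest_paths n s t w P k \<longrightarrow> R (P k))" if "1 \<le> k"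
  proof -
    have "R (P k)" if "\<forall>P\<in>F. successive_cheapest_paths n s t w P k \<longrightarrow> R (P k)" "successive_cheapest_paths n s t w P k" for P
    proof -
      have "R (restrict P {1..k} k)" using *[OF that(2)] that(1) by blast
      thus ?thesis using \<open>1 \<le> k\<close> by simp
    qed
    thus ?thesis by blast
  qed
qed

context random_weights
begin

lemma measurable_path_cost: "p \<in> st_paths n s t \<Longrightarrow> (\<lambda>\<omega>. path_cost (\<lambda>e. W e \<omega>) p) \<in> borel_measurable M"
  unfolding path_cost_def using st_path_edges_complete by (intro borel_measurable_sum W_measurable) blast

lemma pred_successive_cheapest_paths:
  "Measurable.pred M (\<lambda>\<omega>. successive_cheapest_paths n s t (\<lambda>e. W e \<omega>) P k)"
proof -
  let ?Q = "\<lambda>j p. p \<in> st_paths n s t \<and> (\<forall>i\<in>{1..<j}. path_edges p \<inter> path_edges (P i) = {})"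
  have le: "Measurable.pred M (\<lambda>\<omega>. path_cost (\<lambda>e. W e \<omega>) p \<le> path_cost (\<lambda>e. W e \<omega>) q)" if "p \<in> st_paths n s t" "q \<in> st_paths n s t" for p q
    using borel_measurable_le[OF measurable_path_cost[OF that(1)] measurable_path_cost[OF that(2)]] by (simp add: pred_def)
  \<comment> \<open>Rewrites minimality as finitely many comparisons; the condition
    \<open>x \<in> A\<close> inside the index set ensures that only costs of genuine paths, which
    are measurable, are compared.\<close>
  have arg_min: "is_arg_min f Q x \<longleftrightarrow> Q x \<and> (\<forall>y\<in>{y \<in> A. Q y \<and> x \<in> A}. f x \<le> f y)" if "\<And>y. Q y \<Longrightarrow> y \<in> A"
    for f :: "nat list \<Rightarrow> real" and Q x A
    using that unfolding is_arg_min_def by (auto simp: not_less)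
  have eq: "successive_cheapest_paths n s t (\<lambda>e. W e \<omega>) P k \<longleftrightarrow> (\<forall>j\<in>{1..k}. ?Q j (P j) \<and>
     (\<forall>p\<in>{p \<in> st_paths n s t. ?Q j p \<and> P j \<in> st_paths n s t}. path_cost (\<lambda>e. W e \<omega>) (P j) \<le> path_cost (\<lambda>e. W e \<omega>) p))" for \<omega>
    unfolding successive_cheapest_paths_def by (intro ball_cong refl arg_min) blast
  have "Measurable.pred M (\<lambda>\<omega>. \<forall>j\<in>{1..k}. ?Q j (P j) \<and>
     (\<forall>p\<in>{p \<in> st_paths n s t. ?Q j p \<and> P j \<in> st_paths n s t}. path_cost (\<lambda>e. W e \<omega>) (P j) \<le> path_cost (\<lambda>e. W e \<omega>) p))"
    by (intro pred_intros_finite(3) pred_intros_conj1' le) auto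
  thus ?thesis unfolding eq .
qed

text \<open>The limit theorem speaks of \<open>measure\<close> itself, so for this one event an
  outer probability is not enough.\<close>

lemma successive_cheapest_paths_event:
  assumes R: "\<And>k. {x. R k x} \<in> sets borel"
  shows "{\<omega> \<in> space M. \<forall>k\<in>{1..m}. (\<exists>P. successive_cheapest_paths n s t (\<lambda>e. W e \<omega>) P k) \<and>
    (\<forall>P. successive_cheapest_paths n s t (\<lambda>e. W e \<omega>) P k \<longrightarrow> R k (path_cost (\<lambda>e. W e \<omega>) (P k)))} \<in> events"
proof -
  let ?F = "\<lambda>k. PiE {1..k} (\<lambda>_. st_paths n s t)"
  have c: "(\<lambda>\<omega>. path_cost (\<lambda>e. W e \<omega>) (P k)) \<in> borel_measurable M" if "k \<in> {1..m}" "P \<in> ?F k" for k P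
    using that by (intro measurable_path_cost) auto
  have "Measurable.pred M (\<lambda>\<omega>. R k (path_cost (\<lambda>e. W e \<omega>) (P k)))" if "k \<in> {1..m}" "P \<in> ?F k" for k P
    using measurable_sets[OF c[OF that] R[of k]] by (simp add: pred_def vimage_def Int_def conj_commute)
  hence "Measurable.pred M (\<lambda>\<omega>. \<forall>k\<in>{1..m}. (\<exists>P\<in>?F k. successive_cheapest_paths n s t (\<lambda>e. W e \<omega>) P k) \<and>
    (\<forall>P\<in>?F k. successive_cheapest_paths n s t (\<lambda>e. W e \<omega>) P k \<longrightarrow> R k (path_cost (\<lambda>e. W e \<omega>) (P k))))"
    by (intro pred_intros_finite(3,4) pred_intros_logic(3,4) pred_successive_cheapest_paths successive_cheapest_paths_finite_range(1)) auto
  moreover have "(\<forall>k\<in>{1..m}. (\<exists>P. successive_cheapest_paths n s t w P k) \<and>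
      (\<forall>P. successive_cheapest_paths n s t w P k \<longrightarrow> R k (path_cost w (P k)))) \<longleftrightarrow>
    (\<forall>k\<in>{1..m}. (\<exists>P\<in>?F k. successive_cheapest_paths n s t w P k) \<and>
      (\<forall>P\<in>?F k. successive_cheapest_paths n s t w P k \<longrightarrow> R k (path_cost w (P k))))" for w
    by (intro ball_cong refl conj_cong successive_cheapest_paths_finite_range(2)
        successive_cheapest_paths_finite_range(3)[where R="\<lambda>p. R _ (path_cost w p)"]) auto
  ultimately show ?thesis by (simp add: pred_def)
qed

end

section \<open>Both bounds together and the limit\<close>

context random_weights_seq
begin

lemma whp_cost_bounds:
  fixes \<epsilon> :: real
  assumes \<epsilon>: "0 < \<epsilon>" "\<epsilon> \<le> 1"
  shows "whp (\<lambda>n \<omega>. \<forall>k\<in>{1..n - 1}. (\<exists>P. paths_between n \<omega> P k) \<and>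
    (\<forall>P. paths_between n \<omega> P k \<longrightarrow>
      (1 - \<epsilon>) * (2 * real k + ln (real n)) / n \<le> path_cost (Wn n \<omega>) (P k) \<and>
      path_cost (Wn n \<omega>) (P k) \<le> (1 + \<epsilon>) * (2 * real k + ln (real n)) / n))"
proof -
  \<comment> \<open>The upper bounds enter the proof of the lower bound and must be finer than
    \<epsilon>, of the order of the quadratic saving in \<open>path_cost_ge\<close>.\<close>
  define d where "d = \<epsilon>\<^sup>2 / 48"
  have \<epsilon>2: "0 < \<epsilon>\<^sup>2" "\<epsilon>\<^sup>2 \<le> \<epsilon>" using \<epsilon> by (auto simp: power2_eq_square mult_left_le)
  have d: "0 < d" "d < 1" "d \<le> 1" "d \<le> \<epsilon>" using \<epsilon>2 \<epsilon> by (auto simp: d_def)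
  have C: "0 < 8 / \<epsilon>\<^sup>2 + 1" using \<epsilon>2 by (simp add: add_pos_pos)
  have n1: "\<forall>\<^sub>F n in sequentially. 96 / \<epsilon>\<^sup>2 + 1 \<le> ln (real n)" by (rule eventually_ln_ge)
  show ?thesis
  proof (rule whp_mono[OF whp_conj[OF whp_conj[OF whp_weights whp_star_ok[OF d(1,3)]] whp_conj[OF whp_cost_le[OF d(1,3)] whp_no_cheap[OF C d(1,2)]]]])
    show "\<forall>\<^sub>F n in sequentially. \<forall>\<omega>\<in>space (M n).
      (unit_weights n \<omega> \<and> (\<forall>x\<in>{s n, t n}. star_ok (Wn n \<omega>) n x d)) \<and>
      (\<forall>k<n. (\<exists>P. paths_between n \<omega> P k) \<and>
        (\<forall>P. paths_between n \<omega> P k \<longrightarrow>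
          (\<forall>i\<in>{1..k}. path_cost (Wn n \<omega>) (P i) \<le> (1 + d) * (2 * real i + ln (real n)) / n))) \<and>
      no_cheap_path (8 / \<epsilon>\<^sup>2 + 1) d n \<omega> \<longrightarrow>
      (\<forall>k\<in>{1..n - 1}. (\<exists>P. paths_between n \<omega> P k) \<and>
        (\<forall>P. paths_between n \<omega> P k \<longrightarrow>
          (1 - \<epsilon>) * (2 * real k + ln (real n)) / n \<le> path_cost (Wn n \<omega>) (P k) \<and>
          path_cost (Wn n \<omega>) (P k) \<le> (1 + \<epsilon>) * (2 * real k + ln (real n)) / n))"
      using n1 eventually_ge_at_top[of 2]
    proof eventually_elim
      case (elim n)
      have stn: "s n \<in> {1..n}" "t n \<in> {1..n}" "s n \<noteq> t n" using st[OF elim(2)] by auto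
      have L: "96 / \<epsilon>\<^sup>2 < ln (real n)" using elim(1) by linarith
      show ?case
      proof (intro ballI impI, elim conjE)
        fix \<omega> k
        assume weights: "unit_weights n \<omega>"
          and star: "\<forall>x\<in>{s n, t n}. star_ok (Wn n \<omega>) n x d"
          and upper: "\<forall>k<n. (\<exists>P. paths_between n \<omega> P k) \<and>
            (\<forall>P. paths_between n \<omega> P k \<longrightarrow>
              (\<forall>i\<in>{1..k}. path_cost (Wn n \<omega>) (P i) \<le> (1 + d) * (2 * real i + ln (real n)) / n))"
          and middle: "\<forall>q. distinct q \<longrightarrow> set q \<subseteq> {1..n} - {s n, t n} \<longrightarrow> 2 \<le> length q \<longrightarrow>
            0 \<le> W n {s n, hd q} \<omega> \<longrightarrow> W n {s n, hd q} \<omega> \<le> (8 / \<epsilon>\<^sup>2 + 1) * ln (real n) / n \<longrightarrow>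
            0 \<le> W n {last q, t n} \<omega> \<longrightarrow> W n {last q, t n} \<omega> \<le> (8 / \<epsilon>\<^sup>2 + 1) * ln (real n) / n \<longrightarrow>
            (\<forall>e\<in>path_edges q. 0 \<le> W n e \<omega>) \<longrightarrow> (1 - d) * ln (real n) / n < path_cost (Wn n \<omega>) q"
          and common: "\<forall>u\<in>{1..n} - {s n, t n}. 0 \<le> W n {s n, u} \<omega> \<longrightarrow> W n {s n, u} \<omega> \<le> (8 / \<epsilon>\<^sup>2 + 1) * ln (real n) / n \<longrightarrow>
            0 \<le> W n {u, t n} \<omega> \<longrightarrow> (8 / \<epsilon>\<^sup>2 + 1) * ln (real n) / n < W n {u, t n} \<omega>"
          and direct: "0 \<le> W n {s n, t n} \<omega> \<longrightarrow> (8 / \<epsilon>\<^sup>2 + 1) * ln (real n) / n < W n {s n, t n} \<omega>"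
          and k: "k \<in> {1..n - 1}"
        interpret nonneg_weights "Wn n \<omega>" n using weights by unfold_locales auto
        have kn: "1 \<le> k" "k < n" using k by auto
        have edge0: "0 \<le> W n {u, v} \<omega>" if "u \<in> {1..n}" "v \<in> {1..n}" "u \<noteq> v" for u v
          using nonneg[of "{u, v}"] that unfolding doubleton_complete_edges_iff by blast
        show "(\<exists>P. paths_between n \<omega> P k) \<and>
          (\<forall>P. paths_between n \<omega> P k \<longrightarrow>
            (1 - \<epsilon>) * (2 * real k + ln (real n)) / n \<le> path_cost (Wn n \<omega>) (P k) \<and>
            path_cost (Wn n \<omega>) (P k) \<le> (1 + \<epsilon>) * (2 * real k + ln (real n)) / n)"
        proof (intro conjI allI impI)
          show "\<exists>P. paths_between n \<omega> P k" using upper kn by blast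
          fix P assume P: "paths_between n \<omega> P k"
          have cost: "path_cost (Wn n \<omega>) (P i) \<le> (1 + d) * (2 * real i + ln (real n)) / n" if "i \<in> {1..k}" for i
            using upper kn P that by blast
          have "path_cost (Wn n \<omega>) (P k) \<le> (1 + d) * (2 * real k + ln (real n)) / n" using cost[of k] kn by simp
          also have "\<dots> \<le> (1 + \<epsilon>) * (2 * real k + ln (real n)) / n" using d elim(2) by (intro divide_right_mono mult_right_mono) auto
          finally show "path_cost (Wn n \<omega>) (P k) \<le> (1 + \<epsilon>) * (2 * real k + ln (real n)) / n" .
          show "(1 - \<epsilon>) * (2 * real k + ln (real n)) / n \<le> path_cost (Wn n \<omega>) (P k)"
          proof (rule path_cost_ge[OF stn \<epsilon> d_def refl L kn(1) P bspec[OF star] _ cost])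
            fix q assume q: "distinct q" "set q \<subseteq> {1..n} - {s n, t n}" "2 \<le> length q"
              "W n {s n, hd q} \<omega> \<le> (8 / \<epsilon>\<^sup>2 + 1) * ln (real n) / n" "W n {last q, t n} \<omega> \<le> (8 / \<epsilon>\<^sup>2 + 1) * ln (real n) / n"
            have "q \<noteq> []" using q(3) by auto
            hence hl: "hd q \<in> {1..n} - {s n, t n}" "last q \<in> {1..n} - {s n, t n}" using q(2) hd_in_set last_in_set by blast+
            have "path_edges q \<subseteq> complete_edges n"
              using st_path_edges_complete[of q n "hd q" "last q"] q \<open>q \<noteq> []\<close> unfolding st_paths_def by blast
            hence "\<forall>e\<in>path_edges q. 0 \<le> W n e \<omega>" using nonneg by blast
            moreover have "0 \<le> W n {s n, hd q} \<omega>" "0 \<le> W n {last q, t n} \<omega>" using hl stn by (auto intro!: edge0)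
            ultimately show "(1 - d) * ln (real n) / n < path_cost (Wn n \<omega>) q" using middle q by blast
          next
            fix u assume "u \<in> {1..n} - {s n, t n}" "W n {s n, u} \<omega> \<le> (8 / \<epsilon>\<^sup>2 + 1) * ln (real n) / n"
            moreover have "0 \<le> W n {s n, u} \<omega>" "0 \<le> W n {u, t n} \<omega>" using calculation(1) stn by (auto intro!: edge0)
            ultimately show "(8 / \<epsilon>\<^sup>2 + 1) * ln (real n) / n < W n {u, t n} \<omega>" using common by blast
          next
            show "(8 / \<epsilon>\<^sup>2 + 1) * ln (real n) / n < W n {s n, t n} \<omega>" using direct edge0[OF stn] by blast
          qed (use weights in auto)
        qed
      qed
    qed
  qed
qed

lemma whp_imp_tendsto:
  assumes "whp Q" "\<And>n. {\<omega> \<in> space (M n). R n \<omega>} \<in> sets (M n)" "\<forall>\<^sub>F n in sequentially. \<forall>\<omega>\<in>space (M n). Q n \<omega> \<longrightarrow> R n \<omega>"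
  shows "(\<lambda>n. measure (M n) {\<omega> \<in> space (M n). R n \<omega>}) \<longlonglongrightarrow> 1"
proof -
  obtain p where p: "p \<longlonglongrightarrow> 0" "\<forall>\<^sub>F n in sequentially. prob_le n (\<lambda>\<omega>. \<not> R n \<omega>) (p n)"
    using whp_mono[OF assms(1,3)] unfolding whp_def by blast
  show ?thesis
  proof (rule tendsto_sandwich)
    show "\<forall>\<^sub>F n in sequentially. 1 - p n \<le> measure (M n) {\<omega> \<in> space (M n). R n \<omega>}"
      using p(2) by (rule eventually_mono) (rule prob_le_imp_prob_ge[OF _ assms(2)], auto)
    show "(\<lambda>n. 1 - p n) \<longlonglongrightarrow> 1" using tendsto_diff[OF tendsto_const p(1), of 1] by simp
    show "\<forall>\<^sub>F n in sequentially. measure (M n) {\<omega> \<in> space (M n). R n \<omega>} \<le> 1" by simp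
  qed simp
qed

end

theorem theorem1p1:
  fixes M :: "nat \<Rightarrow> 'a measure"
    and W :: "nat \<Rightarrow> nat set \<Rightarrow> 'a \<Rightarrow> real"
    and s t :: "nat \<Rightarrow> nat"
    and \<epsilon> :: real
  assumes prob: "\<And>n. prob_space (M n)"
    and indep: "\<And>n. prob_space.indep_vars (M n) (\<lambda>_. borel) (W n) (complete_edges n)"
    and unif: "\<And>n e. e \<in> complete_edges n \<Longrightarrow>
                 distr (M n) lborel (W n e) = uniform_measure lborel {0..1}"
    and st: "\<And>n. n \<ge> 2 \<Longrightarrow> s n \<in> {1..n} \<and> t n \<in> {1..n} \<and> s n \<noteq> t n"
    and eps: "\<epsilon> > 0"
  shows "(\<lambda>n. measure (M n) {\<omega> \<in> space (M n). \<forall>k\<in>{1..n - 1}.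
            (\<exists>P. successive_cheapest_paths n (s n) (t n) (\<lambda>e. W n e \<omega>) P k) \<and>
            (\<forall>P. successive_cheapest_paths n (s n) (t n) (\<lambda>e. W n e \<omega>) P k \<longrightarrow>
               1 - \<epsilon> \<le> path_cost (\<lambda>e. W n e \<omega>) (P k) / (2 * real k / real n + ln (real n) / real n) \<and>
               path_cost (\<lambda>e. W n e \<omega>) (P k) / (2 * real k / real n + ln (real n) / real n) \<le> 1 + \<epsilon>)})
         \<longlonglongrightarrow> 1"
proof -
  interpret random_weights_seq M W s t
    using prob indep unif st by (simp add: random_weights_seq_def random_weights_def random_weights_axioms_def)
  \<comment> \<open>The bounds with high probability are available for precision at most 1; a larger
    \<epsilon> only weakens the claim.\<close>
  define \<delta> where "\<delta> = min \<epsilon> 1"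
  have \<delta>: "0 < \<delta>" "\<delta> \<le> 1" "\<delta> \<le> \<epsilon>" using eps by (auto simp: \<delta>_def)
  show ?thesis
  proof (rule whp_imp_tendsto[OF whp_cost_bounds[OF \<delta>(1,2)]])
    show "{\<omega> \<in> space (M n). \<forall>k\<in>{1..n - 1}.
            (\<exists>P. successive_cheapest_paths n (s n) (t n) (\<lambda>e. W n e \<omega>) P k) \<and>
            (\<forall>P. successive_cheapest_paths n (s n) (t n) (\<lambda>e. W n e \<omega>) P k \<longrightarrow>
               1 - \<epsilon> \<le> path_cost (\<lambda>e. W n e \<omega>) (P k) / (2 * real k / real n + ln (real n) / real n) \<and>
               path_cost (\<lambda>e. W n e \<omega>) (P k) / (2 * real k / real n + ln (real n) / real n) \<le> 1 + \<epsilon>)} \<in> sets (M n)" for n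
      by (rule successive_cheapest_paths_event[where
            R="\<lambda>k x. 1 - \<epsilon> \<le> x / (2 * real k / real n + ln (real n) / real n) \<and> x / (2 * real k / real n + ln (real n) / real n) \<le> 1 + \<epsilon>"])
         measurable
    have "1 - \<epsilon> \<le> x / (2 * real k / real n + ln (real n) / real n) \<and> x / (2 * real k / real n + ln (real n) / real n) \<le> 1 + \<epsilon>"
      if "1 \<le> k" "2 \<le> n" and x: "(1 - \<delta>) * (2 * real k + ln (real n)) / n \<le> x" "x \<le> (1 + \<delta>) * (2 * real k + ln (real n)) / n" for n k x
    proof -
      have B: "0 < 2 * real k / real n + ln (real n) / real n" using that by (intro add_pos_nonneg) auto
      have e: "c * (2 * real k + ln (real n)) / n = c * (2 * real k / real n + ln (real n) / real n)" for c :: real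
        unfolding add_divide_distrib[symmetric] by simp
      have "(1 - \<epsilon>) * (2 * real k / real n + ln (real n) / real n) \<le> (1 - \<delta>) * (2 * real k / real n + ln (real n) / real n)"
        "(1 + \<delta>) * (2 * real k / real n + ln (real n) / real n) \<le> (1 + \<epsilon>) * (2 * real k / real n + ln (real n) / real n)"
        using B \<delta> by (auto intro!: mult_right_mono)
      thus ?thesis using x unfolding e pos_le_divide_eq[OF B] pos_divide_le_eq[OF B] by linarith
    qed
    thus "\<forall>\<^sub>F n in sequentially. \<forall>\<omega>\<in>space (M n).
      (\<forall>k\<in>{1..n - 1}. (\<exists>P. successive_cheapest_paths n (s n) (t n) (\<lambda>e. W n e \<omega>) P k) \<and>
        (\<forall>P. successive_cheapest_paths n (s n) (t n) (\<lambda>e. W n e \<omega>) P k \<longrightarrow>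
          (1 - \<delta>) * (2 * real k + ln (real n)) / n \<le> path_cost (\<lambda>e. W n e \<omega>) (P k) \<and>
          path_cost (\<lambda>e. W n e \<omega>) (P k) \<le> (1 + \<delta>) * (2 * real k + ln (real n)) / n)) \<longrightarrow>
      (\<forall>k\<in>{1..n - 1}. (\<exists>P. successive_cheapest_paths n (s n) (t n) (\<lambda>e. W n e \<omega>) P k) \<and>
        (\<forall>P. successive_cheapest_paths n (s n) (t n) (\<lambda>e. W n e \<omega>) P k \<longrightarrow>
          1 - \<epsilon> \<le> path_cost (\<lambda>e. W n e \<omega>) (P k) / (2 * real k / real n + ln (real n) / real n) \<and>
          path_cost (\<lambda>e. W n e \<omega>) (P k) / (2 * real k / real n + ln (real n) / real n) \<le> 1 + \<epsilon>))"
      by (intro eventually_mono[OF eventually_ge_at_top[of 2]]) (meson atLeastAtMost_iff)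
  qed
qed

end
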